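(* Let $\{(X_i,Y_i,Z_i)\}_{i\ge1}$ be an i.i.d. sequence of $\mathbb{R}^{3d}$-valued random variables on a sublinear expectation space $(\Omega,\mathcal{H},\hat{\mathbb{E}})$ satisfying assumptions (A1)-(A3) of the context, and put $S_n^1=\sum_{i=1}^nX_i$, $S_n^2=\sum_{i=1}^nY_i$, $S_n^3=\sum_{i=1}^nZ_i$. Let $(\xi_t,\eta_t,\zeta_t)_{t\in[0,1]}$ be the nonlinear Lévy process associated with $\Theta$ under the sublinear expectation $\tilde{\mathbb{E}}$ (see context), and let $E_1,E_2:\mathbb{R}_+^5\to\mathbb{R}_+$ be the error functions of the scheme, i.e. functions for which properties (C2) and (C3) of the context hold. Then for any $\phi\in C_{b,\mathrm{Lip}}(\mathbb{R}^{3d})$ and all $n\in\mathbb{N}$, $n\ge 1$, $$-4C_0n^{-1/2}-\inf_{\varepsilon>0}\Big(8C_0\varepsilon+E_1(\varepsilon,n^{-1},\|\phi\|_\infty,C_0,K_\rho)\Big)\le\hat{\mathbb{E}}\Big[\phi\Big(\frac{S_n^1}{\sqrt n},\frac{S_n^2}{n},\frac{S_n^3}{n^{1/\alpha}}\Big)\Big]-\tilde{\mathbb{E}}[\phi(\xi_1,\eta_1,\zeta_1)]$$ and $$\hat{\mathbb{E}}\Big[\phi\Big(\frac{S_n^1}{\sqrt n},\frac{S_n^2}{n},\frac{S_n^3}{n^{1/\alpha}}\Big)\Big]-\tilde{\mathbb{E}}[\phi(\xi_1,\eta_1,\zeta_1)]\le2C_0n^{-1/2}+\inf_{\varepsilo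n>0}\Big(8C_0\varepsilon+E_2(\varepsilon,n^{-1},\|\phi\|_\infty,C_0,K_\rho)\Big).$$
   Context: Notation. $|\cdot|$ is the Euclidean norm (for matrices $|A|^2=\mathrm{tr}[AA^{\intercal}]$), $\langle\cdot,\cdot\rangle$ the Euclidean inner product, $a\vee b=\max(a,b)$, $\mathbb{S}(d)$ the symmetric $d\times d$ matrices, $\mathbb{S}_+(d)$ the positive semidefinite ones. $C_{b,\mathrm{Lip}}$ denotes bounded Lipschitz functions, $C_b$ bounded continuous functions, $C_b^k$ functions with uniformly bounded derivatives up to order $k$. Sublinear expectations. $\mathcal{H}$ is a linear space of real random variables on $\Omega$, stable under composition of finitely many of its elements with a Lipschitz function. $\hat{\mathbb{E}}:\mathcal{H}\to\mathbb{R}$ is a sublinear expectation: monotone, $\hat{\mathbb{E}}[c]=c$ for constants, sub-additive, and positively homogeneous. Random variables to which $\hat{\mathbb{E}}$ is applied are understood to lie in $\mathcal{H}$; for vectors $\hat{\mathbb{E}}$ acts componentwise. $X\overset{d}{=}X'$ (possibly on different spaces) means that the sublinear expectations of $\varphi(X)$ and $\varphi(X')$ agree for all $\varphi\in C_{b,\mathrm{Lip}}$. $Y$ is independent from $X$ if $\hat{\mathbb{E}}[\varphi(X,Y)]=\hat{\mathbb{E}}\big[\hat{\mathbb{E}}[\varphi(x,Y)]_{x=X}\big]$ for all $\varphi\in C_{b,\mathrm{Lip}}$. A sequence $\{\chi_i\}$ is i.i.d. if $\chi_{i+1}\overset{d}{=}\chi_i$ and $\chi_{i+1}$ is independent from $(\chi_1,\dots,\chi_i)$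 for all $i$. Uncertainty set and PIDE. Fix $\alpha\in(1,2)$ and $0<\underline\Lambda<\overline\Lambda$. For a finite measure $\mu$ on the unit sphere $S\subset\mathbb{R}^d$ let $F_\mu(B)=\int_S\mu(dx)\int_0^\infty \mathbf 1_B(rx)\frac{dr}{r^{1+\alpha}}$. Let $\mathcal{L}_0=\{F_\mu:\mu(S)\in(\underline\Lambda,\overline\Lambda)\}$ and let $\mathcal{L}\subset\mathcal{L}_0$ be non-empty, compact and convex (compact for weak convergence of the spectral measures $\mu$). Let $\Theta\subset\mathcal{L}\times\mathbb{R}^d\times\mathbb{S}_+(d)$ be the (non-empty) uncertainty set, with $\sup_{(F_\mu,q,Q)\in\Theta}\{\int|z|\wedge|z|^2F_\mu(dz)+|q|+|Q|\}<\infty$; it need not be a Cartesian product. Put $\delta_\lambda\varphi(z)=\varphi(z+\lambda)-\varphi(z)-\langle D\varphi(z),\lambda\rangle$ and $$G(p,A,\varphi(\cdot))=\sup_{(F_\mu,q,Q)\in\Theta}\Big\{\int_{\mathbb{R}^d}\delta_\lambda\varphi(0)F_\mu(d\lambda)+\langle p,q\rangle+\tfrac12\mathrm{tr}[AQ]\Big\}.$$ The PIDE (P) is $$\partial_tu-G\big(D_yu(t,x,y,z),D_x^2u(t,x,y,z),u(t,x,y,z+\cdot)\big)=0\ \text{on }(0,1]\times\mathbb{R}^{3d},\qquad u(0,\cdot)=\phi .$$ A bounded upper (resp. lower) semicontinuous $u$ is a viscosity subsolution (resp. supersolution) if $u(0,\cdot)\le\phi$ (resp. $\ge\phi$) and for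 each $(t,x,y,z)\in(0,1]\times\mathbb{R}^{3d}$ and each $\psi\in C_b^{2,3}((0,1]\times\mathbb{R}^{3d})$ (bounded derivatives up to order 2 in $t$ and 3 in space) with $\psi\ge u$ (resp. $\psi\le u$) and equality at $(t,x,y,z)$, one has $\partial_t\psi-G(D_y\psi,D_x^2\psi,\psi(t,x,y,z+\cdot))\le0$ (resp. $\ge0$) at that point. A bounded continuous function is a viscosity solution if it is both. Nonlinear Lévy process. A càdlàg process $(L_t)$ on a sublinear expectation space is a nonlinear Lévy process if $L_0=0$, $L_t-L_s\overset{d}{=}L_{t-s}$ for $0\le s\le t$, and $L_t-L_s$ is independent from $(L_{t_1},\dots,L_{t_n})$ for $0\le t_1\le\dots\le t_n\le s\le t$. It is known that under the assumptions below there is a nonlinear Lévy process $(\xi_t,\eta_t,\zeta_t)_{t\in[0,1]}$ with values in $\mathbb{R}^{3d}$, on a space with sublinear expectation $\tilde{\mathbb{E}}$, such that for every $\phi\in C_{b,\mathrm{Lip}}(\mathbb{R}^{3d})$ the function $u(t,x,y,z)=\tilde{\mathbb{E}}[\phi(x+\xi_t,y+\eta_t,z+\zeta_t)]$ is the unique viscosity solution of (P), with $\|u\|_\infty\le\|\phi\|_\infty$ and $|u(t,x,y,z)-u(t',x',y',z')|\le C_0(|t-t'|^{1/2}+|x-x'|+|y-y'|+|z-z'|)$, with $C_0$ as below. This is the process associated with $\Theta$. Assumptions. Write $M_\xi^p=\hat{\mathbb{E}}[|\xi|^p]$. (A1) $\hat{\mathbb{E}}[X_1]=\hat{\mathbb{E}}[-X_1]=0$,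 $M_{X_1}^3<\infty$, $M_{Y_1}^2<\infty$. (A2) $\hat{\mathbb{E}}[Z_1]=\hat{\mathbb{E}}[-Z_1]=0$, $M_*:=\sup_{n\ge1}\hat{\mathbb{E}}[n^{-1/\alpha}|S_n^3|]<\infty$, and $M_{Z_1}^\delta<\infty$ for some $\delta\in(\frac34\alpha\vee1,\alpha)$. (A3) For each $(p,A)\in\mathbb{R}^d\times\mathbb{S}(d)$ and $\varphi\in C_b^3(\mathbb{R}^d)$, $$\frac1s\Big|\hat{\mathbb{E}}\Big[\varphi(z+s^{1/\alpha}Z_1)-\varphi(z)+\langle p,sY_1\rangle+\tfrac12\langle As^{1/2}X_1,s^{1/2}X_1\rangle\Big]-sG(p,A,\varphi(z+\cdot))\Big|\le\hat l(s,L_0),$$ where $\hat l$ is a function of $s\in[0,1]$ and $L_0:=|p|+|A|+\|\varphi\|_\infty+\sum_{i=1}^3\|D^i\varphi\|_\infty$ such that, for each constant $C>0$, $\hat l(s,L_0)\to0$ as $s\to0$, uniformly in $z\in\mathbb{R}^d$ and $L_0\le C$. Scheme. With $(X,Y,Z)\overset{d}{=}(X_1,Y_1,Z_1)$ on $(\Omega,\mathcal{H},\hat{\mathbb{E}})$ and $h\in(0,1)$, define $u_h:[0,1]\times\mathbb{R}^{3d}\to\mathbb{R}$ by $u_h(t,x,y,z)=\phi(x,y,z)$ for $t\in[0,h)$ and $u_h(t,x,y,z)=\hat{\mathbb{E}}[u_h(t-h,x+h^{1/2}X,y+hY,z+h^{1/\alpha}Z)]$ for $t\in[h,1]$. Set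 $$S(h,x,y,z,p,v)=\frac1h\Big(p-\hat{\mathbb{E}}[v(x+h^{1/2}X,y+hY,z+h^{1/\alpha}Z)]\Big).$$ Let $C_\phi$ be the Lipschitz constant of $\phi$ (i.e. $|\phi(x,y,z)-\phi(x',y',z')|\le C_\phi(|x-x'|+|y-y'|+|z-z'|)$) and $C_0:=C_\phi\big((M_{X_1}^2)^{1/2}+M_{Y_1}^1+M_*\big)\vee C_\phi$. Mollification. Fix a nonnegative $\rho\in C_c^\infty(\mathbb{R}\times\mathbb{R}^{3d})$ with unit integral and support in $[-1,0]\times B_1$; $\rho_\varepsilon(\tau,e)=\varepsilon^{-(2+3d)}\rho(\tau/\varepsilon^2,e/\varepsilon)$. A function $v$ on $[0,1]\times\mathbb{R}^{3d}$ is extended by $v(t,\chi)=v(1,\chi)$ for $t\in[1,1+\varepsilon^2]$, and $(v*\rho_\varepsilon)(t,\chi)=\int_{-\varepsilon^2}^0\int_{|e|<\varepsilon}v(t-\tau,\chi-e)\rho_\varepsilon(\tau,e)\,de\,d\tau$. Put $K_\rho=\max_{i+j\le3}\max_{|\gamma|=j}\int_{-1}^0\int_{|e|<1}|\partial_t^iD^\gamma\rho(\tau,e)|\,de\,d\tau$. Let $u^\varepsilon=u*\rho_\varepsilon$ and $u_h^\varepsilon=u_h*\rho_\varepsilon$. Error functions. $E_1,E_2:\mathbb{R}_+^5\to\mathbb{R}_+$ are functions such that for all $\varepsilon\in(0,1)$, $h\in(0,1)$, $(t,x,y,z)\in[h,1]\times\mathbb{R}^{3d}$: (C2) $S(h,x,y,z,u_h^\varepsilon(t,x,y,z),u_h^\varepsilon(t-h,\cdot))\le\partial_tu_h^\varepsilon-G(D_yu_h^\varepsilon,D_x^2u_h^\varepsilon,u_h^\varepsilon(t,x,y,z+\cdot))+E_1(\varepsilon,h,\|\phi\|_\infty,C_0,K_\rho)$;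 (C3) $S(h,x,y,z,u^\varepsilon(t,x,y,z),u^\varepsilon(t-h,\cdot))\ge\partial_tu^\varepsilon-G(D_yu^\varepsilon,D_x^2u^\varepsilon,u^\varepsilon(t,x,y,z+\cdot))-E_2(\varepsilon,h,\|\phi\|_\infty,C_0,K_\rho)$. *)

theory Defs
  imports "HOL-Analysis.Analysis"
begin

text \<open>\<open>\<real>\<^sup>3\<^sup>d\<close> as a product; the product norm is the Euclidean norm of \<open>\<real>\<^sup>3\<^sup>d\<close>.\<close>

type_synonym 'd vec3 = "(real^'d) \<times> (real^'d) \<times> (real^'d)"

section \<open>Function spaces and derivatives\<close>

definition Cb_Lip :: "('a::real_normed_vector \<Rightarrow> real) set" where
  "Cb_Lip = {f. bounded (range f) \<and> (\<exists>C. C-lipschitz_on UNIV f)}"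

definition sup_norm :: "('a \<Rightarrow> real) \<Rightarrow> real" where
  "sup_norm f = (SUP x. \<bar>f x\<bar>)"

text \<open>\<open>iter_deriv [b\<^sub>1, \<dots>, b\<^sub>k] f\<close> is \<open>\<partial>\<^bsub>b\<^sub>1\<^esub> \<dots> \<partial>\<^bsub>b\<^sub>k\<^esub> f\<close>.\<close>

fun iter_deriv :: "'a::euclidean_space list \<Rightarrow> ('a \<Rightarrow> real) \<Rightarrow> 'a \<Rightarrow> real" where
  "iter_deriv [] f = f"
| "iter_deriv (b # bs) f = (\<lambda>x. frechet_derivative (iter_deriv bs f) (at x) b)"

definition grad :: "((real^'d) \<Rightarrow> real) \<Rightarrow> real^'d \<Rightarrow> real^'d" where
  "grad f x = (\<chi> i. iter_deriv [axis i 1] f x)"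

definition hess :: "((real^'d) \<Rightarrow> real) \<Rightarrow> real^'d \<Rightarrow> real^'d^'d" where
  "hess f x = (\<chi> i j. iter_deriv [axis j 1, axis i 1] f x)"

definition basis_lists :: "nat \<Rightarrow> 'a::euclidean_space list set" where
  "basis_lists k = {bs. set bs \<subseteq> Basis \<and> length bs = k}"

definition Cb_k :: "nat \<Rightarrow> ('a::euclidean_space \<Rightarrow> real) set" where
  "Cb_k k = {f.
     (\<forall>j<k. \<forall>bs\<in>basis_lists j. \<forall>x. iter_deriv bs f differentiable (at x)) \<and>
     (\<forall>j\<le>k. \<forall>bs\<in>basis_lists j.
        continuous_on UNIV (iter_deriv bs f) \<and> bounded (range (iter_deriv bs f)))}"

text \<open>Sup norm of the pointwise Euclidean norm of the tensor \<open>D\<^sup>kf\<close>.\<close>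

definition deriv_sup_norm :: "nat \<Rightarrow> ('a::euclidean_space \<Rightarrow> real) \<Rightarrow> real" where
  "deriv_sup_norm k f = (SUP x. sqrt (\<Sum>bs\<in>basis_lists k. (iter_deriv bs f x)\<^sup>2))"

text \<open>The time derivative on \<open>(0,1]\<close>; it is one-sided at \<open>t = 1\<close>.\<close>

definition time_deriv :: "(real \<Rightarrow> 'a \<Rightarrow> real) \<Rightarrow> real \<Rightarrow> 'a \<Rightarrow> real" where
  "time_deriv u t \<kappa> = vector_derivative (\<lambda>s. u s \<kappa>) (at t within {0<..1})"

definition cont_bdd_on :: "real set \<Rightarrow> (real \<Rightarrow> 'a::real_normed_vector \<Rightarrow> real) \<Rightarrow> bool" where
  "cont_bdd_on I u \<longleftrightarrow>
     continuous_on (I \<times> UNIV) (\<lambda>(t, \<kappa>). u t \<kappa>) \<and> bounded ((\<lambda>(t, \<kappa>). u t \<kappa>) ` (I \<times> UNIV))"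

text \<open>\<open>C\<^sub>b\<^sup>2\<^sup>,\<^sup>3((0,1] \<times> \<real>\<^sup>m)\<close> in the usual parabolic sense: continuous bounded \<open>\<partial>\<^sub>t\<psi>\<close>, \<open>\<partial>\<^sub>t\<^sup>2\<psi>\<close>
  and space derivatives of order at most 3, with no condition on mixed time-space derivatives.\<close>

definition Cb_23 :: "(real \<Rightarrow> 'a::euclidean_space \<Rightarrow> real) set" where
  "Cb_23 = {\<psi>.
     (\<forall>t\<in>{0<..1}. \<forall>\<kappa>. (\<lambda>s. \<psi> s \<kappa>) differentiable (at t within {0<..1})
        \<and> (\<lambda>s. time_deriv \<psi> s \<kappa>) differentiable (at t within {0<..1})) \<and>
     cont_bdd_on {0<..1} (time_deriv \<psi>) \<and>
     cont_bdd_on {0<..1} (time_deriv (time_deriv \<psi>)) \<and>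
     (\<forall>j<3. \<forall>bs\<in>basis_lists j. \<forall>t\<in>{0<..1}. \<forall>\<kappa>. iter_deriv bs (\<psi> t) differentiable (at \<kappa>)) \<and>
     (\<forall>j\<le>3. \<forall>bs\<in>basis_lists j. cont_bdd_on {0<..1} (\<lambda>t. iter_deriv bs (\<psi> t)))}"

section \<open>Sublinear expectations\<close>

text \<open>In the stability axiom, functions on \<open>\<real>\<^sup>n\<close> are functions of sequences whose Lipschitz
  bound involves the first \<open>n\<close> coordinates only. The functional \<open>E\<close> is meaningful only on \<open>H\<close>.\<close>

locale sublinear_expectation =
  fixes H :: "('w \<Rightarrow> real) set" and E :: "('w \<Rightarrow> real) \<Rightarrow> real"
  assumes zero_mem: "(\<lambda>_. 0) \<in> H"
    and add_mem: "X \<in> H \<Longrightarrow> Y \<in> H \<Longrightarrow> (\<lambda>\<omega>. X \<omega> + Y \<omega>) \<in> H"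
    and scale_mem: "X \<in> H \<Longrightarrow> (\<lambda>\<omega>. c * X \<omega>) \<in> H"
    and lipschitz_mem:
      "(\<And>j. j < n \<Longrightarrow> Xs j \<in> H) \<Longrightarrow>
       (\<And>v w. \<bar>f v - f w\<bar> \<le> C * (\<Sum>j<n. \<bar>v j - w j\<bar>)) \<Longrightarrow>
       (\<lambda>\<omega>. f (\<lambda>j::nat. Xs j \<omega>)) \<in> H"
    and mono: "X \<in> H \<Longrightarrow> Y \<in> H \<Longrightarrow> (\<And>\<omega>. X \<omega> \<le> Y \<omega>) \<Longrightarrow> E X \<le> E Y"
    and const: "E (\<lambda>_. c) = c"
    and subadd: "X \<in> H \<Longrightarrow> Y \<in> H \<Longrightarrow> E (\<lambda>\<omega>. X \<omega> + Y \<omega>) \<le> E X + E Y"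
    and pos_hom: "X \<in> H \<Longrightarrow> 0 \<le> c \<Longrightarrow> E (\<lambda>\<omega>. c * X \<omega>) = c * E X"

definition random_vector :: "('w \<Rightarrow> real) set \<Rightarrow> ('w \<Rightarrow> 'a::euclidean_space) \<Rightarrow> bool" where
  "random_vector H X \<longleftrightarrow> (\<forall>b\<in>Basis. (\<lambda>\<omega>. X \<omega> \<bullet> b) \<in> H)"

definition eq_dist ::
  "(('w \<Rightarrow> real) \<Rightarrow> real) \<Rightarrow> ('w \<Rightarrow> 'a::euclidean_space) \<Rightarrow>
   (('v \<Rightarrow> real) \<Rightarrow> real) \<Rightarrow> ('v \<Rightarrow> 'a) \<Rightarrow> bool" where
  "eq_dist E X E' X' \<longleftrightarrow> (\<forall>\<phi>\<in>Cb_Lip. E (\<lambda>\<omega>. \<phi> (X \<omega>)) = E' (\<lambda>\<omega>. \<phi> (X' \<omega>)))"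

text \<open>\<open>Y\<close> is independent from \<open>(Xs 0, \<dots>, Xs (n - 1))\<close>; bounded Lipschitz functions of \<open>n + 1\<close>
  vectors are encoded as in the stability axiom above.\<close>

definition indep_from ::
  "(('w \<Rightarrow> real) \<Rightarrow> real) \<Rightarrow> nat \<Rightarrow> (nat \<Rightarrow> 'w \<Rightarrow> 'a::euclidean_space) \<Rightarrow>
   ('w \<Rightarrow> 'b::euclidean_space) \<Rightarrow> bool" where
  "indep_from E n Xs Y \<longleftrightarrow>
     (\<forall>\<phi> :: (nat \<Rightarrow> 'a) \<Rightarrow> 'b \<Rightarrow> real.
        (\<exists>B. \<forall>v y. \<bar>\<phi> v y\<bar> \<le> B) \<and>
        (\<exists>C. \<forall>v y w y'. \<bar>\<phi> v y - \<phi> w y'\<bar> \<le> C * ((\<Sum>j<n. norm (v j - w j)) + norm (y - y'))) \<longrightarrow>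
        E (\<lambda>\<omega>. \<phi> (\<lambda>j. Xs j \<omega>) (Y \<omega>)) = E (\<lambda>\<omega>. E (\<lambda>\<omega>'. \<phi> (\<lambda>j. Xs j \<omega>) (Y \<omega>'))))"

text \<open>Sequences are indexed from 1; \<open>\<kappa> 0\<close> is irrelevant.\<close>

definition iid_seq ::
  "('w \<Rightarrow> real) set \<Rightarrow> (('w \<Rightarrow> real) \<Rightarrow> real) \<Rightarrow> (nat \<Rightarrow> 'w \<Rightarrow> 'a::euclidean_space) \<Rightarrow> bool" where
  "iid_seq H E \<kappa> \<longleftrightarrow>
     (\<forall>i\<ge>1. random_vector H (\<kappa> i)) \<and>
     (\<forall>i\<ge>1. eq_dist E (\<kappa> (i + 1)) E (\<kappa> i) \<and> indep_from E i (\<lambda>j. \<kappa> (j + 1)) (\<kappa> (i + 1)))"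

definition abs_moment ::
  "(('w \<Rightarrow> real) \<Rightarrow> real) \<Rightarrow> real \<Rightarrow> ('w \<Rightarrow> 'a::real_normed_vector) \<Rightarrow> real" where
  "abs_moment E p X = E (\<lambda>\<omega>. norm (X \<omega>) powr p)"

text \<open>Since \<open>E\<close> is real-valued on \<open>H\<close>, finiteness of a moment means membership in \<open>H\<close>.\<close>

definition finite_moment :: "('w \<Rightarrow> real) set \<Rightarrow> real \<Rightarrow> ('w \<Rightarrow> 'a::real_normed_vector) \<Rightarrow> bool" where
  "finite_moment H p X \<longleftrightarrow> (\<lambda>\<omega>. norm (X \<omega>) powr p) \<in> H"

definition no_mean_uncertainty ::
  "(('w \<Rightarrow> real) \<Rightarrow> real) \<Rightarrow> ('w \<Rightarrow> real^'d) \<Rightarrow> bool" where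
  "no_mean_uncertainty E X \<longleftrightarrow> (\<forall>k. E (\<lambda>\<omega>. X \<omega> $ k) = 0 \<and> E (\<lambda>\<omega>. - (X \<omega> $ k)) = 0)"

definition partial_sum :: "(nat \<Rightarrow> 'w \<Rightarrow> 'a::real_vector) \<Rightarrow> nat \<Rightarrow> 'w \<Rightarrow> 'a" where
  "partial_sum X n \<omega> = (\<Sum>i=1..n. X i \<omega>)"

section \<open>The uncertainty set and the PIDE\<close>

definition spectral_measures :: "(real^'d) measure set" where
  "spectral_measures =
     {\<mu>. sets \<mu> = sets (restrict_space borel (sphere 0 1)) \<and> finite_measure \<mu>}"

definition levy_measure :: "real \<Rightarrow> (real^'d) measure \<Rightarrow> (real^'d) measure" where
  "levy_measure \<alpha> \<mu> = measure_of UNIV (sets borel)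
     (\<lambda>B. \<integral>\<^sup>+x. (\<integral>\<^sup>+r\<in>{0<..}. indicator B (r *\<^sub>R x) * ennreal (1 / r powr (1 + \<alpha>)) \<partial>lborel) \<partial>\<mu>)"

definition weak_topology :: "(real^'d) measure topology" where
  "weak_topology = topology_generated_by
     {{\<mu>\<in>spectral_measures. (\<integral>x. f x \<partial>\<mu>) \<in> U} |f U. continuous_on (sphere 0 1) f \<and> open (U :: real set)}"

definition levy_class :: "real \<Rightarrow> real \<Rightarrow> real \<Rightarrow> (real^'d) measure set" where
  "levy_class \<alpha> lo hi =
     {levy_measure \<alpha> \<mu> |\<mu>. \<mu> \<in> spectral_measures \<and> lo < measure \<mu> (sphere 0 1) \<and> measure \<mu> (sphere 0 1) < hi}"

definition convex_measures :: "'a measure set \<Rightarrow> bool" where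
  "convex_measures K \<longleftrightarrow>
     (\<forall>F\<^sub>1\<in>K. \<forall>F\<^sub>2\<in>K. \<forall>a\<in>{0..1::real}. \<exists>F\<in>K. \<forall>B\<in>sets F\<^sub>1.
        emeasure F B = ennreal a * emeasure F\<^sub>1 B + ennreal (1 - a) * emeasure F\<^sub>2 B)"

definition sym_matrices :: "(real^'d^'d) set" where
  "sym_matrices = {A. transpose A = A}"

definition psd_matrices :: "(real^'d^'d) set" where
  "psd_matrices = {A \<in> sym_matrices. \<forall>x. 0 \<le> x \<bullet> (A *v x)}"

definition uncertainty_set ::
  "real \<Rightarrow> real \<Rightarrow> real \<Rightarrow> (real^'d) measure set \<Rightarrow>
   ((real^'d) measure \<times> (real^'d) \<times> (real^'d^'d)) set \<Rightarrow> bool" where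
  "uncertainty_set \<alpha> lo hi K \<Theta> \<longleftrightarrow>
     K \<subseteq> levy_class \<alpha> lo hi \<and> K \<noteq> {} \<and>
     compactin weak_topology {\<mu>\<in>spectral_measures. levy_measure \<alpha> \<mu> \<in> K} \<and>
     convex_measures K \<and>
     \<Theta> \<subseteq> K \<times> UNIV \<times> psd_matrices \<and> \<Theta> \<noteq> {} \<and>
     (SUP (F, q, Q)\<in>\<Theta>.
        (\<integral>\<^sup>+z. ennreal (min (norm z) ((norm z)\<^sup>2)) \<partial>F) + ennreal (norm q) + ennreal (norm Q)) < \<infinity>"

definition jump_delta :: "real^'d \<Rightarrow> (real^'d \<Rightarrow> real) \<Rightarrow> real^'d \<Rightarrow> real" where
  "jump_delta l \<phi> z = \<phi> (z + l) - \<phi> z - grad \<phi> z \<bullet> l"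

definition G_op ::
  "((real^'d) measure \<times> (real^'d) \<times> (real^'d^'d)) set \<Rightarrow>
   real^'d \<Rightarrow> real^'d^'d \<Rightarrow> (real^'d \<Rightarrow> real) \<Rightarrow> real" where
  "G_op \<Theta> p A \<phi> =
     (SUP (F, q, Q)\<in>\<Theta>. (\<integral>l. jump_delta l \<phi> 0 \<partial>F) + p \<bullet> q + 1/2 * trace (A ** Q))"

definition pide_op ::
  "((real^'d) measure \<times> (real^'d) \<times> (real^'d^'d)) set \<Rightarrow>
   (real \<Rightarrow> 'd vec3 \<Rightarrow> real) \<Rightarrow> real \<Rightarrow> real^'d \<Rightarrow> real^'d \<Rightarrow> real^'d \<Rightarrow> real" where
  "pide_op \<Theta> u t x y z = time_deriv u t (x, y, z)
     - G_op \<Theta> (grad (\<lambda>y'. u t (x, y', z)) y) (hess (\<lambda>x'. u t (x', y, z)) x) (\<lambda>l. u t (x, y, z + l))"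

definition bdd_fun :: "(real \<Rightarrow> 'a \<Rightarrow> real) \<Rightarrow> bool" where
  "bdd_fun u \<longleftrightarrow> bounded ((\<lambda>(t, \<kappa>). u t \<kappa>) ` ({0..1} \<times> UNIV))"

definition usc_fun :: "(real \<Rightarrow> 'a::topological_space \<Rightarrow> real) \<Rightarrow> bool" where
  "usc_fun u \<longleftrightarrow>
     (\<forall>c. openin (top_of_set ({0..1} \<times> UNIV)) {(t, \<kappa>). t \<in> {0..1} \<and> u t \<kappa> < c})"

definition lsc_fun :: "(real \<Rightarrow> 'a::topological_space \<Rightarrow> real) \<Rightarrow> bool" where
  "lsc_fun u \<longleftrightarrow> usc_fun (\<lambda>t \<kappa>. - u t \<kappa>)"

definition viscosity_subsolution ::
  "((real^'d) measure \<times> (real^'d) \<times> (real^'d^'d)) set \<Rightarrow> ('d vec3 \<Rightarrow> real) \<Rightarrow>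
   (real \<Rightarrow> 'd vec3 \<Rightarrow> real) \<Rightarrow> bool" where
  "viscosity_subsolution \<Theta> \<phi> u \<longleftrightarrow>
     bdd_fun u \<and> usc_fun u \<and> (\<forall>\<kappa>. u 0 \<kappa> \<le> \<phi> \<kappa>) \<and>
     (\<forall>t\<in>{0<..1}. \<forall>x y z. \<forall>\<psi>\<in>Cb_23.
        (\<forall>s\<in>{0<..1}. \<forall>\<kappa>. u s \<kappa> \<le> \<psi> s \<kappa>) \<and> \<psi> t (x, y, z) = u t (x, y, z) \<longrightarrow>
        pide_op \<Theta> \<psi> t x y z \<le> 0)"

definition viscosity_supersolution ::
  "((real^'d) measure \<times> (real^'d) \<times> (real^'d^'d)) set \<Rightarrow> ('d vec3 \<Rightarrow> real) \<Rightarrow>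
   (real \<Rightarrow> 'd vec3 \<Rightarrow> real) \<Rightarrow> bool" where
  "viscosity_supersolution \<Theta> \<phi> u \<longleftrightarrow>
     bdd_fun u \<and> lsc_fun u \<and> (\<forall>\<kappa>. \<phi> \<kappa> \<le> u 0 \<kappa>) \<and>
     (\<forall>t\<in>{0<..1}. \<forall>x y z. \<forall>\<psi>\<in>Cb_23.
        (\<forall>s\<in>{0<..1}. \<forall>\<kappa>. \<psi> s \<kappa> \<le> u s \<kappa>) \<and> \<psi> t (x, y, z) = u t (x, y, z) \<longrightarrow>
        0 \<le> pide_op \<Theta> \<psi> t x y z)"

definition viscosity_solution ::
  "((real^'d) measure \<times> (real^'d) \<times> (real^'d^'d)) set \<Rightarrow> ('d vec3 \<Rightarrow> real) \<Rightarrow>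
   (real \<Rightarrow> 'd vec3 \<Rightarrow> real) \<Rightarrow> bool" where
  "viscosity_solution \<Theta> \<phi> u \<longleftrightarrow>
     cont_bdd_on {0..1} u \<and> viscosity_subsolution \<Theta> \<phi> u \<and> viscosity_supersolution \<Theta> \<phi> u"

section \<open>Nonlinear Levy processes\<close>

definition nonlinear_levy ::
  "('v \<Rightarrow> real) set \<Rightarrow> (('v \<Rightarrow> real) \<Rightarrow> real) \<Rightarrow> (real \<Rightarrow> 'v \<Rightarrow> 'a::euclidean_space) \<Rightarrow> bool" where
  "nonlinear_levy H E L \<longleftrightarrow>
     (\<forall>t\<in>{0..1}. random_vector H (L t)) \<and>
     (\<forall>\<omega>. (\<forall>t\<in>{0..<1}. ((\<lambda>s. L s \<omega>) \<longlongrightarrow> L t \<omega>) (at_right t)) \<and>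
          (\<forall>t\<in>{0<..1}. \<exists>l. ((\<lambda>s. L s \<omega>) \<longlongrightarrow> l) (at_left t))) \<and>
     (\<forall>\<omega>. L 0 \<omega> = 0) \<and>
     (\<forall>s t. 0 \<le> s \<and> s \<le> t \<and> t \<le> 1 \<longrightarrow> eq_dist E (\<lambda>\<omega>. L t \<omega> - L s \<omega>) E (L (t - s))) \<and>
     (\<forall>n s t \<tau>. (\<forall>j<n. 0 \<le> \<tau> j \<and> \<tau> j \<le> s) \<and> (\<forall>i j. i \<le> j \<and> j < n \<longrightarrow> \<tau> i \<le> \<tau> j)
          \<and> 0 \<le> s \<and> s \<le> t \<and> t \<le> 1 \<longrightarrow>
        indep_from E n (\<lambda>j. L (\<tau> j)) (\<lambda>\<omega>. L t \<omega> - L s \<omega>))"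

definition value_fun ::
  "(('v \<Rightarrow> real) \<Rightarrow> real) \<Rightarrow> (real \<Rightarrow> 'v \<Rightarrow> 'a::plus) \<Rightarrow> ('a \<Rightarrow> real) \<Rightarrow> real \<Rightarrow> 'a \<Rightarrow> real" where
  "value_fun E L \<phi> t \<kappa> = E (\<lambda>\<omega>. \<phi> (\<kappa> + L t \<omega>))"

text \<open>\<open>C\<^sub>0 \<phi>\<close> is the regularity constant of the value function with initial datum \<open>\<phi>\<close>.\<close>

definition associated_process ::
  "((real^'d) measure \<times> (real^'d) \<times> (real^'d^'d)) set \<Rightarrow> (('d vec3 \<Rightarrow> real) \<Rightarrow> real) \<Rightarrow>
   ('v \<Rightarrow> real) set \<Rightarrow> (('v \<Rightarrow> real) \<Rightarrow> real) \<Rightarrow> (real \<Rightarrow> 'v \<Rightarrow> 'd vec3) \<Rightarrow> bool" where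
  "associated_process \<Theta> C\<^sub>0 H E L \<longleftrightarrow>
     nonlinear_levy H E L \<and>
     (\<forall>\<phi>\<in>Cb_Lip.
        viscosity_solution \<Theta> \<phi> (value_fun E L \<phi>) \<and>
        (\<forall>v. viscosity_solution \<Theta> \<phi> v \<longrightarrow> (\<forall>t\<in>{0..1}. \<forall>\<kappa>. v t \<kappa> = value_fun E L \<phi> t \<kappa>)) \<and>
        (\<forall>t\<in>{0..1}. \<forall>\<kappa>. \<bar>value_fun E L \<phi> t \<kappa>\<bar> \<le> sup_norm \<phi>) \<and>
        (\<forall>t\<in>{0..1}. \<forall>t'\<in>{0..1}. \<forall>x y z x' y' z'.
           \<bar>value_fun E L \<phi> t (x, y, z) - value_fun E L \<phi> t' (x', y', z')\<bar>
             \<le> C\<^sub>0 \<phi> * (sqrt \<bar>t - t'\<bar> + norm (x - x') + norm (y - y') + norm (z - z'))))"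

section \<open>Assumptions on the sequence\<close>

definition XY_moment_conditions ::
  "('w \<Rightarrow> real) set \<Rightarrow> (('w \<Rightarrow> real) \<Rightarrow> real) \<Rightarrow>
   (nat \<Rightarrow> 'w \<Rightarrow> real^'d) \<Rightarrow> (nat \<Rightarrow> 'w \<Rightarrow> real^'d) \<Rightarrow> bool" where
  "XY_moment_conditions H E X Y \<longleftrightarrow>
     no_mean_uncertainty E (X 1) \<and> finite_moment H 3 (X 1) \<and> finite_moment H 2 (Y 1)"

definition M_star ::
  "(('w \<Rightarrow> real) \<Rightarrow> real) \<Rightarrow> real \<Rightarrow> (nat \<Rightarrow> 'w \<Rightarrow> real^'d) \<Rightarrow> real" where
  "M_star E \<alpha> Z = (SUP n\<in>{1..}. E (\<lambda>\<omega>. real n powr (- 1 / \<alpha>) * norm (partial_sum Z n \<omega>)))"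

definition Z_moment_conditions ::
  "('w \<Rightarrow> real) set \<Rightarrow> (('w \<Rightarrow> real) \<Rightarrow> real) \<Rightarrow> real \<Rightarrow> (nat \<Rightarrow> 'w \<Rightarrow> real^'d) \<Rightarrow> bool" where
  "Z_moment_conditions H E \<alpha> Z \<longleftrightarrow>
     no_mean_uncertainty E (Z 1) \<and>
     bdd_above ((\<lambda>n. E (\<lambda>\<omega>. real n powr (- 1 / \<alpha>) * norm (partial_sum Z n \<omega>))) ` {1..}) \<and>
     (\<exists>\<delta>. max (3/4 * \<alpha>) 1 < \<delta> \<and> \<delta> < \<alpha> \<and> finite_moment H \<delta> (Z 1))"

text \<open>The random variable below need not lie in \<open>H\<close> by the stability axiom, because of its
  quadratic term; its membership is therefore part of the condition.\<close>

definition consistency_condition ::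
  "('w \<Rightarrow> real) set \<Rightarrow> (('w \<Rightarrow> real) \<Rightarrow> real) \<Rightarrow> real \<Rightarrow>
   ((real^'d) measure \<times> (real^'d) \<times> (real^'d^'d)) set \<Rightarrow>
   ('w \<Rightarrow> real^'d) \<Rightarrow> ('w \<Rightarrow> real^'d) \<Rightarrow> ('w \<Rightarrow> real^'d) \<Rightarrow> bool" where
  "consistency_condition H E \<alpha> \<Theta> X Y Z \<longleftrightarrow>
     (\<exists>err :: real \<Rightarrow> real \<Rightarrow> real.
        (\<forall>C>0. uniform_limit {0..C} err (\<lambda>_. 0) (at_right 0)) \<and>
        (\<forall>p. \<forall>A\<in>sym_matrices. \<forall>\<phi>\<in>Cb_k 3. \<forall>z. \<forall>s\<in>{0<..1}.
           let V = (\<lambda>\<omega>. \<phi> (z + s powr (1/\<alpha>) *\<^sub>R Z \<omega>) - \<phi> z + p \<bullet> (s *\<^sub>R Y \<omega>)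
                     + 1/2 * ((A *v (sqrt s *\<^sub>R X \<omega>)) \<bullet> (sqrt s *\<^sub>R X \<omega>)));
               L\<^sub>0 = norm p + norm A + sup_norm \<phi> + (\<Sum>i=1..3. deriv_sup_norm i \<phi>)
           in V \<in> H \<and> 1/s * \<bar>E V - s * G_op \<Theta> p A (\<lambda>l. \<phi> (z + l))\<bar> \<le> err s L\<^sub>0))"

section \<open>The approximation scheme\<close>

function u_scheme ::
  "(('w \<Rightarrow> real) \<Rightarrow> real) \<Rightarrow> real \<Rightarrow> ('w \<Rightarrow> real^'d) \<Rightarrow> ('w \<Rightarrow> real^'d) \<Rightarrow> ('w \<Rightarrow> real^'d) \<Rightarrow>
   ('d vec3 \<Rightarrow> real) \<Rightarrow> real \<Rightarrow> real \<Rightarrow> 'd vec3 \<Rightarrow> real" where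
  "u_scheme E \<alpha> X Y Z \<phi> h t (x, y, z) =
     (if 0 < h \<and> h \<le> t
      then E (\<lambda>\<omega>. u_scheme E \<alpha> X Y Z \<phi> h (t - h)
                (x + sqrt h *\<^sub>R X \<omega>, y + h *\<^sub>R Y \<omega>, z + h powr (1/\<alpha>) *\<^sub>R Z \<omega>))
      else \<phi> (x, y, z))"
  by pat_completeness auto
termination
proof (relation "Wellfounded.measure (\<lambda>(E, \<alpha>, X, Y, Z, \<phi>, h, t, \<kappa>). nat \<lfloor>t / h\<rfloor>)", goal_cases)
  case 1
  then show ?case by simp
next
  case (2 E \<alpha> X Y Z \<phi> h t x y z \<omega>)
  then have "\<lfloor>(t - h) / h\<rfloor> = \<lfloor>t / h\<rfloor> - 1" and "1 \<le> \<lfloor>t / h\<rfloor>"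
    by (simp_all add: diff_divide_distrib le_floor_iff)
  then show ?case by simp
qed

definition scheme_S ::
  "(('w \<Rightarrow> real) \<Rightarrow> real) \<Rightarrow> real \<Rightarrow> ('w \<Rightarrow> real^'d) \<Rightarrow> ('w \<Rightarrow> real^'d) \<Rightarrow> ('w \<Rightarrow> real^'d) \<Rightarrow>
   real \<Rightarrow> real^'d \<Rightarrow> real^'d \<Rightarrow> real^'d \<Rightarrow> real \<Rightarrow> ('d vec3 \<Rightarrow> real) \<Rightarrow> real" where
  "scheme_S E \<alpha> X Y Z h x y z p v =
     1/h * (p - E (\<lambda>\<omega>. v (x + sqrt h *\<^sub>R X \<omega>, y + h *\<^sub>R Y \<omega>, z + h powr (1/\<alpha>) *\<^sub>R Z \<omega>)))"

definition lip_const :: "('d::finite vec3 \<Rightarrow> real) \<Rightarrow> real" where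
  "lip_const \<phi> = Inf {C. 0 \<le> C \<and> (\<forall>x y z x' y' z'.
     \<bar>\<phi> (x, y, z) - \<phi> (x', y', z')\<bar> \<le> C * (norm (x - x') + norm (y - y') + norm (z - z')))}"

definition C0_const ::
  "(('w \<Rightarrow> real) \<Rightarrow> real) \<Rightarrow> real \<Rightarrow> (nat \<Rightarrow> 'w \<Rightarrow> real^'d) \<Rightarrow> (nat \<Rightarrow> 'w \<Rightarrow> real^'d) \<Rightarrow>
   (nat \<Rightarrow> 'w \<Rightarrow> real^'d) \<Rightarrow> ('d vec3 \<Rightarrow> real) \<Rightarrow> real" where
  "C0_const E \<alpha> X Y Z \<phi> =
     max (lip_const \<phi> * (sqrt (abs_moment E 2 (X 1)) + abs_moment E 1 (Y 1) + M_star E \<alpha> Z))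
         (lip_const \<phi>)"

section \<open>Mollification\<close>

definition mollifier :: "(real \<times> 'd::finite vec3 \<Rightarrow> real) \<Rightarrow> bool" where
  "mollifier \<rho> \<longleftrightarrow>
     (\<forall>k. \<forall>bs\<in>basis_lists k. \<forall>p. iter_deriv bs \<rho> differentiable (at p)) \<and>
     (\<forall>p. 0 \<le> \<rho> p) \<and>
     closure {p. \<rho> p \<noteq> 0} \<subseteq> {-1..0} \<times> cball 0 1 \<and>
     (\<integral>p. \<rho> p \<partial>lborel) = 1"

definition rho_eps :: "(real \<times> 'd::finite vec3 \<Rightarrow> real) \<Rightarrow> real \<Rightarrow> real \<Rightarrow> 'd vec3 \<Rightarrow> real" where
  "rho_eps \<rho> \<epsilon> \<tau> e = 1 / \<epsilon> ^ (2 + 3 * CARD('d)) * \<rho> (\<tau> / \<epsilon>\<^sup>2, e /\<^sub>R \<epsilon>)"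

text \<open>\<open>v (min 1 s)\<close> is the extension of \<open>v\<close> beyond time 1 by its value at time 1.\<close>

definition mollify ::
  "(real \<times> 'd::finite vec3 \<Rightarrow> real) \<Rightarrow> real \<Rightarrow> (real \<Rightarrow> 'd vec3 \<Rightarrow> real) \<Rightarrow> real \<Rightarrow> 'd vec3 \<Rightarrow> real" where
  "mollify \<rho> \<epsilon> v t \<kappa> =
     (LINT \<tau>:{-(\<epsilon>\<^sup>2)..0}|lborel. (LINT e:ball 0 \<epsilon>|lborel.
        v (min 1 (t - \<tau>)) (\<kappa> - e) * rho_eps \<rho> \<epsilon> \<tau> e))"

text \<open>The list \<open>replicate i (1, 0) @ map (Pair 0) bs\<close> encodes \<open>\<partial>\<^sub>t\<^sup>i D\<^sup>\<gamma>\<close> with \<open>|\<gamma>| = length bs\<close>.\<close>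

definition K_rho :: "(real \<times> 'd::finite vec3 \<Rightarrow> real) \<Rightarrow> real" where
  "K_rho \<rho> = Max {(LINT \<tau>:{-1..0}|lborel. (LINT e:ball 0 1|lborel.
        \<bar>iter_deriv (replicate i (1, 0) @ map (Pair 0) bs) \<rho> (\<tau>, e)\<bar>))
      |i j bs. i + j \<le> 3 \<and> bs \<in> basis_lists j}"

section \<open>Error functions of the scheme\<close>

definition nonneg5 :: "(real \<Rightarrow> real \<Rightarrow> real \<Rightarrow> real \<Rightarrow> real \<Rightarrow> real) \<Rightarrow> bool" where
  "nonneg5 f \<longleftrightarrow> (\<forall>a\<ge>0. \<forall>b\<ge>0. \<forall>c\<ge>0. \<forall>d\<ge>0. \<forall>e\<ge>0. 0 \<le> f a b c d e)"

text \<open>In the two conditions below \<open>w \<epsilon> h\<close> is the mollified function (\<open>u\<^sub>h\<^sup>\<epsilon>\<close>, resp. \<open>u\<^sup>\<epsilon>\<close>) and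
  \<open>err \<epsilon> h\<close> the error function at its remaining three arguments.\<close>

definition upper_consistent ::
  "(('w \<Rightarrow> real) \<Rightarrow> real) \<Rightarrow> real \<Rightarrow> ('w \<Rightarrow> real^'d) \<Rightarrow> ('w \<Rightarrow> real^'d) \<Rightarrow> ('w \<Rightarrow> real^'d) \<Rightarrow>
   ((real^'d) measure \<times> (real^'d) \<times> (real^'d^'d)) set \<Rightarrow>
   (real \<Rightarrow> real \<Rightarrow> real \<Rightarrow> 'd vec3 \<Rightarrow> real) \<Rightarrow> (real \<Rightarrow> real \<Rightarrow> real) \<Rightarrow> bool" where
  "upper_consistent E \<alpha> X Y Z \<Theta> w err \<longleftrightarrow>
     (\<forall>\<epsilon>\<in>{0<..<1}. \<forall>h\<in>{0<..<1}. \<forall>t\<in>{h..1}. \<forall>x y z.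
        scheme_S E \<alpha> X Y Z h x y z (w \<epsilon> h t (x, y, z)) (w \<epsilon> h (t - h))
          \<le> pide_op \<Theta> (w \<epsilon> h) t x y z + err \<epsilon> h)"

definition lower_consistent ::
  "(('w \<Rightarrow> real) \<Rightarrow> real) \<Rightarrow> real \<Rightarrow> ('w \<Rightarrow> real^'d) \<Rightarrow> ('w \<Rightarrow> real^'d) \<Rightarrow> ('w \<Rightarrow> real^'d) \<Rightarrow>
   ((real^'d) measure \<times> (real^'d) \<times> (real^'d^'d)) set \<Rightarrow>
   (real \<Rightarrow> real \<Rightarrow> real \<Rightarrow> 'd vec3 \<Rightarrow> real) \<Rightarrow> (real \<Rightarrow> real \<Rightarrow> real) \<Rightarrow> bool" where
  "lower_consistent E \<alpha> X Y Z \<Theta> w err \<longleftrightarrow>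
     (\<forall>\<epsilon>\<in>{0<..<1}. \<forall>h\<in>{0<..<1}. \<forall>t\<in>{h..1}. \<forall>x y z.
        scheme_S E \<alpha> X Y Z h x y z (w \<epsilon> h t (x, y, z)) (w \<epsilon> h (t - h))
          \<ge> pide_op \<Theta> (w \<epsilon> h) t x y z - err \<epsilon> h)"

end

theory Submission
  imports Defs
begin

text \<open>
  Write \<open>h = 1/n\<close>, let \<open>T f \<kappa> = E[f(\<kappa> + D)]\<close> be the one-step operator with the scaled increment \<open>D\<close>, let \<open>u\<^sub>h\<close> be the
  scheme and \<open>u(t, \<kappa>) = E'[\<phi>(\<kappa> + L\<^sub>t)]\<close> the value function of the Levy process. By independence the expectation of
  \<open>\<phi>\<close> of the normalized sums is \<open>T\<^sup>n \<phi>\<close> at 0, that is \<open>u\<^sub>h(1, 0)\<close> (\<open>iid_sum_eq_step_pow\<close>), so \<open>u\<^sub>h(1, 0) - u(1, 0)\<close> has to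
  be estimated. Both functions are Lipschitz in space and half-Hoelder in time with constant \<open>C\<^sub>0\<close>, the scheme up to
  the grid width (\<open>step_pow_time_regularity\<close>, \<open>uh_regularity\<close>). Hence replacing them by their mollifications at scale
  \<open>\<epsilon>\<close> costs multiples of \<open>C\<^sub>0 \<epsilon>\<close> and \<open>C\<^sub>0 sqrt h\<close>.

  Both evolutions are given by sublinear expectations, and a sublinear expectation satisfies Jensen's inequality for
  averages over a parameter (\<open>Jensen\<close>, \<open>conv_Jensen\<close>). Consequently the mollified functions are supersolutions:
  \<open>T(u\<^sub>h\<^sup>\<epsilon>(t - h)) \<le> u\<^sub>h\<^sup>\<epsilon>(t)\<close> and \<open>E'[u\<^sup>\<epsilon>(t, \<kappa> + L\<^sub>s)] \<le> u\<^sup>\<epsilon>(t + s, \<kappa>)\<close>.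

  For the lower bound, the first inequality and the upper consistency condition make \<open>u\<^sub>h\<^sup>\<epsilon>\<close> a smooth supersolution of the
  equation up to \<open>E\<^sub>1\<close>, and it dominates the viscosity subsolution \<open>u\<close> by comparison (\<open>comparison_subsolution\<close>,
  \<open>lower_bound\<close>). Comparing a viscosity solution with a smooth function needs no doubling of variables, only a maximum
  point, which a small bump provides although space is not compact (\<open>perturbed_maximum\<close>).

  For the upper bound, the second inequality makes \<open>u\<^sup>\<epsilon>\<close> a classical supersolution of the equation. The only access to
  the generator of the process is through viscosity solutions, so this step compares the value function with datum
  \<open>u\<^sup>\<epsilon>(t, _)\<close> with an explicit smooth strict subsolution (\<open>smooth_majorant_supersolution\<close>). The lower consistency condition turns it
  into a supersolution of the scheme up to \<open>E\<^sub>2\<close>, and comparison is an induction along the time grid (\<open>upper_bound\<close>).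

  The kernel reaches forward in time by up to \<open>\<epsilon>\<^sup>2\<close>, where the extension beyond time 1 is constant, so both supersolution
  properties are available up to time \<open>1 - \<epsilon>\<^sup>2\<close> only. The time regularity bridges the remaining interval and the initial
  layer. The two arguments give \<open>C\<^sub>0 (3 sqrt h + 7 \<epsilon>) + E\<^sub>1\<close> and \<open>C\<^sub>0 (2 sqrt h + 15/2 \<epsilon>) + E\<^sub>2\<close>. When \<open>\<epsilon>\<close> is of order one or
  \<open>n = 1\<close>, the crude bound \<open>2 C\<^sub>0\<close> on the difference suffices.
\<close>

section \<open>Directional derivatives and Taylor bounds\<close>

text \<open>Directions are arbitrary vectors, which makes chain rules and the linear expansion \<open>pd_expand\<close> available;
  \<^const>\<open>iter_deriv\<close> is the iteration of \<open>pd\<close> along basis vectors.\<close>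

definition pd :: "'a::euclidean_space \<Rightarrow> ('a \<Rightarrow> real) \<Rightarrow> 'a \<Rightarrow> real" where
  "pd b f p = frechet_derivative f (at p) b"

lemma pd_expand:
  fixes f :: "'a::euclidean_space \<Rightarrow> real"
  assumes "f differentiable (at p)"
  shows "pd v f p = (\<Sum>b\<in>Basis. (v \<bullet> b) * pd b f p)"
proof -
  have l: "linear (frechet_derivative f (at p))"
    by (rule linear_frechet_derivative[OF assms])
  have "frechet_derivative f (at p) v = frechet_derivative f (at p) (\<Sum>b\<in>Basis. (v \<bullet> b) *\<^sub>R b)"
    by (simp add: euclidean_representation)
  also have "\<dots> = (\<Sum>b\<in>Basis. (v \<bullet> b) * frechet_derivative f (at p) b)"
    by (simp add: linear_sum[OF l] linear_cmul[OF l])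
  finally show ?thesis by (simp add: pd_def)
qed

lemma has_derivative_pd:
  fixes f :: "'a::euclidean_space \<Rightarrow> real"
  assumes "f differentiable (at p)"
  shows "(f has_derivative (\<lambda>v. pd v f p)) (at p)"
  using assms by (simp add: pd_def[abs_def] frechet_derivative_works)

lemma pd_eqI:
  fixes f :: "'a::euclidean_space \<Rightarrow> real"
  assumes "(f has_derivative f') (at p)"
  shows "pd v f p = f' v"
  using frechet_derivative_at[OF assms] by (simp add: pd_def)

lemma abs_pd_le:
  fixes f :: "'a::euclidean_space \<Rightarrow> real"
  assumes "f differentiable (at p)" "\<And>b. b \<in> Basis \<Longrightarrow> \<bar>pd b f p\<bar> \<le> B"
  shows "\<bar>pd v f p\<bar> \<le> real DIM('a) * B * norm v"
proof -
  have "\<bar>pd v f p\<bar> \<le> (\<Sum>b\<in>Basis. \<bar>(v \<bullet> b) * pd b f p\<bar>)"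
    by (subst pd_expand[OF assms(1)]) (rule sum_abs)
  also have "\<dots> \<le> (\<Sum>b\<in>(Basis::'a set). norm v * B)"
    using assms(2) by (intro sum_mono) (auto simp: abs_mult intro!: mult_mono Basis_le_norm)
  finally show ?thesis by (simp add: mult_ac)
qed

lemma mean_value_pd:
  fixes f :: "'a::euclidean_space \<Rightarrow> real"
  assumes "convex S" "x \<in> S" "y \<in> S"
    and "\<And>p. p \<in> S \<Longrightarrow> f differentiable (at p)"
    and "\<And>p b. p \<in> S \<Longrightarrow> b \<in> Basis \<Longrightarrow> \<bar>pd b f p\<bar> \<le> B"
  shows "\<bar>f x - f y\<bar> \<le> real DIM('a) * B * norm (x - y)"
proof -
  have "norm (f x - f y) \<le> (real DIM('a) * B) * norm (x - y)"
  proof (rule differentiable_bound[OF assms(1) _ _ assms(2,3)])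
    fix p assume p: "p \<in> S"
    show "(f has_derivative (\<lambda>v. pd v f p)) (at p within S)"
      using has_derivative_pd[OF assms(4)[OF p]] has_derivative_at_withinI by blast
    show "onorm (\<lambda>v. pd v f p) \<le> real DIM('a) * B"
      by (rule onorm_le) (use abs_pd_le[OF assms(4)[OF p] assms(5)[OF p]] in simp)
  qed
  then show ?thesis by simp
qed

text \<open>Apply the mean value bound to \<open>f\<close> minus its linearisation at \<open>x\<close>: on the segment its derivative is an
  increment of the gradient, hence at most a multiple of \<open>B * norm h\<close> by the mean value bound again.
  The factor \<open>DIM\<^sup>2\<close> is the price of bounding second derivatives along basis vectors only.\<close>

lemma taylor_pd:
  fixes f :: "'a::euclidean_space \<Rightarrow> real"
  assumes "convex S" "x \<in> S" "x + h \<in> S"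
    and "\<And>p. p \<in> S \<Longrightarrow> f differentiable (at p)"
    and "\<And>p b. p \<in> S \<Longrightarrow> b \<in> Basis \<Longrightarrow> pd b f differentiable (at p)"
    and B: "\<And>p b c. p \<in> S \<Longrightarrow> b \<in> Basis \<Longrightarrow> c \<in> Basis \<Longrightarrow> \<bar>pd c (pd b f) p\<bar> \<le> B"
  shows "\<bar>f (x + h) - f x - pd h f x\<bar> \<le> (real DIM('a))\<^sup>2 * B * (norm h)\<^sup>2"
proof -
  let ?g = "\<lambda>y. f y - pd y f x"
  let ?S = "closed_segment x (x + h)"
  have sub: "?S \<subseteq> S"
    using assms(1-3) by (simp add: closed_segment_subset)
  have lin: "bounded_linear (\<lambda>v. pd v f x)"
    using has_derivative_bounded_linear[OF has_derivative_pd[OF assms(4)[OF assms(2)]]] .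
  have gd: "(?g has_derivative (\<lambda>v. pd v f p - pd v f x)) (at p)" if "p \<in> S" for p
    by (intro has_derivative_diff has_derivative_pd assms(4) that
        bounded_linear.has_derivative[OF lin] has_derivative_ident)
  have Bn: "0 \<le> B" using B[OF assms(2) SOME_Basis SOME_Basis] by (meson abs_ge_zero order_trans)
  have "\<bar>?g (x + h) - ?g x\<bar> \<le> real DIM('a) * (real DIM('a) * B * norm h) * norm (x + h - x)"
  proof (rule mean_value_pd[of ?S])
    fix p assume p: "p \<in> ?S"
    show "?g differentiable (at p)" using gd[of p] p sub by (auto simp: differentiable_def)
    fix b :: 'a assume b: "b \<in> Basis"
    have "pd b ?g p = pd b f p - pd b f x" using pd_eqI[OF gd[of p]] p sub by auto
    also have "\<bar>\<dots>\<bar> \<le> real DIM('a) * B * norm (p - x)"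
      by (rule mean_value_pd[OF assms(1)]) (use p sub assms(2,5) B b in auto)
    also have "\<dots> \<le> real DIM('a) * B * norm h"
      using segment_bound(1)[OF p] Bn by (intro mult_left_mono) auto
    finally show "\<bar>pd b ?g p\<bar> \<le> real DIM('a) * B * norm h" .
  qed auto
  moreover have "pd (x + h) f x = pd x f x + pd h f x"
    using bounded_linear.linear[OF lin] linear_add by blast
  ultimately show ?thesis by (simp add: power2_eq_square algebra_simps)
qed

section \<open>Smooth functions bounded on time strips\<close>

text \<open>Bounds on every strip, uniform in space. Global bounds would exclude polynomials in time, which serve as
  penalties below; bounds on \<open>[0,1]\<close> alone would not be stable under shifts in time.\<close>

definition strip_bounded :: "(real \<times> 'a \<Rightarrow> real) \<Rightarrow> bool" where
  "strip_bounded f \<longleftrightarrow> (\<forall>R. \<exists>B. \<forall>t\<in>{-R..R}. \<forall>\<kappa>. \<bar>f (t, \<kappa>)\<bar> \<le> B)"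

text \<open>The recursion over first derivatives turns closure under products and convolutions into a plain induction,
  without a formula for higher derivatives of a product.\<close>

primrec strip_smooth :: "nat \<Rightarrow> (real \<times> 'a::euclidean_space \<Rightarrow> real) \<Rightarrow> bool" where
  "strip_smooth 0 f \<longleftrightarrow> strip_bounded f"
| "strip_smooth (Suc n) f \<longleftrightarrow> strip_bounded f \<and> (\<forall>p. f differentiable (at p)) \<and>
     (\<forall>b\<in>Basis. strip_smooth n (pd b f))"

lemma strip_boundedE:
  assumes "strip_bounded f"
  obtains B where "0 \<le> B" "\<And>t \<kappa>. \<bar>t\<bar> \<le> R \<Longrightarrow> \<bar>f (t, \<kappa>)\<bar> \<le> B"
proof -
  from assms obtain B where B: "\<forall>t\<in>{-R..R}. \<forall>\<kappa>. \<bar>f (t, \<kappa>)\<bar> \<le> B"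
    unfolding strip_bounded_def by blast
  show thesis
  proof (rule that[of "max 0 B"])
    fix t \<kappa> assume "\<bar>t\<bar> \<le> R"
    then have "\<bar>f (t, \<kappa>)\<bar> \<le> B" using B by (auto simp: abs_le_iff)
    then show "\<bar>f (t, \<kappa>)\<bar> \<le> max 0 B" by simp
  qed simp
qed

lemma strip_boundedI:
  assumes "\<And>R. \<exists>B. \<forall>t \<kappa>. \<bar>t\<bar> \<le> R \<longrightarrow> \<bar>f (t, \<kappa>)\<bar> \<le> B"
  shows "strip_bounded f"
  unfolding strip_bounded_def
proof
  fix R
  obtain B where "\<forall>t \<kappa>. \<bar>t\<bar> \<le> R \<longrightarrow> \<bar>f (t, \<kappa>)\<bar> \<le> B" using assms by blast
  then show "\<exists>B. \<forall>t\<in>{-R..R}. \<forall>\<kappa>. \<bar>f (t, \<kappa>)\<bar> \<le> B"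
    by (intro exI[of _ B] ballI allI) (auto simp: abs_le_iff)
qed

lemma strip_bounded_add:
  assumes "strip_bounded f" "strip_bounded g"
  shows "strip_bounded (\<lambda>p. f p + g p)"
proof (rule strip_boundedI)
  fix R
  obtain B where "\<And>t \<kappa>. \<bar>t\<bar> \<le> R \<Longrightarrow> \<bar>f (t, \<kappa>)\<bar> \<le> B" using strip_boundedE[OF assms(1)] by blast
  moreover obtain C where "\<And>t \<kappa>. \<bar>t\<bar> \<le> R \<Longrightarrow> \<bar>g (t, \<kappa>)\<bar> \<le> C" using strip_boundedE[OF assms(2)] by blast
  ultimately have "\<bar>f (t, \<kappa>) + g (t, \<kappa>)\<bar> \<le> B + C" if "\<bar>t\<bar> \<le> R" for t \<kappa>
    using that by (intro order_trans[OF abs_triangle_ineq] add_mono) blast+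
  then show "\<exists>B. \<forall>t \<kappa>. \<bar>t\<bar> \<le> R \<longrightarrow> \<bar>f (t, \<kappa>) + g (t, \<kappa>)\<bar> \<le> B" by blast
qed

lemma strip_bounded_mult:
  assumes "strip_bounded f" "strip_bounded g"
  shows "strip_bounded (\<lambda>p. f p * g p)"
proof (rule strip_boundedI)
  fix R
  obtain B where "\<And>t \<kappa>. \<bar>t\<bar> \<le> R \<Longrightarrow> \<bar>f (t, \<kappa>)\<bar> \<le> B" using strip_boundedE[OF assms(1)] by blast
  moreover obtain C where "\<And>t \<kappa>. \<bar>t\<bar> \<le> R \<Longrightarrow> \<bar>g (t, \<kappa>)\<bar> \<le> C" using strip_boundedE[OF assms(2)] by blast
  ultimately have "\<bar>f (t, \<kappa>) * g (t, \<kappa>)\<bar> \<le> B * C" if "\<bar>t\<bar> \<le> R" for t \<kappa>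
    unfolding abs_mult using that by (intro mult_mono') simp_all
  then show "\<exists>B. \<forall>t \<kappa>. \<bar>t\<bar> \<le> R \<longrightarrow> \<bar>f (t, \<kappa>) * g (t, \<kappa>)\<bar> \<le> B" by blast
qed

lemma strip_bounded_translate:
  assumes "strip_bounded f"
  shows "strip_bounded (\<lambda>p. f (p + a))"
proof (rule strip_boundedI)
  fix R
  obtain B where B: "\<And>t \<kappa>. \<bar>t\<bar> \<le> R + \<bar>fst a\<bar> \<Longrightarrow> \<bar>f (t, \<kappa>)\<bar> \<le> B"
    using strip_boundedE[OF assms] by blast
  have "\<bar>f ((t, \<kappa>) + a)\<bar> \<le> B" if "\<bar>t\<bar> \<le> R" for t \<kappa>
    using B[of "t + fst a" "\<kappa> + snd a"] that by (simp add: plus_prod_def)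
  then show "\<exists>B. \<forall>t \<kappa>. \<bar>t\<bar> \<le> R \<longrightarrow> \<bar>f ((t, \<kappa>) + a)\<bar> \<le> B" by blast
qed

lemma strip_smooth_bounded: "strip_smooth n f \<Longrightarrow> strip_bounded f"
  by (cases n) simp_all

lemma strip_smoothD:
  assumes "strip_smooth (Suc n) f"
  shows "strip_bounded f" "f differentiable (at p)" "b \<in> Basis \<Longrightarrow> strip_smooth n (pd b f)"
  using assms unfolding strip_smooth.simps by blast+

lemma strip_smooth_SucI:
  assumes "strip_bounded f" "\<And>p. f differentiable (at p)" "\<And>b. b \<in> Basis \<Longrightarrow> strip_smooth n (pd b f)"
  shows "strip_smooth (Suc n) f"
  unfolding strip_smooth.simps using assms by blast

lemma strip_smooth_Suc: "strip_smooth (Suc n) f \<Longrightarrow> strip_smooth n f"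
  by (induction n arbitrary: f) simp_all

lemma strip_smooth_le: "strip_smooth n f \<Longrightarrow> m \<le> n \<Longrightarrow> strip_smooth m f"
proof (induction n)
  case (Suc n) then show ?case using strip_smooth_Suc by (metis le_Suc_eq)
qed simp

lemma strip_bounded_const: "strip_bounded (\<lambda>_. c)"
  by (rule strip_boundedI) blast

lemma strip_smooth_const: "strip_smooth n (\<lambda>_. c)"
proof (induction n arbitrary: c)
  case 0 then show ?case by (simp add: strip_bounded_const)
next
  case (Suc n)
  have "pd b (\<lambda>_. c) = (\<lambda>_. 0)" for b :: "real \<times> 'a"
    by (rule ext, rule pd_eqI) simp
  with Suc show ?case by (simp add: strip_bounded_const)
qed

lemma has_derivative_fst': "(fst has_derivative fst) (at p)"
  by (rule bounded_linear_imp_has_derivative[OF bounded_linear_fst])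

lemma pd_fst: "pd b (fst :: real \<times> 'a::euclidean_space \<Rightarrow> real) p = fst b"
  by (rule pd_eqI[OF has_derivative_fst'])

lemma strip_smooth_fst: "strip_smooth n (fst :: real \<times> 'a::euclidean_space \<Rightarrow> real)"
proof -
  have b: "strip_bounded (fst :: real \<times> 'a \<Rightarrow> real)"
    by (rule strip_boundedI) auto
  have "pd b (fst :: real \<times> 'a \<Rightarrow> real) = (\<lambda>_. fst b)" for b
    by (rule ext, rule pd_fst)
  moreover have "(fst :: real \<times> 'a \<Rightarrow> real) differentiable (at p)" for p
    using has_derivative_fst' unfolding differentiable_def by blast
  ultimately show ?thesis using b by (cases n) (simp_all add: strip_smooth_const)
qed

lemma pd_add:
  assumes "f differentiable (at p)" "g differentiable (at p)"
  shows "pd b (\<lambda>p. f p + g p) p = pd b f p + pd b g p"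
  by (rule pd_eqI, intro has_derivative_add has_derivative_pd assms)

lemma pd_mult:
  assumes "f differentiable (at p)" "g differentiable (at p)"
  shows "pd b (\<lambda>p. f p * g p) p = f p * pd b g p + pd b f p * g p"
  by (rule pd_eqI, intro has_derivative_mult has_derivative_pd assms)

lemma strip_smooth_add:
  "strip_smooth n f \<Longrightarrow> strip_smooth n g \<Longrightarrow> strip_smooth n (\<lambda>p. f p + g p)"
proof (induction n arbitrary: f g)
  case (0 f g)
  then show ?case by (simp add: strip_bounded_add)
next
  case (Suc n f g)
  have "pd b (\<lambda>p. f p + g p) = (\<lambda>p. pd b f p + pd b g p)" for b
    using Suc.prems by (intro ext pd_add strip_smoothD)
  then show ?case using Suc by (simp add: strip_bounded_add)
qed

lemma strip_smooth_mult:
  "strip_smooth n f \<Longrightarrow> strip_smooth n g \<Longrightarrow> strip_smooth n (\<lambda>p. f p * g p)"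
proof (induction n arbitrary: f g)
  case (0 f g)
  then show ?case by (simp add: strip_bounded_mult)
next
  case (Suc n f g)
  have "pd b (\<lambda>p. f p * g p) = (\<lambda>p. f p * pd b g p + pd b f p * g p)" for b
    using Suc.prems by (intro ext pd_mult strip_smoothD)
  moreover have "strip_smooth n f" "strip_smooth n g"
    using Suc.prems by (simp_all only: strip_smooth_Suc)
  ultimately show ?case using Suc by (simp add: strip_bounded_mult strip_smooth_add)
qed

lemma strip_smooth_cmult: "strip_smooth n f \<Longrightarrow> strip_smooth n (\<lambda>p. c * f p)"
  by (rule strip_smooth_mult[OF strip_smooth_const])

lemma pd_translate:
  fixes f :: "'a::euclidean_space \<Rightarrow> real"
  assumes "f differentiable (at (p + a))"
  shows "pd b (\<lambda>p. f (p + a)) p = pd b f (p + a)" "(\<lambda>p. f (p + a)) differentiable (at p)"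
proof -
  have "((\<lambda>p. f (p + a)) has_derivative (\<lambda>v. pd v f (p + a))) (at p)"
    by (rule has_derivative_compose[of "\<lambda>p. p + a" "\<lambda>v. v", OF _ has_derivative_pd[OF assms]])
      (auto intro!: derivative_eq_intros)
  then show "pd b (\<lambda>p. f (p + a)) p = pd b f (p + a)" "(\<lambda>p. f (p + a)) differentiable (at p)"
    by (auto simp: differentiable_def intro: pd_eqI)
qed

lemma strip_smooth_translate:
  "strip_smooth n f \<Longrightarrow> strip_smooth n (\<lambda>p. f (p + a))"
proof (induction n arbitrary: f)
  case (0 f)
  then show ?case by (simp add: strip_bounded_translate)
next
  case (Suc n f)
  have "pd b (\<lambda>p. f (p + a)) = (\<lambda>p. pd b f (p + a))" for b
    using Suc.prems by (intro ext pd_translate(1) strip_smoothD)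
  then show ?case
    using strip_smoothD[OF Suc.prems]
    by (intro strip_smooth_SucI strip_bounded_translate pd_translate(2)) (simp_all only: Suc.IH)
qed

section \<open>Convolution with smooth kernels of bounded support\<close>

definition conv :: "('a::euclidean_space \<Rightarrow> real) \<Rightarrow> ('a \<Rightarrow> real) \<Rightarrow> 'a \<Rightarrow> real" where
  "conv V k p = (\<integral>q. V q * k (p - q) \<partial>lborel)"

text \<open>All supports lie in the same ball of radius \<open>R\<close>, which makes the remainder in the derivative of a convolution
  uniformly integrable.\<close>

primrec kernel :: "nat \<Rightarrow> real \<Rightarrow> ('a::euclidean_space \<Rightarrow> real) \<Rightarrow> bool" where
  "kernel 0 R k \<longleftrightarrow> continuous_on UNIV k \<and> (\<forall>p. norm p > R \<longrightarrow> k p = 0)"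
| "kernel (Suc n) R k \<longleftrightarrow> (continuous_on UNIV k \<and> (\<forall>p. norm p > R \<longrightarrow> k p = 0)) \<and>
     (\<forall>p. k differentiable (at p)) \<and> (\<forall>b\<in>Basis. kernel n R (pd b k))"

lemma kernel_0: "kernel n R k \<Longrightarrow> kernel 0 R k"
  by (cases n) simp_all

lemma kernel_SucD:
  assumes "kernel (Suc n) R k"
  shows "k differentiable (at p)" "b \<in> Basis \<Longrightarrow> kernel n R (pd b k)"
  using assms unfolding kernel.simps by blast+

lemma kernel_bounded:
  assumes "kernel n R k"
  obtains B where "0 \<le> B" "\<And>p. \<bar>k p\<bar> \<le> B"
proof -
  have c: "continuous_on (cball 0 R) k" and z: "\<And>p. norm p > R \<Longrightarrow> k p = 0"
    using kernel_0[OF assms] by (auto intro: continuous_on_subset)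
  have "bounded (k ` cball 0 R)"
    by (intro compact_imp_bounded compact_continuous_image c compact_cball)
  then obtain B where B: "\<And>p. norm p \<le> R \<Longrightarrow> \<bar>k p\<bar> \<le> B"
    unfolding bounded_iff by (metis imageI mem_cball_0 real_norm_def)
  show thesis
  proof (rule that[of "max 0 B"])
    fix p show "\<bar>k p\<bar> \<le> max 0 B" using B[of p] z[of p] by (cases "norm p \<le> R") auto
  qed simp
qed

lemma integrable_bounded_cball:
  fixes g :: "'a::euclidean_space \<Rightarrow> real"
  assumes "g \<in> borel_measurable borel" "\<And>q. \<bar>g q\<bar> \<le> C" "\<And>q. q \<notin> cball c R \<Longrightarrow> g q = 0"
  shows "integrable lborel g" "\<bar>\<integral>q. g q \<partial>lborel\<bar> \<le> C * measure lborel (cball c R)"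
proof -
  have i: "integrable lborel (\<lambda>q. C * indicator (cball c R) q :: real)"
    by (intro integrable_mult_right integrable_real_indicator) (use emeasure_lborel_cball_finite[of c R] in auto)
  have le: "\<bar>g q\<bar> \<le> C * indicator (cball c R) q" for q
    using assms(2)[of q] assms(3)[of q] by (cases "q \<in> cball c R") auto
  show int: "integrable lborel g"
    by (rule Bochner_Integration.integrable_bound[OF i]) (use assms(1) le in \<open>auto intro: order_trans[OF _ abs_ge_self]\<close>)
  have "\<bar>\<integral>q. g q \<partial>lborel\<bar> \<le> (\<integral>q. \<bar>g q\<bar> \<partial>lborel)"
    by (rule integral_abs_bound)
  also have "\<dots> \<le> (\<integral>q. C * indicator (cball c R) q \<partial>lborel)"
    by (rule integral_mono[OF integrable_abs[OF int] i]) (rule le)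
  finally show "\<bar>\<integral>q. g q \<partial>lborel\<bar> \<le> C * measure lborel (cball c R)" by simp
qed

lemma conv_integrable:
  assumes [measurable]: "V \<in> borel_measurable borel" and "\<And>q. \<bar>V q\<bar> \<le> M" "kernel n R k"
  shows "integrable lborel (\<lambda>q. V q * k (p - q))"
proof -
  have [measurable]: "k \<in> borel_measurable borel"
    using kernel_0[OF assms(3)] by (auto intro: borel_measurable_continuous_onI)
  obtain B where B: "0 \<le> B" "\<And>p. \<bar>k p\<bar> \<le> B" using kernel_bounded[OF assms(3)] by blast
  show ?thesis
  proof (rule integrable_bounded_cball(1))
    show "\<bar>V q * k (p - q)\<bar> \<le> M * B" for q
      unfolding abs_mult using assms(2) B by (intro mult_mono') auto
    show "V q * k (p - q) = 0" if "q \<notin> cball p R" for q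
      using that kernel_0[OF assms(3)] by (auto simp: dist_norm)
  qed measurable
qed

lemma measure_cball_translate:
  "measure lborel (cball (p::'a::euclidean_space) R) = measure lborel (cball (0::'a) R)"
  by (cases "0 \<le> R") (simp_all add: content_cball)

lemma conv_bounded:
  assumes [measurable]: "V \<in> borel_measurable borel" and "\<And>q. \<bar>V q\<bar> \<le> M" "kernel n R k"
  shows "\<exists>C. \<forall>p. \<bar>conv V k p\<bar> \<le> C"
proof -
  have [measurable]: "k \<in> borel_measurable borel"
    using kernel_0[OF assms(3)] by (auto intro: borel_measurable_continuous_onI)
  obtain B where B: "0 \<le> B" "\<And>p. \<bar>k p\<bar> \<le> B" using kernel_bounded[OF assms(3)] by blast
  have "\<bar>conv V k p\<bar> \<le> M * B * measure lborel (cball p R)" for p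
    unfolding conv_def
  proof (rule integrable_bounded_cball(2))
    show "\<bar>V q * k (p - q)\<bar> \<le> M * B" for q
      unfolding abs_mult using assms(2) B by (intro mult_mono') auto
    show "V q * k (p - q) = 0" if "q \<notin> cball p R" for q
      using that kernel_0[OF assms(3)] by (auto simp: dist_norm)
  qed measurable
  then have "\<bar>conv V k p\<bar> \<le> M * B * measure lborel (cball (0::'a) R)" for p
    using measure_cball_translate[of p R] by metis
  then show ?thesis by blast
qed

text \<open>The kernel carries all the smoothness, so the other factor need only be bounded and measurable: the second-order
  remainder of the kernel is \<open>O(norm h\<^sup>2)\<close> uniformly, and it lives on a ball that is fixed for \<open>norm h \<le> 1\<close>.
  This matters because the scheme jumps in time.\<close>

lemma conv_has_derivative:
  fixes V k :: "'a::euclidean_space \<Rightarrow> real"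
  assumes [measurable]: "V \<in> borel_measurable borel" and M: "\<And>q. \<bar>V q\<bar> \<le> M"
    and k: "kernel (Suc (Suc n)) R k"
  shows "(conv V k has_derivative (\<lambda>h. \<Sum>b\<in>Basis. (h \<bullet> b) * conv V (pd b k) p)) (at p)"
proof -
  have kd: "k differentiable (at p)" for p using kernel_SucD[OF k] by blast
  have kb: "kernel (Suc n) R (pd b k)" if "b \<in> Basis" for b using kernel_SucD[OF k] that by blast
  have kbd: "pd b k differentiable (at p)" if "b \<in> Basis" for p b using kernel_SucD[OF kb[OF that]] by blast
  have kbc: "kernel n R (pd c (pd b k))" if "b \<in> Basis" "c \<in> Basis" for b c
    using kernel_SucD[OF kb] that by blast
  have k0: "k x = 0" if "norm x > R" for x using kernel_0[OF k] that by simp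
  have pd0: "pd h k x = 0" if "norm x > R" for x h
    by (subst pd_expand[OF kd]) (use kernel_0[OF kb] that in simp)
  have [measurable]: "k \<in> borel_measurable borel"
    using kernel_0[OF k] by (auto intro: borel_measurable_continuous_onI)
  have expand: "pd h k x = (\<Sum>b\<in>Basis. (h \<bullet> b) * pd b k x)" for h x
    by (rule pd_expand[OF kd])
  have [measurable]: "pd h k \<in> borel_measurable borel" for h
    unfolding ext[of "pd h k", OF expand] by (intro borel_measurable_sum borel_measurable_times borel_measurable_const
         borel_measurable_continuous_onI) (use kernel_0[OF kb] in simp)
  have "\<forall>b\<in>Basis. \<forall>c\<in>Basis. \<exists>B. \<forall>p. \<bar>pd c (pd b k) p\<bar> \<le> B"
    using kernel_bounded[OF kbc] by metis
  then obtain B where B: "\<And>b c p. b \<in> Basis \<Longrightarrow> c \<in> Basis \<Longrightarrow> \<bar>pd c (pd b k) p\<bar> \<le> B b c"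
    by metis
  define C where "C = (\<Sum>b\<in>(Basis::'a set). \<Sum>c\<in>(Basis::'a set). B b c)"
  have B0: "0 \<le> B b c" if "b \<in> Basis" "c \<in> Basis" for b c
    using B[OF that, of 0] by linarith
  have BC: "\<bar>pd c (pd b k) p\<bar> \<le> C" if "b \<in> Basis" "c \<in> Basis" for b c p
  proof -
    have "B b c \<le> (\<Sum>c\<in>(Basis::'a set). B b c)" using that B0 by (intro member_le_sum) auto
    also have "\<dots> \<le> C" unfolding C_def using that B0
      by (intro member_le_sum[of b Basis "\<lambda>b. \<Sum>c\<in>Basis. B b c"] sum_nonneg) auto
    finally show ?thesis using B[OF that, of p] by linarith
  qed
  have C0: "0 \<le> C" using BC[OF SOME_Basis SOME_Basis] by (meson abs_ge_zero order_trans)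
  define A where "A = (real DIM('a))\<^sup>2 * C"
  have A0: "0 \<le> A" unfolding A_def using C0 by simp
  have tay: "\<bar>k (x + h) - k x - pd h k x\<bar> \<le> A * (norm h)\<^sup>2" for x h
    unfolding A_def by (rule taylor_pd[of UNIV]) (use kd kbd BC in auto)
  have rem: "\<bar>conv V k (p + h) - conv V k p - (\<Sum>b\<in>Basis. (h \<bullet> b) * conv V (pd b k) p)\<bar>
      \<le> M * (A * (norm h)\<^sup>2) * measure lborel (cball p (R + 1))" if h: "norm h \<le> 1" for h
  proof -
    let ?r = "\<lambda>q. V q * (k (p - q + h) - k (p - q) - pd h k (p - q))"
    have "conv V k (p + h) - conv V k p - (\<Sum>b\<in>Basis. (h \<bullet> b) * conv V (pd b k) p)
      = (\<integral>q. V q * k (p + h - q) - V q * k (p - q) - (\<Sum>b\<in>Basis. (h \<bullet> b) * (V q * pd b k (p - q))) \<partial>lborel)"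
      unfolding conv_def
      by (subst Bochner_Integration.integral_diff Bochner_Integration.integral_sum integral_mult_right_zero
            | intro Bochner_Integration.integrable_diff Bochner_Integration.integrable_sum
               integrable_mult_right conv_integrable[OF assms(1) M k] conv_integrable[OF assms(1) M kb]
            | simp)+
    also have "\<dots> = (\<integral>q. ?r q \<partial>lborel)"
      by (intro Bochner_Integration.integral_cong refl)
        (simp add: expand[of h] algebra_simps sum_distrib_left)
    also have "\<bar>\<dots>\<bar> \<le> M * (A * (norm h)\<^sup>2) * measure lborel (cball p (R + 1))"
    proof (rule integrable_bounded_cball(2))
      show "\<bar>?r q\<bar> \<le> M * (A * (norm h)\<^sup>2)" for q
        unfolding abs_mult using M tay by (intro mult_mono') auto
      fix q assume "q \<notin> cball p (R + 1)"
      then have 1: "norm (p - q) > R + 1" by (simp add: dist_norm)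
      have "norm (p - q) \<le> norm (p - q + h) + norm h" using norm_triangle_ineq4[of "p - q + h" h] by simp
      with 1 h have 2: "norm (p - q + h) > R" by linarith
      show "?r q = 0" using k0[OF 2] k0[of "p - q"] pd0[of "p - q"] 1 by simp
    qed measurable
    finally show ?thesis .
  qed
  define D where "D = M * A * measure lborel (cball p (R + 1))"
  have M0: "0 \<le> M" using M[of 0] by linarith
  have D0: "0 \<le> D" unfolding D_def using M0 A0 by simp
  show ?thesis
    unfolding has_derivative_at_alt
  proof (intro conjI allI impI)
    show "bounded_linear (\<lambda>h. \<Sum>b\<in>Basis. (h \<bullet> b) * conv V (pd b k) p)"
      by (intro bounded_linear_intros) 
    fix e :: real assume e: "0 < e"
    define d where "d = min 1 (e / (D + 1))"
    have "norm (conv V k y - conv V k p - (\<Sum>b\<in>Basis. ((y - p) \<bullet> b) * conv V (pd b k) p)) \<le> e * norm (y - p)"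
      if y: "norm (y - p) < d" for y
    proof -
      have "\<bar>conv V k (p + (y - p)) - conv V k p - (\<Sum>b\<in>Basis. ((y - p) \<bullet> b) * conv V (pd b k) p)\<bar>
        \<le> M * (A * (norm (y - p))\<^sup>2) * measure lborel (cball p (R + 1))"
        by (rule rem) (use y in \<open>simp add: d_def\<close>)
      also have "\<dots> = D * norm (y - p) * norm (y - p)" by (simp add: D_def power2_eq_square)
      also have "\<dots> \<le> e * norm (y - p)"
      proof (rule mult_right_mono)
        have "D * norm (y - p) \<le> (D + 1) * (e / (D + 1))"
          using y D0 by (intro mult_mono) (auto simp: d_def)
        then show "D * norm (y - p) \<le> e" using D0 by simp
      qed simp
      finally show ?thesis by simp
    qed
    then show "\<exists>d>0. \<forall>y. norm (y - p) < d \<longrightarrow>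
        norm (conv V k y - conv V k p - (\<Sum>b\<in>Basis. ((y - p) \<bullet> b) * conv V (pd b k) p)) \<le> e * norm (y - p)"
      using e D0 by (intro exI[of _ d]) (auto simp: d_def)
  qed
qed

lemma strip_smooth_conv:
  assumes "V \<in> borel_measurable borel" and M: "\<And>q. \<bar>V q\<bar> \<le> M"
  shows "kernel (Suc (Suc n)) R k \<Longrightarrow> strip_smooth n (conv V k)"
proof (induction n arbitrary: k)
  case (0 k)
  have "strip_bounded (conv V k)"
    using conv_bounded[OF assms 0] by (intro strip_boundedI) blast
  then show ?case by simp
next
  case (Suc n k)
  have b: "strip_bounded (conv V k)"
    using conv_bounded[OF assms Suc.prems] by (intro strip_boundedI) blast
  have eq: "pd b (conv V k) = conv V (pd b k)" if "b \<in> Basis" for b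
  proof
    fix p
    show "pd b (conv V k) p = conv V (pd b k) p"
      by (subst pd_eqI[OF conv_has_derivative[OF assms Suc.prems]])
        (use that in \<open>simp add: inner_Basis if_distrib[of "\<lambda>x. x * _"] sum.delta cong: if_cong\<close>)
  qed
  show ?case
  proof (rule strip_smooth_SucI[OF b])
    show "conv V k differentiable (at p)" for p
      using conv_has_derivative[OF assms Suc.prems] unfolding differentiable_def by blast
    show "strip_smooth n (pd b (conv V k))" if "b \<in> Basis" for b
      unfolding eq[OF that] by (rule Suc.IH[OF kernel_SucD(2)[OF Suc.prems that]])
  qed
qed

lemma conv_commute:
  fixes V k :: "'a::euclidean_space \<Rightarrow> real"
  assumes [measurable]: "V \<in> borel_measurable borel" "k \<in> borel_measurable borel"
  shows "conv V k p = (\<integral>q. V (p - q) * k q \<partial>lborel)"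
proof -
  have "(lborel :: 'a measure) = distr lborel borel (\<lambda>x. p + (-1) *\<^sub>R x)"
    using lborel_affine[of "-1" p] by (simp add: density_1)
  then have "(lborel :: 'a measure) = distr lborel borel (\<lambda>x. p - x)" by simp
  then have "conv V k p = (\<integral>q. V q * k (p - q) \<partial>distr lborel borel (\<lambda>x. p - x))"
    unfolding conv_def by simp
  also have "\<dots> = (\<integral>q. V (p - q) * k q \<partial>lborel)"
    by (subst integral_distr) simp_all
  finally show ?thesis .
qed

lemma iter_deriv_zero_off_support:
  fixes f :: "'a::euclidean_space \<Rightarrow> real"
  assumes "\<And>p. norm p > R \<Longrightarrow> f p = 0"
  shows "norm p > R \<Longrightarrow> iter_deriv bs f p = 0"
proof (induction bs arbitrary: p)
  case Nil then show ?case using assms by simp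
next
  case (Cons b bs)
  have "open {p::'a. R < norm p}" by (intro open_Collect_less continuous_intros)
  then have "(iter_deriv bs f has_derivative (\<lambda>_. 0)) (at p)"
  proof (rule has_derivative_transform_within_open[OF has_derivative_const])
    show "p \<in> {p. R < norm p}" using Cons.prems by simp
    show "0 = iter_deriv bs f x" if "x \<in> {p. R < norm p}" for x using Cons.IH that by simp
  qed
  then have eq: "(\<lambda>_. 0) = frechet_derivative (iter_deriv bs f) (at p)"
    by (rule frechet_derivative_at)
  show ?case unfolding iter_deriv.simps eq[symmetric] by (rule refl)
qed

lemma kernel_mollifier:
  assumes "mollifier \<rho>"
  shows "kernel n 2 \<rho>"
proof -
  have supp: "closure {p. \<rho> p \<noteq> 0} \<subseteq> {-1..0} \<times> cball 0 1"
    and d: "\<And>bs p. set bs \<subseteq> Basis \<Longrightarrow> iter_deriv bs \<rho> differentiable (at p)"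
    using assms unfolding mollifier_def basis_lists_def by auto
  have z: "\<rho> p = 0" if "norm p > 2" for p
  proof (rule ccontr)
    assume "\<rho> p \<noteq> 0"
    then have "p \<in> {p. \<rho> p \<noteq> 0}" by simp
    then have "p \<in> closure {p. \<rho> p \<noteq> 0}" by (rule subsetD[OF closure_subset])
    then have "p \<in> {-1..0} \<times> cball 0 1" by (rule subsetD[OF supp])
    moreover obtain t x where p: "p = (t, x)" by (cases p)
    ultimately have "norm t \<le> 1" "norm x \<le> 1" by simp_all
    moreover have "norm p \<le> norm t + norm x" unfolding p by (rule norm_Pair_le)
    ultimately show False using that by linarith
  qed
  have "kernel n 2 (iter_deriv bs \<rho>)" if "set bs \<subseteq> Basis" for bs
    using that
  proof (induction n arbitrary: bs)
    case (0 bs)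
    then show ?case using iter_deriv_zero_off_support[OF z, where bs = bs] d[of bs]
      by (auto intro!: differentiable_imp_continuous_on differentiable_at_imp_differentiable_on)
  next
    case (Suc n bs)
    have "pd b (iter_deriv bs \<rho>) = iter_deriv (b # bs) \<rho>" for b
      by (simp add: pd_def fun_eq_iff)
    then have "kernel n 2 (pd b (iter_deriv bs \<rho>))" if "b \<in> Basis" for b
      using Suc.IH[of "b # bs"] Suc.prems that by simp
    moreover have "kernel 0 2 (iter_deriv bs \<rho>)" using iter_deriv_zero_off_support[OF z, where bs = bs] d[of bs] Suc.prems
      by (auto intro!: differentiable_imp_continuous_on differentiable_at_imp_differentiable_on)
    ultimately show ?case using d[OF Suc.prems] unfolding kernel.simps by blast
  qed
  from this[of "[]"] show ?thesis by simp
qed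

text \<open>The parabolic rescaling is diagonal, so a partial derivative of the rescaled kernel is a multiple of the rescaled
  partial derivative. For \<open>\<epsilon> \<le> 1\<close> it stretches the argument, and the support stays in the same ball.\<close>

lemma kernel_rescale:
  fixes k :: "real \<times> 'a::euclidean_space \<Rightarrow> real"
  assumes "0 < \<epsilon>" "\<epsilon> \<le> 1"
  shows "kernel n R k \<Longrightarrow> kernel n R (\<lambda>p. c * k (fst p / \<epsilon>\<^sup>2, snd p /\<^sub>R \<epsilon>))"
proof -
  let ?A = "\<lambda>p::real \<times> 'a. (fst p / \<epsilon>\<^sup>2, snd p /\<^sub>R \<epsilon>)"
  have nA: "norm p \<le> norm (?A p)" for p
  proof -
    have "norm (fst p) \<le> norm (fst (?A p))" "norm (snd p) \<le> norm (snd (?A p))"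
      using assms by (auto simp: field_simps power_le_one mult_left_le mult_left_le_one_le)
    then show ?thesis unfolding norm_prod_def
      by (intro real_sqrt_le_mono add_mono power_mono) (simp_all only: norm_ge_zero)
  qed
  have base: "continuous_on UNIV (\<lambda>p. c * k (?A p)) \<and> (\<forall>p. norm p > R \<longrightarrow> c * k (?A p) = 0)"
    if "kernel n R k" for n c and k :: "real \<times> 'a \<Rightarrow> real"
  proof
    have "continuous_on UNIV k" using kernel_0[OF that] by simp
    then have "continuous_on UNIV (\<lambda>p. k (?A p))"
      by (rule continuous_on_compose2) (use assms in \<open>auto intro!: continuous_intros\<close>)
    then show "continuous_on UNIV (\<lambda>p. c * k (?A p))" by (rule continuous_on_mult_left)
    show "\<forall>p. norm p > R \<longrightarrow> c * k (?A p) = 0"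
    proof (intro allI impI)
      fix p :: "real \<times> 'a" assume "R < norm p"
      then have "R < norm (?A p)" using nA[of p] by linarith
      then show "c * k (?A p) = 0" using kernel_0[OF that] by simp
    qed
  qed
  show "kernel n R k \<Longrightarrow> kernel n R (\<lambda>p. c * k (?A p))"
  proof (induction n arbitrary: c k)
    case (0 c k)
    show ?case unfolding kernel.simps by (rule base[OF 0])
  next
    case (Suc n c k)
    have bl: "bounded_linear ?A"
      by (intro bounded_linear_Pair bounded_linear_compose[OF bounded_linear_divide bounded_linear_fst]
            bounded_linear_compose[OF bounded_linear_scaleR_right bounded_linear_snd])
    have hd: "((\<lambda>p. c * k (?A p)) has_derivative (\<lambda>v. c * pd (?A v) k (?A p))) (at p)" for p
      by (intro has_derivative_mult_right
            has_derivative_compose[OF bounded_linear_imp_has_derivative[OF bl]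
              has_derivative_pd[OF kernel_SucD(1)[OF Suc.prems]]])
    have pde: "\<exists>l. pd b (\<lambda>p. c * k (?A p)) = (\<lambda>p. (c * l) * pd b k (?A p))" if "b \<in> Basis" for b
    proof -
      have "\<exists>l. ?A b = l *\<^sub>R b"
        using that unfolding Basis_prod_def by (auto intro: exI[of _ "1 / \<epsilon>\<^sup>2"] exI[of _ "1 / \<epsilon>"] simp: divide_inverse_commute)
      then obtain l where l: "?A b = l *\<^sub>R b" by blast
      have "pd (l *\<^sub>R b) k q = l * pd b k q" for q
        using linear_cmul[OF linear_frechet_derivative[OF kernel_SucD(1)[OF Suc.prems]]]
        by (simp add: pd_def)
      then show ?thesis using pd_eqI[OF hd] l by (intro exI[of _ l]) (auto simp: fun_eq_iff)
    qed
    show ?case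
      unfolding kernel.simps
    proof (intro conjI allI ballI)
      show "continuous_on UNIV (\<lambda>p. c * k (?A p))" using base[OF Suc.prems] by blast
      show "R < norm p \<longrightarrow> c * k (?A p) = 0" for p using base[OF Suc.prems] by blast
      show "(\<lambda>p. c * k (?A p)) differentiable (at p)" for p
        using hd unfolding differentiable_def by blast
      fix b :: "real \<times> 'a" assume b: "b \<in> Basis"
      then obtain l where l: "pd b (\<lambda>p. c * k (?A p)) = (\<lambda>p. (c * l) * pd b k (?A p))" using pde by blast
      show "kernel n R (pd b (\<lambda>p. c * k (?A p)))"
        unfolding l by (rule Suc.IH[OF kernel_SucD(2)[OF Suc.prems b]])
    qed
  qed
qed

section \<open>Slices of smooth functions\<close>

lemma pd_compose:
  fixes f :: "'b::euclidean_space \<Rightarrow> real" and g :: "'a::euclidean_space \<Rightarrow> 'b"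
  assumes "(g has_derivative g') (at x)" "f differentiable (at (g x))"
  shows "pd v (\<lambda>x. f (g x)) x = pd (g' v) f (g x)"
    "(\<lambda>x. f (g x)) differentiable (at x)"
proof -
  have h: "((\<lambda>x. f (g x)) has_derivative (\<lambda>v. pd (g' v) f (g x))) (at x)"
    by (rule has_derivative_compose[OF assms(1) has_derivative_pd[OF assms(2)]])
  show "pd v (\<lambda>x. f (g x)) x = pd (g' v) f (g x)" by (rule pd_eqI[OF h])
  show "(\<lambda>x. f (g x)) differentiable (at x)" using h unfolding differentiable_def by blast
qed

lemma grad_inner:
  assumes "f differentiable (at x)"
  shows "grad f x \<bullet> q = pd q f x"
proof -
  have l: "linear (\<lambda>v. pd v f x)"
    unfolding pd_def by (rule linear_frechet_derivative[OF assms])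
  have "q = (\<Sum>i\<in>UNIV. (q $ i) *\<^sub>R axis i 1)"
    using basis_expansion[of q] by (simp add: scalar_mult_eq_scaleR)
  then have "pd q f x = pd (\<Sum>i\<in>UNIV. (q $ i) *\<^sub>R axis i 1) f x" by simp
  also have "\<dots> = (\<Sum>i\<in>UNIV. q $ i * pd (axis i 1) f x)"
    by (simp add: linear_sum[OF l] linear_cmul[OF l])
  finally show ?thesis
    by (simp add: grad_def inner_vec_def pd_def mult.commute)
qed

lemma Pair0_Basis: "b \<in> Basis \<Longrightarrow> (0::'b::euclidean_space, b::'a::euclidean_space) \<in> Basis"
  by (simp add: Basis_prod_def)

lemma Basis_Pair0: "b \<in> Basis \<Longrightarrow> (b::'b::euclidean_space, 0::'a::euclidean_space) \<in> Basis"
  by (simp add: Basis_prod_def)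

lemma axis_slot_Basis:
  "(0::real, axis i (1::real), 0::real^'d, 0::real^'d) \<in> Basis" for i :: "'d::finite"
  by (rule Pair0_Basis, rule Basis_Pair0[where 'a="(real^'d) \<times> (real^'d)", unfolded zero_prod_def])
    (simp add: axis_in_Basis_iff)

lemma slice_deriv: "((\<lambda>\<kappa>. (t, \<kappa>)) has_derivative (\<lambda>v. (0, v))) (at \<kappa>)"
  by (intro has_derivative_Pair has_derivative_const has_derivative_ident)

text \<open>Space derivatives of a time slice are derivatives of the full function along vectors \<open>(0, b)\<close>; this translates
  the test function class, stated for slices, into the class of smooth functions on \<open>\<real> \<times> \<real>\<^sup>3\<^sup>d\<close>.\<close>

lemma iter_deriv_slice:
  assumes "strip_smooth n P" "set bs \<subseteq> Basis" "length bs \<le> n"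
  shows "strip_smooth (n - length bs) (iter_deriv (map (Pair 0) bs) P)
    \<and> iter_deriv bs (\<lambda>\<kappa>. P (t, \<kappa>)) = (\<lambda>\<kappa>. iter_deriv (map (Pair 0) bs) P (t, \<kappa>))"
  using assms(2,3)
proof (induction bs)
  case Nil then show ?case using assms(1) by simp
next
  case (Cons b bs)
  define m where "m = n - length (b # bs)"
  let ?Q = "iter_deriv (map (Pair 0) bs) P"
  have "n - length bs = Suc m" using Cons.prems by (simp add: m_def)
  then have sm: "strip_smooth (Suc m) ?Q"
    and eq: "iter_deriv bs (\<lambda>\<kappa>. P (t, \<kappa>)) = (\<lambda>\<kappa>. ?Q (t, \<kappa>))"
    using Cons by auto
  have "strip_smooth m (pd (0, b) ?Q)"
    by (rule strip_smoothD(3)[OF sm Pair0_Basis]) (use Cons.prems in simp)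
  moreover have "iter_deriv (map (Pair 0) (b # bs)) P = pd (0, b) ?Q"
    by (simp add: pd_def fun_eq_iff)
  moreover have "iter_deriv (b # bs) (\<lambda>\<kappa>. P (t, \<kappa>)) = (\<lambda>\<kappa>. pd (0, b) ?Q (t, \<kappa>))"
  proof
    fix \<kappa>
    have "iter_deriv (b # bs) (\<lambda>\<kappa>. P (t, \<kappa>)) \<kappa> = pd b (\<lambda>\<kappa>. ?Q (t, \<kappa>)) \<kappa>"
      by (simp add: eq pd_def)
    also have "\<dots> = pd (0, b) ?Q (t, \<kappa>)"
      by (rule pd_compose(1)[OF slice_deriv strip_smoothD(2)[OF sm]])
    finally show "iter_deriv (b # bs) (\<lambda>\<kappa>. P (t, \<kappa>)) \<kappa> = pd (0, b) ?Q (t, \<kappa>)" .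
  qed
  ultimately show ?case by (simp only: m_def)
qed

lemma strip_smooth_continuous:
  assumes "strip_smooth (Suc n) P"
  shows "continuous_on S P"
  by (intro differentiable_imp_continuous_on differentiable_at_imp_differentiable_on
      strip_smoothD(2)[OF assms])

lemma cont_bdd_on_strip_smooth:
  assumes "strip_smooth (Suc n) P"
  shows "cont_bdd_on {0<..1} (\<lambda>t \<kappa>. P (t, \<kappa>))"
proof -
  have "continuous_on ({0<..1} \<times> UNIV) (\<lambda>(t, \<kappa>). P (t, \<kappa>))"
    using strip_smooth_continuous[OF assms] by simp
  moreover obtain B where "\<And>t \<kappa>. \<bar>t\<bar> \<le> 1 \<Longrightarrow> \<bar>P (t, \<kappa>)\<bar> \<le> B"
    using strip_boundedE[OF strip_smoothD(1)[OF assms]] by blast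
  then have "bounded ((\<lambda>(t, \<kappa>). P (t, \<kappa>)) ` ({0<..1} \<times> UNIV))"
    unfolding bounded_iff by (auto intro!: exI[of _ B])
  ultimately show ?thesis by (simp add: cont_bdd_on_def)
qed

lemma time_slice_derivative:
  assumes "strip_smooth (Suc n) P"
  shows "((\<lambda>s. P (s, \<kappa>)) has_vector_derivative pd (1, 0) P (t, \<kappa>)) (at t within S)"
proof -
  have "((\<lambda>s. P (s, \<kappa>)) has_derivative (\<lambda>v. pd (v, 0) P (t, \<kappa>))) (at t)"
  proof (rule has_derivative_compose[of "\<lambda>s. (s, \<kappa>)" "\<lambda>v. (v, 0)"])
    show "((\<lambda>s. (s, \<kappa>)) has_derivative (\<lambda>v. (v, 0))) (at t)"
      by (intro has_derivative_Pair has_derivative_const has_derivative_ident)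
    show "(P has_derivative (\<lambda>v. pd v P (t, \<kappa>))) (at (t, \<kappa>))"
      by (rule has_derivative_pd[OF strip_smoothD(2)[OF assms]])
  qed
  then have "((\<lambda>s. P (s, \<kappa>)) has_derivative (\<lambda>v. pd (v, 0) P (t, \<kappa>))) (at t within S)"
    by (rule has_derivative_at_withinI)
  moreover have "(\<lambda>v. pd (v, 0) P (t, \<kappa>)) = (\<lambda>v. v *\<^sub>R pd (1, 0) P (t, \<kappa>))"
  proof
    fix v :: real
    have "pd (v *\<^sub>R (1, 0)) P (t, \<kappa>) = v *\<^sub>R pd (1, 0) P (t, \<kappa>)"
      unfolding pd_def by (rule linear_cmul[OF linear_frechet_derivative[OF strip_smoothD(2)[OF assms]]])
    then show "pd (v, 0) P (t, \<kappa>) = v *\<^sub>R pd (1, 0) P (t, \<kappa>)" by simp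
  qed
  ultimately show ?thesis
    unfolding has_vector_derivative_def by (rule back_subst)
qed

lemma unit_interval_not_bot: "t \<in> {0<..1} \<Longrightarrow> at t within {0<..1::real} \<noteq> bot"
  using islimpt_subset[OF islimpt_greaterThanLessThan2[of 0 t], of "{0<..1}"]
  by (simp add: trivial_limit_within subset_eq)

lemma time_deriv_strip_smooth:
  assumes "strip_smooth (Suc n) P" "t \<in> {0<..1}"
  shows "time_deriv (\<lambda>t \<kappa>. P (t, \<kappa>)) t \<kappa> = pd (1, 0) P (t, \<kappa>)"
  unfolding time_deriv_def
  by (rule vector_derivative_within[OF unit_interval_not_bot[OF assms(2)] time_slice_derivative[OF assms(1)]])

lemma cont_bdd_on_cong:
  assumes "\<And>t \<kappa>. t \<in> I \<Longrightarrow> u t \<kappa> = v t \<kappa>"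
  shows "cont_bdd_on I u \<longleftrightarrow> cont_bdd_on I v"
proof -
  have "continuous_on (I \<times> UNIV) (\<lambda>(t, \<kappa>). u t \<kappa>) = continuous_on (I \<times> UNIV) (\<lambda>(t, \<kappa>). v t \<kappa>)"
    by (rule continuous_on_cong) (use assms in auto)
  moreover have "(\<lambda>(t, \<kappa>). u t \<kappa>) ` (I \<times> UNIV) = (\<lambda>(t, \<kappa>). v t \<kappa>) ` (I \<times> UNIV)"
    by (rule image_cong) (use assms in auto)
  ultimately show ?thesis by (simp add: cont_bdd_on_def)
qed

text \<open>Three space derivatives must be continuous, and continuity of the last one comes from one more derivative:
  hence order 4.\<close>

lemma strip_smooth_Cb_23:
  fixes P :: "real \<times> 'a::euclidean_space \<Rightarrow> real"
  assumes P: "strip_smooth 4 P"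
  shows "(\<lambda>t \<kappa>. P (t, \<kappa>)) \<in> Cb_23"
proof -
  let ?u = "\<lambda>t \<kappa>. P (t, \<kappa>)"
  have P4: "strip_smooth (Suc 3) P" using P by (simp add: numeral_eq_Suc del: strip_smooth.simps)
  have b: "(1::real, 0::'a) \<in> Basis" by (simp add: Basis_Pair0)
  have P3: "strip_smooth (Suc 2) (pd (1, 0) P)" using strip_smoothD(3)[OF P4 b] by (simp add: numeral_eq_Suc del: strip_smooth.simps)
  have P2: "strip_smooth (Suc 1) (pd (1, 0) (pd (1, 0) P))" using strip_smoothD(3)[OF P3 b] by (simp add: numeral_eq_Suc del: strip_smooth.simps)
  have t1: "time_deriv ?u t \<kappa> = pd (1, 0) P (t, \<kappa>)" if "t \<in> {0<..1}" for t \<kappa>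
    by (rule time_deriv_strip_smooth[OF P4 that])
  have v2: "((\<lambda>s. time_deriv ?u s \<kappa>) has_vector_derivative pd (1, 0) (pd (1, 0) P) (t, \<kappa>)) (at t within {0<..1})"
    if "t \<in> {0<..1}" for t \<kappa>
    by (rule has_vector_derivative_transform[OF that _ time_slice_derivative[OF P3]]) (rule t1)
  have t2: "time_deriv (time_deriv ?u) t \<kappa> = pd (1, 0) (pd (1, 0) P) (t, \<kappa>)" if "t \<in> {0<..1}" for t \<kappa>
    unfolding time_deriv_def[of "time_deriv ?u"]
    by (rule vector_derivative_within[OF unit_interval_not_bot[OF that] v2[OF that]])
  have dv: "f differentiable (at t within S)" if "(f has_vector_derivative D) (at t within S)"
    for f :: "real \<Rightarrow> real" and D t S
    using that unfolding has_vector_derivative_def differentiable_def by blast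
  have s: "strip_smooth (4 - length bs) (iter_deriv (map (Pair 0) bs) P)"
    "\<And>t. iter_deriv bs (?u t) = (\<lambda>\<kappa>. iter_deriv (map (Pair 0) bs) P (t, \<kappa>))"
    if "bs \<in> basis_lists j" "j \<le> 3" for bs j
    using iter_deriv_slice[OF P, of bs] that by (auto simp: basis_lists_def)
  have s': "strip_smooth (Suc 0) (iter_deriv (map (Pair 0) bs) P)"
    if "bs \<in> basis_lists j" "j \<le> 3" for bs j
    by (rule strip_smooth_le[OF s(1)[OF that]]) (use that in \<open>auto simp: basis_lists_def\<close>)
  show ?thesis
    unfolding Cb_23_def mem_Collect_eq
  proof (intro conjI ballI allI impI)
    show "(\<lambda>s. ?u s \<kappa>) differentiable (at t within {0<..1})" for t \<kappa>
      by (rule dv[OF time_slice_derivative[OF P4]])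
    show "(\<lambda>s. time_deriv ?u s \<kappa>) differentiable (at t within {0<..1})" if "t \<in> {0<..1}" for t \<kappa>
      by (rule dv[OF v2[OF that]])
    show "cont_bdd_on {0<..1} (time_deriv ?u)"
    proof -
      have "cont_bdd_on {0<..1} (time_deriv ?u) \<longleftrightarrow> cont_bdd_on {0<..1} (\<lambda>t \<kappa>. pd (1, 0) P (t, \<kappa>))"
        by (rule cont_bdd_on_cong) (rule t1)
      then show ?thesis using cont_bdd_on_strip_smooth[OF P3] by simp
    qed
    show "cont_bdd_on {0<..1} (time_deriv (time_deriv ?u))"
    proof -
      have "cont_bdd_on {0<..1} (time_deriv (time_deriv ?u)) \<longleftrightarrow> cont_bdd_on {0<..1} (\<lambda>t \<kappa>. pd (1, 0) (pd (1, 0) P) (t, \<kappa>))"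
        by (rule cont_bdd_on_cong) (rule t2)
      then show ?thesis using cont_bdd_on_strip_smooth[OF P2] by simp
    qed
    show "iter_deriv bs (?u t) differentiable (at \<kappa>)" if "j < 3" "bs \<in> basis_lists j" for j bs t \<kappa>
      unfolding s(2)[OF that(2) less_imp_le[OF that(1)]]
      by (rule pd_compose(2)[OF slice_deriv strip_smoothD(2)[OF s'[OF that(2) less_imp_le[OF that(1)]]]])
    show "cont_bdd_on {0<..1} (\<lambda>t. iter_deriv bs (?u t))" if "j \<le> 3" "bs \<in> basis_lists j" for j bs
      unfolding s(2)[OF that(2,1)] by (rule cont_bdd_on_strip_smooth[OF s'[OF that(2,1)]])
  qed
qed

section \<open>The integro-differential operator\<close>

text \<open>The generator at a fixed triple of the uncertainty set, written with directional derivatives of a function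
  on \<open>\<real> \<times> \<real>\<^sup>3\<^sup>d\<close>. It is linear in the function, which \<^const>\<open>G_op\<close> is not.\<close>

fun levy_op :: "(real^'d) measure \<times> (real^'d) \<times> (real^'d^'d) \<Rightarrow> (real \<times> 'd::finite vec3 \<Rightarrow> real) \<Rightarrow>
    real \<times> 'd vec3 \<Rightarrow> real" where
  "levy_op (F, q, Q) P p =
     (\<integral>l. P (p + (0, 0, 0, l)) - P p - pd (0, 0, 0, l) P p \<partial>F) + pd (0, 0, q, 0) P p
     + 1/2 * (\<Sum>i\<in>UNIV. \<Sum>j\<in>UNIV. pd (0, axis j 1, 0, 0) (pd (0, axis i 1, 0, 0) P) p * Q $ j $ i)"

definition pide :: "((real^'d) measure \<times> (real^'d) \<times> (real^'d^'d)) set \<Rightarrow>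
    (real \<times> 'd::finite vec3 \<Rightarrow> real) \<Rightarrow> real \<times> 'd vec3 \<Rightarrow> real" where
  "pide \<Theta> P p = pd (1, 0) P p - (SUP \<theta>\<in>\<Theta>. levy_op \<theta> P p)"

lemma pide_op_eq:
  fixes P :: "real \<times> 'd::finite vec3 \<Rightarrow> real"
  assumes P: "strip_smooth (Suc (Suc n)) P" and t: "t \<in> {0<..1}"
  shows "pide_op \<Theta> (\<lambda>t \<kappa>. P (t, \<kappa>)) t x y z = pide \<Theta> P (t, x, y, z)"
proof -
  note d = strip_smoothD(2)[OF P]
  have dx: "((\<lambda>x'. (t, x', y, z)) has_derivative (\<lambda>v. (0, v, 0, 0))) (at x')" for x'
    by (intro has_derivative_Pair has_derivative_const has_derivative_ident)
  have dy: "((\<lambda>y'. (t, x, y', z)) has_derivative (\<lambda>v. (0, 0, v, 0))) (at y)"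
    by (intro has_derivative_Pair has_derivative_const has_derivative_ident)
  have dz: "((\<lambda>l. (t, x, y, z + l)) has_derivative (\<lambda>v. (0, 0, 0, v))) (at l)" for l
    by (intro has_derivative_Pair has_derivative_const) (auto intro!: derivative_eq_intros)
  have y: "grad (\<lambda>y'. P (t, x, y', z)) y \<bullet> q = pd (0, 0, q, 0) P (t, x, y, z)" for q
    using grad_inner[OF pd_compose(2)[OF dy d]] pd_compose(1)[OF dy d] by simp
  have z: "jump_delta l (\<lambda>l. P (t, x, y, z + l)) 0 =
     P ((t, x, y, z) + (0, 0, 0, l)) - P (t, x, y, z) - pd (0, 0, 0, l) P (t, x, y, z)" for l
    using grad_inner[OF pd_compose(2)[OF dz d], of 0 l] pd_compose(1)[OF dz d, of l 0]
    by (simp add: jump_delta_def)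
  have x1: "iter_deriv [axis i 1] (\<lambda>x'. P (t, x', y, z)) = (\<lambda>x'. pd (0, axis i 1, 0, 0) P (t, x', y, z))" for i
    using pd_compose(1)[OF dx d] by (simp add: pd_def[symmetric] fun_eq_iff)
  have ax: "(0::real, axis i (1::real), 0::real^'d, 0::real^'d) \<in> Basis" for i :: 'd
    by (rule axis_slot_Basis)
  have x2: "hess (\<lambda>x'. P (t, x', y, z)) x $ i $ j
      = pd (0, axis j 1, 0, 0) (pd (0, axis i 1, 0, 0) P) (t, x, y, z)" for i j
  proof -
    have "hess (\<lambda>x'. P (t, x', y, z)) x $ i $ j = pd (axis j 1) (iter_deriv [axis i 1] (\<lambda>x'. P (t, x', y, z))) x"
      by (simp add: hess_def pd_def)
    also have "\<dots> = pd (0, axis j 1, 0, 0) (pd (0, axis i 1, 0, 0) P) (t, x, y, z)"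
      unfolding x1 by (rule pd_compose(1)[OF dx strip_smoothD(2)[OF strip_smoothD(3)[OF P ax]]])
    finally show ?thesis .
  qed
  have tr: "trace (hess (\<lambda>x'. P (t, x', y, z)) x ** Q) = (\<Sum>i\<in>UNIV. \<Sum>j\<in>UNIV.
      pd (0, axis j 1, 0, 0) (pd (0, axis i 1, 0, 0) P) (t, x, y, z) * Q $ j $ i)" for Q
    by (simp add: trace_def matrix_matrix_mult_def x2)
  have "G_op \<Theta> (grad (\<lambda>y'. P (t, x, y', z)) y) (hess (\<lambda>x'. P (t, x', y, z)) x) (\<lambda>l. P (t, x, y, z + l))
      = (SUP \<theta>\<in>\<Theta>. levy_op \<theta> P (t, x, y, z))"
    unfolding G_op_def by (rule SUP_cong) (auto simp: y z tr)
  then show ?thesis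
    unfolding pide_op_def pide_def time_deriv_strip_smooth[OF P t] by simp
qed

text \<open>These uniform bounds make the supremum of the operators over the uncertainty set finite and Lipschitz in the first
  two space derivatives.\<close>

definition levy_bounded :: "((real^'d) measure \<times> (real^'d) \<times> (real^'d^'d)) set \<Rightarrow> real \<Rightarrow> bool" where
  "levy_bounded \<Theta> C \<longleftrightarrow> \<Theta> \<noteq> {} \<and> (\<forall>(F, q, Q)\<in>\<Theta>. sets F = sets borel \<and>
     integrable F (\<lambda>z. min (norm z) ((norm z)\<^sup>2)) \<and> (\<integral>z. min (norm z) ((norm z)\<^sup>2) \<partial>F) \<le> C \<and>
     norm q \<le> C \<and> norm Q \<le> C)"

text \<open>The supremum in the definition is taken in the extended nonnegative reals, so its finiteness also yields the
  integrability of \<open>min (norm z) ((norm z)\<^sup>2)\<close>.\<close>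

lemma uncertainty_set_levy_bounded:
  fixes \<Theta> :: "((real^'d) measure \<times> (real^'d) \<times> (real^'d^'d)) set"
  assumes "uncertainty_set \<alpha> lo hi K \<Theta>"
  obtains C where "levy_bounded \<Theta> C"
proof -
  let ?f = "\<lambda>(F::(real^'d) measure, q::real^'d, Q::real^'d^'d).
        (\<integral>\<^sup>+z. ennreal (min (norm z) ((norm z)\<^sup>2)) \<partial>F) + ennreal (norm q) + ennreal (norm Q)"
  define C where "C = enn2real (SUP \<theta>\<in>\<Theta>. ?f \<theta>)"
  have fin: "(SUP \<theta>\<in>\<Theta>. ?f \<theta>) < \<infinity>" and ne: "\<Theta> \<noteq> {}" and sub: "\<Theta> \<subseteq> K \<times> UNIV \<times> psd_matrices"
    and K: "K \<subseteq> levy_class \<alpha> lo hi"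
    using assms by (auto simp: uncertainty_set_def)
  have C: "(SUP \<theta>\<in>\<Theta>. ?f \<theta>) = ennreal C" using fin by (simp add: C_def less_top)
  have C0: "0 \<le> C" by (simp add: C_def)
  have "sets F = sets borel \<and> integrable F (\<lambda>z. min (norm z) ((norm z)\<^sup>2)) \<and>
     (\<integral>z. min (norm z) ((norm z)\<^sup>2) \<partial>F) \<le> C \<and> norm q \<le> C \<and> norm Q \<le> C" if \<theta>: "(F, q, Q) \<in> \<Theta>" for F q Q
  proof -
    have "F \<in> levy_class \<alpha> lo hi" using \<theta> sub K by blast
    then obtain \<mu> where "F = levy_measure \<alpha> \<mu>" unfolding levy_class_def by blast
    then have S: "sets F = sets borel"
      unfolding levy_measure_def
      using sets.sets_measure_of_eq[of "borel :: (real^'d) measure"] by (simp only: space_borel)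
    have "?f (F, q, Q) \<le> ennreal C" unfolding C[symmetric] by (rule SUP_upper[OF \<theta>])
    then have le: "(\<integral>\<^sup>+z. ennreal (min (norm z) ((norm z)\<^sup>2)) \<partial>F) + ennreal (norm q) + ennreal (norm Q) \<le> ennreal C"
      by simp
    have 1: "(\<integral>\<^sup>+z. ennreal (min (norm z) ((norm z)\<^sup>2)) \<partial>F) \<le> ennreal C"
      by (rule order_trans[OF _ le]) (simp add: add.assoc)
    have 2: "ennreal (norm q) \<le> ennreal C" "ennreal (norm Q) \<le> ennreal C"
      by (rule order_trans[OF _ le]; simp add: add_increasing add_increasing2)+
    have [measurable]: "(\<lambda>z::real^'d. min (norm z) ((norm z)\<^sup>2)) \<in> borel_measurable F"
      unfolding measurable_cong_sets[OF S refl] by measurable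
    have int: "integrable F (\<lambda>z. min (norm z) ((norm z)\<^sup>2))"
    proof (rule integrableI_nonneg)
      show "(\<integral>\<^sup>+z. ennreal (min (norm z) ((norm z)\<^sup>2)) \<partial>F) < \<infinity>"
        by (rule le_less_trans[OF 1]) simp
    qed simp_all
    have "ennreal (\<integral>z. min (norm z) ((norm z)\<^sup>2) \<partial>F) \<le> ennreal C"
      using 1 by (subst nn_integral_eq_integral[OF int, symmetric]) simp_all
    then have "(\<integral>z. min (norm z) ((norm z)\<^sup>2) \<partial>F) \<le> C" using C0 by (simp only: ennreal_le_iff)
    moreover have "norm q \<le> C" "norm Q \<le> C" using 2 C0 by (simp_all only: ennreal_le_iff)
    ultimately show ?thesis using S int by blast
  qed
  then have "levy_bounded \<Theta> C" unfolding levy_bounded_def using ne by blast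
  then show thesis by (rule that)
qed

text \<open>Only space directions count: the operator does not see time derivatives, and perturbations with large time
  derivative but small space derivatives must leave it almost unchanged.\<close>

definition deriv_le :: "real \<Rightarrow> real \<Rightarrow> (real \<times> 'a::euclidean_space \<Rightarrow> real) \<Rightarrow> bool" where
  "deriv_le B t P \<longleftrightarrow> (\<forall>\<kappa>. \<forall>b\<in>Basis.
     \<bar>pd (0, b) P (t, \<kappa>)\<bar> \<le> B \<and> (\<forall>c\<in>Basis. \<bar>pd (0, c) (pd (0, b) P) (t, \<kappa>)\<bar> \<le> B))"

lemma deriv_le_nonneg: "deriv_le B t P \<Longrightarrow> 0 \<le> B"
  unfolding deriv_le_def using SOME_Basis abs_ge_zero order_trans by blast

text \<open>The three summands come from the jump, drift and diffusion part of the operator.\<close>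

definition op_const :: "'d::finite itself \<Rightarrow> real" where
  "op_const _ = 2 * (real DIM('d vec3))\<^sup>2 + real DIM('d vec3) + real (CARD('d))^2"

lemma DIM_real_ge1: "1 \<le> real DIM('a::euclidean_space)"
  using DIM_positive[where 'a='a] by linarith

text \<open>Small jumps are controlled by the second-order Taylor bound and large ones by the mean value bound; the minimum of
  the two is what the jump measures integrate.\<close>

lemma jump_bound:
  fixes P :: "real \<times> 'd::finite vec3 \<Rightarrow> real"
  assumes P: "strip_smooth (Suc (Suc n)) P" and B: "deriv_le B t P"
  shows "\<bar>P ((t, \<kappa>) + (0, 0, 0, l)) - P (t, \<kappa>) - pd (0, 0, 0, l) P (t, \<kappa>)\<bar>
    \<le> 2 * (real DIM('d vec3))\<^sup>2 * B * min (norm l) ((norm l)\<^sup>2)"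
proof -
  let ?D = "real DIM('d vec3)"
  let ?P = "\<lambda>\<kappa>. P (t, \<kappa>)" and ?l = "(0, 0, l) :: 'd vec3"
  note d = strip_smoothD(2)[OF P]
  have B0: "0 \<le> B" by (rule deriv_le_nonneg[OF B])
  have nl: "norm ?l = norm l" by (simp add: norm_Pair)
  have sl: "pd v ?P = (\<lambda>\<kappa>. pd (0, v) P (t, \<kappa>))" "?P differentiable (at \<kappa>)" for v \<kappa>
    using pd_compose[OF slice_deriv d] by (simp_all add: fun_eq_iff)
  have sl2: "pd v (pd b ?P) \<kappa> = pd (0, v) (pd (0, b) P) (t, \<kappa>)" "pd b ?P differentiable (at \<kappa>)"
    if "b \<in> Basis" for v b \<kappa>
    unfolding sl(1) using pd_compose[OF slice_deriv strip_smoothD(2)[OF strip_smoothD(3)[OF P Pair0_Basis[OF that]]]]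
    by simp_all
  have B1: "\<bar>pd b ?P \<kappa>\<bar> \<le> B" if "b \<in> Basis" for b \<kappa>
    using B that unfolding deriv_le_def sl(1) by blast
  have B2: "\<bar>pd c (pd b ?P) \<kappa>\<bar> \<le> B" if "b \<in> Basis" "c \<in> Basis" for b c \<kappa>
    using B that unfolding deriv_le_def sl2(1)[OF that(1)] by blast
  have D: "?D \<le> ?D\<^sup>2" using DIM_real_ge1[where 'a="'d vec3"] by (simp add: power2_eq_square)
  have "\<bar>?P (\<kappa> + ?l) - ?P \<kappa> - pd ?l ?P \<kappa>\<bar> \<le> ?D\<^sup>2 * B * (norm ?l)\<^sup>2"
    by (rule taylor_pd[OF convex_UNIV UNIV_I UNIV_I sl(2) sl2(2) B2])
  also have "\<dots> \<le> 2 * ?D\<^sup>2 * B * (norm l)\<^sup>2" unfolding nl using B0 by (intro mult_right_mono) auto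
  finally have 1: "\<bar>?P (\<kappa> + ?l) - ?P \<kappa> - pd ?l ?P \<kappa>\<bar> \<le> 2 * ?D\<^sup>2 * B * (norm l)\<^sup>2" .
  have "\<bar>?P (\<kappa> + ?l) - ?P \<kappa>\<bar> \<le> ?D * B * norm (\<kappa> + ?l - \<kappa>)"
    by (rule mean_value_pd[OF convex_UNIV UNIV_I UNIV_I sl(2) B1])
  moreover have "\<bar>pd ?l ?P \<kappa>\<bar> \<le> ?D * B * norm ?l"
    by (rule abs_pd_le[OF sl(2) B1])
  ultimately have "\<bar>?P (\<kappa> + ?l) - ?P \<kappa> - pd ?l ?P \<kappa>\<bar> \<le> 2 * (?D * B * norm l)"
    unfolding add_diff_cancel_left' nl by linarith
  also have "\<dots> \<le> 2 * (?D\<^sup>2 * B * norm l)" using B0 D by (intro mult_left_mono mult_right_mono) auto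
  finally have 2: "\<bar>?P (\<kappa> + ?l) - ?P \<kappa> - pd ?l ?P \<kappa>\<bar> \<le> 2 * ?D\<^sup>2 * B * norm l" by simp
  have "(t, \<kappa>) + (0, 0, 0, l) = (t, \<kappa> + ?l)" by simp
  then show ?thesis using 1 2 unfolding sl(1) by (simp add: min_def)
qed

lemma jump_integrable:
  fixes P :: "real \<times> 'd::finite vec3 \<Rightarrow> real"
  assumes P: "strip_smooth (Suc (Suc n)) P" and B: "deriv_le B t P"
    and F: "sets F = sets borel" "integrable F (\<lambda>z. min (norm z) ((norm z)\<^sup>2))"
  shows "integrable F (\<lambda>l. P ((t, \<kappa>) + (0, 0, 0, l)) - P (t, \<kappa>) - pd (0, 0, 0, l) P (t, \<kappa>))"
proof (rule Bochner_Integration.integrable_bound)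
  let ?D = "2 * (real DIM('d vec3))\<^sup>2 * B"
  show "integrable F (\<lambda>l. ?D * min (norm l) ((norm l)\<^sup>2))" using F by simp
  have "continuous_on UNIV (\<lambda>l::real^'d. pd (0, 0, 0, l) P (t, \<kappa>))"
    by (rule linear_continuous_on, rule bounded_linear_compose[OF
          has_derivative_bounded_linear[OF has_derivative_pd[OF strip_smoothD(2)[OF P]]]])
      (intro bounded_linear_Pair bounded_linear_zero bounded_linear_ident)
  moreover have "continuous_on UNIV (\<lambda>l::real^'d. P ((t, \<kappa>) + (0, 0, 0, l)))"
    by (rule continuous_on_compose2[OF strip_smooth_continuous[OF P, of UNIV]]) (auto intro!: continuous_intros)
  ultimately have "continuous_on UNIV (\<lambda>l. P ((t, \<kappa>) + (0, 0, 0, l)) - P (t, \<kappa>) - pd (0, 0, 0, l) P (t, \<kappa>))"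
    by (intro continuous_on_diff continuous_on_const)
  then show "(\<lambda>l. P ((t, \<kappa>) + (0, 0, 0, l)) - P (t, \<kappa>) - pd (0, 0, 0, l) P (t, \<kappa>)) \<in> borel_measurable F"
    unfolding measurable_cong_sets[OF F(1) refl] by (rule borel_measurable_continuous_onI)
  show "AE l in F. norm (P ((t, \<kappa>) + (0, 0, 0, l)) - P (t, \<kappa>) - pd (0, 0, 0, l) P (t, \<kappa>))
      \<le> norm (?D * min (norm l) ((norm l)\<^sup>2))"
    using jump_bound[OF P B] deriv_le_nonneg[OF B] by (intro AE_I2) (simp add: abs_mult)
qed

lemma levy_op_bound:
  fixes P :: "real \<times> 'd::finite vec3 \<Rightarrow> real"
  assumes P: "strip_smooth (Suc (Suc n)) P" and B: "deriv_le B t P"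
    and \<Theta>: "levy_bounded \<Theta> C" "\<theta> \<in> \<Theta>"
  shows "\<bar>levy_op \<theta> P (t, \<kappa>)\<bar> \<le> op_const TYPE('d) * C * B"
proof -
  obtain F q Q where \<theta>: "\<theta> = (F, q, Q)" by (cases \<theta>) blast
  have F: "sets F = sets borel" "integrable F (\<lambda>z. min (norm z) ((norm z)\<^sup>2))"
    "(\<integral>z. min (norm z) ((norm z)\<^sup>2) \<partial>F) \<le> C" "norm q \<le> C" "norm Q \<le> C"
    using \<Theta> unfolding levy_bounded_def \<theta> by auto
  let ?D = "real DIM('d vec3)"
  have B0: "0 \<le> B" by (rule deriv_le_nonneg[OF B])
  have C0: "0 \<le> C" using F(4) norm_ge_zero order_trans by blast
  have "\<bar>\<integral>l. P ((t, \<kappa>) + (0, 0, 0, l)) - P (t, \<kappa>) - pd (0, 0, 0, l) P (t, \<kappa>) \<partial>F\<bar>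
    \<le> (\<integral>l. \<bar>P ((t, \<kappa>) + (0, 0, 0, l)) - P (t, \<kappa>) - pd (0, 0, 0, l) P (t, \<kappa>)\<bar> \<partial>F)"
    by (rule integral_abs_bound)
  also have "\<dots> \<le> (\<integral>l. 2 * ?D\<^sup>2 * B * min (norm l) ((norm l)\<^sup>2) \<partial>F)"
    by (intro integral_mono jump_bound[OF P B] integrable_abs jump_integrable[OF P B F(1,2)]
        integrable_mult_right F(2))
  also have "\<dots> \<le> 2 * ?D\<^sup>2 * B * C" using F(2,3) B0 by (simp add: mult_left_mono)
  finally have 1: "\<bar>\<integral>l. P ((t, \<kappa>) + (0, 0, 0, l)) - P (t, \<kappa>) - pd (0, 0, 0, l) P (t, \<kappa>) \<partial>F\<bar>
     \<le> 2 * ?D\<^sup>2 * B * C" .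
  have "pd (0, 0, q, 0) P (t, \<kappa>) = pd (0, q, 0) (\<lambda>\<kappa>. P (t, \<kappa>)) \<kappa>"
    by (rule pd_compose(1)[OF slice_deriv strip_smoothD(2)[OF P], symmetric])
  also have "\<bar>\<dots>\<bar> \<le> ?D * B * norm ((0, q, 0) :: 'd vec3)"
  proof (rule abs_pd_le[OF pd_compose(2)[OF slice_deriv strip_smoothD(2)[OF P]]])
    fix b :: "'d vec3" assume "b \<in> Basis"
    then show "\<bar>pd b (\<lambda>\<kappa>. P (t, \<kappa>)) \<kappa>\<bar> \<le> B"
      using B unfolding pd_compose(1)[OF slice_deriv strip_smoothD(2)[OF P]] deriv_le_def by blast
  qed
  also have "\<dots> \<le> ?D * B * C" using F(4) B0 by (intro mult_left_mono) (auto simp: norm_Pair)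
  finally have 2: "\<bar>pd (0, 0, q, 0) P (t, \<kappa>)\<bar> \<le> ?D * B * C" .
  have ax: "(axis i (1::real), 0::real^'d, 0::real^'d) \<in> Basis" for i :: 'd
    by (rule Basis_Pair0[where 'a="(real^'d) \<times> (real^'d)", unfolded zero_prod_def]) (simp add: axis_in_Basis_iff)
  have "\<bar>\<Sum>i\<in>UNIV. \<Sum>j\<in>UNIV. pd (0, axis j 1, 0, 0) (pd (0, axis i 1, 0, 0) P) (t, \<kappa>) * Q $ j $ i\<bar>
    \<le> (\<Sum>i\<in>(UNIV::'d set). \<Sum>j\<in>(UNIV::'d set). B * C)"
  proof (intro order_trans[OF sum_abs] sum_mono order_trans[OF sum_abs])
    fix i j :: 'd
    have "\<bar>Q $ j $ i\<bar> \<le> norm (Q $ j)" using component_le_norm_cart[of "Q $ j" i] by simp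
    also have "\<dots> \<le> norm Q" by (rule Finite_Cartesian_Product.norm_nth_le)
    finally have "\<bar>Q $ j $ i\<bar> \<le> C" using F(5) by simp
    moreover have "\<bar>pd (0, axis j 1, 0, 0) (pd (0, axis i 1, 0, 0) P) (t, \<kappa>)\<bar> \<le> B"
      using B ax unfolding deriv_le_def by blast
    ultimately show "\<bar>pd (0, axis j 1, 0, 0) (pd (0, axis i 1, 0, 0) P) (t, \<kappa>) * Q $ j $ i\<bar> \<le> B * C"
      unfolding abs_mult by (intro mult_mono' abs_ge_zero)
  qed
  also have "\<dots> = (real CARD('d))\<^sup>2 * B * C" by (simp add: power2_eq_square)
  finally have 3: "\<bar>\<Sum>i\<in>UNIV. \<Sum>j\<in>UNIV. pd (0, axis j 1, 0, 0) (pd (0, axis i 1, 0, 0) P) (t, \<kappa>) * Q $ j $ i\<bar>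
    \<le> (real CARD('d))\<^sup>2 * B * C" .
  have 4: "\<bar>a + b + 1/2 * c\<bar> \<le> A + A' + A''" if "\<bar>a\<bar> \<le> A" "\<bar>b\<bar> \<le> A'" "\<bar>c\<bar> \<le> A''" for a b c A A' A'' :: real
    using that by linarith
  have "\<bar>levy_op \<theta> P (t, \<kappa>)\<bar> \<le> 2 * ?D\<^sup>2 * B * C + ?D * B * C + (real CARD('d))\<^sup>2 * B * C"
    unfolding \<theta> levy_op.simps by (rule 4[OF 1 2 3])
  also have "\<dots> = op_const TYPE('d) * C * B" by (simp add: op_const_def algebra_simps)
  finally show ?thesis .
qed

lemma strip_smooth_deriv_le:
  assumes P: "strip_smooth (Suc (Suc n)) P"
  obtains B where "\<And>t. \<bar>t\<bar> \<le> R \<Longrightarrow> deriv_le B t P"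
proof -
  have 1: "\<exists>B. \<forall>b\<in>(Basis::(real \<times> 'a) set). \<forall>t \<kappa>. \<bar>t\<bar> \<le> R \<longrightarrow> \<bar>f b (t, \<kappa>)\<bar> \<le> B"
    if "\<And>b. b \<in> Basis \<Longrightarrow> strip_bounded (f b)" for f :: "_ \<Rightarrow> real \<times> 'a \<Rightarrow> real"
  proof -
    have "\<forall>b\<in>Basis. \<exists>B. \<forall>t \<kappa>. \<bar>t\<bar> \<le> R \<longrightarrow> \<bar>f b (t, \<kappa>)\<bar> \<le> B" using strip_boundedE[OF that] by metis
    then obtain B where "\<forall>b\<in>Basis. \<forall>t \<kappa>. \<bar>t\<bar> \<le> R \<longrightarrow> \<bar>f b (t, \<kappa>)\<bar> \<le> B b" by metis
    moreover have "B b \<le> Max (B ` Basis)" if "b \<in> Basis" for b using that by simp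
    ultimately show ?thesis by (meson order_trans)
  qed
  obtain B1 where B1: "\<forall>b\<in>Basis. \<forall>t \<kappa>. \<bar>t\<bar> \<le> R \<longrightarrow> \<bar>pd b P (t, \<kappa>)\<bar> \<le> B1"
    using 1[of "\<lambda>b. pd b P"] strip_smoothD(1)[OF strip_smoothD(3)[OF P]] by blast
  have "\<forall>b\<in>Basis. \<exists>B. \<forall>c\<in>Basis. \<forall>t \<kappa>. \<bar>t\<bar> \<le> R \<longrightarrow> \<bar>pd c (pd b P) (t, \<kappa>)\<bar> \<le> B"
  proof
    fix b :: "real \<times> 'a" assume b: "b \<in> Basis"
    show "\<exists>B. \<forall>c\<in>Basis. \<forall>t \<kappa>. \<bar>t\<bar> \<le> R \<longrightarrow> \<bar>pd c (pd b P) (t, \<kappa>)\<bar> \<le> B"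
      by (rule 1[OF strip_smooth_bounded[OF strip_smoothD(3)[OF strip_smoothD(3)[OF P b]]]])
  qed
  then obtain B where B: "\<forall>b\<in>Basis. \<forall>c\<in>Basis. \<forall>t \<kappa>. \<bar>t\<bar> \<le> R \<longrightarrow> \<bar>pd c (pd b P) (t, \<kappa>)\<bar> \<le> B b" by metis
  have M: "B b \<le> Max (B ` Basis)" if "b \<in> Basis" for b using that by simp
  let ?B = "max B1 (Max (B ` Basis))"
  have "\<bar>pd b P (t, \<kappa>)\<bar> \<le> ?B" "\<bar>pd c (pd b P) (t, \<kappa>)\<bar> \<le> ?B" if "\<bar>t\<bar> \<le> R" "b \<in> Basis" "c \<in> Basis" for t \<kappa> b c
    using B1 B M that by (meson max.coboundedI1 max.coboundedI2 order_trans)+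
  then have "deriv_le (max B1 (Max (B ` Basis))) t P" if "\<bar>t\<bar> \<le> R" for t
    unfolding deriv_le_def using that SOME_Basis by (blast intro: Pair0_Basis)
  then show thesis by (rule that)
qed

lemma levy_op_add:
  fixes P P' :: "real \<times> 'd::finite vec3 \<Rightarrow> real"
  assumes P: "strip_smooth (Suc (Suc n)) P" and P': "strip_smooth (Suc (Suc m)) P'"
    and \<Theta>: "levy_bounded \<Theta> C" "\<theta> \<in> \<Theta>"
  shows "levy_op \<theta> (\<lambda>p. P p + P' p) (t, \<kappa>) = levy_op \<theta> P (t, \<kappa>) + levy_op \<theta> P' (t, \<kappa>)"
proof -
  obtain F q Q where \<theta>: "\<theta> = (F, q, Q)" by (cases \<theta>) blast
  have F: "sets F = sets borel" "integrable F (\<lambda>z. min (norm z) ((norm z)\<^sup>2))"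
    using \<Theta> unfolding levy_bounded_def \<theta> by auto
  obtain B where B: "deriv_le B t P" using strip_smooth_deriv_le[OF P, of "\<bar>t\<bar>"] by blast
  obtain B' where B': "deriv_le B' t P'" using strip_smooth_deriv_le[OF P', of "\<bar>t\<bar>"] by blast
  note d = strip_smoothD(2)[OF P] strip_smoothD(2)[OF P']
  have eq: "pd v (\<lambda>p. P p + P' p) = (\<lambda>p. pd v P p + pd v P' p)" for v
    by (rule ext, rule pd_add[OF d])
  have ax: "(0::real, axis i (1::real), 0::real^'d, 0::real^'d) \<in> Basis" for i :: 'd
    by (rule axis_slot_Basis)
  have eq2: "pd v (\<lambda>p. pd (0, axis i 1, 0, 0) P p + pd (0, axis i 1, 0, 0) P' p) p
     = pd v (pd (0, axis i 1, 0, 0) P) p + pd v (pd (0, axis i 1, 0, 0) P') p" for v p i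
    by (rule pd_add[OF strip_smoothD(2)[OF strip_smoothD(3)[OF P ax]] strip_smoothD(2)[OF strip_smoothD(3)[OF P' ax]]])
  have "(\<integral>l. P ((t, \<kappa>) + (0, 0, 0, l)) + P' ((t, \<kappa>) + (0, 0, 0, l)) - (P (t, \<kappa>) + P' (t, \<kappa>)) -
       (pd (0, 0, 0, l) P (t, \<kappa>) + pd (0, 0, 0, l) P' (t, \<kappa>)) \<partial>F) =
     (\<integral>l. (P ((t, \<kappa>) + (0, 0, 0, l)) - P (t, \<kappa>) - pd (0, 0, 0, l) P (t, \<kappa>)) +
       (P' ((t, \<kappa>) + (0, 0, 0, l)) - P' (t, \<kappa>) - pd (0, 0, 0, l) P' (t, \<kappa>)) \<partial>F)"
    by (rule Bochner_Integration.integral_cong) auto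
  also have "\<dots> = (\<integral>l. P ((t, \<kappa>) + (0, 0, 0, l)) - P (t, \<kappa>) - pd (0, 0, 0, l) P (t, \<kappa>) \<partial>F) +
      (\<integral>l. P' ((t, \<kappa>) + (0, 0, 0, l)) - P' (t, \<kappa>) - pd (0, 0, 0, l) P' (t, \<kappa>) \<partial>F)"
    by (rule Bochner_Integration.integral_add[OF jump_integrable[OF P B F] jump_integrable[OF P' B' F]])
  finally show ?thesis
    unfolding \<theta> levy_op.simps eq eq2 by (simp add: algebra_simps sum.distrib)
qed

lemma levy_op_bdd_above:
  fixes P :: "real \<times> 'd::finite vec3 \<Rightarrow> real"
  assumes P: "strip_smooth (Suc (Suc n)) P" and \<Theta>: "levy_bounded \<Theta> C"
  shows "bdd_above ((\<lambda>\<theta>. levy_op \<theta> P p) ` \<Theta>)"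
proof -
  obtain t \<kappa> where p: "p = (t, \<kappa>)" by (cases p) blast
  obtain B where B: "deriv_le B t P" using strip_smooth_deriv_le[OF P, of "\<bar>t\<bar>"] by blast
  show ?thesis
    unfolding p by (rule bdd_aboveI2[of _ _ "op_const TYPE('d) * C * B"])
      (use levy_op_bound[OF P B \<Theta>] abs_le_D1 in blast)
qed

text \<open>The operators are linear and uniformly bounded, so their supremum is Lipschitz with respect to the first two space
  derivatives.\<close>

lemma pide_perturb:
  fixes P P' :: "real \<times> 'd::finite vec3 \<Rightarrow> real"
  assumes P: "strip_smooth (Suc (Suc n)) P" and P': "strip_smooth (Suc (Suc n)) P'"
    and \<Theta>: "levy_bounded \<Theta> C" and B: "deriv_le B t P'"
  shows "\<bar>pide \<Theta> (\<lambda>p. P p + P' p) (t, \<kappa>) - pide \<Theta> P (t, \<kappa>) - pd (1, 0) P' (t, \<kappa>)\<bar>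
    \<le> op_const TYPE('d) * C * B"
proof -
  let ?K = "op_const TYPE('d) * C * B"
  let ?p = "(t, \<kappa>)"
  have ne: "\<Theta> \<noteq> {}" using \<Theta> by (simp add: levy_bounded_def)
  note add = levy_op_add[OF P P' \<Theta>]
  have K: "\<bar>levy_op \<theta> P' ?p\<bar> \<le> ?K" if "\<theta> \<in> \<Theta>" for \<theta> by (rule levy_op_bound[OF P' B \<Theta> that])
  have PP: "strip_smooth (Suc (Suc n)) (\<lambda>p. P p + P' p)" by (rule strip_smooth_add[OF P P'])
  have 1: "(SUP \<theta>\<in>\<Theta>. levy_op \<theta> (\<lambda>p. P p + P' p) ?p) \<le> (SUP \<theta>\<in>\<Theta>. levy_op \<theta> P ?p) + ?K"
  proof (rule cSUP_least[OF ne])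
    fix \<theta> assume \<theta>: "\<theta> \<in> \<Theta>"
    have "levy_op \<theta> P ?p \<le> (SUP \<theta>\<in>\<Theta>. levy_op \<theta> P ?p)"
      by (rule cSUP_upper[OF \<theta> levy_op_bdd_above[OF P \<Theta>]])
    then show "levy_op \<theta> (\<lambda>p. P p + P' p) ?p \<le> (SUP \<theta>\<in>\<Theta>. levy_op \<theta> P ?p) + ?K"
      using K[OF \<theta>] unfolding add[OF \<theta>] by linarith
  qed
  have 2: "(SUP \<theta>\<in>\<Theta>. levy_op \<theta> P ?p) \<le> (SUP \<theta>\<in>\<Theta>. levy_op \<theta> (\<lambda>p. P p + P' p) ?p) + ?K"
  proof (rule cSUP_least[OF ne])
    fix \<theta> assume \<theta>: "\<theta> \<in> \<Theta>"
    have "levy_op \<theta> (\<lambda>p. P p + P' p) ?p \<le> (SUP \<theta>\<in>\<Theta>. levy_op \<theta> (\<lambda>p. P p + P' p) ?p)"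
      by (rule cSUP_upper[OF \<theta> levy_op_bdd_above[OF PP \<Theta>]])
    then show "levy_op \<theta> P ?p \<le> (SUP \<theta>\<in>\<Theta>. levy_op \<theta> (\<lambda>p. P p + P' p) ?p) + ?K"
      using K[OF \<theta>] unfolding add[OF \<theta>] by linarith
  qed
  have "pd (1, 0) (\<lambda>p. P p + P' p) ?p = pd (1, 0) P ?p + pd (1, 0) P' ?p"
    by (rule pd_add[OF strip_smoothD(2)[OF P] strip_smoothD(2)[OF P']])
  then show ?thesis using 1 2 unfolding pide_def by linarith
qed

(* Points of the product space are kept as single variables by the simplifier. *)
declare split_paired_All [simp del] split_paired_Ex [simp del]

section \<open>The rescaled mollifier\<close>

definition scaled_kernel :: "(real \<times> 'd::finite vec3 \<Rightarrow> real) \<Rightarrow> real \<Rightarrow> real \<times> 'd vec3 \<Rightarrow> real" where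
  "scaled_kernel \<rho> \<epsilon> p = rho_eps \<rho> \<epsilon> (fst p) (snd p)"

lemma kernel_scaled:
  assumes "mollifier \<rho>" "0 < \<epsilon>" "\<epsilon> \<le> 1"
  shows "kernel n 2 (scaled_kernel \<rho> \<epsilon>)"
proof -
  have "scaled_kernel \<rho> \<epsilon> = (\<lambda>p. (1 / \<epsilon> ^ (2 + 3 * CARD('a))) * \<rho> (fst p / \<epsilon>\<^sup>2, snd p /\<^sub>R \<epsilon>))"
    by (simp add: scaled_kernel_def rho_eps_def fun_eq_iff)
  then show ?thesis using kernel_rescale[OF assms(2,3) kernel_mollifier[OF assms(1)]] by (simp only:)
qed

lemma scaled_kernel_nonneg:
  assumes "mollifier \<rho>" "0 < \<epsilon>"
  shows "0 \<le> scaled_kernel \<rho> \<epsilon> p"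
proof -
  have "\<forall>p. 0 \<le> \<rho> p" using assms(1) unfolding mollifier_def by (elim conjE)
  then have "0 \<le> \<rho> (fst p / \<epsilon>\<^sup>2, snd p /\<^sub>R \<epsilon>)" by (rule spec)
  then show ?thesis using assms(2) unfolding scaled_kernel_def rho_eps_def by simp
qed

text \<open>The set where \<open>\<rho>\<close> does not vanish is open, so it lies in the interior of the prescribed support. The strict
  inequalities identify the integral over the open ball in the definition of the mollification with an integral
  over the whole space.\<close>

lemma mollifier_support:
  assumes "mollifier \<rho>" "\<rho> p \<noteq> 0"
  shows "fst p \<in> {-1<..<0}" "norm (snd p) < 1"
proof -
  have "continuous_on UNIV \<rho>" using kernel_0[OF kernel_mollifier[OF assms(1)]] by simp
  then have o: "open {p. \<rho> p \<noteq> 0}"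
    using open_Collect_neq[of \<rho> "\<lambda>_. 0"] by (simp add: continuous_on_const)
  have "closure {p. \<rho> p \<noteq> 0} \<subseteq> {-1..0} \<times> cball 0 1"
    using assms(1) unfolding mollifier_def by (elim conjE)
  with closure_subset have "{p. \<rho> p \<noteq> 0} \<subseteq> {-1..0} \<times> cball 0 1" by (rule order_trans)
  then have "{p. \<rho> p \<noteq> 0} \<subseteq> interior ({-1..0} \<times> cball 0 1)"
    by (rule interior_maximal[OF _ o])
  moreover have "p \<in> {p. \<rho> p \<noteq> 0}" using assms(2) by simp
  ultimately have "p \<in> interior ({-1..0} \<times> cball 0 1)" by (rule subsetD)
  then have "p \<in> {-1<..<0} \<times> ball 0 1"
    by (simp only: interior_Times interior_atLeastAtMost_real interior_cball)
  then show "fst p \<in> {-1<..<0}" "norm (snd p) < 1" by (auto simp: mem_Times_iff)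
qed

lemma scaled_kernel_support:
  assumes "mollifier \<rho>" "0 < \<epsilon>" "scaled_kernel \<rho> \<epsilon> p \<noteq> 0"
  shows "- (\<epsilon>\<^sup>2) < fst p" "fst p < 0" "norm (snd p) < \<epsilon>"
proof -
  have "\<rho> (fst p / \<epsilon>\<^sup>2, snd p /\<^sub>R \<epsilon>) \<noteq> 0"
    using assms(3) by (simp add: scaled_kernel_def rho_eps_def)
  note s = mollifier_support[OF assms(1) this]
  show "- (\<epsilon>\<^sup>2) < fst p" "fst p < 0" "norm (snd p) < \<epsilon>"
    using s assms(2) by (auto simp: field_simps divide_less_0_iff)
qed

lemma scaled_kernel_measurable:
  assumes "mollifier \<rho>" "0 < \<epsilon>" "\<epsilon> \<le> 1"
  shows "scaled_kernel \<rho> \<epsilon> \<in> borel_measurable borel"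
  using kernel_0[OF kernel_scaled[OF assms]] by (auto intro: borel_measurable_continuous_onI)

lemma scaled_kernel_integrable:
  assumes "mollifier \<rho>" "0 < \<epsilon>" "\<epsilon> \<le> 1"
  shows "integrable lborel (scaled_kernel \<rho> \<epsilon>)"
proof -
  obtain B where B: "\<And>p. \<bar>scaled_kernel \<rho> \<epsilon> p\<bar> \<le> B" using kernel_bounded[OF kernel_scaled[OF assms]] by blast
  show ?thesis
    by (rule integrable_bounded_cball(1)[OF scaled_kernel_measurable[OF assms] B, of 0 2])
      (use kernel_0[OF kernel_scaled[OF assms]] in auto)
qed

lemma lborel_parabolic_scaling:
  assumes "0 < (\<epsilon>::real)"
  shows "(lborel :: (real \<times> 'd::finite vec3) measure) =
    density (distr lborel borel (\<lambda>p. (\<epsilon>\<^sup>2 * fst p, \<epsilon> *\<^sub>R snd p))) (\<lambda>_. ennreal (\<epsilon> ^ (2 + 3 * CARD('d))))"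
proof -
  define c :: "real \<times> 'd vec3 \<Rightarrow> real" where "c b = (if fst b = 0 then \<epsilon> else \<epsilon>\<^sup>2)" for b
  have T: "0 + (\<Sum>j\<in>Basis. (c j * (p \<bullet> j)) *\<^sub>R j) = (\<epsilon>\<^sup>2 * fst p, \<epsilon> *\<^sub>R snd p)" for p
  proof (rule euclidean_eqI)
    fix b :: "real \<times> 'd vec3" assume b: "b \<in> Basis"
    then have "(0 + (\<Sum>j\<in>Basis. (c j * (p \<bullet> j)) *\<^sub>R j)) \<bullet> b = c b * (p \<bullet> b)"
      by (simp add: inner_sum_left inner_Basis if_distrib sum.delta cong: if_cong)
    also have "\<dots> = (\<epsilon>\<^sup>2 * fst p, \<epsilon> *\<^sub>R snd p) \<bullet> b"
    proof (cases "fst b = 0")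
      case True then show ?thesis by (cases b, cases p) (simp add: c_def algebra_simps)
    next
      case False
      then have "snd b = 0" using b by (auto simp: Basis_prod_def)
      then show ?thesis using False by (cases b, cases p) (simp add: c_def)
    qed
    finally show "(0 + (\<Sum>j\<in>Basis. (c j * (p \<bullet> j)) *\<^sub>R j)) \<bullet> b = (\<epsilon>\<^sup>2 * fst p, \<epsilon> *\<^sub>R snd p) \<bullet> b" .
  qed
  have pr: "(\<Prod>j\<in>Basis. \<bar>c j\<bar>) = \<epsilon> ^ (2 + 3 * CARD('d))"
  proof -
    have "(\<Prod>j\<in>(Basis :: (real \<times> 'd vec3) set). \<bar>c j\<bar>) =
      (\<Prod>j\<in>(\<lambda>u. (u, 0)) ` Basis. \<bar>c j\<bar>) * (\<Prod>j\<in>(\<lambda>v. (0, v)) ` Basis. \<bar>c j\<bar>)"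
      unfolding Basis_prod_def[where 'a=real] by (rule prod.union_disjoint) auto
    also have "(\<Prod>j\<in>(\<lambda>u. (u, 0)) ` (Basis :: real set). \<bar>c j\<bar>) = \<epsilon>\<^sup>2"
      using assms by (simp add: c_def)
    also have "(\<Prod>j\<in>(\<lambda>v. (0, v)) ` (Basis :: 'd vec3 set). \<bar>c j\<bar>) = \<epsilon> ^ (3 * CARD('d))"
      using assms by (subst prod.reindex) (simp_all add: inj_on_def c_def mult.commute[of 3] numeral_3_eq_3)
    finally show ?thesis by (simp only: power_add)
  qed
  have "(lborel :: (real \<times> 'd vec3) measure) =
      density (distr lborel borel (\<lambda>x. 0 + (\<Sum>j\<in>Basis. (c j * (x \<bullet> j)) *\<^sub>R j))) (\<lambda>_. ennreal (\<Prod>j\<in>Basis. \<bar>c j\<bar>))"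
    by (rule lborel_affine_euclidean) (use assms in \<open>auto simp: c_def\<close>)
  then show ?thesis unfolding T pr .
qed

lemma integral_scaled_kernel:
  fixes \<rho> :: "real \<times> 'd::finite vec3 \<Rightarrow> real"
  assumes "mollifier \<rho>" "0 < \<epsilon>" "\<epsilon> \<le> 1"
  shows "(\<integral>p. scaled_kernel \<rho> \<epsilon> p \<partial>lborel) = 1"
proof -
  let ?m = "2 + 3 * CARD('d)"
  let ?T = "\<lambda>p::real \<times> 'd vec3. (\<epsilon>\<^sup>2 * fst p, \<epsilon> *\<^sub>R snd p)"
  have [measurable]: "scaled_kernel \<rho> \<epsilon> \<in> borel_measurable borel" by (rule scaled_kernel_measurable[OF assms])
  have "continuous_on UNIV ?T" by (intro continuous_intros)
  then have [measurable]: "?T \<in> lborel \<rightarrow>\<^sub>M borel"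
    using borel_measurable_continuous_onI by simp
  have "(\<integral>p. scaled_kernel \<rho> \<epsilon> p \<partial>lborel) =
    (\<integral>p. scaled_kernel \<rho> \<epsilon> p \<partial>density (distr lborel borel ?T) (\<lambda>_. ennreal (\<epsilon> ^ ?m)))"
    using lborel_parabolic_scaling[OF assms(2), where 'd='d] by simp
  also have "\<dots> = (\<integral>p. \<epsilon> ^ ?m * scaled_kernel \<rho> \<epsilon> p \<partial>distr lborel borel ?T)"
    using assms(2) by (subst integral_density) simp_all
  also have "\<dots> = (\<integral>p. \<epsilon> ^ ?m * scaled_kernel \<rho> \<epsilon> (?T p) \<partial>lborel)"
    by (rule integral_distr) simp_all
  also have "\<dots> = (\<integral>p. \<rho> p \<partial>lborel)"
    using assms(2) by (intro Bochner_Integration.integral_cong) (simp_all add: scaled_kernel_def rho_eps_def)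
  also have "\<dots> = 1" using assms(1) by (simp add: mollifier_def)
  finally show ?thesis .
qed

section \<open>Bump functions\<close>

text \<open>Independence of time makes the bump invisible to the time derivative. Functions of this kind come from mollifying
  the indicator of a ball.\<close>

definition is_bump :: "real \<Rightarrow> (real \<times> 'a::euclidean_space \<Rightarrow> real) \<Rightarrow> bool" where
  "is_bump r \<beta> \<longleftrightarrow> (\<forall>n. strip_smooth n \<beta>) \<and> (\<forall>t \<kappa>. \<beta> (t, \<kappa>) = \<beta> (0, \<kappa>)) \<and>
     (\<forall>p. 0 \<le> \<beta> p \<and> \<beta> p \<le> 1) \<and> (\<forall>t \<kappa>. norm \<kappa> \<le> r \<longrightarrow> \<beta> (t, \<kappa>) = 1) \<and>
     (\<forall>t \<kappa>. 3 * r \<le> norm \<kappa> \<longrightarrow> \<beta> (t, \<kappa>) = 0)"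

lemma is_bumpD:
  assumes "is_bump r \<beta>"
  shows "\<And>n. strip_smooth n \<beta>" "\<And>t \<kappa>. \<beta> (t, \<kappa>) = \<beta> (0, \<kappa>)"
    "\<And>p. 0 \<le> \<beta> p" "\<And>p. \<beta> p \<le> 1"
    "\<And>t \<kappa>. norm \<kappa> \<le> r \<Longrightarrow> \<beta> (t, \<kappa>) = 1" "\<And>t \<kappa>. 3 * r \<le> norm \<kappa> \<Longrightarrow> \<beta> (t, \<kappa>) = 0"
  using assms unfolding is_bump_def by blast+

lemma bump_exists:
  fixes \<rho> :: "real \<times> 'd::finite vec3 \<Rightarrow> real"
  assumes \<rho>: "mollifier \<rho>" and r: "0 < r"
  shows "\<exists>\<beta> :: real \<times> 'd vec3 \<Rightarrow> real. is_bump r \<beta>"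
proof -
  define \<epsilon> where "\<epsilon> = min 1 r"
  have \<epsilon>: "0 < \<epsilon>" "\<epsilon> \<le> 1" "\<epsilon> \<le> r" using r by (auto simp: \<epsilon>_def)
  let ?k = "scaled_kernel \<rho> \<epsilon>"
  define V :: "real \<times> 'd vec3 \<Rightarrow> real" where "V = indicator (UNIV \<times> ball 0 (2 * r))"
  have Vm: "V \<in> borel_measurable borel"
    unfolding V_def by (intro borel_measurable_indicator borel_open open_Times) auto
  note km = scaled_kernel_measurable[OF \<rho> \<epsilon>(1,2)]
  note ki = scaled_kernel_integrable[OF \<rho> \<epsilon>(1,2)]
  have V01: "0 \<le> V p" "V p \<le> 1" "\<bar>V p\<bar> \<le> 1" for p by (auto simp: V_def indicator_def)
  have eq: "conv V ?k p = (\<integral>q. V (p - q) * ?k q \<partial>lborel)" for p by (rule conv_commute[OF Vm km])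
  have k0: "0 \<le> ?k q" for q by (rule scaled_kernel_nonneg[OF \<rho> \<epsilon>(1)])
  have int: "integrable lborel (\<lambda>q. V (p - q) * ?k q)" for p
  proof (rule Bochner_Integration.integrable_bound[OF ki])
    have "(\<lambda>q. V (p - q)) \<in> borel_measurable borel" by (rule measurable_compose[OF _ Vm]) simp
    then show "(\<lambda>q. V (p - q) * ?k q) \<in> borel_measurable lborel" using km by simp
    show "AE q in lborel. norm (V (p - q) * ?k q) \<le> norm (?k q)"
      unfolding norm_mult using V01(3) by (intro AE_I2 mult_left_le_one_le norm_ge_zero) (simp only: real_norm_def)
  qed
  show ?thesis
    unfolding is_bump_def
  proof (intro exI[of _ "conv V ?k"] conjI allI impI)
    show "strip_smooth n (conv V ?k)" for n
      by (rule strip_smooth_conv[OF Vm V01(3) kernel_scaled[OF \<rho> \<epsilon>(1,2)]])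
    show "conv V ?k (t, \<kappa>) = conv V ?k (0, \<kappa>)" for t \<kappa>
      unfolding eq by (intro Bochner_Integration.integral_cong) (auto simp: V_def indicator_def)
    show "0 \<le> conv V ?k p" for p
      unfolding eq by (intro integral_nonneg_AE AE_I2 mult_nonneg_nonneg V01 k0)
    show "conv V ?k p \<le> 1" for p
    proof -
      have "conv V ?k p \<le> (\<integral>q. ?k q \<partial>lborel)"
        unfolding eq by (rule integral_mono[OF int ki mult_left_le_one_le[OF k0 V01(1,2)]])
      then show ?thesis using integral_scaled_kernel[OF \<rho> \<epsilon>(1,2)] by simp
    qed
    show "conv V ?k (t, \<kappa>) = 1" if "norm \<kappa> \<le> r" for t \<kappa>
    proof -
      have "V ((t, \<kappa>) - q) * ?k q = ?k q" for q
      proof (cases "?k q = 0")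
        case False
        then have "norm (snd q) < r" using scaled_kernel_support(3)[OF \<rho> \<epsilon>(1)] \<epsilon>(3) by fastforce
        then have "norm (\<kappa> - snd q) < 2 * r" using that norm_triangle_ineq4[of \<kappa> "snd q"] by linarith
        then show ?thesis by (cases q) (simp add: V_def)
      qed simp
      then have "(\<lambda>q. V ((t, \<kappa>) - q) * ?k q) = ?k" by (rule ext)
      then show ?thesis unfolding eq using integral_scaled_kernel[OF \<rho> \<epsilon>(1,2)] by (simp only:)
    qed
    show "conv V ?k (t, \<kappa>) = 0" if "3 * r \<le> norm \<kappa>" for t \<kappa>
    proof -
      have "V ((t, \<kappa>) - q) * ?k q = 0" for q
      proof (cases "?k q = 0")
        case False
        then have "norm (snd q) < r" using scaled_kernel_support(3)[OF \<rho> \<epsilon>(1)] \<epsilon>(3) by fastforce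
        then have "\<not> norm (\<kappa> - snd q) < 2 * r" using that norm_triangle_ineq2[of \<kappa> "snd q"] by linarith
        then show ?thesis by (cases q) (simp add: V_def)
      qed simp
      then have "(\<lambda>q. V ((t, \<kappa>) - q) * ?k q) = (\<lambda>_. 0)" by (rule ext)
      then show ?thesis unfolding eq by (simp only: Bochner_Integration.integral_zero)
    qed
  qed
qed

section \<open>Calculus of the operator\<close>

lemma pd_time_invariant:
  assumes "\<And>t \<kappa>. \<beta> (t, \<kappa>) = \<beta> (0, \<kappa>)" "\<beta> differentiable (at (t, \<kappa>))"
  shows "pd (1, 0) \<beta> (t, \<kappa>) = 0"
proof -
  have d: "((\<lambda>s. (s, \<kappa>)) has_derivative (\<lambda>v. (v, 0))) (at t)"
    by (intro has_derivative_Pair has_derivative_const has_derivative_ident)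
  have "pd (1, 0) \<beta> (t, \<kappa>) = pd 1 (\<lambda>s. \<beta> (s, \<kappa>)) t"
    by (rule pd_compose(1)[OF d assms(2), symmetric])
  also have "(\<lambda>s. \<beta> (s, \<kappa>)) = (\<lambda>_. \<beta> (0, \<kappa>))" using assms(1) by auto
  also have "pd 1 (\<lambda>_. \<beta> (0, \<kappa>)) t = 0" by (rule pd_eqI) simp
  finally show ?thesis .
qed

lemma pd_cmult: "f differentiable (at p) \<Longrightarrow> pd b (\<lambda>p. c * f p) p = c * pd b f p"
  by (rule pd_eqI, intro has_derivative_mult_right has_derivative_pd)

lemma deriv_le_mono: "deriv_le B t P \<Longrightarrow> B \<le> C \<Longrightarrow> deriv_le C t P"
  unfolding deriv_le_def by (meson order_trans)

lemma deriv_le_cmult: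
  assumes "strip_smooth (Suc (Suc n)) P" "deriv_le B t P"
  shows "deriv_le (\<bar>c\<bar> * B) t (\<lambda>p. c * P p)"
proof -
  have 1: "pd b (\<lambda>p. c * P p) = (\<lambda>p. c * pd b P p)" for b
    by (rule ext, rule pd_cmult[OF strip_smoothD(2)[OF assms(1)]])
  have 2: "pd v (pd b (\<lambda>p. c * P p)) p = c * pd v (pd b P) p" if "b \<in> Basis" for v b p
    unfolding 1 by (rule pd_cmult[OF strip_smoothD(2)[OF strip_smoothD(3)[OF assms(1) that]]])
  show ?thesis
    unfolding deriv_le_def
  proof (intro allI ballI conjI)
    fix \<kappa> :: 'a and b c' :: 'a assume b: "b \<in> Basis"
    show "\<bar>pd (0, b) (\<lambda>p. c * P p) (t, \<kappa>)\<bar> \<le> \<bar>c\<bar> * B"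
      unfolding 1 abs_mult using assms(2) b unfolding deriv_le_def by (intro mult_left_mono) auto
    assume c': "c' \<in> Basis"
    show "\<bar>pd (0, c') (pd (0, b) (\<lambda>p. c * P p)) (t, \<kappa>)\<bar> \<le> \<bar>c\<bar> * B"
      unfolding 2[OF Pair0_Basis[OF b]] abs_mult
      using assms(2) b c' unfolding deriv_le_def by (intro mult_left_mono) auto
  qed
qed

lemma deriv_le_add:
  assumes "strip_smooth (Suc (Suc n)) P" "deriv_le B t P" "strip_smooth (Suc (Suc m)) Q" "deriv_le C t Q"
  shows "deriv_le (B + C) t (\<lambda>p. P p + Q p)"
proof -
  have 1: "pd b (\<lambda>p. P p + Q p) = (\<lambda>p. pd b P p + pd b Q p)" for b
    by (rule ext, rule pd_add[OF strip_smoothD(2)[OF assms(1)] strip_smoothD(2)[OF assms(3)]])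
  have 2: "pd v (pd b (\<lambda>p. P p + Q p)) p = pd v (pd b P) p + pd v (pd b Q) p" if "b \<in> Basis" for v b p
    unfolding 1 by (rule pd_add[OF strip_smoothD(2)[OF strip_smoothD(3)[OF assms(1) that]]
          strip_smoothD(2)[OF strip_smoothD(3)[OF assms(3) that]]])
  show ?thesis
    unfolding deriv_le_def
  proof (intro allI ballI conjI)
    fix \<kappa> :: 'a and b c' :: 'a assume b: "b \<in> Basis"
    show "\<bar>pd (0, b) (\<lambda>p. P p + Q p) (t, \<kappa>)\<bar> \<le> B + C"
      unfolding 1 using assms(2,4) b unfolding deriv_le_def
      by (intro order_trans[OF abs_triangle_ineq] add_mono) auto
    assume c': "c' \<in> Basis"
    show "\<bar>pd (0, c') (pd (0, b) (\<lambda>p. P p + Q p)) (t, \<kappa>)\<bar> \<le> B + C"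
      unfolding 2[OF Pair0_Basis[OF b]]
      using assms(2,4) b c' unfolding deriv_le_def by (intro order_trans[OF abs_triangle_ineq] add_mono) auto
  qed
qed

lemma pd_const: "pd b (\<lambda>_. c) = (\<lambda>_. 0)"
  by (rule ext, rule pd_eqI) simp

lemma deriv_le_const: "deriv_le 0 t (\<lambda>_. c)"
  by (simp add: deriv_le_def pd_const)

lemma deriv_le_translate:
  assumes "strip_smooth (Suc (Suc n)) P"
  shows "deriv_le B t (\<lambda>p. P (p + a)) \<longleftrightarrow> deriv_le B (t + fst a) P"
proof -
  have 1: "pd b (\<lambda>p. P (p + a)) = (\<lambda>p. pd b P (p + a))" for b
    by (rule ext, rule pd_translate(1)[OF strip_smoothD(2)[OF assms(1)]])
  have 2: "pd v (pd b (\<lambda>p. P (p + a))) p = pd v (pd b P) (p + a)" if "b \<in> Basis" for v b p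
    unfolding 1 by (rule pd_translate(1)[OF strip_smoothD(2)[OF strip_smoothD(3)[OF assms(1) that]]])
  have 3: "(t, \<kappa>) + a = (t + fst a, \<kappa> + snd a)" for \<kappa> by (cases a) simp
  have "(\<forall>\<kappa>. Q (\<kappa> + snd a)) \<longleftrightarrow> (\<forall>\<kappa>. Q \<kappa>)" for Q by (metis diff_add_cancel)
  then have 4: "(\<forall>\<kappa>. Q (\<kappa> + snd a)) = (\<forall>\<kappa>. Q \<kappa>)" for Q .
  have "deriv_le B t (\<lambda>p. P (p + a)) \<longleftrightarrow> (\<forall>\<kappa>. \<forall>b\<in>Basis. \<bar>pd (0, b) P (t + fst a, \<kappa> + snd a)\<bar> \<le> B \<and>
     (\<forall>c\<in>Basis. \<bar>pd (0, c) (pd (0, b) P) (t + fst a, \<kappa> + snd a)\<bar> \<le> B))"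
    unfolding deriv_le_def using 2[OF Pair0_Basis] by (simp add: 1 3)
  also have "\<dots> \<longleftrightarrow> deriv_le B (t + fst a) P"
    unfolding deriv_le_def by (rule 4)
  finally show ?thesis .
qed

lemma pide_translate:
  fixes P :: "real \<times> 'd::finite vec3 \<Rightarrow> real"
  assumes "strip_smooth (Suc (Suc n)) P"
  shows "pide \<Theta> (\<lambda>p. P (p + a)) p = pide \<Theta> P (p + a)"
proof -
  have 1: "pd b (\<lambda>p. P (p + a)) = (\<lambda>p. pd b P (p + a))" for b
    by (rule ext, rule pd_translate(1)[OF strip_smoothD(2)[OF assms(1)]])
  have 2: "pd v (\<lambda>p. pd b P (p + a)) p = pd v (pd b P) (p + a)" if "b \<in> Basis" for v b p
    by (rule pd_translate(1)[OF strip_smoothD(2)[OF strip_smoothD(3)[OF assms(1) that]]])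
  have "levy_op \<theta> (\<lambda>p. P (p + a)) p = levy_op \<theta> P (p + a)" for \<theta>
    by (cases \<theta>) (simp only: levy_op.simps 1 2[OF axis_slot_Basis] add.assoc add.commute[of a] add.left_commute[of a])
  then show ?thesis unfolding pide_def 1 by simp
qed

section \<open>Comparison with smooth functions\<close>

text \<open>The supremum of \<open>f\<close> need not be attained, as space is not compact. A bump of small height \<open>\<delta>\<close> around a point
  with value above \<open>M - \<delta>/2\<close> lifts that point above \<open>M + \<delta>/2\<close>, while \<open>f \<le> M\<close> away from the bump; so the
  maximum of the sum is attained near the bump. The bump is a translate of a fixed one, hence its derivatives are
  small with \<open>\<delta>\<close>, wherever the near-maximum lies.\<close>

lemma perturbed_maximum:
  fixes f \<rho> :: "real \<times> 'd::finite vec3 \<Rightarrow> real"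
  assumes \<rho>: "mollifier \<rho>"
    and cont: "continuous_on ({0..1} \<times> UNIV) f"
    and bdd: "\<And>t \<kappa>. t \<in> {0..1} \<Longrightarrow> f (t, \<kappa>) \<le> B"
    and pos: "t1 \<in> {0..1}" "0 < f (t1, \<kappa>1)" and e: "0 < e"
  shows "\<exists>R t0 \<kappa>0. strip_smooth 4 R \<and> t0 \<in> {0..1} \<and> 0 < f (t0, \<kappa>0) \<and>
    (\<forall>t\<in>{0..1}. \<forall>\<kappa>. f (t, \<kappa>) \<le> R (t, \<kappa>)) \<and> R (t0, \<kappa>0) = f (t0, \<kappa>0) \<and>
    deriv_le e t0 R \<and> pd (1, 0) R (t0, \<kappa>0) = 0"
proof -
  obtain \<beta> :: "real \<times> 'd vec3 \<Rightarrow> real" where b: "is_bump 1 \<beta>"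
    using bump_exists[OF \<rho> zero_less_one] by blast
  note \<beta> = is_bumpD[OF b]
  obtain A where A: "\<And>t. \<bar>t\<bar> \<le> 1 \<Longrightarrow> deriv_le A t \<beta>"
    using strip_smooth_deriv_le[OF \<beta>(1)] by blast
  have A0: "0 \<le> A" using deriv_le_nonneg[OF A[of 0]] by simp
  define M where "M = (SUP p\<in>{0..1} \<times> UNIV. f p)"
  have ba: "bdd_above (f ` ({0..1} \<times> UNIV))" using bdd by (intro bdd_aboveI2[of _ _ B]) auto
  have fM: "f (t, \<kappa>) \<le> M" if "t \<in> {0..1}" for t \<kappa>
    unfolding M_def by (rule cSUP_upper[OF _ ba]) (use that in simp)
  have M0: "0 < M" using fM[OF pos(1)] pos(2) by (rule less_le_trans[rotated])
  \<comment> \<open>\<open>\<delta> \<le> M\<close> keeps the touching value positive, the other bound makes the derivatives small.\<close>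
  define \<delta> where "\<delta> = min M (e / (A + 1))"
  have \<delta>: "0 < \<delta>" "\<delta> \<le> M" "\<delta> * A \<le> e"
  proof -
    show "0 < \<delta>" "\<delta> \<le> M" using M0 e A0 by (auto simp: \<delta>_def)
    have "\<delta> * A \<le> e / (A + 1) * (A + 1)" using A0 e by (intro mult_mono) (auto simp: \<delta>_def)
    then show "\<delta> * A \<le> e" using A0 by simp
  qed
  have "M - \<delta> / 2 < (SUP p\<in>{0..1} \<times> UNIV. f p)" using \<delta> by (simp add: M_def)
  then obtain p2 where p2: "p2 \<in> {0..1} \<times> UNIV" "M - \<delta> / 2 < f p2"
    using less_cSUP_iff[OF _ ba] by fastforce
  obtain t2 \<kappa>2 where p2e: "p2 = (t2, \<kappa>2)" by (cases p2)
  have t2: "t2 \<in> {0..1}" "M - \<delta> / 2 < f (t2, \<kappa>2)" using p2 p2e by auto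
  define X where "X p = \<beta> (p + (0, - \<kappa>2))" for p
  have Xs: "strip_smooth n X" for n unfolding X_def by (rule strip_smooth_translate[OF \<beta>(1)])
  have Xt: "X (t, \<kappa>) = X (0, \<kappa>)" for t \<kappa> using \<beta>(2)[of t "\<kappa> - \<kappa>2"] by (simp add: X_def)
  have X01: "0 \<le> X p" "X p \<le> 1" for p using \<beta>(3,4) by (simp_all add: X_def)
  have X1: "X (t2, \<kappa>2) = 1" using \<beta>(5)[of 0] by (simp add: X_def)
  have X0: "X (t, \<kappa>) = 0" if "\<kappa> \<notin> cball \<kappa>2 3" for t \<kappa>
    using \<beta>(6)[of "\<kappa> - \<kappa>2"] that by (simp add: X_def dist_norm norm_minus_commute)
  define g where "g p = f p + \<delta> * X p" for p
  have "continuous_on ({0..1} \<times> cball \<kappa>2 3) g"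
    unfolding g_def using strip_smooth_continuous[OF Xs]
    by (intro continuous_intros continuous_on_subset[OF cont]) auto
  then obtain p0 where p0: "p0 \<in> {0..1} \<times> cball \<kappa>2 3" "\<And>p. p \<in> {0..1} \<times> cball \<kappa>2 3 \<Longrightarrow> g p \<le> g p0"
    using continuous_attains_sup[of "{0..1} \<times> cball \<kappa>2 3" g] t2(1)
    by (metis compact_Icc compact_Times compact_cball empty_iff mem_Sigma_iff centre_in_cball zero_le_numeral)
  obtain t0 \<kappa>0 where p0e: "p0 = (t0, \<kappa>0)" by (cases p0)
  have t0: "t0 \<in> {0..1}" using p0 p0e by auto
  have "g (t2, \<kappa>2) \<le> g p0" using t2 by (intro p0) auto
  then have g0: "M + \<delta> / 2 < g p0" using t2 X1 by (simp add: g_def)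
  have gmax: "g (t, \<kappa>) \<le> g p0" if "t \<in> {0..1}" for t \<kappa>
  proof (cases "\<kappa> \<in> cball \<kappa>2 3")
    case True then show ?thesis using that by (intro p0) auto
  next
    case False
    then have "g (t, \<kappa>) = f (t, \<kappa>)" by (simp add: g_def X0)
    then show ?thesis using fM[OF that, of \<kappa>] g0 \<delta> by linarith
  qed
  define R where "R p = g p0 + (- \<delta>) * X p" for p
  have Rd: "R = (\<lambda>p. g p0 + (- \<delta>) * X p)" by (rule ext) (rule R_def)
  have "strip_smooth 4 R"
    unfolding Rd by (intro strip_smooth_add strip_smooth_const strip_smooth_cmult Xs)
  then have Rdiff: "R differentiable (at p)" for p
    by (rule strip_smoothD(2)[OF strip_smooth_le[of 4 R "Suc 0"]]) simp
  show ?thesis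
  proof (intro exI[of _ R] exI[of _ t0] exI[of _ \<kappa>0] conjI ballI allI)
    show "strip_smooth 4 R" by fact
    show "t0 \<in> {0..1}" by fact
    have "\<delta> * X p0 \<le> \<delta> * 1" using X01(2)[of p0] \<delta>(1) by (intro mult_left_mono) auto
    then have "0 < f p0" using g0 \<delta>(1,2) unfolding g_def by linarith
    then show "0 < f (t0, \<kappa>0)" by (simp add: p0e)
    show "f (t, \<kappa>) \<le> R (t, \<kappa>)" if "t \<in> {0..1}" for t \<kappa>
      using gmax[OF that, of \<kappa>] by (simp add: R_def g_def)
    show "R (t0, \<kappa>0) = f (t0, \<kappa>0)" by (simp add: R_def g_def p0e)
    have "deriv_le A t0 X"
      unfolding X_def using deriv_le_translate[OF \<beta>(1), of A t0 "(0, - \<kappa>2)"] A[of t0] t0 by simp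
    from deriv_le_cmult[OF Xs this, of "- \<delta>"]
    have "deriv_le (0 + \<bar>- \<delta>\<bar> * A) t0 R"
      unfolding Rd by (rule deriv_le_add[OF strip_smooth_const deriv_le_const strip_smooth_cmult[OF Xs]])
    then show "deriv_le e t0 R" by (rule deriv_le_mono) (use \<delta> in simp)
    have "R (t, \<kappa>) = R (0, \<kappa>)" for t \<kappa> using Xt by (simp add: R_def)
    then show "pd (1, 0) R (t0, \<kappa>0) = 0"
      by (rule pd_time_invariant) (rule Rdiff)
  qed
qed

lemma op_const_nonneg: "0 \<le> op_const TYPE('d::finite)"
  by (simp add: op_const_def)

lemma levy_bounded_nonneg: "levy_bounded \<Theta> C \<Longrightarrow> 0 \<le> C"
  unfolding levy_bounded_def by (force intro: order_trans[OF norm_ge_zero])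

lemma numeral_4_Suc: "(4::nat) = Suc (Suc 2)" by simp

text \<open>The sign \<open>\<sigma>\<close> covers touching from above and from below at once: if \<open>\<sigma> v\<close> exceeds \<open>\<sigma> P\<close> somewhere, then a small
  perturbation of \<open>P\<close>, shifted by a constant, touches \<open>v\<close> at a point where \<open>\<sigma> v\<close> still exceeds \<open>\<sigma> P\<close>.\<close>

lemma touching_perturbation:
  fixes P \<rho> :: "real \<times> 'd::finite vec3 \<Rightarrow> real"
  assumes \<rho>: "mollifier \<rho>" and \<Theta>: "levy_bounded \<Theta> C" and \<sigma>: "\<bar>\<sigma>\<bar> = 1"
    and cont: "cont_bdd_on {0..1} v" and P: "strip_smooth 4 P" and \<eta>: "0 < \<eta>"
    and pos: "t1 \<in> {0..1}" "0 < \<sigma> * (v t1 \<kappa>1 - P (t1, \<kappa>1))"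
  shows "\<exists>\<psi> t0 \<kappa>0. strip_smooth 4 \<psi> \<and> t0 \<in> {0..1} \<and> 0 < \<sigma> * (v t0 \<kappa>0 - P (t0, \<kappa>0)) \<and>
    (\<forall>t\<in>{0..1}. \<forall>\<kappa>. 0 \<le> \<sigma> * (\<psi> (t, \<kappa>) - v t \<kappa>)) \<and> \<psi> (t0, \<kappa>0) = v t0 \<kappa>0 \<and>
    \<bar>pide \<Theta> \<psi> (t0, \<kappa>0) - pide \<Theta> P (t0, \<kappa>0)\<bar> < \<eta>"
proof -
  let ?f = "\<lambda>p. \<sigma> * (v (fst p) (snd p) - P p)"
  let ?K = "op_const TYPE('d) * C"
  have K0: "0 \<le> ?K" by (rule mult_nonneg_nonneg[OF op_const_nonneg levy_bounded_nonneg[OF \<Theta>]])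
  have \<sigma>2: "\<sigma> * (\<sigma> * x) = x" for x
    using \<sigma> by (simp add: abs_if split: if_splits)
  have P2: "strip_smooth (Suc (Suc 2)) P" using P by (simp only: numeral_4_Suc)
  obtain Bv where Bv: "\<And>t \<kappa>. t \<in> {0..1} \<Longrightarrow> \<bar>v t \<kappa>\<bar> \<le> Bv"
    using cont unfolding cont_bdd_on_def bounded_iff by force
  obtain BP where BP: "\<And>t \<kappa>. \<bar>t\<bar> \<le> 1 \<Longrightarrow> \<bar>P (t, \<kappa>)\<bar> \<le> BP"
    using strip_boundedE[OF strip_smooth_bounded[OF P]] by blast
  have c: "continuous_on ({0..1} \<times> UNIV) ?f"
    using cont unfolding cont_bdd_on_def case_prod_beta
    by (intro continuous_on_mult_left continuous_on_diff strip_smooth_continuous[OF P2]) simp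
  have b: "?f (t, \<kappa>) \<le> Bv + BP" if "t \<in> {0..1}" for t \<kappa>
  proof -
    have "\<bar>\<sigma> * (v t \<kappa> - P (t, \<kappa>))\<bar> = \<bar>v t \<kappa> - P (t, \<kappa>)\<bar>" using \<sigma> by (simp add: abs_mult)
    moreover have "\<bar>P (t, \<kappa>)\<bar> \<le> BP" using BP[of t \<kappa>] that by simp
    ultimately have "\<sigma> * (v t \<kappa> - P (t, \<kappa>)) \<le> Bv + BP" using Bv[OF that, of \<kappa>] by linarith
    then show ?thesis by simp
  qed
  have e: "0 < \<eta> / (?K + 1)" using \<eta> K0 by simp
  have pos': "0 < ?f (t1, \<kappa>1)" using pos(2) by simp
  obtain R t0 \<kappa>0 where R: "strip_smooth 4 R" "t0 \<in> {0..1}" "0 < ?f (t0, \<kappa>0)"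
    "\<And>t \<kappa>. t \<in> {0..1} \<Longrightarrow> ?f (t, \<kappa>) \<le> R (t, \<kappa>)" "R (t0, \<kappa>0) = ?f (t0, \<kappa>0)"
    "deriv_le (\<eta> / (?K + 1)) t0 R" "pd (1, 0) R (t0, \<kappa>0) = 0"
    using perturbed_maximum[OF \<rho> c b pos(1) pos' e] by blast
  have R2: "strip_smooth (Suc (Suc 2)) R" using R(1) by (simp only: numeral_4_Suc)
  have S2: "strip_smooth (Suc (Suc 2)) (\<lambda>p. \<sigma> * R p)" by (rule strip_smooth_cmult[OF R2])
  have S6: "deriv_le (\<eta> / (?K + 1)) t0 (\<lambda>p. \<sigma> * R p)" using deriv_le_cmult[OF R2 R(6), of \<sigma>] \<sigma> by simp
  have S7: "pd (1, 0) (\<lambda>p. \<sigma> * R p) (t0, \<kappa>0) = 0"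
    using pd_cmult[OF strip_smoothD(2)[OF R2], of "(1, 0)" \<sigma>] R(7) by simp
  define \<psi> where "\<psi> p = P p + \<sigma> * R p" for p
  have "?K * (\<eta> / (?K + 1)) < \<eta>" using \<eta> K0 by (simp add: field_simps)
  then have "\<bar>pide \<Theta> \<psi> (t0, \<kappa>0) - pide \<Theta> P (t0, \<kappa>0)\<bar> < \<eta>"
    using pide_perturb[OF P2 S2 \<Theta> S6, of \<kappa>0] unfolding \<psi>_def S7 by simp
  moreover have "strip_smooth 4 \<psi>" unfolding \<psi>_def by (intro strip_smooth_add strip_smooth_cmult P R(1))
  moreover have "0 \<le> \<sigma> * (\<psi> (t, \<kappa>) - v t \<kappa>)" if "t \<in> {0..1}" for t \<kappa>
  proof -
    have "\<sigma> * (\<psi> (t, \<kappa>) - v t \<kappa>) = R (t, \<kappa>) - ?f (t, \<kappa>)" by (simp add: \<psi>_def algebra_simps \<sigma>2)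
    then show ?thesis using R(4)[OF that, of \<kappa>] by simp
  qed
  moreover have "\<psi> (t0, \<kappa>0) = v t0 \<kappa>0" by (simp add: \<psi>_def R(5) \<sigma>2)
  moreover have "0 < \<sigma> * (v t0 \<kappa>0 - P (t0, \<kappa>0))" using R(3) by simp
  ultimately show ?thesis using R(2) by blast
qed

text \<open>A violation would be touched by an admissible test function whose operator value is within \<open>\<eta>\<close> of that of \<open>P\<close>,
  at a time where the strict inequality for \<open>P\<close> holds; this contradicts the subsolution property. Letting every
  time satisfy one of two alternatives covers an initial layer in which no equation is available.\<close>

lemma comparison_subsolution:
  fixes P \<rho> :: "real \<times> 'd::finite vec3 \<Rightarrow> real"
  assumes \<rho>: "mollifier \<rho>" and \<Theta>: "levy_bounded \<Theta> C"
    and v: "viscosity_subsolution \<Theta> \<phi> v" and cont: "cont_bdd_on {0..1} v"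
    and P: "strip_smooth 4 P" and \<eta>: "0 < \<eta>"
    and dich: "\<And>t. t \<in> {0..1} \<Longrightarrow> (\<forall>\<kappa>. v t \<kappa> \<le> P (t, \<kappa>)) \<or> (0 < t \<and> (\<forall>\<kappa>. \<eta> \<le> pide \<Theta> P (t, \<kappa>)))"
    and t1: "t1 \<in> {0..1}"
  shows "v t1 \<kappa>1 \<le> P (t1, \<kappa>1)"
proof (rule ccontr)
  assume "\<not> v t1 \<kappa>1 \<le> P (t1, \<kappa>1)"
  then have pos: "0 < 1 * (v t1 \<kappa>1 - P (t1, \<kappa>1))" by simp
  have one: "\<bar>1::real\<bar> = 1" by simp
  obtain \<psi> t0 \<kappa>0 where \<psi>: "strip_smooth 4 \<psi>" "t0 \<in> {0..1}" "0 < 1 * (v t0 \<kappa>0 - P (t0, \<kappa>0))"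
    "\<And>t \<kappa>. t \<in> {0..1} \<Longrightarrow> 0 \<le> 1 * (\<psi> (t, \<kappa>) - v t \<kappa>)" "\<psi> (t0, \<kappa>0) = v t0 \<kappa>0"
    "\<bar>pide \<Theta> \<psi> (t0, \<kappa>0) - pide \<Theta> P (t0, \<kappa>0)\<bar> < \<eta>"
    using touching_perturbation[OF \<rho> \<Theta> one cont P \<eta> t1 pos] by blast
  have t0: "0 < t0" "\<eta> \<le> pide \<Theta> P (t0, \<kappa>0)"
    using dich[OF \<psi>(2)] \<psi>(3) by (auto simp: not_less[symmetric])
  obtain x y z where xyz: "\<kappa>0 = (x, y, z)" by (cases \<kappa>0)
  have "\<forall>s\<in>{0<..1}. \<forall>\<kappa>. v s \<kappa> \<le> \<psi> (s, \<kappa>)" using \<psi>(4) by simp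
  then have "pide_op \<Theta> (\<lambda>t \<kappa>. \<psi> (t, \<kappa>)) t0 x y z \<le> 0"
    using v strip_smooth_Cb_23[OF \<psi>(1)] t0(1) \<psi>(2,5) unfolding viscosity_subsolution_def xyz by auto
  then have "pide \<Theta> \<psi> (t0, \<kappa>0) \<le> 0"
    using pide_op_eq[OF \<psi>(1)[unfolded numeral_4_Suc], of t0 \<Theta> x y z] t0(1) \<psi>(2) unfolding xyz by simp
  then show False using t0(2) \<psi>(6) by linarith
qed

lemma comparison_supersolution:
  fixes P \<rho> :: "real \<times> 'd::finite vec3 \<Rightarrow> real"
  assumes \<rho>: "mollifier \<rho>" and \<Theta>: "levy_bounded \<Theta> C"
    and v: "viscosity_supersolution \<Theta> \<phi> v" and cont: "cont_bdd_on {0..1} v"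
    and P: "strip_smooth 4 P" and \<eta>: "0 < \<eta>"
    and dich: "\<And>t. t \<in> {0..1} \<Longrightarrow> (\<forall>\<kappa>. P (t, \<kappa>) \<le> v t \<kappa>) \<or> (0 < t \<and> (\<forall>\<kappa>. pide \<Theta> P (t, \<kappa>) \<le> - \<eta>))"
    and t1: "t1 \<in> {0..1}"
  shows "P (t1, \<kappa>1) \<le> v t1 \<kappa>1"
proof (rule ccontr)
  assume "\<not> P (t1, \<kappa>1) \<le> v t1 \<kappa>1"
  then have pos: "0 < -1 * (v t1 \<kappa>1 - P (t1, \<kappa>1))" by simp
  have one: "\<bar>-1::real\<bar> = 1" by simp
  obtain \<psi> t0 \<kappa>0 where \<psi>: "strip_smooth 4 \<psi>" "t0 \<in> {0..1}" "0 < -1 * (v t0 \<kappa>0 - P (t0, \<kappa>0))"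
    "\<And>t \<kappa>. t \<in> {0..1} \<Longrightarrow> 0 \<le> -1 * (\<psi> (t, \<kappa>) - v t \<kappa>)" "\<psi> (t0, \<kappa>0) = v t0 \<kappa>0"
    "\<bar>pide \<Theta> \<psi> (t0, \<kappa>0) - pide \<Theta> P (t0, \<kappa>0)\<bar> < \<eta>"
    using touching_perturbation[OF \<rho> \<Theta> one cont P \<eta> t1 pos] by blast
  have t0: "0 < t0" "pide \<Theta> P (t0, \<kappa>0) \<le> - \<eta>"
    using dich[OF \<psi>(2)] \<psi>(3) by (auto simp: not_less[symmetric])
  obtain x y z where xyz: "\<kappa>0 = (x, y, z)" by (cases \<kappa>0)
  have "\<forall>s\<in>{0<..1}. \<forall>\<kappa>. \<psi> (s, \<kappa>) \<le> v s \<kappa>" using \<psi>(4) by simp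
  then have "0 \<le> pide_op \<Theta> (\<lambda>t \<kappa>. \<psi> (t, \<kappa>)) t0 x y z"
    using v strip_smooth_Cb_23[OF \<psi>(1)] t0(1) \<psi>(2,5) unfolding viscosity_supersolution_def xyz by auto
  then have "0 \<le> pide \<Theta> \<psi> (t0, \<kappa>0)"
    using pide_op_eq[OF \<psi>(1)[unfolded numeral_4_Suc], of t0 \<Theta> x y z] t0(1) \<psi>(2) unfolding xyz by simp
  then show False using t0(2) \<psi>(6) by linarith
qed

section \<open>Smooth minorants and the generator\<close>

text \<open>The bound \<open>pide_perturb\<close> around the zero function turns into a bound on the operator itself.\<close>

lemma pide_zero:
  fixes \<Theta> :: "((real^'d::finite) measure \<times> (real^'d) \<times> (real^'d^'d)) set"
  assumes "levy_bounded \<Theta> C"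
  shows "pide \<Theta> (\<lambda>_. 0) p = 0"
proof -
  have "\<Theta> \<noteq> {}" using assms by (simp add: levy_bounded_def)
  moreover have "levy_op \<theta> (\<lambda>_. 0) p = 0" for \<theta> :: "(real^'d) measure \<times> (real^'d) \<times> (real^'d^'d)"
    by (cases \<theta>) (simp add: pd_const)
  ultimately show ?thesis by (simp add: pide_def pd_const)
qed

lemma pide_bounded:
  fixes P :: "real \<times> 'd::finite vec3 \<Rightarrow> real"
  assumes \<Theta>: "levy_bounded \<Theta> C" and P: "strip_smooth (Suc (Suc n)) P"
  obtains K where "\<And>t \<kappa>. \<bar>t\<bar> \<le> R \<Longrightarrow> \<bar>pide \<Theta> P (t, \<kappa>)\<bar> \<le> K"
proof -
  obtain B where B: "\<And>t. \<bar>t\<bar> \<le> R \<Longrightarrow> deriv_le B t P" using strip_smooth_deriv_le[OF P] by blast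
  have b: "(1::real, 0::'d vec3) \<in> Basis" by (simp add: Basis_Pair0)
  obtain A where A: "\<And>t \<kappa>. \<bar>t\<bar> \<le> R \<Longrightarrow> \<bar>pd (1, 0) P (t, \<kappa>)\<bar> \<le> A"
    using strip_boundedE[OF strip_smoothD(1)[OF strip_smoothD(3)[OF P b]]] by blast
  have "\<bar>pide \<Theta> P (t, \<kappa>)\<bar> \<le> A + op_const TYPE('d) * C * B" if "\<bar>t\<bar> \<le> R" for t \<kappa>
    using pide_perturb[OF strip_smooth_const[of _ 0] P \<Theta> B[OF that], of \<kappa>] A[OF that, of \<kappa>]
    unfolding pide_zero[OF \<Theta>] by simp
  then show thesis by (rule that)
qed

lemma strip_smooth_Lipschitz:
  fixes P :: "real \<times> 'a::euclidean_space \<Rightarrow> real"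
  assumes P: "strip_smooth (Suc n) P"
  obtains L where "0 \<le> L" "\<And>p q. \<bar>fst p\<bar> \<le> R \<Longrightarrow> \<bar>fst q\<bar> \<le> R \<Longrightarrow> \<bar>P p - P q\<bar> \<le> L * norm (p - q)"
proof -
  have "\<forall>b\<in>Basis. \<exists>B. \<forall>t \<kappa>. \<bar>t\<bar> \<le> R \<longrightarrow> \<bar>pd b P (t, \<kappa>)\<bar> \<le> B"
    using strip_boundedE[OF strip_smooth_bounded[OF strip_smoothD(3)[OF P]]] by metis
  then obtain B where B: "\<forall>b\<in>Basis. \<forall>t \<kappa>. \<bar>t\<bar> \<le> R \<longrightarrow> \<bar>pd b P (t, \<kappa>)\<bar> \<le> B b" by metis
  define M where "M = max 0 (Max (B ` Basis))"
  have M: "\<bar>pd b P p\<bar> \<le> M" if "b \<in> Basis" "p \<in> {-R..R} \<times> UNIV" for b p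
  proof -
    obtain t \<kappa> where p: "p = (t, \<kappa>)" by (cases p)
    have "\<bar>pd b P p\<bar> \<le> B b" using B that unfolding p by (auto simp: abs_le_iff)
    also have "\<dots> \<le> Max (B ` Basis)" using that by simp
    finally show ?thesis by (simp add: M_def)
  qed
  show thesis
  proof (rule that[of "real DIM(real \<times> 'a) * M"])
    show "0 \<le> real DIM(real \<times> 'a) * M" by (simp add: M_def)
    fix p q :: "real \<times> 'a" assume "\<bar>fst p\<bar> \<le> R" "\<bar>fst q\<bar> \<le> R"
    then have "p \<in> {-R..R} \<times> UNIV" "q \<in> {-R..R} \<times> UNIV" by (auto simp: mem_Times_iff abs_le_iff)
    then show "\<bar>P p - P q\<bar> \<le> real DIM(real \<times> 'a) * M * norm (p - q)"
      by (intro mean_value_pd[of "{-R..R} \<times> UNIV"] convex_Times strip_smoothD(2)[OF P] M) auto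
  qed
qed

text \<open>A shifted function differs from the original by an increment whose first two derivatives are small by the bounds
  on the third ones, and the operator commutes with shifts; so \<open>pide_perturb\<close> applies.\<close>

lemma pide_Lipschitz:
  fixes P :: "real \<times> 'd::finite vec3 \<Rightarrow> real"
  assumes \<Theta>: "levy_bounded \<Theta> C" and P: "strip_smooth 4 P"
  obtains L where "0 \<le> L"
    "\<And>p q. \<bar>fst p\<bar> \<le> R \<Longrightarrow> \<bar>fst q\<bar> \<le> R \<Longrightarrow> \<bar>pide \<Theta> P p - pide \<Theta> P q\<bar> \<le> L * norm (p - q)"
proof -
  have P': "strip_smooth (Suc (Suc (Suc 1))) P" using P by (simp add: eval_nat_numeral del: strip_smooth.simps)
  define \<Lambda> where "\<Lambda> Q = (SOME L. 0 \<le> L \<and> (\<forall>p q. \<bar>fst p\<bar> \<le> R \<longrightarrow> \<bar>fst q\<bar> \<le> R \<longrightarrow>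
      \<bar>Q p - Q q\<bar> \<le> L * norm (p - q)))" for Q :: "real \<times> 'd vec3 \<Rightarrow> real"
  have \<Lambda>: "0 \<le> \<Lambda> Q" "\<And>p q. \<bar>fst p\<bar> \<le> R \<Longrightarrow> \<bar>fst q\<bar> \<le> R \<Longrightarrow> \<bar>Q p - Q q\<bar> \<le> \<Lambda> Q * norm (p - q)"
    if "strip_smooth (Suc 0) Q" for Q :: "real \<times> 'd vec3 \<Rightarrow> real"
  proof -
    have "\<exists>L. 0 \<le> L \<and> (\<forall>p q. \<bar>fst p\<bar> \<le> R \<longrightarrow> \<bar>fst q\<bar> \<le> R \<longrightarrow> \<bar>Q p - Q q\<bar> \<le> L * norm (p - q))"
      by (rule strip_smooth_Lipschitz[OF that, of R]) blast
    from someI_ex[OF this] show "0 \<le> \<Lambda> Q"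
      "\<And>p q. \<bar>fst p\<bar> \<le> R \<Longrightarrow> \<bar>fst q\<bar> \<le> R \<Longrightarrow> \<bar>Q p - Q q\<bar> \<le> \<Lambda> Q * norm (p - q)"
      unfolding \<Lambda>_def by blast+
  qed
  let ?B = "Basis :: (real \<times> 'd vec3) set"
  have s1: "strip_smooth (Suc 0) (pd b P)" if "b \<in> ?B" for b
    by (rule strip_smooth_le[OF strip_smoothD(3)[OF P' that]]) simp
  have s2: "strip_smooth (Suc 0) (pd c (pd b P))" if "b \<in> ?B" "c \<in> ?B" for b c
    by (rule strip_smooth_le[OF strip_smoothD(3)[OF strip_smoothD(3)[OF P' that(1)] that(2)]]) simp
  define L where "L = (\<Sum>b\<in>?B. \<Lambda> (pd b P)) + (\<Sum>b\<in>?B. \<Sum>c\<in>?B. \<Lambda> (pd c (pd b P)))"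
  have n1: "0 \<le> (\<Sum>b\<in>?B. \<Lambda> (pd b P))" by (intro sum_nonneg \<Lambda>(1) s1)
  have n2: "0 \<le> (\<Sum>b\<in>?B. \<Sum>c\<in>?B. \<Lambda> (pd c (pd b P)))" by (intro sum_nonneg \<Lambda>(1) s2)
  have L0: "0 \<le> L" unfolding L_def using n1 n2 by simp
  have L1: "\<Lambda> (pd b P) \<le> L" if "b \<in> ?B" for b
  proof -
    have "\<Lambda> (pd b P) \<le> (\<Sum>b\<in>?B. \<Lambda> (pd b P))"
      using that by (intro member_le_sum[of b ?B "\<lambda>b. \<Lambda> (pd b P)"] \<Lambda>(1) s1) auto
    then show ?thesis unfolding L_def using n2 by linarith
  qed
  have L2: "\<Lambda> (pd c (pd b P)) \<le> L" if "b \<in> ?B" "c \<in> ?B" for b c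
  proof -
    have "\<Lambda> (pd c (pd b P)) \<le> (\<Sum>c\<in>?B. \<Lambda> (pd c (pd b P)))"
      using that by (intro member_le_sum[of c ?B "\<lambda>c. \<Lambda> (pd c (pd b P))"] \<Lambda>(1) s2) auto
    also have "\<dots> \<le> (\<Sum>b\<in>?B. \<Sum>c\<in>?B. \<Lambda> (pd c (pd b P)))"
      using that by (intro member_le_sum[of b ?B "\<lambda>b. \<Sum>c\<in>?B. \<Lambda> (pd c (pd b P))"] sum_nonneg \<Lambda>(1) s2) auto
    finally show ?thesis unfolding L_def using n1 by linarith
  qed
  show thesis
  proof (rule that[of "L + op_const TYPE('d) * C * L"])
    show "0 \<le> L + op_const TYPE('d) * C * L"
      by (intro add_nonneg_nonneg mult_nonneg_nonneg L0 op_const_nonneg levy_bounded_nonneg[OF \<Theta>])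
    fix p q :: "real \<times> 'd vec3" assume R: "\<bar>fst p\<bar> \<le> R" "\<bar>fst q\<bar> \<le> R"
    define a where "a = p - q"
    obtain t \<kappa> where q: "q = (t, \<kappa>)" by (cases q)
    define D where "D r = P (r + a) + -1 * P r" for r
    have Pa: "strip_smooth (Suc (Suc (Suc 1))) (\<lambda>r. P (r + a))" by (rule strip_smooth_translate[OF P'])
    have D: "strip_smooth (Suc (Suc (Suc 1))) D"
      unfolding D_def by (intro strip_smooth_add strip_smooth_cmult Pa P')
    have pdD: "pd b D = (\<lambda>r. pd b P (r + a) - pd b P r)" for b
    proof
      fix r
      have "pd b D r = pd b (\<lambda>r. P (r + a)) r + pd b (\<lambda>r. -1 * P r) r"
        unfolding D_def by (rule pd_add[OF strip_smoothD(2)[OF Pa] strip_smoothD(2)[OF strip_smooth_cmult[OF P']]])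
      also have "pd b (\<lambda>r. P (r + a)) r = pd b P (r + a)"
        by (rule pd_translate(1)[OF strip_smoothD(2)[OF P']])
      also have "pd b (\<lambda>r. -1 * P r) r = -1 * pd b P r"
        by (rule pd_cmult[OF strip_smoothD(2)[OF P']])
      finally show "pd b D r = pd b P (r + a) - pd b P r" by simp
    qed
    have pdD2: "pd c (pd b D) r = pd c (pd b P) (r + a) - pd c (pd b P) r" if "b \<in> ?B" for b c r
    proof -
      note d = strip_smoothD(2)[OF s1[OF that]]
      have "((\<lambda>r. pd b P (r + a) - pd b P r) has_derivative (\<lambda>v. pd v (\<lambda>r. pd b P (r + a)) r - pd v (pd b P) r)) (at r)"
        by (intro has_derivative_diff has_derivative_pd d pd_translate(2))
      from pd_eqI[OF this, of c] show ?thesis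
        unfolding pdD pd_translate(1)[OF d] .
    qed
    have fp: "\<bar>fst ((t, \<kappa>') + a)\<bar> \<le> R" "\<bar>fst (t, \<kappa>')\<bar> \<le> R" for \<kappa>'
      using R by (simp_all add: a_def q)
    have le: "\<bar>Q ((t, \<kappa>') + a) - Q (t, \<kappa>')\<bar> \<le> L * norm a" if "strip_smooth (Suc 0) Q" "\<Lambda> Q \<le> L" for Q \<kappa>'
    proof -
      have "\<bar>Q ((t, \<kappa>') + a) - Q (t, \<kappa>')\<bar> \<le> \<Lambda> Q * norm ((t, \<kappa>') + a - (t, \<kappa>'))"
        by (rule \<Lambda>(2)[OF that(1) fp])
      also have "\<dots> \<le> L * norm a" unfolding add_diff_cancel_left' using that(2) by (intro mult_right_mono) auto
      finally show ?thesis .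
    qed
    have dl: "deriv_le (L * norm a) t D"
      unfolding deriv_le_def pdD2[OF Pair0_Basis] using pdD2[OF Pair0_Basis]
      by (auto simp: pdD pdD2[OF Pair0_Basis] intro!: le s1 s2 L1 L2 Pair0_Basis)
    have b: "(1::real, 0::'d vec3) \<in> Basis" by (simp add: Basis_Pair0)
    have "\<bar>pide \<Theta> (\<lambda>r. P r + D r) (t, \<kappa>) - pide \<Theta> P (t, \<kappa>) - pd (1, 0) D (t, \<kappa>)\<bar>
      \<le> op_const TYPE('d) * C * (L * norm a)"
      by (rule pide_perturb[OF P' D \<Theta> dl])
    moreover have "(\<lambda>r. P r + D r) = (\<lambda>r. P (r + a))" by (simp add: D_def)
    moreover have "pide \<Theta> (\<lambda>r. P (r + a)) (t, \<kappa>) = pide \<Theta> P p"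
      unfolding pide_translate[OF P'] by (simp add: a_def q[symmetric])
    moreover have "\<bar>pd (1, 0) D (t, \<kappa>)\<bar> \<le> L * norm a"
      unfolding pdD by (rule le[OF s1[OF b] L1[OF b]])
    ultimately show "\<bar>pide \<Theta> P p - pide \<Theta> P q\<bar> \<le> (L + op_const TYPE('d) * C * L) * norm (p - q)"
      unfolding a_def[symmetric] q[symmetric] by (simp add: algebra_simps abs_le_iff)
  qed
qed

text \<open>The viscosity property is turned into a differential inequality at time 0. If the smooth \<open>P\<close> violated it at
  \<open>(t1, \<kappa>1)\<close> by \<open>3\<eta>\<close>, then \<open>\<psi>(s, \<kappa>) = P(t1 + s, \<kappa>) + \<eta> s - M X(\<kappa>) s - N s\<^sup>2\<close>, with \<open>X\<close> a function that vanishes near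
  \<open>\<kappa>1\<close> and equals 1 away from it, would be a strict subsolution for suitable constants: near \<open>(0, \<kappa>1)\<close> by
  continuity of the operator, far away in space because of \<open>M\<close> and far away in time because of \<open>N\<close>. Comparison then
  gives \<open>\<psi> \<le> v\<close>, and \<open>v \<le> P(t1 + s, \<kappa>1)\<close> at \<open>\<kappa>1\<close> is contradicted for small \<open>s\<close>, where \<open>\<eta> s > N s\<^sup>2\<close>.\<close>

lemma smooth_majorant_supersolution:
  fixes P \<rho> :: "real \<times> 'd::finite vec3 \<Rightarrow> real"
  assumes \<rho>: "mollifier \<rho>" and \<Theta>: "levy_bounded \<Theta> C"
    and v: "viscosity_supersolution \<Theta> \<phi> v" and cont: "cont_bdd_on {0..1} v"
    and P: "strip_smooth 4 P"
    and init: "\<And>\<kappa>. P (t1, \<kappa>) \<le> v 0 \<kappa>"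
    and s0: "0 < s0" and maj: "\<And>s. 0 \<le> s \<Longrightarrow> s \<le> s0 \<Longrightarrow> v s \<kappa>1 \<le> P (t1 + s, \<kappa>1)"
  shows "0 \<le> pide \<Theta> P (t1, \<kappa>1)"
proof (rule ccontr)
  assume neg: "\<not> 0 \<le> pide \<Theta> P (t1, \<kappa>1)"
  define \<eta> where "\<eta> = - pide \<Theta> P (t1, \<kappa>1) / 3"
  have \<eta>: "0 < \<eta>" using neg by (simp add: \<eta>_def)
  define W where "W p = P (p + (t1, 0))" for p
  have W: "strip_smooth 4 W" unfolding W_def by (rule strip_smooth_translate[OF P])
  have W2: "strip_smooth (Suc (Suc 2)) W" using W by (simp only: numeral_4_Suc)
  have P2: "strip_smooth (Suc (Suc 2)) P" using P by (simp only: numeral_4_Suc)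
  have W0: "pide \<Theta> W (0, \<kappa>1) = - 3 * \<eta>"
    unfolding W_def pide_translate[OF P2] by (simp add: \<eta>_def)
  obtain L where L: "0 \<le> L"
    "\<And>p q. \<bar>fst p\<bar> \<le> 1 \<Longrightarrow> \<bar>fst q\<bar> \<le> 1 \<Longrightarrow> \<bar>pide \<Theta> W p - pide \<Theta> W q\<bar> \<le> L * norm (p - q)"
    using pide_Lipschitz[OF \<Theta> W] by blast
  obtain K where K: "\<And>t \<kappa>. \<bar>t\<bar> \<le> 1 \<Longrightarrow> \<bar>pide \<Theta> W (t, \<kappa>)\<bar> \<le> K" using pide_bounded[OF \<Theta> W2] by blast
  have K0: "0 \<le> K" using order_trans[OF abs_ge_zero K[of 0 0]] by simp
  \<comment> \<open>Points with \<open>s < r\<close> outside the region where \<open>X\<close> equals 1 have distance at most \<open>4 r\<close> from \<open>(0, \<kappa>1)\<close>.\<close>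
  define r where "r = \<eta> / (4 * (L + 1))"
  have r: "0 < r" using \<eta> L by (simp add: r_def)
  have Lr: "L * (4 * r) \<le> \<eta>"
  proof -
    have "L * (4 * r) = \<eta> * (L / (L + 1))" using L(1) by (simp add: r_def field_simps)
    also have "\<dots> \<le> \<eta> * 1" using \<eta> L(1) by (intro mult_left_mono) auto
    finally show ?thesis by simp
  qed
  obtain \<beta> :: "real \<times> 'd vec3 \<Rightarrow> real" where b: "is_bump r \<beta>"
    using bump_exists[OF \<rho> r] by blast
  note \<beta> = is_bumpD[OF b]
  define X where "X p = 1 + -1 * \<beta> (p + (0, - \<kappa>1))" for p
  have Xs: "strip_smooth n X" for n
    unfolding X_def by (intro strip_smooth_add strip_smooth_const strip_smooth_cmult strip_smooth_translate \<beta>(1))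
  have Xt: "X (t, \<kappa>) = X (0, \<kappa>)" for t \<kappa> using \<beta>(2)[of t "\<kappa> - \<kappa>1"] by (simp add: X_def)
  have X0: "0 \<le> X p" for p using \<beta>(4) by (simp add: X_def)
  have X1: "X (t, \<kappa>1) = 0" for t using \<beta>(5)[of 0 t] r by (simp add: X_def)
  have Xfar: "X (t, \<kappa>) = 1" if "3 * r \<le> norm (\<kappa> - \<kappa>1)" for t \<kappa> using \<beta>(6)[OF that] by (simp add: X_def)
  obtain A where A: "\<And>t. \<bar>t\<bar> \<le> 1 \<Longrightarrow> deriv_le A t X" using strip_smooth_deriv_le[OF Xs] by blast
  have A0: "0 \<le> A" using deriv_le_nonneg[OF A[of 0]] by simp
  let ?K = "op_const TYPE('d) * C"
  have OC: "0 \<le> ?K" by (rule mult_nonneg_nonneg[OF op_const_nonneg levy_bounded_nonneg[OF \<Theta>]])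
  define M where "M = K + 2 * \<eta>"
  define N where "N = ?K * (M * A) + (K + 2 * \<eta>) / r + 1"
  have M0: "0 \<le> M" using K0 \<eta> by (simp add: M_def)
  have N: "?K * (M * A) \<le> N" "K + 2 * \<eta> \<le> N * r" "0 < N"
  proof -
    have 1: "0 \<le> ?K * (M * A)" using OC M0 A0 by simp
    have 2: "0 \<le> (K + 2 * \<eta>) / r" using K0 \<eta> r by simp
    show "?K * (M * A) \<le> N" "0 < N" using 1 2 by (simp_all add: N_def)
    have "(K + 2 * \<eta>) / r * r \<le> N * r" using 1 r by (intro mult_right_mono) (simp_all add: N_def)
    then show "K + 2 * \<eta> \<le> N * r" using r by simp
  qed
  define T where "T p = \<eta> * fst p + (- N) * (fst p * fst p)" for p :: "real \<times> 'd vec3"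
  define Y where "Y p = (- M) * (X p * fst p)" for p
  define R where "R p = T p + Y p" for p
  have Ts: "strip_smooth n T" for n
    unfolding T_def by (intro strip_smooth_add strip_smooth_cmult strip_smooth_mult strip_smooth_fst)
  have Ys: "strip_smooth n Y" for n
    unfolding Y_def by (intro strip_smooth_cmult strip_smooth_mult strip_smooth_fst Xs)
  have Rs: "strip_smooth n R" for n unfolding R_def by (intro strip_smooth_add Ts Ys)
  note Xd = strip_smoothD(2)[OF Xs[of "Suc 0"]]
  have fd: "(fst :: real \<times> 'd vec3 \<Rightarrow> real) differentiable (at p)" for p
    by (rule strip_smoothD(2)[OF strip_smooth_fst[of "Suc 0"]])
  have pdT: "pd b T p = fst b * (\<eta> - 2 * N * fst p)" for b p
    by (rule pd_eqI) (auto simp: T_def algebra_simps intro!: derivative_eq_intros)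
  have fm: "(\<lambda>p::real \<times> 'd vec3. X p * fst p) differentiable (at p)" for p
    by (rule differentiable_mult[OF Xd fd])
  have pdY: "pd b Y p = - M * (X p * fst b + pd b X p * fst p)" for b p
  proof -
    have "pd b Y p = (- M) * pd b (\<lambda>p. X p * fst p) p" unfolding Y_def by (rule pd_cmult[OF fm])
    then show ?thesis using pd_mult[OF Xd fd, of b p] by (simp add: pd_fst)
  qed
  have pdYs: "pd (0, b) Y = (\<lambda>p. (- M) * (pd (0, b) X p * fst p))" for b
    by (rule ext) (simp add: pdY)
  have pdYs2: "pd (0, c) (pd (0, b) Y) p = (- M) * (pd (0, c) (pd (0, b) X) p * fst p)" if "b \<in> Basis" for b c p
  proof -
    have d: "pd (0, b) X differentiable (at p)"
      by (rule strip_smoothD(2)[OF strip_smoothD(3)[OF Xs[of "Suc (Suc 0)"] Pair0_Basis[OF that]]])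
    have "pd (0, c) (pd (0, b) Y) p = (- M) * pd (0, c) (\<lambda>p. pd (0, b) X p * fst p) p"
      unfolding pdYs by (rule pd_cmult) (rule differentiable_mult[OF d fd])
    then show ?thesis using pd_mult[OF d fd, of "(0, c)"] by (simp add: pd_fst)
  qed
  have dT: "deriv_le 0 s T" for s
  proof -
    have "pd (0, b) T = (\<lambda>_. 0)" for b by (rule ext) (simp add: pdT)
    then show ?thesis by (simp add: deriv_le_def pd_const)
  qed
  have dY: "deriv_le (M * A * s) s Y" if "0 \<le> s" "s \<le> 1" for s
  proof -
    have le: "\<bar>(- M) * (x * s)\<bar> \<le> M * A * s" if "\<bar>x\<bar> \<le> A" for x
    proof -
      have "\<bar>(- M) * (x * s)\<bar> = M * \<bar>x\<bar> * s" using M0 \<open>0 \<le> s\<close> by (simp add: abs_mult)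
      also have "\<dots> \<le> M * A * s" using that M0 \<open>0 \<le> s\<close> by (intro mult_right_mono mult_left_mono)
      finally show ?thesis .
    qed
    show ?thesis
      unfolding deriv_le_def
    proof (intro allI ballI conjI)
      fix \<kappa> and b c :: "'d vec3" assume b: "b \<in> Basis"
      have "\<bar>pd (0, b) X (s, \<kappa>)\<bar> \<le> A" using A[of s] that b unfolding deriv_le_def by simp
      then show "\<bar>pd (0, b) Y (s, \<kappa>)\<bar> \<le> M * A * s" unfolding pdYs using le by simp
      assume c: "c \<in> Basis"
      have "\<bar>pd (0, c) (pd (0, b) X) (s, \<kappa>)\<bar> \<le> A" using A[of s] that b c unfolding deriv_le_def by simp
      then show "\<bar>pd (0, c) (pd (0, b) Y) (s, \<kappa>)\<bar> \<le> M * A * s" unfolding pdYs2[OF b] using le by simp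
    qed
  qed
  define \<psi> where "\<psi> p = W p + R p" for p
  have \<psi>: "strip_smooth 4 \<psi>" unfolding \<psi>_def by (rule strip_smooth_add[OF W Rs])
  have pide\<psi>: "pide \<Theta> \<psi> (s, \<kappa>) \<le> pide \<Theta> W (s, \<kappa>) + \<eta> - N * s - M * X (s, \<kappa>)"
    if s: "0 \<le> s" "s \<le> 1" for s \<kappa>
  proof -
    have dR: "deriv_le (0 + M * A * s) s R"
      unfolding R_def by (rule deriv_le_add[OF Ts[of "Suc (Suc 0)"] dT Ys[of "Suc (Suc 0)"] dY[OF s]])
    have "pd (1, 0) R (s, \<kappa>) = pd (1, 0) T (s, \<kappa>) + pd (1, 0) Y (s, \<kappa>)"
      unfolding R_def by (rule pd_add[OF strip_smoothD(2)[OF Ts[of "Suc 0"]] strip_smoothD(2)[OF Ys[of "Suc 0"]]])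
    also have "\<dots> = \<eta> - 2 * N * s - M * X (s, \<kappa>)"
      by (simp add: pdT pdY pd_time_invariant[OF Xt Xd])
    finally have "pide \<Theta> \<psi> (s, \<kappa>) \<le> pide \<Theta> W (s, \<kappa>) + (\<eta> - 2 * N * s - M * X (s, \<kappa>)) + ?K * (M * A * s)"
      using pide_perturb[OF W2 Rs \<Theta> dR, of \<kappa>] unfolding \<psi>_def by (simp add: abs_le_iff)
    moreover have "?K * (M * A * s) \<le> N * s" using mult_right_mono[OF N(1) s(1)] by (simp add: mult_ac)
    ultimately show ?thesis by (simp add: algebra_simps)
  qed
  have strict: "pide \<Theta> \<psi> (s, \<kappa>) \<le> - \<eta>" if s: "0 \<le> s" "s \<le> 1" for s \<kappa>
  proof -
    note p = pide\<psi>[OF s, of \<kappa>]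
    have Kw: "pide \<Theta> W (s, \<kappa>) \<le> K" using K[of s \<kappa>] s by (simp add: abs_le_iff)
    have MX: "0 \<le> M * X (s, \<kappa>)" using M0 X0 by simp
    have Ns: "0 \<le> N * s" using N s by simp
    consider "3 * r \<le> norm (\<kappa> - \<kappa>1)" | "r \<le> s" | "norm (\<kappa> - \<kappa>1) < 3 * r" "s < r" by linarith
    then show ?thesis
    proof cases
      case 1
      then have "M * X (s, \<kappa>) = K + 2 * \<eta>" by (simp add: Xfar M_def)
      then show ?thesis using p Kw Ns by linarith
    next
      case 2
      then have "N * r \<le> N * s" using N by simp
      then show ?thesis using p Kw MX N(2) by linarith
    next
      case 3
      have "norm ((s, \<kappa>) - (0, \<kappa>1)) \<le> \<bar>s\<bar> + norm (\<kappa> - \<kappa>1)"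
        using norm_Pair_le[of s "\<kappa> - \<kappa>1"] by simp
      also have "\<dots> \<le> 4 * r" using 3 s by simp
      finally have "L * norm ((s, \<kappa>) - (0, \<kappa>1)) \<le> L * (4 * r)" using L(1) by (rule mult_left_mono)
      then have "\<bar>pide \<Theta> W (s, \<kappa>) - pide \<Theta> W (0, \<kappa>1)\<bar> \<le> \<eta>"
        using L(2)[of "(s, \<kappa>)" "(0, \<kappa>1)"] s Lr by simp
      then show ?thesis using p MX Ns W0 by (simp add: abs_le_iff)
    qed
  qed
  have below: "\<psi> (s, \<kappa>1) \<le> v s \<kappa>1" if "s \<in> {0..1}" for s
  proof (rule comparison_supersolution[OF \<rho> \<Theta> v cont \<psi> \<eta> _ that])
    fix t :: real assume t: "t \<in> {0..1}"
    have "\<psi> (0, \<kappa>) = P (t1, \<kappa>)" for \<kappa> by (simp add: \<psi>_def W_def R_def T_def Y_def)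
    then show "(\<forall>\<kappa>. \<psi> (t, \<kappa>) \<le> v t \<kappa>) \<or> (0 < t \<and> (\<forall>\<kappa>. pide \<Theta> \<psi> (t, \<kappa>) \<le> - \<eta>))"
      using t strict[of t] init by (cases "t = 0") auto
  qed
  define s where "s = min 1 (min s0 (\<eta> / (2 * N)))"
  have s: "0 < s" "s \<le> 1" "s \<le> s0" "s \<le> \<eta> / (2 * N)" using s0 \<eta> N(3) by (auto simp: s_def)
  have "\<psi> (s, \<kappa>1) \<le> v s \<kappa>1" using below[of s] s by simp
  also have "\<dots> \<le> P (t1 + s, \<kappa>1)" using maj[of s] s by simp
  finally have "\<eta> * s \<le> N * (s * s)"
    by (simp add: \<psi>_def W_def R_def T_def Y_def X1 add.commute)
  then have "\<eta> * s \<le> (N * s) * s" by (simp add: mult_ac)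
  then have "\<eta> \<le> N * s" using s(1) by (rule mult_right_le_imp_le)
  also have "\<dots> \<le> N * (\<eta> / (2 * N))" using s N by (intro mult_left_mono) auto
  also have "\<dots> = \<eta> / 2" using N by simp
  finally show False using \<eta> by simp
qed

section \<open>Sublinear expectations of Lipschitz functions\<close>

lemma Cb_LipE:
  assumes "f \<in> Cb_Lip"
  obtains B C where "0 \<le> B" "0 \<le> C" "\<And>x. \<bar>f x\<bar> \<le> B" "\<And>x y. \<bar>f x - f y\<bar> \<le> C * norm (x - y)"
proof -
  obtain B where B: "\<And>x. \<bar>f x\<bar> \<le> B" using assms by (auto simp: Cb_Lip_def bounded_iff)
  obtain C where C: "C-lipschitz_on UNIV f" using assms by (auto simp: Cb_Lip_def)
  show thesis
  proof (rule that)
    show "0 \<le> B" using B[of undefined] by linarith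
    show "0 \<le> C" using C by (rule lipschitz_on_nonneg)
    show "\<bar>f x - f y\<bar> \<le> C * norm (x - y)" for x y
      using lipschitz_onD[OF C, of x y] by (simp add: dist_norm)
  qed (rule B)
qed

lemma Cb_LipI:
  fixes f :: "'a::real_normed_vector \<Rightarrow> real"
  assumes "\<And>x. \<bar>f x\<bar> \<le> B" "\<And>x y. \<bar>f x - f y\<bar> \<le> C * norm (x - y)"
  shows "f \<in> Cb_Lip"
proof -
  have "\<bar>f x - f y\<bar> \<le> \<bar>C\<bar> * norm (x - y)" for x y
    by (rule order_trans[OF assms(2)]) (intro mult_right_mono, auto)
  then have "\<bar>C\<bar>-lipschitz_on UNIV f" by (intro lipschitz_onI) (auto simp: dist_norm)
  moreover have "bounded (range f)" using assms(1) by (auto simp: bounded_iff)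
  ultimately show ?thesis by (auto simp: Cb_Lip_def)
qed

context sublinear_expectation
begin

lemma const_mem: "(\<lambda>_. c) \<in> H"
  using lipschitz_mem[of 0 "\<lambda>_ _. 0" "\<lambda>_. c" 0] by simp

lemma Lipschitz_mem:
  fixes f :: "'a::euclidean_space \<Rightarrow> real"
  assumes D: "random_vector H D" and f: "\<And>x y. \<bar>f x - f y\<bar> \<le> C * norm (x - y)"
  shows "(\<lambda>\<omega>. f (D \<omega>)) \<in> H"
proof -
  obtain e where e: "bij_betw e {0..<card (Basis :: 'a set)} (Basis :: 'a set)"
    using ex_bij_betw_nat_finite[OF finite_Basis] by blast
  let ?n = "DIM('a)"
  define F where "F v = f (\<Sum>j<?n. v j *\<^sub>R e j)" for v :: "nat \<Rightarrow> real"
  have eB: "e j \<in> Basis" if "j < ?n" for j using bij_betwE[OF e] that by simp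
  have "(\<lambda>\<omega>. F (\<lambda>j. D \<omega> \<bullet> e j)) \<in> H"
  proof (rule lipschitz_mem[of ?n "\<lambda>j \<omega>. D \<omega> \<bullet> e j" F "\<bar>C\<bar>"])
    show "(\<lambda>\<omega>. D \<omega> \<bullet> e j) \<in> H" if "j < ?n" for j using D eB[OF that] by (simp add: random_vector_def)
    fix v w :: "nat \<Rightarrow> real"
    have "\<bar>F v - F w\<bar> \<le> C * norm ((\<Sum>j<?n. v j *\<^sub>R e j) - (\<Sum>j<?n. w j *\<^sub>R e j))"
      unfolding F_def by (rule f)
    also have "\<dots> \<le> \<bar>C\<bar> * norm ((\<Sum>j<?n. v j *\<^sub>R e j) - (\<Sum>j<?n. w j *\<^sub>R e j))"
      by (intro mult_right_mono) auto
    also have "(\<Sum>j<?n. v j *\<^sub>R e j) - (\<Sum>j<?n. w j *\<^sub>R e j) = (\<Sum>j<?n. (v j - w j) *\<^sub>R e j)"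
      by (simp add: sum_subtractf scaleR_diff_left)
    also have "\<bar>C\<bar> * norm (\<Sum>j<?n. (v j - w j) *\<^sub>R e j) \<le> \<bar>C\<bar> * (\<Sum>j<?n. \<bar>v j - w j\<bar>)"
      by (intro mult_left_mono sum_norm_le) (use eB in auto)
    finally show "\<bar>F v - F w\<bar> \<le> \<bar>C\<bar> * (\<Sum>j<?n. \<bar>v j - w j\<bar>)" .
  qed
  moreover have "F (\<lambda>j. D \<omega> \<bullet> e j) = f (D \<omega>)" for \<omega>
  proof -
    have "(\<Sum>j<?n. (D \<omega> \<bullet> e j) *\<^sub>R e j) = (\<Sum>b\<in>Basis. (D \<omega> \<bullet> b) *\<^sub>R b)"
      using sum.reindex_bij_betw[OF e, of "\<lambda>b. (D \<omega> \<bullet> b) *\<^sub>R b"] by (simp add: atLeast0LessThan)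
    then show ?thesis by (simp add: F_def euclidean_representation)
  qed
  ultimately show ?thesis by simp
qed

lemma Cb_Lip_mem:
  assumes D: "random_vector H D" and f: "f \<in> Cb_Lip"
  shows "(\<lambda>\<omega>. f (D \<omega>)) \<in> H"
proof -
  obtain B C where "\<And>x y. \<bar>f x - f y\<bar> \<le> C * norm (x - y)" using Cb_LipE[OF f] by metis
  then show ?thesis by (rule Lipschitz_mem[OF D])
qed

lemma E_add_const:
  assumes "X \<in> H"
  shows "E (\<lambda>\<omega>. X \<omega> + c) = E X + c"
proof (rule antisym)
  show "E (\<lambda>\<omega>. X \<omega> + c) \<le> E X + c"
    using subadd[OF assms const_mem[of c]] const by simp
  have "E (\<lambda>\<omega>. (X \<omega> + c) + - c) \<le> E (\<lambda>\<omega>. X \<omega> + c) + - c"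
    using subadd[OF add_mem[OF assms const_mem[of c]] const_mem[of "- c"]] const by simp
  then show "E X + c \<le> E (\<lambda>\<omega>. X \<omega> + c)" by simp
qed

lemma E_mono_const:
  assumes "X \<in> H" "Y \<in> H" "\<And>\<omega>. X \<omega> \<le> Y \<omega> + c"
  shows "E X \<le> E Y + c"
  using mono[OF assms(1) add_mem[OF assms(2) const_mem[of c]] assms(3)] E_add_const[OF assms(2)] by simp

lemma E_diff_le:
  assumes "X \<in> H" "Y \<in> H" "\<And>\<omega>. \<bar>X \<omega> - Y \<omega>\<bar> \<le> c"
  shows "\<bar>E X - E Y\<bar> \<le> c"
proof -
  have "E X \<le> E Y + c" "E Y \<le> E X + c"
    using assms(3) by (intro E_mono_const assms(1,2); simp add: abs_le_iff algebra_simps)+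
  then show ?thesis by (simp add: abs_le_iff)
qed

lemma E_abs_le: "X \<in> H \<Longrightarrow> (\<And>\<omega>. \<bar>X \<omega>\<bar> \<le> c) \<Longrightarrow> \<bar>E X\<bar> \<le> c"
  using E_diff_le[of X "\<lambda>_. 0" c] zero_mem const[of 0] by simp

lemma sum_mem: "(\<And>i. i \<in> I \<Longrightarrow> X i \<in> H) \<Longrightarrow> (\<lambda>\<omega>. \<Sum>i\<in>I. X i \<omega>) \<in> H"
  by (induction I rule: infinite_finite_induct) (auto intro: zero_mem add_mem)

lemma E_sum_le:
  assumes "finite I" "\<And>i. i \<in> I \<Longrightarrow> X i \<in> H"
  shows "E (\<lambda>\<omega>. \<Sum>i\<in>I. X i \<omega>) \<le> (\<Sum>i\<in>I. E (X i))"
  using assms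
proof (induction I rule: finite_induct)
  case empty then show ?case using const[of 0] by simp
next
  case (insert i I)
  then have "E (\<lambda>\<omega>. X i \<omega> + (\<Sum>i\<in>I. X i \<omega>)) \<le> E (X i) + E (\<lambda>\<omega>. \<Sum>i\<in>I. X i \<omega>)"
    by (intro subadd sum_mem) auto
  then show ?case using insert by simp
qed

lemma random_vector_Lipschitz:
  fixes g :: "'a::euclidean_space \<Rightarrow> 'b::euclidean_space"
  assumes "random_vector H D" "\<And>x y. norm (g x - g y) \<le> C * norm (x - y)"
  shows "random_vector H (\<lambda>\<omega>. g (D \<omega>))"
  unfolding random_vector_def
proof
  fix b :: 'b assume b: "b \<in> Basis"
  show "(\<lambda>\<omega>. g (D \<omega>) \<bullet> b) \<in> H"
  proof (rule Lipschitz_mem[OF assms(1)])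
    show "\<bar>g x \<bullet> b - g y \<bullet> b\<bar> \<le> C * norm (x - y)" for x y
      using Basis_le_norm[OF b, of "g x - g y"] assms(2)[of x y] by (simp add: inner_diff_left)
  qed
qed

lemma random_vector_sum:
  "(\<And>i. i \<in> I \<Longrightarrow> random_vector H (D i)) \<Longrightarrow> random_vector H (\<lambda>\<omega>. \<Sum>i\<in>I. D i \<omega>)"
  by (auto simp: random_vector_def inner_sum_left intro!: sum_mem)

lemma random_vector_Pair:
  assumes "random_vector H D" "random_vector H D'"
  shows "random_vector H (\<lambda>\<omega>. (D \<omega>, D' \<omega>))"
  using assms by (auto simp: random_vector_def Basis_prod_def)

lemma random_vector_real: "X \<in> H \<Longrightarrow> random_vector H X"
  by (simp add: random_vector_def)

lemma norm_mem: "random_vector H W \<Longrightarrow> (\<lambda>\<omega>. norm (W \<omega>)) \<in> H"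
  by (rule Lipschitz_mem[where C = 1]) (auto intro: norm_triangle_ineq3)

lemma E_nonneg: "W \<in> H \<Longrightarrow> (\<And>\<omega>. 0 \<le> W \<omega>) \<Longrightarrow> 0 \<le> E W"
  using mono[OF zero_mem, of W] const[of 0] by simp

lemma E_diff_le_E:
  assumes "X \<in> H" "Y \<in> H" "W \<in> H" "\<And>\<omega>. \<bar>X \<omega> - Y \<omega>\<bar> \<le> W \<omega>"
  shows "\<bar>E X - E Y\<bar> \<le> E W"
proof -
  have "E X \<le> E (\<lambda>\<omega>. Y \<omega> + W \<omega>)" "E Y \<le> E (\<lambda>\<omega>. X \<omega> + W \<omega>)"
    using assms(4) by (intro mono add_mem assms(1-3); simp add: abs_le_iff algebra_simps)+
  then show ?thesis using subadd[OF assms(2,3)] subadd[OF assms(1,3)] by (simp add: abs_le_iff)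
qed

lemma random_vector_partial_sum: "(\<And>i. 1 \<le> i \<Longrightarrow> random_vector H (W i)) \<Longrightarrow> random_vector H (partial_sum W k)"
  unfolding partial_sum_def[abs_def] by (rule random_vector_sum) simp

section \<open>Jensen's inequality\<close>

lemma weighted_integral_mem:
  fixes F :: "'p \<Rightarrow> 'a::euclidean_space \<Rightarrow> real"
  assumes D: "random_vector H D" and k: "integrable M k" "\<And>p. 0 \<le> k p"
    and lip: "\<And>p y y'. \<bar>F p y - F p y'\<bar> \<le> C * norm (y - y')"
    and int: "\<And>y. integrable M (\<lambda>p. k p * F p y)"
  shows "(\<lambda>\<omega>. \<integral>p. k p * F p (D \<omega>) \<partial>M) \<in> H"
proof (rule Lipschitz_mem[OF D])
  fix x y
  have "\<bar>(\<integral>p. k p * F p x \<partial>M) - (\<integral>p. k p * F p y \<partial>M)\<bar> = \<bar>\<integral>p. k p * F p x - k p * F p y \<partial>M\<bar>"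
    by (subst Bochner_Integration.integral_diff[OF int int]) simp
  also have "\<dots> \<le> (\<integral>p. \<bar>k p * F p x - k p * F p y\<bar> \<partial>M)" by (rule integral_abs_bound)
  also have "\<dots> \<le> (\<integral>p. k p * (C * norm (x - y)) \<partial>M)"
  proof (rule integral_mono)
    show "\<bar>k p * F p x - k p * F p y\<bar> \<le> k p * (C * norm (x - y))" for p
      using mult_left_mono[OF lip[of p x y] k(2)[of p]] k(2)[of p] by (simp add: abs_mult flip: right_diff_distrib)
  qed (use k int in auto)
  also have "\<dots> = (\<integral>p. k p \<partial>M) * C * norm (x - y)" by simp
  finally show "\<bar>(\<integral>p. k p * F p x \<partial>M) - (\<integral>p. k p * F p y \<partial>M)\<bar> \<le> (\<integral>p. k p \<partial>M) * C * norm (x - y)" .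
qed

text \<open>Cut the parameter space into finitely many cells on which the integrand is constant up to \<open>\<delta>\<close>, uniformly in \<open>y\<close>.
  On a cell the integral is a positive multiple of one random variable, up to \<open>\<delta>\<close>, so sublinearity applies. Finite
  partitions are essential, since a sublinear expectation need not be continuous along monotone sequences. The majorant \<open>G\<close>
  carries the measurability in the parameter.\<close>

lemma Jensen:
  fixes F :: "'p \<Rightarrow> 'a::euclidean_space \<Rightarrow> real"
  assumes D: "random_vector H D" and k: "integrable M k" "\<And>p. 0 \<le> k p"
    and lip: "\<And>p y y'. \<bar>F p y - F p y'\<bar> \<le> C * norm (y - y')" and B: "\<And>p y. \<bar>F p y\<bar> \<le> B"
    and Fm: "\<And>y. (\<lambda>p. F p y) \<in> borel_measurable M"
    and Gm: "G \<in> borel_measurable M" and GB: "\<And>p. \<bar>G p\<bar> \<le> B"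
    and EG: "\<And>p. k p \<noteq> 0 \<Longrightarrow> E (\<lambda>\<omega>. F p (D \<omega>)) \<le> G p"
    and cover: "\<And>\<delta>. 0 < \<delta> \<Longrightarrow> \<exists>\<A>. finite \<A> \<and> \<A> \<subseteq> sets M \<and> (\<forall>p\<in>space M. k p \<noteq> 0 \<longrightarrow> p \<in> \<Union>\<A>) \<and>
        (\<forall>A\<in>\<A>. \<forall>p\<in>A. \<forall>p'\<in>A. \<forall>y. \<bar>F p y - F p' y\<bar> \<le> \<delta>)"
  shows "E (\<lambda>\<omega>. \<integral>p. k p * F p (D \<omega>) \<partial>M) \<le> (\<integral>p. k p * G p \<partial>M)"
proof -
  let ?e = "\<lambda>p. E (\<lambda>\<omega>. F p (D \<omega>))"
  have FH: "(\<lambda>\<omega>. F p (D \<omega>)) \<in> H" for p by (rule Lipschitz_mem[OF D lip])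
  have [measurable]: "k \<in> borel_measurable M" using k(1) by simp
  note [measurable] = Fm Gm
  define kk where "kk U p = indicator U p * k p" for U p
  have kk: "integrable M (kk U)" "\<And>p. 0 \<le> kk U p" if "U \<in> sets M" for U
  proof -
    show "integrable M (kk U)" unfolding kk_def using integrable_mult_indicator[OF that k(1)] by simp
    show "0 \<le> kk U p" for p using k(2) by (simp add: kk_def)
  qed
  have bint: "integrable M (\<lambda>p. kk U p * g p)" if "U \<in> sets M" "\<And>p. \<bar>g p\<bar> \<le> B" "g \<in> borel_measurable M" for U g
  proof (rule Bochner_Integration.integrable_bound)
    show "integrable M (\<lambda>p. B * kk U p)" using kk[OF that(1)] by simp
    show "(\<lambda>p. kk U p * g p) \<in> borel_measurable M" using kk[OF that(1)] that(3) by auto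
    have "0 \<le> B" using that(2)[of undefined] by linarith
    then show "AE p in M. norm (kk U p * g p) \<le> norm (B * kk U p)"
      using that(2) kk(2)[OF that(1)] by (intro AE_I2) (simp add: abs_mult mult.commute[of B] mult_left_mono)
  qed
  note Fint = bint[OF _ B Fm] and eint = bint[OF _ GB Gm]
  define I where "I U \<omega> = (\<integral>p. kk U p * F p (D \<omega>) \<partial>M)" for U \<omega>
  define J where "J U = (\<integral>p. kk U p * G p \<partial>M)" for U
  define c where "c U = (\<integral>p. kk U p \<partial>M)" for U
  have IH: "I U \<in> H" if "U \<in> sets M" for U
    unfolding I_def by (rule weighted_integral_mem[OF D kk[OF that] lip Fint[OF that]])
  have c0: "0 \<le> c U" if "U \<in> sets M" for U unfolding c_def using kk(2)[OF that] by simp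
  have split: "kk (U \<union> V) p = kk U p + kk V p" if "U \<inter> V = {}" for U V p
    using that by (auto simp: kk_def indicator_def)
  have cell: "E (I A) \<le> J A + 2 * \<delta> * c A"
    if A: "A \<in> sets M" and osc: "\<And>p p' y. p \<in> A \<Longrightarrow> p' \<in> A \<Longrightarrow> \<bar>F p y - F p' y\<bar> \<le> \<delta>" for A \<delta>
  proof (cases "A = {}")
    case True
    then have "I A = (\<lambda>_. 0)" by (simp add: I_def kk_def fun_eq_iff)
    then show ?thesis using True const[of 0] by (simp add: J_def c_def kk_def)
  next
    case False
    then obtain p0 where p0: "p0 \<in> A" by blast
    have "I A \<omega> \<le> c A * (F p0 (D \<omega>) + \<delta>)" for \<omega>
    proof -
      have "I A \<omega> \<le> (\<integral>p. kk A p * (F p0 (D \<omega>) + \<delta>) \<partial>M)"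
        unfolding I_def
      proof (rule integral_mono[OF Fint[OF A]])
        show "integrable M (\<lambda>p. kk A p * (F p0 (D \<omega>) + \<delta>))" using kk(1)[OF A] by simp
        show "kk A p * F p (D \<omega>) \<le> kk A p * (F p0 (D \<omega>) + \<delta>)" for p
          using osc[of p p0 "D \<omega>"] p0 kk(2)[OF A, of p]
          by (cases "p \<in> A") (auto simp: kk_def abs_le_iff intro!: mult_left_mono k)
      qed
      then show ?thesis by (simp add: c_def)
    qed
    then have "E (I A) \<le> E (\<lambda>\<omega>. c A * (F p0 (D \<omega>) + \<delta>))"
      by (rule mono[OF IH[OF A] scale_mem[OF add_mem[OF FH const_mem]]])
    also have "\<dots> = c A * (?e p0 + \<delta>)"
      by (simp add: pos_hom[OF add_mem[OF FH const_mem] c0[OF A]] E_add_const[OF FH])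
    also have "\<dots> = (\<integral>p. kk A p * (?e p0 + \<delta>) \<partial>M)" by (simp add: c_def)
    also have "\<dots> \<le> (\<integral>p. kk A p * G p + kk A p * (2 * \<delta>) \<partial>M)"
    proof (rule integral_mono)
      show "integrable M (\<lambda>p. kk A p * (?e p0 + \<delta>))" using kk(1)[OF A] by simp
      show "integrable M (\<lambda>p. kk A p * G p + kk A p * (2 * \<delta>))"
        by (rule Bochner_Integration.integrable_add[OF eint[OF A]]) (use kk(1)[OF A] in simp)
      show "kk A p * (?e p0 + \<delta>) \<le> kk A p * G p + kk A p * (2 * \<delta>)" for p
      proof (cases "p \<in> A")
        case True
        have "\<bar>?e p0 - ?e p\<bar> \<le> \<delta>" by (rule E_diff_le[OF FH FH]) (rule osc[OF p0 True])
        then have "kk A p * (?e p0 + \<delta>) \<le> kk A p * (?e p + 2 * \<delta>)"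
          by (intro mult_left_mono kk(2)[OF A]) (simp add: abs_le_iff)
        moreover have "kk A p * ?e p \<le> kk A p * G p"
          using EG[of p] kk(2)[OF A, of p] by (cases "k p = 0") (simp_all add: kk_def mult_left_mono k(2))
        ultimately show ?thesis by (simp add: algebra_simps)
      qed (simp add: kk_def)
    qed
    also have "\<dots> = J A + 2 * \<delta> * c A"
      unfolding J_def c_def
      by (subst Bochner_Integration.integral_add[OF eint[OF A]]) (use kk(1)[OF A] in simp_all)
    finally show ?thesis .
  qed
  have union: "E (I (\<Union>\<A>)) \<le> J (\<Union>\<A>) + 2 * \<delta> * c (\<Union>\<A>)"
    if "finite \<A>" "\<A> \<subseteq> sets M" "\<forall>A\<in>\<A>. \<forall>p\<in>A. \<forall>p'\<in>A. \<forall>y. \<bar>F p y - F p' y\<bar> \<le> \<delta>" for \<A> \<delta>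
    using that
  proof (induction \<A> rule: finite_induct)
    case empty then show ?case using cell[of "{}" \<delta>] by simp
  next
    case (insert A \<A>)
    let ?U = "\<Union>\<A>" and ?A = "A - \<Union>\<A>"
    have U: "?U \<in> sets M" using insert by (intro sets.finite_Union) auto
    then have A: "?A \<in> sets M" using insert by auto
    have eq: "\<Union>(insert A \<A>) = ?A \<union> ?U" and disj: "?A \<inter> ?U = {}" by auto
    note sp = split[OF disj]
    have I: "I (?A \<union> ?U) = (\<lambda>\<omega>. I ?A \<omega> + I ?U \<omega>)"
      unfolding I_def sp distrib_right
      by (rule ext, rule Bochner_Integration.integral_add[OF Fint[OF A] Fint[OF U]])
    have J: "J (?A \<union> ?U) = J ?A + J ?U"
      unfolding J_def sp distrib_right
      by (rule Bochner_Integration.integral_add[OF eint[OF A] eint[OF U]])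
    have c: "c (?A \<union> ?U) = c ?A + c ?U"
      unfolding c_def sp by (rule Bochner_Integration.integral_add[OF kk(1)[OF A] kk(1)[OF U]])
    have "E (I (?A \<union> ?U)) \<le> E (I ?A) + E (I ?U)"
      unfolding I by (rule subadd[OF IH[OF A] IH[OF U]])
    moreover have "E (I ?A) \<le> J ?A + 2 * \<delta> * c ?A"
      by (rule cell[OF A]) (use insert in auto)
    moreover have "E (I ?U) \<le> J ?U + 2 * \<delta> * c ?U" using insert by auto
    ultimately show ?case unfolding eq J c by (simp add: algebra_simps)
  qed
  have K0: "0 \<le> (\<integral>p. k p \<partial>M)" using k(2) by simp
  show ?thesis
  proof (rule field_le_epsilon)
    fix e :: real assume e: "0 < e"
    define \<delta> where "\<delta> = e / (2 * ((\<integral>p. k p \<partial>M) + 1))"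
    have \<delta>: "0 < \<delta>" "2 * \<delta> * (\<integral>p. k p \<partial>M) \<le> e"
      using e K0 by (auto simp: \<delta>_def field_simps)
    obtain \<A> where \<A>: "finite \<A>" "\<A> \<subseteq> sets M" "\<forall>p\<in>space M. k p \<noteq> 0 \<longrightarrow> p \<in> \<Union>\<A>"
      "\<forall>A\<in>\<A>. \<forall>p\<in>A. \<forall>p'\<in>A. \<forall>y. \<bar>F p y - F p' y\<bar> \<le> \<delta>" using cover[OF \<delta>(1)] by blast
    have kkU: "kk (\<Union>\<A>) p = k p" if "p \<in> space M" for p
      using \<A>(3) that by (auto simp: kk_def indicator_def)
    have "I (\<Union>\<A>) \<omega> = (\<integral>p. k p * F p (D \<omega>) \<partial>M)" for \<omega>
      unfolding I_def by (intro Bochner_Integration.integral_cong refl) (simp add: kkU)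
    then have I: "I (\<Union>\<A>) = (\<lambda>\<omega>. \<integral>p. k p * F p (D \<omega>) \<partial>M)" by (rule ext)
    have J: "J (\<Union>\<A>) = (\<integral>p. k p * G p \<partial>M)"
      unfolding J_def by (intro Bochner_Integration.integral_cong refl) (simp add: kkU)
    have c: "c (\<Union>\<A>) = (\<integral>p. k p \<partial>M)"
      unfolding c_def by (intro Bochner_Integration.integral_cong refl) (simp add: kkU)
    show "E (\<lambda>\<omega>. \<integral>p. k p * F p (D \<omega>) \<partial>M) \<le> (\<integral>p. k p * G p \<partial>M) + e"
      using union[OF \<A>(1,2,4)] \<delta>(2) unfolding I J c by linarith
  qed
qed

end

section \<open>One-step operator\<close>

definition step :: "(('w \<Rightarrow> real) \<Rightarrow> real) \<Rightarrow> ('w \<Rightarrow> 'a::real_normed_vector) \<Rightarrow> ('a \<Rightarrow> real) \<Rightarrow> 'a \<Rightarrow> real" where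
  "step E D f \<kappa> = E (\<lambda>\<omega>. f (\<kappa> + D \<omega>))"

lemma Cb_Lip_compose:
  assumes f: "f \<in> Cb_Lip" and S: "\<And>x y. norm (S x - S y) \<le> c * norm (x - y)"
  shows "(\<lambda>x. f (S x)) \<in> Cb_Lip"
proof -
  obtain B C where B: "\<And>x. \<bar>f x\<bar> \<le> B" and C: "0 \<le> C" "\<And>x y. \<bar>f x - f y\<bar> \<le> C * norm (x - y)"
    using Cb_LipE[OF f] by metis
  show ?thesis
  proof (rule Cb_LipI)
    show "\<bar>f (S x)\<bar> \<le> B" for x by (rule B)
    show "\<bar>f (S x) - f (S y)\<bar> \<le> (C * c) * norm (x - y)" for x y
      using order_trans[OF C(2) mult_left_mono[OF S C(1)]] by (simp add: mult.assoc)
  qed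
qed

lemma Cb_Lip_translate: "f \<in> Cb_Lip \<Longrightarrow> (\<lambda>x. f (a + x)) \<in> Cb_Lip"
  by (rule Cb_Lip_compose[where c = 1]) auto

context sublinear_expectation
begin

lemma step_mem:
  assumes "random_vector H D" "f \<in> Cb_Lip"
  shows "(\<lambda>\<omega>. f (\<kappa> + D \<omega>)) \<in> H"
  by (rule Cb_Lip_mem[OF assms(1) Cb_Lip_translate[OF assms(2)]])

lemma step_Cb_Lip:
  assumes D: "random_vector H D" and f: "f \<in> Cb_Lip"
  shows "step E D f \<in> Cb_Lip"
proof -
  obtain B C where B: "\<And>x. \<bar>f x\<bar> \<le> B" and C: "\<And>x y. \<bar>f x - f y\<bar> \<le> C * norm (x - y)"
    using Cb_LipE[OF f] by metis
  show ?thesis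
  proof (rule Cb_LipI)
    show "\<bar>step E D f x\<bar> \<le> B" for x unfolding step_def by (rule E_abs_le[OF step_mem[OF D f] B])
    show "\<bar>step E D f x - step E D f y\<bar> \<le> C * norm (x - y)" for x y
      unfolding step_def
    proof (rule E_diff_le[OF step_mem[OF D f] step_mem[OF D f]])
      show "\<bar>f (x + D \<omega>) - f (y + D \<omega>)\<bar> \<le> C * norm (x - y)" for \<omega>
        using C[of "x + D \<omega>" "y + D \<omega>"] by simp
    qed
  qed
qed

lemma step_pow_Cb_Lip:
  "random_vector H D \<Longrightarrow> f \<in> Cb_Lip \<Longrightarrow> (step E D ^^ k) f \<in> Cb_Lip"
  by (induction k) (auto intro: step_Cb_Lip)

lemma step_diff_le:
  assumes D: "random_vector H D" and f: "f \<in> Cb_Lip" and g: "g \<in> Cb_Lip"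
    and le: "\<And>\<kappa>. f \<kappa> \<le> g \<kappa> + c"
  shows "step E D f \<kappa> \<le> step E D g \<kappa> + c"
  unfolding step_def by (rule E_mono_const[OF step_mem[OF D f] step_mem[OF D g] le])

lemma step_pow_abs_le:
  assumes D: "random_vector H D" and f: "f \<in> Cb_Lip" and B: "\<And>\<kappa>. \<bar>f \<kappa>\<bar> \<le> B"
  shows "\<bar>(step E D ^^ k) f \<kappa>\<bar> \<le> B"
proof (induction k arbitrary: \<kappa>)
  case (Suc k)
  have "\<bar>step E D ((step E D ^^ k) f) \<kappa>\<bar> \<le> B"
    unfolding step_def[of E D "(step E D ^^ k) f"] by (rule E_abs_le[OF step_mem[OF D step_pow_Cb_Lip[OF D f]] Suc])
  then show ?case by simp
qed (simp add: B)

lemma step_pow_modulus: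
  assumes D: "random_vector H D" and f: "f \<in> Cb_Lip" and w: "\<And>\<kappa> \<kappa>'. \<bar>f \<kappa> - f \<kappa>'\<bar> \<le> w (\<kappa> - \<kappa>')"
  shows "\<bar>(step E D ^^ k) f \<kappa> - (step E D ^^ k) f \<kappa>'\<bar> \<le> w (\<kappa> - \<kappa>')"
proof (induction k arbitrary: \<kappa> \<kappa>')
  case (Suc k)
  have "\<bar>step E D ((step E D ^^ k) f) \<kappa> - step E D ((step E D ^^ k) f) \<kappa>'\<bar> \<le> w (\<kappa> - \<kappa>')"
    unfolding step_def[of E D "(step E D ^^ k) f"]
  proof (rule E_diff_le[OF step_mem[OF D step_pow_Cb_Lip[OF D f]] step_mem[OF D step_pow_Cb_Lip[OF D f]]])
    show "\<bar>(step E D ^^ k) f (\<kappa> + D \<omega>) - (step E D ^^ k) f (\<kappa>' + D \<omega>)\<bar> \<le> w (\<kappa> - \<kappa>')" for \<omega>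
      using Suc[of "\<kappa> + D \<omega>" "\<kappa>' + D \<omega>"] by simp
  qed
  then show ?case by simp
qed (simp add: w)

lemma iid_eq_dist:
  assumes "iid_seq H E \<xi>" "f \<in> Cb_Lip" "1 \<le> i"
  shows "E (\<lambda>\<omega>. f (\<xi> i \<omega>)) = E (\<lambda>\<omega>. f (\<xi> 1 \<omega>))"
  using assms(3)
proof (induction i rule: dec_induct)
  case (step i)
  then have "E (\<lambda>\<omega>. f (\<xi> (i + 1) \<omega>)) = E (\<lambda>\<omega>. f (\<xi> i \<omega>))"
    using assms(1,2) unfolding iid_seq_def eq_dist_def by blast
  then show ?case using step by simp
qed simp

text \<open>Independence integrates the last summand first, which replaces \<open>f\<close> by one step applied to \<open>f\<close>; then induction.
  Only bounded Lipschitz functions of the summands occur, so equality in distribution can be used.\<close>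

lemma iid_sum_eq_step_pow:
  fixes \<xi> :: "nat \<Rightarrow> 'w \<Rightarrow> 'a::euclidean_space" and S :: "'a \<Rightarrow> 'b::euclidean_space"
  assumes iid: "iid_seq H E \<xi>" and S: "0 \<le> c" "\<And>x y. norm (S x - S y) \<le> c * norm (x - y)" and f: "f \<in> Cb_Lip"
  shows "E (\<lambda>\<omega>. f (a + (\<Sum>i=1..k. S (\<xi> i \<omega>)))) = (step E (\<lambda>\<omega>. S (\<xi> 1 \<omega>)) ^^ k) f a"
  using f
proof (induction k arbitrary: f)
  case 0 then show ?case using const by simp
next
  case (Suc k f)
  let ?D = "\<lambda>\<omega>. S (\<xi> 1 \<omega>)"
  have r: "random_vector H (\<xi> i)" if "1 \<le> i" for i using iid that by (simp add: iid_seq_def)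
  have D: "random_vector H ?D" by (rule random_vector_Lipschitz[OF r S(2)]) simp
  have law: "E (\<lambda>\<omega>. f (b + S (\<xi> i \<omega>))) = step E ?D f b" if "1 \<le> i" for i b
  proof -
    have "(\<lambda>x. f (b + S x)) \<in> Cb_Lip"
      by (rule Cb_Lip_compose[OF Cb_Lip_translate[OF Suc.prems] S(2)])
    from iid_eq_dist[OF iid this that] show ?thesis by (simp add: step_def)
  qed
  have "E (\<lambda>\<omega>. f (a + (\<Sum>i=1..Suc k. S (\<xi> i \<omega>)))) = E (\<lambda>\<omega>. step E ?D f (a + (\<Sum>i=1..k. S (\<xi> i \<omega>))))"
  proof (cases "k = 0")
    case True then show ?thesis using law[of 1 a] const by simp
  next
    case False
    define \<Phi> where "\<Phi> v y = f (a + (\<Sum>j<k. S (v j)) + S y)" for v y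
    obtain B C where B: "\<And>x. \<bar>f x\<bar> \<le> B" and C: "0 \<le> C" "\<And>x y. \<bar>f x - f y\<bar> \<le> C * norm (x - y)"
      using Cb_LipE[OF Suc.prems] by metis
    have "\<bar>\<Phi> v y - \<Phi> w y'\<bar> \<le> (C * c) * ((\<Sum>j<k. norm (v j - w j)) + norm (y - y'))" for v w y y'
    proof -
      have "\<bar>\<Phi> v y - \<Phi> w y'\<bar> \<le> C * norm ((\<Sum>j<k. S (v j) - S (w j)) + (S y - S y'))"
        unfolding \<Phi>_def by (rule order_trans[OF C(2)]) (simp add: sum_subtractf algebra_simps)
      also have "norm ((\<Sum>j<k. S (v j) - S (w j)) + (S y - S y')) \<le> (\<Sum>j<k. c * norm (v j - w j)) + c * norm (y - y')"
        by (intro norm_triangle_mono sum_norm_le S)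
      also have "\<dots> = c * ((\<Sum>j<k. norm (v j - w j)) + norm (y - y'))"
        by (simp add: sum_distrib_left distrib_left)
      finally show ?thesis using C(1) by (simp add: mult_left_mono mult.assoc)
    qed
    moreover have "\<bar>\<Phi> v y\<bar> \<le> B" for v y by (simp add: \<Phi>_def B)
    moreover have "indep_from E k (\<lambda>j. \<xi> (j + 1)) (\<xi> (k + 1))"
      using iid False by (simp add: iid_seq_def)
    ultimately have "E (\<lambda>\<omega>. \<Phi> (\<lambda>j. \<xi> (j + 1) \<omega>) (\<xi> (k + 1) \<omega>))
        = E (\<lambda>\<omega>. E (\<lambda>\<omega>'. \<Phi> (\<lambda>j. \<xi> (j + 1) \<omega>) (\<xi> (k + 1) \<omega>')))"
      unfolding indep_from_def by blast
    moreover have "(\<Sum>j<k. S (\<xi> (j + 1) \<omega>)) = (\<Sum>i=1..k. S (\<xi> i \<omega>))" for \<omega>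
      by (rule sum.reindex_bij_witness[of _ "\<lambda>i. i - 1" "\<lambda>j. j + 1"]) auto
    moreover have "E (\<lambda>\<omega>. f (a + (b + S (\<xi> (k + 1) \<omega>)))) = step E ?D f (a + b)" for b
      using law[of "k + 1" "a + b"] by (simp add: add.assoc)
    ultimately show ?thesis
      unfolding \<Phi>_def by (simp add: add.assoc)
  qed
  also have "\<dots> = (step E ?D ^^ k) (step E ?D f) a"
    by (rule Suc.IH[OF step_Cb_Lip[OF D Suc.prems]])
  finally show ?case by (simp add: funpow_swap1)
qed

end

section \<open>The sum of the block norms\<close>

definition norm1 :: "'d::finite vec3 \<Rightarrow> real" where
  "norm1 \<kappa> = norm (fst \<kappa>) + norm (fst (snd \<kappa>)) + norm (snd (snd \<kappa>))"

lemma norm1_nonneg: "0 \<le> norm1 \<kappa>"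
  by (simp add: norm1_def)

lemma norm1_minus: "norm1 (- \<kappa>) = norm1 \<kappa>"
  by (simp add: norm1_def)

lemma norm1_le: "norm1 \<kappa> \<le> 2 * norm \<kappa>"
proof -
  obtain x y z where \<kappa>: "\<kappa> = (x, y, z)" by (cases \<kappa>)
  define a b c where "a = norm x" and "b = norm y" and "c = norm z"
  have n: "(norm \<kappa>)\<^sup>2 = a\<^sup>2 + b\<^sup>2 + c\<^sup>2" by (simp add: \<kappa> norm_Pair a_def b_def c_def)
  have "(a + b + c)\<^sup>2 + ((a - b)\<^sup>2 + (a - c)\<^sup>2 + (b - c)\<^sup>2) = 3 * (a\<^sup>2 + b\<^sup>2 + c\<^sup>2)"
    by (simp add: power2_eq_square algebra_simps)
  moreover have "0 \<le> (a - b)\<^sup>2 + (a - c)\<^sup>2 + (b - c)\<^sup>2" "0 \<le> a\<^sup>2 + b\<^sup>2 + c\<^sup>2" by simp_all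
  moreover have "p \<le> 4 * s" if "p + q = 3 * s" "0 \<le> q" "0 \<le> s" for p q s :: real using that by linarith
  ultimately have "(a + b + c)\<^sup>2 \<le> 4 * (a\<^sup>2 + b\<^sup>2 + c\<^sup>2)" by blast
  then have "(norm1 \<kappa>)\<^sup>2 \<le> (2 * norm \<kappa>)\<^sup>2"
    unfolding power_mult_distrib n by (simp add: \<kappa> norm1_def a_def b_def c_def)
  then show ?thesis by (rule power2_le_imp_le) simp
qed

text \<open>Puts the infimum in \<^const>\<open>lip_const\<close> over a nonempty set.\<close>

lemma Cb_Lip_norm1:
  fixes \<phi> :: "'d::finite vec3 \<Rightarrow> real"
  assumes "\<phi> \<in> Cb_Lip"
  obtains C where "0 \<le> C" "\<And>\<kappa> \<kappa>'. \<bar>\<phi> \<kappa> - \<phi> \<kappa>'\<bar> \<le> C * norm1 (\<kappa> - \<kappa>')"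
proof -
  obtain C where C: "0 \<le> C" "\<And>x y. \<bar>\<phi> x - \<phi> y\<bar> \<le> C * norm (x - y)"
    using Cb_LipE[OF assms] by metis
  have "norm \<kappa> \<le> norm1 \<kappa>" for \<kappa> :: "'d vec3"
    using norm_Pair_le[of "fst \<kappa>" "snd \<kappa>"] norm_Pair_le[of "fst (snd \<kappa>)" "snd (snd \<kappa>)"]
    by (simp add: norm1_def)
  then have "\<bar>\<phi> x - \<phi> y\<bar> \<le> C * norm1 (x - y)" for x y
    using order_trans[OF C(2) mult_left_mono[OF _ C(1)]] by blast
  then show thesis using that[OF C(1)] by blast
qed

text \<open>The infimum is attained: divide by the distance, which may be assumed positive.\<close>

lemma lip_const:
  fixes \<phi> :: "'d::finite vec3 \<Rightarrow> real"
  assumes "\<phi> \<in> Cb_Lip"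
  shows "0 \<le> lip_const \<phi>" "\<bar>\<phi> \<kappa> - \<phi> \<kappa>'\<bar> \<le> lip_const \<phi> * norm1 (\<kappa> - \<kappa>')"
proof -
  let ?S = "{C. 0 \<le> C \<and> (\<forall>x y z x' y' z'.
     \<bar>\<phi> (x, y, z) - \<phi> (x', y', z')\<bar> \<le> C * (norm (x - x') + norm (y - y') + norm (z - z')))}"
  obtain C where C: "0 \<le> C" "\<And>\<kappa> \<kappa>'. \<bar>\<phi> \<kappa> - \<phi> \<kappa>'\<bar> \<le> C * norm1 (\<kappa> - \<kappa>')"
    using Cb_Lip_norm1[OF assms] by blast
  have ne: "?S \<noteq> {}"
    using C(1) C(2)[of "(_, _, _)" "(_, _, _)"] by (auto simp: norm1_def intro!: exI[of _ C])
  show "0 \<le> lip_const \<phi>" unfolding lip_const_def by (rule cInf_greatest[OF ne]) simp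
  show "\<bar>\<phi> \<kappa> - \<phi> \<kappa>'\<bar> \<le> lip_const \<phi> * norm1 (\<kappa> - \<kappa>')"
  proof (cases "norm1 (\<kappa> - \<kappa>') = 0")
    case True
    then show ?thesis using C(2)[of \<kappa> \<kappa>'] by simp
  next
    case False
    then have pos: "0 < norm1 (\<kappa> - \<kappa>')" using norm1_nonneg[of "\<kappa> - \<kappa>'"] by simp
    have "\<bar>\<phi> \<kappa> - \<phi> \<kappa>'\<bar> / norm1 (\<kappa> - \<kappa>') \<le> lip_const \<phi>"
      unfolding lip_const_def
    proof (rule cInf_greatest[OF ne])
      fix C' assume "C' \<in> ?S"
      then have "\<bar>\<phi> \<kappa> - \<phi> \<kappa>'\<bar> \<le> C' * norm1 (\<kappa> - \<kappa>')"
        by (cases \<kappa>, cases \<kappa>') (simp add: norm1_def)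
      then show "\<bar>\<phi> \<kappa> - \<phi> \<kappa>'\<bar> / norm1 (\<kappa> - \<kappa>') \<le> C'" using pos by (simp add: pos_divide_le_eq)
    qed
    then show ?thesis using pos by (simp add: pos_divide_le_eq)
  qed
qed

section \<open>The scheme as powers of the one-step operator\<close>

definition scale :: "real \<Rightarrow> real \<Rightarrow> 'd::finite vec3 \<Rightarrow> 'd vec3" where
  "scale \<alpha> h \<kappa> = (sqrt h *\<^sub>R fst \<kappa>, h *\<^sub>R fst (snd \<kappa>), h powr (1/\<alpha>) *\<^sub>R snd (snd \<kappa>))"

lemma norm_scale_diff_le:
  assumes "0 < h" "h \<le> 1" "0 < \<alpha>"
  shows "norm (scale \<alpha> h \<kappa> - scale \<alpha> h \<kappa>') \<le> 1 * norm (\<kappa> - \<kappa>')"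
proof -
  obtain x y z where d: "\<kappa> - \<kappa>' = (x, y, z)" by (cases "\<kappa> - \<kappa>'")
  then have "x = fst \<kappa> - fst \<kappa>'" "y = fst (snd \<kappa>) - fst (snd \<kappa>')" "z = snd (snd \<kappa>) - snd (snd \<kappa>')"
    by (metis fst_conv snd_conv fst_diff snd_diff)+
  then have "scale \<alpha> h \<kappa> - scale \<alpha> h \<kappa>' = (sqrt h *\<^sub>R x, h *\<^sub>R y, h powr (1/\<alpha>) *\<^sub>R z)"
    by (simp add: scale_def scaleR_diff_right)
  moreover have "h powr (1/\<alpha>) \<le> 1" using assms by (intro powr_le1) auto
  then have "norm (sqrt h *\<^sub>R x) \<le> norm x" "norm (h *\<^sub>R y) \<le> norm y" "norm (h powr (1/\<alpha>) *\<^sub>R z) \<le> norm z"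
    using assms by (auto simp: mult_left_le_one_le)
  ultimately show ?thesis
    unfolding d by (auto simp: norm_Pair intro!: real_sqrt_le_mono add_mono power_mono)
qed

text \<open>At negative times both sides equal \<open>\<phi>\<close>, as \<^const>\<open>nat\<close> truncates.\<close>

lemma u_scheme_eq_step_pow:
  assumes h: "0 < h"
  shows "u_scheme E \<alpha> X Y Z \<phi> h t \<kappa> =
    (step E (\<lambda>\<omega>. scale \<alpha> h (X \<omega>, Y \<omega>, Z \<omega>)) ^^ nat \<lfloor>t / h\<rfloor>) \<phi> \<kappa>"
proof (induction "nat \<lfloor>t / h\<rfloor>" arbitrary: t \<kappa>)
  case (0 t \<kappa>)
  then have "t / h < 1" by linarith
  then have "\<not> h \<le> t" using h by simp
  then show ?case using 0 by (cases \<kappa>) (simp add: u_scheme.simps[of E \<alpha> X Y Z \<phi> h t])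
next
  case (Suc k t \<kappa>)
  then have "1 \<le> t / h" by linarith
  then have t: "h \<le> t" using h by simp
  have "(t - h) / h = t / h - 1" using h by (simp add: diff_divide_distrib)
  then have k: "k = nat \<lfloor>(t - h) / h\<rfloor>" using Suc.hyps(2) by simp
  obtain x y z where \<kappa>: "\<kappa> = (x, y, z)" by (cases \<kappa>)
  have "u_scheme E \<alpha> X Y Z \<phi> h t \<kappa> = E (\<lambda>\<omega>. u_scheme E \<alpha> X Y Z \<phi> h (t - h)
                (x + sqrt h *\<^sub>R X \<omega>, y + h *\<^sub>R Y \<omega>, z + h powr (1/\<alpha>) *\<^sub>R Z \<omega>))"
    unfolding \<kappa> using h t by (subst u_scheme.simps) simp
  also have "\<dots> = step E (\<lambda>\<omega>. scale \<alpha> h (X \<omega>, Y \<omega>, Z \<omega>))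
      ((step E (\<lambda>\<omega>. scale \<alpha> h (X \<omega>, Y \<omega>, Z \<omega>)) ^^ k) \<phi>) \<kappa>"
    unfolding Suc.hyps(1)[OF k] k[symmetric] by (simp add: step_def[of _ _ "(_ ^^ _) _"] scale_def \<kappa>)
  finally show ?case unfolding Suc.hyps(2)[symmetric] by simp
qed

section \<open>Time regularity of the scheme\<close>

text \<open>The optimal parameter is \<open>l = sqrt a\<close>, which is not admissible for \<open>a = 0\<close>.\<close>

lemma le_sqrt_of_young:
  assumes "0 \<le> a" "\<And>l. 0 < l \<Longrightarrow> t \<le> a / (2 * l) + l / 2"
  shows "t \<le> sqrt a"
proof (cases "a = 0")
  case True
  have "t \<le> 0"
  proof (rule field_le_epsilon)
    fix e :: real assume "0 < e"
    then show "t \<le> 0 + e" using assms(2)[of "2 * e"] True by simp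
  qed
  then show ?thesis using True by simp
next
  case False
  then have "0 < sqrt a" using assms(1) by simp
  moreover have "a = sqrt a * sqrt a" using assms(1) by simp
  then have "a / (2 * sqrt a) = sqrt a / 2" using \<open>0 < sqrt a\<close> by (metis less_irrefl mult.commute nonzero_mult_divide_mult_cancel_left)
  ultimately show ?thesis using assms(2)[of "sqrt a"] by simp
qed

lemma cube_root_trunc_Lipschitz:
  fixes s s' :: real
  shows "\<bar>(root 3 (max s 1))\<^sup>2 - (root 3 (max s' 1))\<^sup>2\<bar> \<le> \<bar>s - s'\<bar>"
proof -
  define u v where "u = root 3 (max s 1)" and "v = root 3 (max s' 1)"
  have uv: "1 \<le> u" "1 \<le> v" by (simp_all add: u_def v_def)
  have c: "u ^ 3 = max s 1" "v ^ 3 = max s' 1" by (simp_all add: u_def v_def)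
  have "u \<le> u * u" "v \<le> v * v" "0 \<le> u * v" using uv by simp_all
  then have le: "u + v \<le> u * u + u * v + v * v" by linarith
  have "\<bar>u\<^sup>2 - v\<^sup>2\<bar> = \<bar>u - v\<bar> * (u + v)"
    using uv by (simp add: power2_eq_square square_diff_square_factored abs_mult)
  also have "\<dots> \<le> \<bar>u - v\<bar> * (u * u + u * v + v * v)" using le by (intro mult_left_mono) auto
  also have "\<dots> = \<bar>(u - v) * (u * u + u * v + v * v)\<bar>" using uv by (simp add: abs_mult)
  also have "(u - v) * (u * u + u * v + v * v) = u ^ 3 - v ^ 3" by (simp add: algebra_simps power3_eq_cube)
  also have "\<bar>u ^ 3 - v ^ 3\<bar> \<le> \<bar>s - s'\<bar>" unfolding c by (simp add: max_def abs_if)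
  finally show ?thesis by (simp add: u_def v_def)
qed

lemma norm_snd_le': "norm (snd p) \<le> norm p"
  by (cases p) (simp add: norm_snd_le)

lemma norm_fst_le': "norm (fst p) \<le> norm p"
  by (cases p) (simp add: norm_fst_le)

locale iid_scheme = sublinear_expectation H E for H :: "('w \<Rightarrow> real) set" and E +
  fixes \<alpha> :: real and X Y Z :: "nat \<Rightarrow> 'w \<Rightarrow> real^'d::finite"
  assumes \<alpha>: "1 < \<alpha>" "\<alpha> < 2"
    and iid: "iid_seq H E (\<lambda>i \<omega>. (X i \<omega>, Y i \<omega>, Z i \<omega>))"
    and XY: "XY_moment_conditions H E X Y"
    and Zc: "Z_moment_conditions H E \<alpha> Z"
begin

definition incr where "incr h \<omega> = scale \<alpha> h (X 1 \<omega>, Y 1 \<omega>, Z 1 \<omega>)"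

lemma rv: "1 \<le> i \<Longrightarrow> random_vector H (\<lambda>\<omega>. (X i \<omega>, Y i \<omega>, Z i \<omega>))"
  using iid by (simp add: iid_seq_def)

lemma rv_X: "1 \<le> i \<Longrightarrow> random_vector H (X i)"
  using random_vector_Lipschitz[OF rv, of i fst 1] norm_fst_le[of "fst _ - fst _" "snd _ - snd _"]
  by (simp add: norm_prod_def real_le_rsqrt)

lemma rv_Y: "1 \<le> i \<Longrightarrow> random_vector H (Y i)"
proof -
  have "norm (fst (snd x) - fst (snd y)) \<le> 1 * norm (x - y)" for x y :: "'d vec3"
    using order_trans[OF norm_fst_le' norm_snd_le', of "x - y"] by simp
  then show "1 \<le> i \<Longrightarrow> random_vector H (Y i)" using random_vector_Lipschitz[OF rv, of i "\<lambda>p. fst (snd p)" 1] by simp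
qed

lemma rv_Z: "1 \<le> i \<Longrightarrow> random_vector H (Z i)"
proof -
  have "norm (snd (snd x) - snd (snd y)) \<le> 1 * norm (x - y)" for x y :: "'d vec3"
    using order_trans[OF norm_snd_le' norm_snd_le', of "x - y"] by simp
  then show "1 \<le> i \<Longrightarrow> random_vector H (Z i)" using random_vector_Lipschitz[OF rv, of i "\<lambda>p. snd (snd p)" 1] by simp
qed

lemma rv_incr: "0 < h \<Longrightarrow> h \<le> 1 \<Longrightarrow> random_vector H (incr h)"
  unfolding incr_def[abs_def] using \<alpha> by (intro random_vector_Lipschitz[OF rv norm_scale_diff_le]) auto

text \<open>Membership of \<open>|X|\<^sup>3\<close> is assumed, and the square is a Lipschitz function of the pair \<open>(X, |X|\<^sup>3)\<close>: use \<open>X\<close> on the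
  unit ball, where squaring is Lipschitz, and the power 2/3 of \<open>|X|\<^sup>3\<close> outside, where that power is Lipschitz.\<close>

lemma norm_X_square_mem: "(\<lambda>\<omega>. (norm (X 1 \<omega>))\<^sup>2) \<in> H"
proof -
  define f :: "(real^'d) \<times> real \<Rightarrow> real" where
    "f p = (min (norm (fst p)) 1)\<^sup>2 + ((root 3 (max (snd p) 1))\<^sup>2 - 1)" for p
  have m3: "(\<lambda>\<omega>. norm (X 1 \<omega>) powr 3) \<in> H"
    using XY by (simp add: XY_moment_conditions_def finite_moment_def)
  have "(\<lambda>\<omega>. f (X 1 \<omega>, norm (X 1 \<omega>) powr 3)) \<in> H"
  proof (rule Lipschitz_mem[OF random_vector_Pair[OF rv_X random_vector_real[OF m3]]])
    fix p q :: "(real^'d) \<times> real"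
    define a b where "a = min (norm (fst p)) 1" and "b = min (norm (fst q)) 1"
    have ab: "0 \<le> a" "a \<le> 1" "0 \<le> b" "b \<le> 1" by (auto simp: a_def b_def)
    have "\<bar>a\<^sup>2 - b\<^sup>2\<bar> = \<bar>a - b\<bar> * (a + b)"
      using ab by (simp add: power2_eq_square square_diff_square_factored abs_mult)
    also have "\<dots> \<le> \<bar>a - b\<bar> * 2" using ab by (intro mult_left_mono) auto
    also have "\<bar>a - b\<bar> \<le> \<bar>norm (fst p) - norm (fst q)\<bar>" unfolding a_def b_def by (simp add: min_def abs_if)
    also have "\<dots> \<le> norm (fst (p - q))" using norm_triangle_ineq3[of "fst p" "fst q"] by simp
    also have "\<dots> \<le> norm (p - q)" by (rule norm_fst_le')
    finally have 1: "\<bar>a\<^sup>2 - b\<^sup>2\<bar> \<le> norm (p - q) * 2" by simp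
    have "\<bar>(root 3 (max (snd p) 1))\<^sup>2 - (root 3 (max (snd q) 1))\<^sup>2\<bar> \<le> norm (snd (p - q))"
      using cube_root_trunc_Lipschitz by simp
    also have "\<dots> \<le> norm (p - q)" by (rule norm_snd_le')
    finally show "\<bar>f p - f q\<bar> \<le> 3 * norm (p - q)"
      using 1 unfolding f_def a_def[symmetric] b_def[symmetric] by (simp add: abs_le_iff)
  qed simp
  moreover have "f (X 1 \<omega>, norm (X 1 \<omega>) powr 3) = (norm (X 1 \<omega>))\<^sup>2" for \<omega>
  proof -
    define t where "t = norm (X 1 \<omega>)"
    have t: "0 \<le> t" by (simp add: t_def)
    then have p3: "t powr 3 = t ^ 3" by simp
    have "(min t 1)\<^sup>2 + ((root 3 (max (t ^ 3) 1))\<^sup>2 - 1) = t\<^sup>2"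
    proof (cases "t \<le> 1")
      case True
      then have "t ^ 3 \<le> 1" using t by (simp add: power_le_one)
      then show ?thesis using True by (simp add: max_def)
    next
      case False
      then have "1 \<le> t ^ 3" by (intro one_le_power) simp
      then have "max (t ^ 3) 1 = t ^ 3" "min t 1 = 1" using False by simp_all
      then show ?thesis using t by (simp add: real_root_power_cancel)
    qed
    then show ?thesis unfolding f_def fst_conv snd_conv t_def[symmetric] p3 .
  qed
  ultimately show ?thesis by simp
qed

abbreviation "M2 \<equiv> abs_moment E 2 (X 1)"
abbreviation "M1 \<equiv> abs_moment E 1 (Y 1)"
abbreviation "Ms \<equiv> M_star E \<alpha> Z"

lemma M2_eq: "M2 = E (\<lambda>\<omega>. (norm (X 1 \<omega>))\<^sup>2)"
  by (simp add: abs_moment_def)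

lemma M1_eq: "M1 = E (\<lambda>\<omega>. norm (Y 1 \<omega>))"
  by (simp add: abs_moment_def)

lemma M2_nonneg: "0 \<le> M2"
  unfolding M2_eq by (rule E_nonneg[OF norm_X_square_mem]) simp

lemma M1_nonneg: "0 \<le> M1"
  unfolding M1_eq by (rule E_nonneg[OF norm_mem[OF rv_Y]]) simp_all

lemma Z_sum_moment_le:
  assumes "1 \<le> k"
  shows "E (\<lambda>\<omega>. real k powr (- 1 / \<alpha>) * norm (partial_sum Z k \<omega>)) \<le> Ms"
  unfolding M_star_def
  by (rule cSUP_upper) (use assms Zc in \<open>auto simp: Z_moment_conditions_def\<close>)

lemma Ms_nonneg: "0 \<le> Ms"
proof -
  have "0 \<le> E (\<lambda>\<omega>. real 1 powr (- 1 / \<alpha>) * norm (partial_sum Z 1 \<omega>))"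
    by (intro E_nonneg scale_mem norm_mem random_vector_partial_sum rv_Z) auto
  then show ?thesis using Z_sum_moment_le[of 1] by simp
qed

lemma inner_X_mem: "(\<lambda>\<omega>. v \<bullet> X 1 \<omega>) \<in> H"
  by (rule Lipschitz_mem[OF rv_X, where C = "norm v"])
    (auto simp: Cauchy_Schwarz_ineq2 simp flip: inner_diff_right)

lemma E_inner_X_le: "E (\<lambda>\<omega>. v \<bullet> X 1 \<omega>) \<le> 0"
proof -
  have c: "(\<lambda>\<omega>. X 1 \<omega> $ i) \<in> H" for i
    using rv_X[of 1] by (auto simp: random_vector_def cart_eq_inner_axis axis_in_Basis_iff)
  have c': "(\<lambda>\<omega>. v $ i * X 1 \<omega> $ i) \<in> H" for i by (rule scale_mem[OF c])
  have "E (\<lambda>\<omega>. v $ i * X 1 \<omega> $ i) \<le> 0" for i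
  proof (cases "0 \<le> v $ i")
    case True
    then show ?thesis using pos_hom[OF c True] XY by (simp add: XY_moment_conditions_def no_mean_uncertainty_def)
  next
    case False
    have "(\<lambda>\<omega>. -1 * X 1 \<omega> $ i) \<in> H" by (rule scale_mem[OF c])
    then have m: "(\<lambda>\<omega>. - (X 1 \<omega> $ i)) \<in> H" by simp
    have "E (\<lambda>\<omega>. (- v $ i) * (- (X 1 \<omega> $ i))) = (- v $ i) * E (\<lambda>\<omega>. - (X 1 \<omega> $ i))"
      by (rule pos_hom[OF m]) (use False in simp)
    then show ?thesis using XY by (simp add: XY_moment_conditions_def no_mean_uncertainty_def)
  qed
  then have "(\<Sum>i\<in>UNIV. E (\<lambda>\<omega>. v $ i * X 1 \<omega> $ i)) \<le> 0" by (intro sum_nonpos) auto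
  moreover have "E (\<lambda>\<omega>. \<Sum>i\<in>UNIV. v $ i * X 1 \<omega> $ i) \<le> (\<Sum>i\<in>UNIV. E (\<lambda>\<omega>. v $ i * X 1 \<omega> $ i))"
    by (rule E_sum_le[OF finite c'])
  ultimately show ?thesis by (simp add: inner_vec_def)
qed

text \<open>The class of these quadratic majorants is stable under one step, because the mixed term has zero mean without
  uncertainty. The induction uses moments of the first summand only; the later summands share its law for bounded
  Lipschitz functions, which does not determine their moments.\<close>

lemma step_pow_quadratic:
  assumes h: "0 < h" "h \<le> 1" and f: "f \<in> Cb_Lip" and A: "0 \<le> A" and C: "0 \<le> C"
    and le: "\<And>\<kappa>. f \<kappa> \<le> A * (norm (fst \<kappa>))\<^sup>2 + C * norm (fst (snd \<kappa>)) + c"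
  shows "(step E (incr h) ^^ k) f \<kappa> \<le> A * ((norm (fst \<kappa>))\<^sup>2 + k * h * M2) + C * (norm (fst (snd \<kappa>)) + k * h * M1) + c"
proof (induction k arbitrary: \<kappa>)
  case 0 then show ?case using le by simp
next
  case (Suc k \<kappa>)
  let ?g = "(step E (incr h) ^^ k) f"
  obtain x y z where \<kappa>: "\<kappa> = (x, y, z)" by (cases \<kappa>)
  define b where "b = A * ((norm x)\<^sup>2 + k * h * M2) + C * (norm y + k * h * M1) + c"
  let ?V = "\<lambda>\<omega>. A * h * (norm (X 1 \<omega>))\<^sup>2 + C * h * norm (Y 1 \<omega>)"
  let ?U = "\<lambda>\<omega>. ((2 * A * sqrt h) *\<^sub>R x) \<bullet> X 1 \<omega> + ?V \<omega>"
  have H1: "(\<lambda>\<omega>. A * h * (norm (X 1 \<omega>))\<^sup>2) \<in> H" "(\<lambda>\<omega>. C * h * norm (Y 1 \<omega>)) \<in> H"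
    by (rule scale_mem[OF norm_X_square_mem]) (rule scale_mem[OF norm_mem[OF rv_Y[OF order_refl]]])
  have H2: "?V \<in> H" by (rule add_mem[OF H1])
  have H3: "?U \<in> H" by (rule add_mem[OF inner_X_mem H2])
  have pt: "?g (\<kappa> + incr h \<omega>) \<le> ?U \<omega> + b" for \<omega>
  proof -
    have n2: "(norm (x + sqrt h *\<^sub>R X 1 \<omega>))\<^sup>2 = (norm x)\<^sup>2 + 2 * sqrt h * (x \<bullet> X 1 \<omega>) + h * (norm (X 1 \<omega>))\<^sup>2"
      using h by (simp add: power2_norm_eq_inner inner_add_left inner_add_right inner_commute algebra_simps flip: power2_eq_square)
    have "norm (y + h *\<^sub>R Y 1 \<omega>) \<le> norm y + h * norm (Y 1 \<omega>)"
      using norm_triangle_ineq[of y "h *\<^sub>R Y 1 \<omega>"] h by simp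
    then have n1: "C * (norm (y + h *\<^sub>R Y 1 \<omega>) + k * h * M1) \<le> C * (norm y + h * norm (Y 1 \<omega>) + k * h * M1)"
      using C by (intro mult_left_mono) auto
    have "?g (\<kappa> + incr h \<omega>) \<le> A * ((norm (x + sqrt h *\<^sub>R X 1 \<omega>))\<^sup>2 + k * h * M2)
        + C * (norm (y + h *\<^sub>R Y 1 \<omega>) + k * h * M1) + c"
    proof -
      have eq: "\<kappa> + incr h \<omega> = (x + sqrt h *\<^sub>R X 1 \<omega>, y + h *\<^sub>R Y 1 \<omega>, z + h powr (1/\<alpha>) *\<^sub>R Z 1 \<omega>)"
        by (simp add: \<kappa> incr_def scale_def)
      show ?thesis using Suc.IH[of "\<kappa> + incr h \<omega>"] unfolding eq fst_conv snd_conv .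
    qed
    then show ?thesis using n1 unfolding n2 b_def by (simp add: algebra_simps)
  qed
  have "(step E (incr h) ^^ Suc k) f \<kappa> = E (\<lambda>\<omega>. ?g (\<kappa> + incr h \<omega>))" by (simp add: step_def[of _ _ ?g])
  also have "\<dots> \<le> E ?U + b"
    by (rule E_mono_const[OF step_mem[OF rv_incr[OF h] step_pow_Cb_Lip[OF rv_incr[OF h] f]] H3 pt])
  also have "E ?U \<le> E (\<lambda>\<omega>. ((2 * A * sqrt h) *\<^sub>R x) \<bullet> X 1 \<omega>) + E ?V" by (rule subadd[OF inner_X_mem H2])
  also have "E (\<lambda>\<omega>. ((2 * A * sqrt h) *\<^sub>R x) \<bullet> X 1 \<omega>) \<le> 0" by (rule E_inner_X_le)
  also have "E ?V \<le> E (\<lambda>\<omega>. A * h * (norm (X 1 \<omega>))\<^sup>2) + E (\<lambda>\<omega>. C * h * norm (Y 1 \<omega>))" by (rule subadd[OF H1])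
  also have "\<dots> = A * h * M2 + C * h * M1"
    unfolding M2_eq M1_eq using A C h
    by (intro arg_cong2[of _ _ _ _ "(+)"] pos_hom norm_X_square_mem norm_mem rv_Y) auto
  finally show ?case by (simp add: b_def \<kappa> algebra_simps)
qed

lemma scaled_sum:
  "(\<Sum>i=1..k. scale \<alpha> h (X i \<omega>, Y i \<omega>, Z i \<omega>)) =
    (sqrt h *\<^sub>R partial_sum X k \<omega>, h *\<^sub>R partial_sum Y k \<omega>, h powr (1/\<alpha>) *\<^sub>R partial_sum Z k \<omega>)"
  by (simp add: scale_def partial_sum_def scaleR_sum_right sum_prod)

lemma E_sum_eq_step_pow:
  assumes "0 < h" "h \<le> 1" "f \<in> Cb_Lip"
  shows "E (\<lambda>\<omega>. f (a + (sqrt h *\<^sub>R partial_sum X k \<omega>, h *\<^sub>R partial_sum Y k \<omega>, h powr (1/\<alpha>) *\<^sub>R partial_sum Z k \<omega>)))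
    = (step E (incr h) ^^ k) f a"
  using iid_sum_eq_step_pow[OF iid _ norm_scale_diff_le[OF assms(1,2)] assms(3), of \<alpha> a k] \<alpha>
  unfolding scaled_sum incr_def[abs_def] by simp

text \<open>The increment of \<open>g\<close> is at most \<open>L\<close> times the sum of the three normalized block sums, and bounded. Truncation
  leaves a bounded Lipschitz function of the first two sums, whose expectation is a power of the one-step operator
  and is bounded by a quadratic majorant; optimizing the latter gives the square root. For the third sum the
  assumed uniform bound on \<open>k powr (-1/\<alpha>)\<close> times its first moment applies directly. The three powers of \<open>k h\<close> are at most
  \<open>sqrt (k h)\<close> because \<open>k h \<le> 1\<close> and \<open>\<alpha> \<le> 2\<close>.\<close>

lemma step_pow_time_regularity:
  assumes h: "0 < h" "k * h \<le> 1" and g: "g \<in> Cb_Lip" and L: "0 \<le> L"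
    and lip: "\<And>\<kappa> \<kappa>'. \<bar>g \<kappa> - g \<kappa>'\<bar> \<le> L * norm1 (\<kappa> - \<kappa>')"
  shows "\<bar>(step E (incr h) ^^ k) g \<kappa> - g \<kappa>\<bar> \<le> L * (sqrt M2 + M1 + Ms) * sqrt (k * h)"
proof (cases "k = 0")
  case True then show ?thesis by simp
next
  case False
  then have k: "1 \<le> k" by simp
  have kh: "0 < k * h" using h k by simp
  have "1 * h \<le> k * h" using k h by (intro mult_right_mono) auto
  then have h1: "h \<le> 1" using h by linarith
  obtain B where B: "0 \<le> B" "\<And>x. \<bar>g x\<bar> \<le> B" using Cb_LipE[OF g] by metis
  define f :: "'d vec3 \<Rightarrow> real" where "f \<kappa> = min (L * (norm (fst \<kappa>) + norm (fst (snd \<kappa>)))) (2 * B)" for \<kappa>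
  define V where "V \<omega> = (sqrt h *\<^sub>R partial_sum X k \<omega>, h *\<^sub>R partial_sum Y k \<omega>, h powr (1/\<alpha>) *\<^sub>R partial_sum Z k \<omega>)" for \<omega>
  have f: "f \<in> Cb_Lip"
  proof (rule Cb_LipI)
    show "\<bar>f x\<bar> \<le> 2 * B" for x
    proof -
      have "0 \<le> f x" using L B(1) by (simp add: f_def)
      then show ?thesis by (simp add: f_def)
    qed
    fix p q :: "'d vec3"
    have "\<bar>f p - f q\<bar> \<le> \<bar>L * (norm (fst p) + norm (fst (snd p))) - L * (norm (fst q) + norm (fst (snd q)))\<bar>"
      unfolding f_def by (simp add: min_def abs_if)
    also have "\<dots> = L * \<bar>(norm (fst p) - norm (fst q)) + (norm (fst (snd p)) - norm (fst (snd q)))\<bar>"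
    proof -
      have "L * (norm (fst p) + norm (fst (snd p))) - L * (norm (fst q) + norm (fst (snd q)))
        = L * ((norm (fst p) - norm (fst q)) + (norm (fst (snd p)) - norm (fst (snd q))))"
        by (simp add: algebra_simps)
      then show ?thesis using L by (simp only: abs_mult abs_of_nonneg)
    qed
    also have "\<dots> \<le> L * (norm (fst (p - q)) + norm (fst (snd (p - q))))"
      using L norm_triangle_ineq3[of "fst p" "fst q"] norm_triangle_ineq3[of "fst (snd p)" "fst (snd q)"]
      by (intro mult_left_mono order_trans[OF abs_triangle_ineq] add_mono) auto
    also have "\<dots> \<le> L * norm1 (p - q)" using L by (intro mult_left_mono) (auto simp: norm1_def)
    also have "\<dots> \<le> L * (2 * norm (p - q))" by (rule mult_left_mono[OF norm1_le L])
    finally show "\<bar>f p - f q\<bar> \<le> (L * 2) * norm (p - q)" by simp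
  qed
  have rvV: "random_vector H V"
    unfolding V_def[abs_def] scaled_sum[symmetric] using \<alpha> h h1
    by (intro random_vector_sum random_vector_Lipschitz[OF rv norm_scale_diff_le]) auto
  have fE: "E (\<lambda>\<omega>. f (V \<omega>)) \<le> L * sqrt (k * h * M2) + L * (k * h * M1)"
  proof -
    have eq: "E (\<lambda>\<omega>. f (V \<omega>)) = (step E (incr h) ^^ k) f 0"
      using E_sum_eq_step_pow[OF h(1) h1 f, of 0 k] by (simp add: V_def)
    have "(step E (incr h) ^^ k) f 0 - L * (k * h * M1) \<le> (L\<^sup>2 * (k * h * M2)) / (2 * l) + l / 2" if l: "0 < l" for l
    proof -
      have "f \<kappa> \<le> L\<^sup>2 / (2 * l) * (norm (fst \<kappa>))\<^sup>2 + L * norm (fst (snd \<kappa>)) + l / 2" for \<kappa>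
      proof -
        have "0 \<le> (L * norm (fst \<kappa>) - l)\<^sup>2" by simp
        then have "2 * l * (L * norm (fst \<kappa>)) \<le> L\<^sup>2 * (norm (fst \<kappa>))\<^sup>2 + l\<^sup>2"
          by (simp add: power2_eq_square algebra_simps)
        then have "L * norm (fst \<kappa>) \<le> (L\<^sup>2 * (norm (fst \<kappa>))\<^sup>2 + l\<^sup>2) / (2 * l)"
          using l by (simp add: field_simps)
        also have "\<dots> = L\<^sup>2 / (2 * l) * (norm (fst \<kappa>))\<^sup>2 + l / 2"
          using l by (simp add: field_simps power2_eq_square)
        finally show ?thesis by (simp add: f_def distrib_left min.coboundedI1)
      qed
      from step_pow_quadratic[OF h(1) h1 f _ L this, of k 0] l
      show ?thesis by simp
    qed
    then have "(step E (incr h) ^^ k) f 0 - L * (k * h * M1) \<le> sqrt (L\<^sup>2 * (k * h * M2))"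
      using M2_nonneg h by (intro le_sqrt_of_young) auto
    then show ?thesis using L unfolding eq by (simp add: real_sqrt_mult)
  qed
  have Zm: "(\<lambda>\<omega>. norm (partial_sum Z k \<omega>)) \<in> H" by (intro norm_mem random_vector_partial_sum rv_Z)
  have ZE: "E (\<lambda>\<omega>. L * norm (snd (snd (V \<omega>)))) \<le> L * ((k * h) powr (1/\<alpha>) * Ms)"
  proof -
    have "h powr (1/\<alpha>) = (k * h) powr (1/\<alpha>) * real k powr (- 1 / \<alpha>)"
      using h k by (simp add: powr_mult powr_minus field_simps flip: powr_add)
    then have "(\<lambda>\<omega>. L * norm (snd (snd (V \<omega>)))) =
        (\<lambda>\<omega>. (L * (k * h) powr (1/\<alpha>)) * (real k powr (- 1 / \<alpha>) * norm (partial_sum Z k \<omega>)))"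
      by (simp add: V_def fun_eq_iff)
    then have "E (\<lambda>\<omega>. L * norm (snd (snd (V \<omega>)))) =
        (L * (k * h) powr (1/\<alpha>)) * E (\<lambda>\<omega>. real k powr (- 1 / \<alpha>) * norm (partial_sum Z k \<omega>))"
      using L by (simp only:) (rule pos_hom[OF scale_mem[OF Zm]], simp)
    also have "\<dots> \<le> (L * (k * h) powr (1/\<alpha>)) * Ms"
      using L by (intro mult_left_mono Z_sum_moment_le k) simp
    finally show ?thesis by simp
  qed
  have fm: "(\<lambda>\<omega>. f (V \<omega>)) \<in> H" by (rule Cb_Lip_mem[OF rvV f])
  have Zm': "(\<lambda>\<omega>. L * norm (snd (snd (V \<omega>)))) \<in> H"
  proof -
    have "(\<lambda>\<omega>. (L * h powr (1/\<alpha>)) * norm (partial_sum Z k \<omega>)) \<in> H" by (rule scale_mem[OF Zm])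
    then show ?thesis by (simp add: V_def mult.assoc)
  qed
  have gm: "(\<lambda>\<omega>. g (\<kappa> + V \<omega>)) \<in> H" by (rule step_mem[OF rvV g])
  have "\<bar>(step E (incr h) ^^ k) g \<kappa> - g \<kappa>\<bar> = \<bar>E (\<lambda>\<omega>. g (\<kappa> + V \<omega>)) - E (\<lambda>_. g \<kappa>)\<bar>"
    using E_sum_eq_step_pow[OF h(1) h1 g, of \<kappa> k] by (simp add: V_def const)
  also have "\<dots> \<le> E (\<lambda>\<omega>. f (V \<omega>) + L * norm (snd (snd (V \<omega>))))"
  proof (rule E_diff_le_E[OF gm const_mem add_mem[OF fm Zm']])
    fix \<omega>
    have 1: "\<bar>g (\<kappa> + V \<omega>) - g \<kappa>\<bar> \<le> L * (norm (fst (V \<omega>)) + norm (fst (snd (V \<omega>)))) + L * norm (snd (snd (V \<omega>)))"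
      using lip[of "\<kappa> + V \<omega>" \<kappa>] by (simp add: norm1_def algebra_simps)
    have 2: "\<bar>g (\<kappa> + V \<omega>) - g \<kappa>\<bar> \<le> 2 * B" using B(2)[of "\<kappa> + V \<omega>"] B(2)[of \<kappa>] by linarith
    have 3: "0 \<le> L * norm (snd (snd (V \<omega>)))" using L by simp
    show "\<bar>g (\<kappa> + V \<omega>) - g \<kappa>\<bar> \<le> f (V \<omega>) + L * norm (snd (snd (V \<omega>)))"
      unfolding f_def using 1 2 3 by (simp add: min_def)
  qed
  also have "\<dots> \<le> E (\<lambda>\<omega>. f (V \<omega>)) + E (\<lambda>\<omega>. L * norm (snd (snd (V \<omega>))))" by (rule subadd[OF fm Zm'])
  also have "\<dots> \<le> L * sqrt (k * h * M2) + L * (k * h * M1) + L * ((k * h) powr (1/\<alpha>) * Ms)"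
    using fE ZE by linarith
  also have "\<dots> \<le> L * (sqrt (k * h) * sqrt M2) + L * (sqrt (k * h) * M1) + L * (sqrt (k * h) * Ms)"
  proof -
    have s: "k * h \<le> sqrt (k * h)"
      using kh h(2) by (intro real_le_rsqrt) (simp add: power2_eq_square mult_left_le)
    have "(k * h) powr (1/\<alpha>) \<le> (k * h) powr (1/2)"
      using kh h(2) \<alpha> by (intro powr_mono') (auto simp: field_simps)
    then have "(k * h) powr (1/\<alpha>) \<le> sqrt (k * h)" using kh by (simp add: powr_half_sqrt)
    then show ?thesis
      using s L M1_nonneg Ms_nonneg
      by (intro add_mono mult_left_mono mult_right_mono) (auto simp: real_sqrt_mult)
  qed
  also have "\<dots> = L * (sqrt M2 + M1 + Ms) * sqrt (k * h)" by (simp add: algebra_simps)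
  finally show ?thesis .
qed

end

section \<open>Mollification as a convolution\<close>

definition clamp01 :: "real \<Rightarrow> real" where
  "clamp01 t = min 1 (max 0 t)"

text \<open>Constant continuation in both directions. It agrees with the extension used in \<^const>\<open>mollify\<close> at nonnegative
  times and keeps the mollification smooth at all times, so that it can be shifted.\<close>

definition time_ext :: "(real \<Rightarrow> 'a \<Rightarrow> real) \<Rightarrow> real \<times> 'a \<Rightarrow> real" where
  "time_ext v p = v (clamp01 (fst p)) (snd p)"

lemma clamp01: "0 \<le> clamp01 t" "clamp01 t \<le> 1" "clamp01 t \<in> {0..1}"
  by (auto simp: clamp01_def)

lemma clamp01_id: "0 \<le> t \<Longrightarrow> t \<le> 1 \<Longrightarrow> clamp01 t = t"
  by (simp add: clamp01_def)

lemma kernel_weighted_integrable: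
  fixes \<rho> :: "real \<times> 'd::finite vec3 \<Rightarrow> real"
  assumes \<rho>: "mollifier \<rho>" "0 < \<epsilon>" "\<epsilon> \<le> 1"
    and V: "V \<in> borel_measurable borel" "\<And>p. \<bar>V p\<bar> \<le> B"
  shows "integrable lborel (\<lambda>q. V (p - q) * scaled_kernel \<rho> \<epsilon> q)"
proof (rule Bochner_Integration.integrable_bound)
  show "integrable lborel (\<lambda>q. B * scaled_kernel \<rho> \<epsilon> q)" using scaled_kernel_integrable[OF \<rho>] by simp
  have "(\<lambda>q. V (p - q)) \<in> borel_measurable borel" by (rule measurable_compose[OF _ V(1)]) simp
  then show "(\<lambda>q. V (p - q) * scaled_kernel \<rho> \<epsilon> q) \<in> borel_measurable lborel"
    using scaled_kernel_measurable[OF \<rho>] by simp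
  show "AE q in lborel. norm (V (p - q) * scaled_kernel \<rho> \<epsilon> q) \<le> norm (B * scaled_kernel \<rho> \<epsilon> q)"
  proof (rule AE_I2)
    fix q
    have "\<bar>V (p - q)\<bar> \<le> \<bar>B\<bar>" using V(2)[of "p - q"] by linarith
    then show "norm (V (p - q) * scaled_kernel \<rho> \<epsilon> q) \<le> norm (B * scaled_kernel \<rho> \<epsilon> q)"
      unfolding real_norm_def abs_mult by (rule mult_right_mono) simp
  qed
qed

lemma conv_diff_le:
  fixes \<rho> :: "real \<times> 'd::finite vec3 \<Rightarrow> real"
  assumes \<rho>: "mollifier \<rho>" "0 < \<epsilon>" "\<epsilon> \<le> 1"
    and V: "V \<in> borel_measurable borel" "\<And>p. \<bar>V p\<bar> \<le> B"
    and V': "V' \<in> borel_measurable borel" "\<And>p. \<bar>V' p\<bar> \<le> B'"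
    and c: "\<And>q. scaled_kernel \<rho> \<epsilon> q \<noteq> 0 \<Longrightarrow> \<bar>V (p - q) - V' (p' - q)\<bar> \<le> c"
  shows "\<bar>conv V (scaled_kernel \<rho> \<epsilon>) p - conv V' (scaled_kernel \<rho> \<epsilon>) p'\<bar> \<le> c"
proof -
  let ?k = "scaled_kernel \<rho> \<epsilon>"
  note km = scaled_kernel_measurable[OF \<rho>] and ki = scaled_kernel_integrable[OF \<rho>]
  note i = kernel_weighted_integrable[OF \<rho> V, of p] kernel_weighted_integrable[OF \<rho> V', of p']
  have "conv V ?k p - conv V' ?k p' = (\<integral>q. V (p - q) * ?k q - V' (p' - q) * ?k q \<partial>lborel)"
    unfolding conv_commute[OF V(1) km] conv_commute[OF V'(1) km]
    by (rule Bochner_Integration.integral_diff[OF i, symmetric])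
  also have "\<bar>\<dots>\<bar> \<le> (\<integral>q. \<bar>V (p - q) * ?k q - V' (p' - q) * ?k q\<bar> \<partial>lborel)"
    by (rule integral_abs_bound)
  also have "\<dots> \<le> (\<integral>q. c * ?k q \<partial>lborel)"
  proof (rule integral_mono)
    show "integrable lborel (\<lambda>q. \<bar>V (p - q) * ?k q - V' (p' - q) * ?k q\<bar>)"
      by (intro integrable_abs Bochner_Integration.integrable_diff i)
    show "integrable lborel (\<lambda>q. c * ?k q)" using ki by simp
    fix q
    show "\<bar>V (p - q) * ?k q - V' (p' - q) * ?k q\<bar> \<le> c * ?k q"
    proof (cases "?k q = 0")
      case False
      have "\<bar>V (p - q) * ?k q - V' (p' - q) * ?k q\<bar> = \<bar>V (p - q) - V' (p' - q)\<bar> * ?k q"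
        using scaled_kernel_nonneg[OF \<rho>(1,2), of q] by (simp add: abs_mult flip: left_diff_distrib)
      also have "\<dots> \<le> c * ?k q"
        by (rule mult_right_mono[OF c[OF False] scaled_kernel_nonneg[OF \<rho>(1,2)]])
      finally show ?thesis .
    qed simp
  qed
  also have "\<dots> = c" using integral_scaled_kernel[OF \<rho>] by simp
  finally show ?thesis .
qed

lemma conv_close:
  fixes \<rho> :: "real \<times> 'd::finite vec3 \<Rightarrow> real"
  assumes \<rho>: "mollifier \<rho>" "0 < \<epsilon>" "\<epsilon> \<le> 1"
    and V: "V \<in> borel_measurable borel" "\<And>p. \<bar>V p\<bar> \<le> B"
    and c: "\<And>q. scaled_kernel \<rho> \<epsilon> q \<noteq> 0 \<Longrightarrow> \<bar>V (p - q) - a\<bar> \<le> c"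
  shows "\<bar>conv V (scaled_kernel \<rho> \<epsilon>) p - a\<bar> \<le> c"
proof -
  have "\<bar>conv V (scaled_kernel \<rho> \<epsilon>) p - conv (\<lambda>_. a) (scaled_kernel \<rho> \<epsilon>) p\<bar> \<le> c"
    by (rule conv_diff_le[OF \<rho> V _ _ c, where B' = "\<bar>a\<bar>"]) simp_all
  moreover have "conv (\<lambda>_. a) (scaled_kernel \<rho> \<epsilon>) p = a"
    using conv_commute[OF _ scaled_kernel_measurable[OF \<rho>], of "\<lambda>_. a" p] integral_scaled_kernel[OF \<rho>] by simp
  ultimately show ?thesis by simp
qed

text \<open>The kernel only reaches forward in time, and at nonnegative times the two extensions of the function agree.\<close>

lemma mollify_eq_conv:
  fixes \<rho> :: "real \<times> 'd::finite vec3 \<Rightarrow> real"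
  assumes \<rho>: "mollifier \<rho>" "0 < \<epsilon>" "\<epsilon> \<le> 1"
    and V: "time_ext v \<in> borel_measurable borel" "\<And>p. \<bar>time_ext v p\<bar> \<le> B" and t: "0 \<le> t"
  shows "mollify \<rho> \<epsilon> v t \<kappa> = conv (time_ext v) (scaled_kernel \<rho> \<epsilon>) (t, \<kappa>)"
proof -
  let ?k = "scaled_kernel \<rho> \<epsilon>"
  let ?f = "\<lambda>q. time_ext v ((t, \<kappa>) - q) * ?k q"
  have i: "integrable (lborel \<Otimes>\<^sub>M lborel) ?f"
    using kernel_weighted_integrable[OF \<rho> V, of "(t, \<kappa>)"] by (simp add: lborel_prod)
  have supp: "?k (\<tau>, e) = 0" if "\<not> (- (\<epsilon>\<^sup>2) \<le> \<tau> \<and> \<tau> \<le> 0 \<and> norm e < \<epsilon>)" for \<tau> e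
    using scaled_kernel_support[OF \<rho>(1,2), of "(\<tau>, e)"] that by fastforce
  have "conv (time_ext v) ?k (t, \<kappa>) = (\<integral>q. ?f q \<partial>(lborel \<Otimes>\<^sub>M lborel))"
    unfolding conv_commute[OF V(1) scaled_kernel_measurable[OF \<rho>]] by (simp add: lborel_prod)
  also have "\<dots> = (\<integral>\<tau>. (\<integral>e. ?f (\<tau>, e) \<partial>lborel) \<partial>lborel)"
    by (rule lborel_pair.integral_fst'[OF i, symmetric])
  also have "\<dots> = mollify \<rho> \<epsilon> v t \<kappa>"
    unfolding mollify_def set_lebesgue_integral_def
  proof (intro Bochner_Integration.integral_cong refl)
    fix \<tau> :: real
    have "(\<integral>e. ?f (\<tau>, e) \<partial>lborel) = (\<integral>e. indicator {- (\<epsilon>\<^sup>2)..0} \<tau> *\<^sub>R (indicator (ball 0 \<epsilon>) e *\<^sub>R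
        (v (min 1 (t - \<tau>)) (\<kappa> - e) * rho_eps \<rho> \<epsilon> \<tau> e)) \<partial>lborel)"
    proof (intro Bochner_Integration.integral_cong refl)
      fix e :: "'d vec3"
      show "?f (\<tau>, e) = indicator {- (\<epsilon>\<^sup>2)..0} \<tau> *\<^sub>R (indicator (ball 0 \<epsilon>) e *\<^sub>R
        (v (min 1 (t - \<tau>)) (\<kappa> - e) * rho_eps \<rho> \<epsilon> \<tau> e))"
      proof (cases "- (\<epsilon>\<^sup>2) \<le> \<tau> \<and> \<tau> \<le> 0 \<and> norm e < \<epsilon>")
        case True
        then have "clamp01 (t - \<tau>) = min 1 (t - \<tau>)" using t by (simp add: clamp01_def)
        then show ?thesis using True by (simp add: time_ext_def scaled_kernel_def)
      next
        case False
        then show ?thesis using supp[OF False] by (auto simp: indicator_def)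
      qed
    qed
    then show "(\<integral>e. ?f (\<tau>, e) \<partial>lborel) = indicator {- (\<epsilon>\<^sup>2)..0} \<tau> *\<^sub>R (\<integral>e. indicator (ball 0 \<epsilon>) e *\<^sub>R
        (v (min 1 (t - \<tau>)) (\<kappa> - e) * rho_eps \<rho> \<epsilon> \<tau> e) \<partial>lborel)"
      by (simp only: integral_scaleR_right)
  qed
  finally show ?thesis by simp
qed

lemma pide_op_cong:
  fixes P :: "real \<times> 'd::finite vec3 \<Rightarrow> real"
  assumes P: "strip_smooth (Suc (Suc n)) P" and t: "t \<in> {0<..1}"
    and eq: "\<And>t \<kappa>. 0 \<le> t \<Longrightarrow> u t \<kappa> = P (t, \<kappa>)"
  shows "pide_op \<Theta> u t x y z = pide \<Theta> P (t, x, y, z)"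
proof -
  have "((\<lambda>s. u s (x, y, z)) has_vector_derivative pd (1, 0) P (t, x, y, z)) (at t within {0<..1})"
    by (rule has_vector_derivative_transform[OF t _ time_slice_derivative[OF P]]) (use eq in simp)
  then have "time_deriv u t (x, y, z) = pd (1, 0) P (t, x, y, z)"
    unfolding time_deriv_def by (rule vector_derivative_within[OF unit_interval_not_bot[OF t]])
  also have "\<dots> = time_deriv (\<lambda>t \<kappa>. P (t, \<kappa>)) t (x, y, z)"
    by (rule time_deriv_strip_smooth[OF P t, symmetric])
  finally have "pide_op \<Theta> u t x y z = pide_op \<Theta> (\<lambda>t \<kappa>. P (t, \<kappa>)) t x y z"
    using eq t unfolding pide_op_def by simp
  then show ?thesis using pide_op_eq[OF P t] by simp
qed

section \<open>Jensen's inequality for mollified functions\<close>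

text \<open>Finitely many measurable pieces of the time axis carry the time dependence up to \<open>\<delta>\<close>, uniformly in space. This
  covers both uniformly continuous functions and functions that are piecewise constant in time.\<close>

definition finitely_patched :: "(real \<times> 'a \<Rightarrow> real) \<Rightarrow> bool" where
  "finitely_patched V \<longleftrightarrow> (\<forall>\<delta>>0. \<exists>g :: real \<Rightarrow> nat. g \<in> borel \<rightarrow>\<^sub>M count_space UNIV \<and> finite (range g) \<and>
     (\<forall>t t' \<kappa>. g t = g t' \<longrightarrow> \<bar>V (t, \<kappa>) - V (t', \<kappa>)\<bar> \<le> \<delta>))"

text \<open>The mollification is an average of shifts, so a one-step inequality for the shifts passes to the average by
  \<open>Jensen\<close>. The cells combine the pieces of the time axis with a cover of the spatial support by small balls.\<close>

lemma (in sublinear_expectation) conv_Jensen: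
  fixes \<rho> :: "real \<times> 'd::finite vec3 \<Rightarrow> real"
  assumes \<rho>: "mollifier \<rho>" "0 < \<epsilon>" "\<epsilon> \<le> 1" and D: "random_vector H D"
    and V: "V \<in> borel_measurable borel" "\<And>p. \<bar>V p\<bar> \<le> B"
    and L: "0 \<le> L" "\<And>t \<kappa> \<kappa>'. \<bar>V (t, \<kappa>) - V (t, \<kappa>')\<bar> \<le> L * norm (\<kappa> - \<kappa>')"
    and patch: "finitely_patched V"
    and sup: "\<And>q. scaled_kernel \<rho> \<epsilon> q \<noteq> 0 \<Longrightarrow> E (\<lambda>\<omega>. V ((r, \<kappa> + D \<omega>) - q)) \<le> V ((r', \<kappa>) - q)"
  shows "E (\<lambda>\<omega>. conv V (scaled_kernel \<rho> \<epsilon>) (r, \<kappa> + D \<omega>)) \<le> conv V (scaled_kernel \<rho> \<epsilon>) (r', \<kappa>)"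
proof -
  let ?k = "scaled_kernel \<rho> \<epsilon>"
  let ?F = "\<lambda>q y. V ((r, \<kappa> + y) - q)"
  have cc: "conv V ?k p = (\<integral>q. ?k q * V (p - q) \<partial>lborel)" for p
    unfolding conv_commute[OF V(1) scaled_kernel_measurable[OF \<rho>]] by (simp add: mult.commute)
  have m: "(\<lambda>q. V (p - q)) \<in> borel_measurable lborel" for p
  proof -
    have "(\<lambda>q. V (p - q)) \<in> borel_measurable borel" by (rule measurable_compose[OF _ V(1)]) simp
    then show ?thesis by simp
  qed
  have "E (\<lambda>\<omega>. \<integral>q. ?k q * ?F q (D \<omega>) \<partial>lborel) \<le> (\<integral>q. ?k q * V ((r', \<kappa>) - q) \<partial>lborel)"
  proof (rule Jensen[OF D scaled_kernel_integrable[OF \<rho>] scaled_kernel_nonneg[OF \<rho>(1,2)] _ V(2) m m V(2) sup])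
    show "\<bar>?F q y - ?F q y'\<bar> \<le> L * norm (y - y')" for q y y'
      using L(2)[of "r - fst q" "\<kappa> + y - snd q" "\<kappa> + y' - snd q"] by (cases q) simp
    fix \<delta> :: real assume \<delta>: "0 < \<delta>"
    then obtain g :: "real \<Rightarrow> nat" where g: "g \<in> borel \<rightarrow>\<^sub>M count_space UNIV" "finite (range g)"
      "\<And>t t' \<kappa>. g t = g t' \<Longrightarrow> \<bar>V (t, \<kappa>) - V (t', \<kappa>)\<bar> \<le> \<delta> / 2"
      using patch unfolding finitely_patched_def by (meson half_gt_zero)
    define d where "d = \<delta> / (4 * (L + 1))"
    have d: "0 < d" using \<delta> L(1) by (simp add: d_def)
    have Ld: "L * (2 * d) \<le> \<delta> / 2"
    proof -
      have "L * (2 * d) = \<delta> / 2 * (L / (L + 1))" using L(1) by (simp add: d_def field_simps)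
      also have "\<dots> \<le> \<delta> / 2 * 1" using \<delta> L(1) by (intro mult_left_mono) auto
      finally show ?thesis by simp
    qed
    obtain C where C: "finite C" "cball (0::'d vec3) \<epsilon> \<subseteq> (\<Union>c\<in>C. ball c d)"
      using compact_cball[of "0::'d vec3" \<epsilon>] d unfolding compact_eq_totally_bounded by meson
    define patch where "patch i c = {q :: real \<times> 'd vec3. g (r - fst q) = i \<and> snd q \<in> ball c d}" for i c
    have pm: "patch i c \<in> sets lborel" for i c
    proof -
      have "(\<lambda>q :: real \<times> 'd vec3. r - fst q) \<in> borel \<rightarrow>\<^sub>M borel"
        by (intro borel_measurable_continuous_onI continuous_intros)
      then have "(\<lambda>q :: real \<times> 'd vec3. g (r - fst q)) \<in> borel \<rightarrow>\<^sub>M count_space UNIV"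
        by (rule measurable_compose[OF _ g(1)])
      from measurable_sets[OF this, of "{i}"]
      have "{q :: real \<times> 'd vec3. g (r - fst q) = i} \<in> sets borel" by (simp add: vimage_def)
      moreover have "{q :: real \<times> 'd vec3. snd q \<in> ball c d} \<in> sets borel"
      proof (rule borel_open)
        have "{q :: real \<times> 'd vec3. snd q \<in> ball c d} = UNIV \<times> ball c d" by auto
        then show "open {q :: real \<times> 'd vec3. snd q \<in> ball c d}" by (simp add: open_Times)
      qed
      ultimately have "{q :: real \<times> 'd vec3. g (r - fst q) = i} \<inter> {q. snd q \<in> ball c d} \<in> sets borel"
        by (rule sets.Int)
      then show ?thesis by (simp add: patch_def Collect_conj_eq)
    qed
    have close: "\<bar>?F q y - ?F q' y\<bar> \<le> \<delta>" if "q \<in> patch i c" "q' \<in> patch i c" for i c q q' y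
    proof -
      obtain \<tau> e \<tau>' e' where q: "q = (\<tau>, e)" "q' = (\<tau>', e')" by (cases q, cases q')
      have gg: "g (r - \<tau>) = g (r - \<tau>')" and ee: "dist c e < d" "dist c e' < d"
        using that by (auto simp: patch_def q)
      have "norm (e' - e) \<le> 2 * d" using dist_triangle3[of e' e c] ee by (simp add: dist_norm)
      then have "L * norm ((\<kappa> + y - e) - (\<kappa> + y - e')) \<le> L * (2 * d)" using L(1) by (intro mult_left_mono) simp_all
      then have "\<bar>V (r - \<tau>', \<kappa> + y - e) - V (r - \<tau>', \<kappa> + y - e')\<bar> \<le> \<delta> / 2"
        using L(2)[of "r - \<tau>'" "\<kappa> + y - e" "\<kappa> + y - e'"] Ld by linarith
      moreover have "\<bar>V (r - \<tau>, \<kappa> + y - e) - V (r - \<tau>', \<kappa> + y - e)\<bar> \<le> \<delta> / 2" by (rule g(3)[OF gg])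
      ultimately have "\<bar>V (r - \<tau>, \<kappa> + y - e) - V (r - \<tau>', \<kappa> + y - e')\<bar> \<le> \<delta>" by linarith
      then show ?thesis by (simp add: q)
    qed
    show "\<exists>\<A>. finite \<A> \<and> \<A> \<subseteq> sets lborel \<and> (\<forall>q\<in>space lborel. ?k q \<noteq> 0 \<longrightarrow> q \<in> \<Union>\<A>) \<and>
        (\<forall>A\<in>\<A>. \<forall>q\<in>A. \<forall>q'\<in>A. \<forall>y. \<bar>?F q y - ?F q' y\<bar> \<le> \<delta>)"
    proof (intro exI[of _ "(\<lambda>(i, c). patch i c) ` (range g \<times> C)"] conjI ballI impI allI)
      show "finite ((\<lambda>(i, c). patch i c) ` (range g \<times> C))" using g(2) C(1) by simp
      show "(\<lambda>(i, c). patch i c) ` (range g \<times> C) \<subseteq> sets lborel" using pm by auto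
      show "q \<in> \<Union> ((\<lambda>(i, c). patch i c) ` (range g \<times> C))" if "?k q \<noteq> 0" for q
      proof -
        have "snd q \<in> cball 0 \<epsilon>" using scaled_kernel_support(3)[OF \<rho>(1,2) that] by simp
        then obtain c where "c \<in> C" "snd q \<in> ball c d" using C(2) by blast
        then show ?thesis by (auto simp: patch_def intro!: bexI[of _ "(g (r - fst q), c)"])
      qed
      show "\<bar>?F q y - ?F q' y\<bar> \<le> \<delta>"
        if A: "A \<in> (\<lambda>(i, c). patch i c) ` (range g \<times> C)" and qA: "q \<in> A" "q' \<in> A" for A q q' y
      proof -
        obtain ic where "A = (case ic of (i, c) \<Rightarrow> patch i c)" using A by (elim imageE)
        then have "A = patch (fst ic) (snd ic)" by (simp only: case_prod_beta)
        then show ?thesis using close qA by blast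
      qed
    qed
  qed
  then show ?thesis unfolding cc .
qed

section \<open>Regularity of the value function\<close>

definition parabolic_Hoelder :: "real \<Rightarrow> (real \<Rightarrow> 'd::finite vec3 \<Rightarrow> real) \<Rightarrow> bool" where
  "parabolic_Hoelder C u \<longleftrightarrow> (\<forall>t\<in>{0..1}. \<forall>t'\<in>{0..1}. \<forall>\<kappa> \<kappa>'.
     \<bar>u t \<kappa> - u t' \<kappa>'\<bar> \<le> C * (sqrt \<bar>t - t'\<bar> + norm1 (\<kappa> - \<kappa>')))"

lemma parabolic_HoelderD:
  assumes "parabolic_Hoelder C u" "0 \<le> t" "t \<le> 1" "0 \<le> t'" "t' \<le> 1"
  shows "\<bar>u t \<kappa> - u t' \<kappa>'\<bar> \<le> C * (sqrt \<bar>t - t'\<bar> + norm1 (\<kappa> - \<kappa>'))"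
  using assms unfolding parabolic_Hoelder_def by auto

lemma time_ext_measurable:
  assumes "cont_bdd_on {0..1} u"
  shows "time_ext u \<in> borel_measurable borel"
proof (rule borel_measurable_continuous_onI)
  have "continuous_on ({0..1} \<times> UNIV) (\<lambda>(t, \<kappa>). u t \<kappa>)" using assms by (simp add: cont_bdd_on_def)
  moreover have "continuous_on UNIV (\<lambda>p :: real \<times> 'a. (clamp01 (fst p), snd p))"
    unfolding clamp01_def by (intro continuous_intros)
  ultimately have "continuous_on UNIV (\<lambda>p. (\<lambda>(t, \<kappa>). u t \<kappa>) (clamp01 (fst p), snd p))"
    by (rule continuous_on_compose2) (use clamp01 in auto)
  then show "continuous_on UNIV (time_ext u)" by (simp add: time_ext_def[abs_def])
qed

lemma finitely_patched_Hoelder: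
  assumes u: "parabolic_Hoelder C u" and C: "0 \<le> C"
  shows "finitely_patched (time_ext u)"
  unfolding finitely_patched_def
proof (intro allI impI)
  fix \<delta> :: real assume \<delta>: "0 < \<delta>"
  define N where "N = ((C + 1) / \<delta>)\<^sup>2"
  have N: "0 < N" using \<delta> C by (simp add: N_def)
  have CN: "C * sqrt (1 / N) \<le> \<delta>"
  proof -
    have "sqrt (1 / N) = \<delta> / (C + 1)" using \<delta> C by (simp add: N_def real_sqrt_divide)
    then have "C * sqrt (1 / N) = \<delta> * (C / (C + 1))" by simp
    also have "\<dots> \<le> \<delta> * 1" using \<delta> C by (intro mult_left_mono) auto
    finally show ?thesis by simp
  qed
  define g where "g t = nat \<lfloor>N * clamp01 t\<rfloor>" for t
  show "\<exists>g :: real \<Rightarrow> nat. g \<in> borel \<rightarrow>\<^sub>M count_space UNIV \<and> finite (range g) \<and>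
     (\<forall>t t' \<kappa>. g t = g t' \<longrightarrow> \<bar>time_ext u (t, \<kappa>) - time_ext u (t', \<kappa>)\<bar> \<le> \<delta>)"
  proof (intro exI[of _ g] conjI allI impI)
    show "g \<in> borel \<rightarrow>\<^sub>M count_space UNIV"
      unfolding g_def clamp01_def by measurable
    have "g t \<le> nat \<lfloor>N\<rfloor>" for t
      unfolding g_def using clamp01[of t] N by (intro nat_mono floor_mono) (simp add: mult_left_le)
    then have "range g \<subseteq> {..nat \<lfloor>N\<rfloor>}" by auto
    then show "finite (range g)" by (rule finite_subset) simp
    fix t t' \<kappa> assume "g t = g t'"
    then have "\<lfloor>N * clamp01 t\<rfloor> = \<lfloor>N * clamp01 t'\<rfloor>"
      unfolding g_def using N clamp01(1) by (subst (asm) eq_nat_nat_iff) auto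
    then have "\<bar>N * clamp01 t - N * clamp01 t'\<bar> \<le> 1" by linarith
    then have "N * \<bar>clamp01 t - clamp01 t'\<bar> \<le> 1" using N by (simp add: abs_mult flip: right_diff_distrib)
    then have "\<bar>clamp01 t - clamp01 t'\<bar> \<le> 1 / N" using N by (simp add: field_simps)
    then have "C * sqrt \<bar>clamp01 t - clamp01 t'\<bar> \<le> C * sqrt (1 / N)"
      using C by (intro mult_left_mono real_sqrt_le_mono)
    then show "\<bar>time_ext u (t, \<kappa>) - time_ext u (t', \<kappa>)\<bar> \<le> \<delta>"
      using parabolic_HoelderD[OF u clamp01(1,2) clamp01(1,2), of t \<kappa> t' \<kappa>] CN
      by (simp add: time_ext_def norm1_def)
  qed
qed

text \<open>Split \<open>L (t + s)\<close> into \<open>L s\<close> and an independent increment with the law of \<open>L t\<close>.\<close>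

lemma value_fun_dynamic_programming:
  fixes L :: "real \<Rightarrow> 'v \<Rightarrow> 'a::euclidean_space"
  assumes "sublinear_expectation H E" and L: "nonlinear_levy H E L" and \<phi>: "\<phi> \<in> Cb_Lip"
    and ts: "0 \<le> t" "0 \<le> s" "t + s \<le> 1"
  shows "value_fun E L \<phi> (t + s) \<kappa> = E (\<lambda>\<omega>. value_fun E L \<phi> t (\<kappa> + L s \<omega>))"
proof -
  obtain B C where B: "\<And>x. \<bar>\<phi> x\<bar> \<le> B" and C: "0 \<le> C" "\<And>x y. \<bar>\<phi> x - \<phi> y\<bar> \<le> C * norm (x - y)"
    using Cb_LipE[OF \<phi>] by metis
  let ?I = "\<lambda>\<omega>. L (t + s) \<omega> - L s \<omega>"
  have "\<forall>n s t \<tau>. (\<forall>j<n. 0 \<le> \<tau> j \<and> \<tau> j \<le> s) \<and> (\<forall>i j. i \<le> j \<and> j < n \<longrightarrow> \<tau> i \<le> \<tau> j)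
          \<and> 0 \<le> s \<and> s \<le> t \<and> t \<le> 1 \<longrightarrow>
        indep_from E n (\<lambda>j. L (\<tau> j)) (\<lambda>\<omega>. L t \<omega> - L s \<omega>)"
    using L unfolding nonlinear_levy_def by blast
  from this[rule_format, of 1 "\<lambda>_. s" s "t + s"] have ind: "indep_from E 1 (\<lambda>_. L s) ?I"
    using ts by simp
  define \<Phi> where "\<Phi> v y = \<phi> (\<kappa> + v 0 + y)" for v :: "nat \<Rightarrow> 'a" and y
  have "\<bar>\<Phi> v y - \<Phi> w y'\<bar> \<le> C * ((\<Sum>j<1. norm (v j - w j)) + norm (y - y'))" for v w y y'
  proof -
    have "\<bar>\<Phi> v y - \<Phi> w y'\<bar> \<le> C * norm ((v 0 - w 0) + (y - y'))"
      unfolding \<Phi>_def by (rule order_trans[OF C(2)]) (simp add: algebra_simps)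
    also have "\<dots> \<le> C * (norm (v 0 - w 0) + norm (y - y'))"
      using C(1) by (intro mult_left_mono norm_triangle_ineq)
    finally show ?thesis by simp
  qed
  moreover have "\<bar>\<Phi> v y\<bar> \<le> B" for v y by (simp add: \<Phi>_def B)
  ultimately have "E (\<lambda>\<omega>. \<Phi> (\<lambda>_. L s \<omega>) (?I \<omega>)) = E (\<lambda>\<omega>. E (\<lambda>\<omega>'. \<Phi> (\<lambda>_. L s \<omega>) (?I \<omega>')))"
    using ind unfolding indep_from_def by blast
  moreover have "E (\<lambda>\<omega>'. \<phi> (b + ?I \<omega>')) = value_fun E L \<phi> t b" for b
  proof -
    have "\<forall>s t. 0 \<le> s \<and> s \<le> t \<and> t \<le> 1 \<longrightarrow> eq_dist E (\<lambda>\<omega>. L t \<omega> - L s \<omega>) E (L (t - s))"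
      using L unfolding nonlinear_levy_def by blast
    then have "eq_dist E ?I E (L (t + s - s))" using ts by (elim allE[of _ s] allE[of _ "t + s"]) simp
    then have "\<forall>\<phi>\<in>Cb_Lip. E (\<lambda>\<omega>. \<phi> (?I \<omega>)) = E (\<lambda>\<omega>. \<phi> (L t \<omega>))" by (simp add: eq_dist_def)
    from bspec[OF this Cb_Lip_translate[OF \<phi>, of b]] show ?thesis unfolding value_fun_def .
  qed
  ultimately have "E (\<lambda>\<omega>. \<phi> (\<kappa> + L s \<omega> + ?I \<omega>)) = E (\<lambda>\<omega>. value_fun E L \<phi> t (\<kappa> + L s \<omega>))"
    by (simp only: \<Phi>_def)
  then show ?thesis by (simp add: value_fun_def add.assoc)
qed

section \<open>Mollified functions near the data\<close>

lemma mollified_slice_Cb_Lip: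
  fixes \<rho> :: "real \<times> 'd::finite vec3 \<Rightarrow> real"
  assumes \<rho>: "mollifier \<rho>" "0 < \<epsilon>" "\<epsilon> \<le> 1"
    and V: "V \<in> borel_measurable borel" "\<And>p. \<bar>V p\<bar> \<le> B"
    and L: "\<And>t \<kappa> \<kappa>'. \<bar>V (t, \<kappa>) - V (t, \<kappa>')\<bar> \<le> L * norm (\<kappa> - \<kappa>')"
  shows "(\<lambda>\<kappa>. conv V (scaled_kernel \<rho> \<epsilon>) (t, \<kappa>)) \<in> Cb_Lip"
proof (rule Cb_LipI)
  show "\<bar>conv V (scaled_kernel \<rho> \<epsilon>) (t, \<kappa>)\<bar> \<le> B" for \<kappa>
    using conv_close[OF \<rho> V, of "(t, \<kappa>)" 0 B] V(2) by simp
  show "\<bar>conv V (scaled_kernel \<rho> \<epsilon>) (t, \<kappa>) - conv V (scaled_kernel \<rho> \<epsilon>) (t, \<kappa>')\<bar> \<le> L * norm (\<kappa> - \<kappa>')" for \<kappa> \<kappa>'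
  proof (rule conv_diff_le[OF \<rho> V V])
    show "\<bar>V ((t, \<kappa>) - q) - V ((t, \<kappa>') - q)\<bar> \<le> L * norm (\<kappa> - \<kappa>')" for q
      using L[of "t - fst q" "\<kappa> - snd q" "\<kappa>' - snd q"] by (cases q) simp
  qed
qed

text \<open>The support of the kernel moves times forward by at most \<open>\<epsilon>\<^sup>2\<close> and points by at most \<open>\<epsilon>\<close>.\<close>

lemma mollified_close:
  fixes \<rho> :: "real \<times> 'd::finite vec3 \<Rightarrow> real"
  assumes \<rho>: "mollifier \<rho>" "0 < \<epsilon>" "\<epsilon> \<le> 1"
    and V: "time_ext v \<in> borel_measurable borel" "\<And>p. \<bar>time_ext v p\<bar> \<le> B" and C: "0 \<le> C"
    and near: "\<And>s \<kappa>'. 0 \<le> s \<Longrightarrow> s \<le> 1 \<Longrightarrow> s \<ge> min 1 t \<Longrightarrow> s \<le> max 0 (t + \<epsilon>\<^sup>2) \<Longrightarrow> \<bar>v s \<kappa>' - a\<bar> \<le> C * (b + norm1 (\<kappa>' - \<kappa>))"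
  shows "\<bar>conv (time_ext v) (scaled_kernel \<rho> \<epsilon>) (t, \<kappa>) - a\<bar> \<le> C * (b + 2 * \<epsilon>)"
proof (rule conv_close[OF \<rho> V])
  fix q assume q: "scaled_kernel \<rho> \<epsilon> q \<noteq> 0"
  note s = scaled_kernel_support[OF \<rho>(1,2) q]
  let ?s = "clamp01 (t - fst q)"
  have "norm1 (\<kappa> - snd q - \<kappa>) \<le> 2 * norm (\<kappa> - snd q - \<kappa>)" by (rule norm1_le)
  also have "\<dots> \<le> 2 * \<epsilon>" using s(3) by simp
  finally have n: "norm1 (\<kappa> - snd q - \<kappa>) \<le> 2 * \<epsilon>" .
  have "?s \<ge> min 1 t" "?s \<le> max 0 (t + \<epsilon>\<^sup>2)" using s(1,2) by (auto simp: clamp01_def)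
  then have "\<bar>v ?s (\<kappa> - snd q) - a\<bar> \<le> C * (b + norm1 (\<kappa> - snd q - \<kappa>))" by (intro near clamp01)
  also have "\<dots> \<le> C * (b + 2 * \<epsilon>)" using n C by (intro mult_left_mono) auto
  finally show "\<bar>time_ext v ((t, \<kappa>) - q) - a\<bar> \<le> C * (b + 2 * \<epsilon>)" by (cases q) (simp add: time_ext_def)
qed

section \<open>The scheme in continuous time\<close>

lemma C0_const_ge:
  fixes \<phi> :: "'d::finite vec3 \<Rightarrow> real"
  assumes "\<phi> \<in> Cb_Lip"
  shows "lip_const \<phi> * (sqrt (abs_moment E 2 (X 1)) + abs_moment E 1 (Y 1) + M_star E \<alpha> Z) \<le> C0_const E \<alpha> X Y Z \<phi>"
    "lip_const \<phi> \<le> C0_const E \<alpha> X Y Z \<phi>" "0 \<le> C0_const E \<alpha> X Y Z \<phi>"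
  using lip_const(1)[OF assms] by (simp_all add: C0_const_def)

context iid_scheme
begin

lemma step_pow_regularity:
  assumes \<phi>: "\<phi> \<in> Cb_Lip" and h: "0 < h" "h \<le> 1" and jk: "j \<le> k" "real (k - j) * h \<le> 1"
  shows "\<bar>(step E (incr h) ^^ k) \<phi> \<kappa> - (step E (incr h) ^^ j) \<phi> \<kappa>'\<bar>
    \<le> C0_const E \<alpha> X Y Z \<phi> * (sqrt (real (k - j) * h) + norm1 (\<kappa> - \<kappa>'))"
proof -
  let ?C = "C0_const E \<alpha> X Y Z \<phi>" and ?T = "step E (incr h)"
  note L = lip_const[OF \<phi>] and C = C0_const_ge[OF \<phi>, where E = E and X = X and Y = Y and \<alpha> = \<alpha> and Z = Z]
  have lip: "\<bar>(?T ^^ i) \<phi> \<kappa> - (?T ^^ i) \<phi> \<kappa>'\<bar> \<le> lip_const \<phi> * norm1 (\<kappa> - \<kappa>')" for i \<kappa> \<kappa>'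
    by (rule step_pow_modulus[OF rv_incr[OF h] \<phi> L(2)])
  have "(?T ^^ k) \<phi> = (?T ^^ (k - j)) ((?T ^^ j) \<phi>)"
    using jk by (simp flip: funpow_add[THEN fun_cong, unfolded comp_def])
  then have "\<bar>(?T ^^ k) \<phi> \<kappa> - (?T ^^ j) \<phi> \<kappa>\<bar> \<le> lip_const \<phi> * (sqrt M2 + M1 + Ms) * sqrt (real (k - j) * h)"
    using step_pow_time_regularity[OF h(1) jk(2) step_pow_Cb_Lip[OF rv_incr[OF h] \<phi>] L(1) lip] by simp
  also have "\<dots> \<le> ?C * sqrt (real (k - j) * h)" using C(1) h by (intro mult_right_mono) auto
  finally have "\<bar>(?T ^^ k) \<phi> \<kappa> - (?T ^^ j) \<phi> \<kappa>\<bar> \<le> ?C * sqrt (real (k - j) * h)" .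
  moreover have "\<bar>(?T ^^ j) \<phi> \<kappa> - (?T ^^ j) \<phi> \<kappa>'\<bar> \<le> ?C * norm1 (\<kappa> - \<kappa>')"
    using order_trans[OF lip mult_right_mono[OF C(2) norm1_nonneg]] .
  ultimately have "\<bar>(?T ^^ k) \<phi> \<kappa> - (?T ^^ j) \<phi> \<kappa>'\<bar> \<le> ?C * sqrt (real (k - j) * h) + ?C * norm1 (\<kappa> - \<kappa>')"
    by linarith
  then show ?thesis by (simp add: distrib_left)
qed

definition uh :: "('d vec3 \<Rightarrow> real) \<Rightarrow> real \<Rightarrow> real \<Rightarrow> 'd vec3 \<Rightarrow> real" where
  "uh \<phi> h t = (step E (incr h) ^^ nat \<lfloor>t / h\<rfloor>) \<phi>"

text \<open>The grid adds \<open>h\<close> under the root: a time difference below \<open>h\<close> may still cost one step. From time 0, which is a grid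
  point, no step is lost.\<close>

lemma uh_regularity:
  assumes \<phi>: "\<phi> \<in> Cb_Lip" and h: "0 < h" "h \<le> 1" and st: "0 \<le> s" "s \<le> t" "t \<le> 1"
  shows "\<bar>uh \<phi> h t \<kappa> - uh \<phi> h s \<kappa>'\<bar> \<le> C0_const E \<alpha> X Y Z \<phi> * (sqrt (t - s + h) + norm1 (\<kappa> - \<kappa>'))"
    and "\<bar>uh \<phi> h t \<kappa> - \<phi> \<kappa>'\<bar> \<le> C0_const E \<alpha> X Y Z \<phi> * (sqrt t + norm1 (\<kappa> - \<kappa>'))"
proof -
  let ?C = "C0_const E \<alpha> X Y Z \<phi>"
  have C0: "0 \<le> ?C" by (rule C0_const_ge(3)[OF \<phi>])
  define k j where "k = nat \<lfloor>t / h\<rfloor>" and "j = nat \<lfloor>s / h\<rfloor>"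
  have k: "real k \<le> t / h" "t / h < real k + 1" and j: "real j \<le> s / h" "s / h < real j + 1"
    using st h by (simp_all add: k_def j_def)
  have kh: "real k * h \<le> t" using k(1) h by (simp add: field_simps)
  have jh: "s < real j * h + h" using j(2) h by (simp add: field_simps)
  have jk: "j \<le> k" unfolding k_def j_def using st h by (intro nat_mono floor_mono divide_right_mono) auto
  have d: "real (k - j) * h \<le> t - s + h" using kh jh jk by (simp add: of_nat_diff algebra_simps)
  have d1: "real (k - j) * h \<le> 1"
  proof -
    have "real (k - j) * h \<le> real k * h" using h by (intro mult_right_mono) auto
    then show ?thesis using kh st by linarith
  qed
  have "\<bar>uh \<phi> h t \<kappa> - uh \<phi> h s \<kappa>'\<bar> \<le> ?C * (sqrt (real (k - j) * h) + norm1 (\<kappa> - \<kappa>'))"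
    unfolding uh_def k_def[symmetric] j_def[symmetric] by (rule step_pow_regularity[OF \<phi> h jk d1])
  also have "\<dots> \<le> ?C * (sqrt (t - s + h) + norm1 (\<kappa> - \<kappa>'))"
    using C0 d by (intro mult_left_mono add_right_mono real_sqrt_le_mono)
  finally show "\<bar>uh \<phi> h t \<kappa> - uh \<phi> h s \<kappa>'\<bar> \<le> ?C * (sqrt (t - s + h) + norm1 (\<kappa> - \<kappa>'))" .
  have "\<bar>uh \<phi> h t \<kappa> - \<phi> \<kappa>'\<bar> \<le> ?C * (sqrt (real (k - 0) * h) + norm1 (\<kappa> - \<kappa>'))"
    unfolding uh_def k_def[symmetric] using step_pow_regularity[OF \<phi> h, of 0 k \<kappa> \<kappa>'] kh st by simp
  also have "\<dots> \<le> ?C * (sqrt t + norm1 (\<kappa> - \<kappa>'))"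
    using C0 kh by (intro mult_left_mono add_right_mono real_sqrt_le_mono) simp_all
  finally show "\<bar>uh \<phi> h t \<kappa> - \<phi> \<kappa>'\<bar> \<le> ?C * (sqrt t + norm1 (\<kappa> - \<kappa>'))" .
qed

lemma uh_step:
  assumes "0 < h" "0 \<le> t"
  shows "uh \<phi> h (t + h) = step E (incr h) (uh \<phi> h t)"
proof -
  have "(t + h) / h = t / h + 1" using assms by (simp add: add_divide_distrib)
  moreover have "0 \<le> \<lfloor>t / h\<rfloor>" using assms by simp
  ultimately have "nat \<lfloor>(t + h) / h\<rfloor> = Suc (nat \<lfloor>t / h\<rfloor>)" by (simp add: nat_add_distrib)
  then show ?thesis unfolding uh_def by (simp only: funpow.simps comp_apply)
qed

lemma time_ext_uh:
  assumes \<phi>: "\<phi> \<in> Cb_Lip" and h: "0 < h" "h \<le> 1"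
  shows "time_ext (uh \<phi> h) \<in> borel_measurable borel" "\<exists>B. \<forall>p. \<bar>time_ext (uh \<phi> h) p\<bar> \<le> B"
    "\<And>t \<kappa> \<kappa>'. \<bar>time_ext (uh \<phi> h) (t, \<kappa>) - time_ext (uh \<phi> h) (t, \<kappa>')\<bar> \<le> (2 * lip_const \<phi>) * norm (\<kappa> - \<kappa>')"
    "finitely_patched (time_ext (uh \<phi> h))"
proof -
  define g where "g t = nat \<lfloor>clamp01 t / h\<rfloor>" for t
  have gm: "g \<in> borel \<rightarrow>\<^sub>M count_space UNIV" unfolding g_def clamp01_def by measurable
  have eq: "time_ext (uh \<phi> h) p = (step E (incr h) ^^ g (fst p)) \<phi> (snd p)" for p
    by (simp add: time_ext_def uh_def g_def)
  have lip: "\<bar>(step E (incr h) ^^ i) \<phi> \<kappa> - (step E (incr h) ^^ i) \<phi> \<kappa>'\<bar> \<le> lip_const \<phi> * norm1 (\<kappa> - \<kappa>')" for i \<kappa> \<kappa>'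
    by (rule step_pow_modulus[OF rv_incr[OF h] \<phi> lip_const(2)[OF \<phi>]])
  have lip2: "\<bar>(step E (incr h) ^^ i) \<phi> \<kappa> - (step E (incr h) ^^ i) \<phi> \<kappa>'\<bar> \<le> (2 * lip_const \<phi>) * norm (\<kappa> - \<kappa>')" for i \<kappa> \<kappa>'
    using order_trans[OF lip mult_left_mono[OF norm1_le lip_const(1)[OF \<phi>]]] by (simp add: mult_ac)
  show "\<bar>time_ext (uh \<phi> h) (t, \<kappa>) - time_ext (uh \<phi> h) (t, \<kappa>')\<bar> \<le> (2 * lip_const \<phi>) * norm (\<kappa> - \<kappa>')" for t \<kappa> \<kappa>'
    unfolding eq using lip2 by simp
  obtain B where "\<And>x. \<bar>\<phi> x\<bar> \<le> B" using Cb_LipE[OF \<phi>] by metis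
  then show "\<exists>B. \<forall>p. \<bar>time_ext (uh \<phi> h) p\<bar> \<le> B"
    unfolding eq using step_pow_abs_le[OF rv_incr[OF h] \<phi>] by blast
  have fm: "(\<lambda>p :: real \<times> 'd vec3. (step E (incr h) ^^ i) \<phi> (snd p)) \<in> borel_measurable borel" for i
  proof -
    have "(2 * lip_const \<phi>)-lipschitz_on UNIV ((step E (incr h) ^^ i) \<phi>)"
      using lip2 lip_const(1)[OF \<phi>] by (intro lipschitz_onI) (auto simp: dist_norm)
    then have "continuous_on UNIV ((step E (incr h) ^^ i) \<phi>)" by (rule lipschitz_on_continuous_on)
    then have "continuous_on UNIV (\<lambda>p :: real \<times> 'd vec3. (step E (incr h) ^^ i) \<phi> (snd p))"
      by (rule continuous_on_compose2) (auto intro!: continuous_intros)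
    then show ?thesis by (rule borel_measurable_continuous_onI)
  qed
  have "(\<lambda>p :: real \<times> 'd vec3. g (fst p)) \<in> borel \<rightarrow>\<^sub>M count_space UNIV"
    by (rule measurable_compose[OF _ gm]) (intro borel_measurable_continuous_onI continuous_intros)
  from measurable_compose_countable[OF fm this]
  show "time_ext (uh \<phi> h) \<in> borel_measurable borel" unfolding ext[of "time_ext (uh \<phi> h)", OF eq] .
  show "finitely_patched (time_ext (uh \<phi> h))"
    unfolding finitely_patched_def
  proof (intro allI impI exI[of _ g] conjI)
    show "g \<in> borel \<rightarrow>\<^sub>M count_space UNIV" by (rule gm)
    have "g t \<le> nat \<lfloor>1 / h\<rfloor>" for t
      unfolding g_def using clamp01[of t] h by (intro nat_mono floor_mono divide_right_mono) auto
    then have "range g \<subseteq> {..nat \<lfloor>1 / h\<rfloor>}" by auto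
    then show "finite (range g)" by (rule finite_subset) simp
    show "\<bar>time_ext (uh \<phi> h) (t, \<kappa>) - time_ext (uh \<phi> h) (t', \<kappa>)\<bar> \<le> \<delta>" if "0 < \<delta>" "g t = g t'" for \<delta> t t' \<kappa>
      unfolding eq using that by simp
  qed
qed

text \<open>Jensen's inequality makes the mollified scheme \<open>W\<close> a supersolution of the scheme, so by consistency its operator
  value is at least \<open>- e\<close>, at times between \<open>h\<close> and \<open>1 - \<epsilon>\<^sup>2\<close>. Delaying \<open>W\<close> by \<open>\<epsilon>\<^sup>2\<close> makes this hold up to time 1, at
  the price of an initial layer of length \<open>h + \<epsilon>\<^sup>2\<close>. Comparison with \<open>W(t - \<epsilon>\<^sup>2) + (e + \<eta>) t\<close> plus a constant for the
  layer gives the bound: the layer costs \<open>2 sqrt h + 4 \<epsilon>\<close> and returning from \<open>W(1 - \<epsilon>\<^sup>2)\<close> to the scheme at time 1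
  costs \<open>sqrt h + 3 \<epsilon>\<close>.\<close>

lemma lower_bound:
  fixes \<rho> :: "real \<times> 'd vec3 \<Rightarrow> real"
  assumes \<rho>: "mollifier \<rho>" and \<epsilon>: "0 < \<epsilon>" "\<epsilon> < 1" and h: "0 < h" "h < 1" and \<phi>: "\<phi> \<in> Cb_Lip"
    and \<Theta>: "levy_bounded \<Theta> C" and u: "viscosity_subsolution \<Theta> \<phi> u" "cont_bdd_on {0..1} u"
      "parabolic_Hoelder (C0_const E \<alpha> X Y Z \<phi>) u" and u0: "\<And>\<kappa>. u 0 \<kappa> = \<phi> \<kappa>"
    and e: "0 \<le> e"
    and consistent: "\<And>t \<kappa>. h \<le> t \<Longrightarrow> t \<le> 1 \<Longrightarrow>
      (mollify \<rho> \<epsilon> (uh \<phi> h) t \<kappa> - step E (incr h) (mollify \<rho> \<epsilon> (uh \<phi> h) (t - h)) \<kappa>) / h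
       \<le> pide_op \<Theta> (mollify \<rho> \<epsilon> (uh \<phi> h)) t (fst \<kappa>) (fst (snd \<kappa>)) (snd (snd \<kappa>)) + e"
  shows "u 1 0 - uh \<phi> h 1 0 \<le> C0_const E \<alpha> X Y Z \<phi> * (3 * sqrt h + 7 * \<epsilon>) + e"
proof -
  let ?C = "C0_const E \<alpha> X Y Z \<phi>" and ?k = "scaled_kernel \<rho> \<epsilon>" and ?V = "time_ext (uh \<phi> h)"
  have C0: "0 \<le> ?C" by (rule C0_const_ge(3)[OF \<phi>])
  have \<epsilon>1: "\<epsilon> \<le> 1" and h1: "h \<le> 1" using \<epsilon> h by auto
  note \<rho>\<epsilon> = \<rho> \<epsilon>(1) \<epsilon>1 and h' = h(1) h1
  note V = time_ext_uh[OF \<phi> h']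
  obtain B where B: "\<And>p. \<bar>?V p\<bar> \<le> B" using V(2) by blast
  define W where "W = conv ?V ?k"
  have W: "strip_smooth n W" for n
    unfolding W_def by (rule strip_smooth_conv[OF V(1) B kernel_scaled[OF \<rho>\<epsilon>]])
  have mW: "mollify \<rho> \<epsilon> (uh \<phi> h) t \<kappa> = W (t, \<kappa>)" if "0 \<le> t" for t \<kappa>
    unfolding W_def by (rule mollify_eq_conv[OF \<rho>\<epsilon> V(1) B that])
  have Jensen_W: "step E (incr h) (\<lambda>\<kappa>. W (s - h, \<kappa>)) \<kappa> \<le> W (s, \<kappa>)" if s: "h \<le> s" "s \<le> 1 - \<epsilon>\<^sup>2" for s \<kappa>
    unfolding W_def step_def
  proof (rule conv_Jensen[OF \<rho>\<epsilon> rv_incr[OF h'] V(1) B _ V(3,4)])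
    show "0 \<le> 2 * lip_const \<phi>" using lip_const(1)[OF \<phi>] by simp
    fix q assume q: "?k q \<noteq> 0"
    note sq = scaled_kernel_support[OF \<rho>\<epsilon>(1,2) q]
    have t: "0 \<le> s - h - fst q" "s - h - fst q + h \<le> 1" using s sq h by auto
    have "?V ((s, \<kappa>) - q) = uh \<phi> h (s - h - fst q + h) (\<kappa> - snd q)"
      using t h by (cases q) (simp add: time_ext_def clamp01_id)
    also have "\<dots> = E (\<lambda>\<omega>. uh \<phi> h (s - h - fst q) (\<kappa> - snd q + incr h \<omega>))"
      unfolding uh_step[OF h(1) t(1)] step_def by simp
    also have "\<dots> = E (\<lambda>\<omega>. ?V ((s - h, \<kappa> + incr h \<omega>) - q))"
      using t h by (cases q) (simp add: time_ext_def clamp01_id algebra_simps)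
    finally show "E (\<lambda>\<omega>. ?V ((s - h, \<kappa> + incr h \<omega>) - q)) \<le> ?V ((s, \<kappa>) - q)" by simp
  qed
  have pW: "- e \<le> pide \<Theta> W (s, \<kappa>)" if s: "h \<le> s" "s \<le> 1 - \<epsilon>\<^sup>2" for s \<kappa>
  proof -
    obtain x y z where \<kappa>: "\<kappa> = (x, y, z)" by (cases \<kappa>)
    have s1: "s \<le> 1" using s zero_le_power2[of \<epsilon>] by linarith
    have "mollify \<rho> \<epsilon> (uh \<phi> h) (s - h) = (\<lambda>\<kappa>. W (s - h, \<kappa>))" using mW[of "s - h"] s by auto
    then have "0 \<le> (mollify \<rho> \<epsilon> (uh \<phi> h) s \<kappa> - step E (incr h) (mollify \<rho> \<epsilon> (uh \<phi> h) (s - h)) \<kappa>) / h"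
      using Jensen_W[OF s, of \<kappa>] mW[of s \<kappa>] s h by simp
    also have "\<dots> \<le> pide_op \<Theta> (mollify \<rho> \<epsilon> (uh \<phi> h)) s x y z + e"
      using consistent[OF s(1) s1, of \<kappa>] by (simp add: \<kappa>)
    also have "pide_op \<Theta> (mollify \<rho> \<epsilon> (uh \<phi> h)) s x y z = pide \<Theta> W (s, x, y, z)"
      using s s1 h by (intro pide_op_cong[OF W] mW) auto
    finally show ?thesis by (simp add: \<kappa>)
  qed
  let ?b = "sqrt (h + \<epsilon>\<^sup>2)"
  have b: "?b \<le> sqrt h + \<epsilon>" using sqrt_add_le_add_sqrt[of h "\<epsilon>\<^sup>2"] h \<epsilon> by simp
  have start: "u t \<kappa> \<le> W (t - \<epsilon>\<^sup>2, \<kappa>) + ?C * (2 * sqrt h + 4 * \<epsilon>)" if t: "0 \<le> t" "t \<le> 1" "t < h + \<epsilon>\<^sup>2" for t \<kappa>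
  proof -
    have "\<bar>u t \<kappa> - u 0 \<kappa>\<bar> \<le> ?C * (sqrt \<bar>t - 0\<bar> + norm1 (\<kappa> - \<kappa>))"
      by (rule parabolic_HoelderD[OF u(3)]) (use t in auto)
    also have "\<dots> \<le> ?C * ?b" using t C0 by (intro mult_left_mono) (auto simp: norm1_def)
    finally have 1: "\<bar>u t \<kappa> - \<phi> \<kappa>\<bar> \<le> ?C * ?b" by (simp add: u0)
    have 2: "\<bar>W (t - \<epsilon>\<^sup>2, \<kappa>) - \<phi> \<kappa>\<bar> \<le> ?C * (?b + 2 * \<epsilon>)"
      unfolding W_def
    proof (rule mollified_close[OF \<rho>\<epsilon> V(1) B C0])
      fix s \<kappa>' assume s: "0 \<le> s" "s \<le> 1" "s \<le> max 0 (t - \<epsilon>\<^sup>2 + \<epsilon>\<^sup>2)"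
      have "\<bar>uh \<phi> h s \<kappa>' - \<phi> \<kappa>\<bar> \<le> ?C * (sqrt s + norm1 (\<kappa>' - \<kappa>))"
        by (rule uh_regularity(2)[OF \<phi> h' order_refl s(1,2)])
      also have "\<dots> \<le> ?C * (?b + norm1 (\<kappa>' - \<kappa>))"
        using s t C0 by (intro mult_left_mono add_right_mono real_sqrt_le_mono) auto
      finally show "\<bar>uh \<phi> h s \<kappa>' - \<phi> \<kappa>\<bar> \<le> ?C * (?b + norm1 (\<kappa>' - \<kappa>))" .
    qed
    have "?C * ?b + ?C * (?b + 2 * \<epsilon>) = ?C * (2 * ?b + 2 * \<epsilon>)" by (simp add: algebra_simps)
    also have "\<dots> \<le> ?C * (2 * sqrt h + 4 * \<epsilon>)" using b C0 by (intro mult_left_mono) auto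
    finally show ?thesis using 1 2 by linarith
  qed
  have finish: "W (1 - \<epsilon>\<^sup>2, 0) \<le> uh \<phi> h 1 0 + ?C * (sqrt h + 3 * \<epsilon>)"
  proof -
    have "\<bar>W (1 - \<epsilon>\<^sup>2, 0) - uh \<phi> h 1 0\<bar> \<le> ?C * (?b + 2 * \<epsilon>)"
      unfolding W_def
    proof (rule mollified_close[OF \<rho>\<epsilon> V(1) B C0])
      fix s and \<kappa>' :: "'d vec3" assume s: "0 \<le> s" "s \<le> 1" "min 1 (1 - \<epsilon>\<^sup>2) \<le> s"
      have "\<bar>uh \<phi> h 1 0 - uh \<phi> h s \<kappa>'\<bar> \<le> ?C * (sqrt (1 - s + h) + norm1 (0 - \<kappa>'))"
        by (rule uh_regularity(1)[OF \<phi> h' s(1,2) order_refl])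
      also have "\<dots> \<le> ?C * (?b + norm1 (\<kappa>' - 0))"
      proof (intro mult_left_mono[OF _ C0] add_mono)
        show "sqrt (1 - s + h) \<le> ?b" using s by simp
        show "norm1 (0 - \<kappa>') \<le> norm1 (\<kappa>' - 0)" by (simp add: norm1_minus)
      qed
      finally show "\<bar>uh \<phi> h s \<kappa>' - uh \<phi> h 1 0\<bar> \<le> ?C * (?b + norm1 (\<kappa>' - 0))" by (simp add: abs_minus_commute)
    qed
    moreover have "?C * (?b + 2 * \<epsilon>) \<le> ?C * (sqrt h + 3 * \<epsilon>)" using b C0 by (intro mult_left_mono) auto
    ultimately show ?thesis by linarith
  qed
  have "u 1 0 \<le> uh \<phi> h 1 0 + ?C * (3 * sqrt h + 7 * \<epsilon>) + e + \<eta>" if \<eta>: "0 < \<eta>" for \<eta>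
  proof -
    define c where "c = ?C * (2 * sqrt h + 4 * \<epsilon>)"
    have c0: "0 \<le> c" unfolding c_def using C0 h \<epsilon> by simp
    define Q where "Q p = (e + \<eta>) * fst p + c" for p :: "real \<times> 'd vec3"
    define S where "S p = W (p + (- (\<epsilon>\<^sup>2), 0))" for p
    have Qs: "strip_smooth n Q" for n
      unfolding Q_def by (intro strip_smooth_add strip_smooth_cmult strip_smooth_fst strip_smooth_const)
    have Ss: "strip_smooth n S" for n unfolding S_def by (rule strip_smooth_translate[OF W])
    have pdQ: "pd b Q = (\<lambda>_. fst b * (e + \<eta>))" for b
      by (rule ext, rule pd_eqI) (auto simp: Q_def intro!: derivative_eq_intros)
    have dQ: "deriv_le 0 t Q" for t by (simp add: deriv_le_def pdQ pd_const)
    define P where "P p = S p + Q p" for p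
    have Ps: "strip_smooth 4 P" unfolding P_def by (rule strip_smooth_add[OF Ss Qs])
    have P: "P (t, \<kappa>) = W (t - \<epsilon>\<^sup>2, \<kappa>) + (e + \<eta>) * t + c" for t \<kappa> by (simp add: P_def S_def Q_def)
    have pP: "pide \<Theta> P (t, \<kappa>) = pide \<Theta> W (t - \<epsilon>\<^sup>2, \<kappa>) + (e + \<eta>)" for t \<kappa>
    proof -
      have "pide \<Theta> S (t, \<kappa>) = pide \<Theta> W (t - \<epsilon>\<^sup>2, \<kappa>)" unfolding S_def pide_translate[OF W] by simp
      then show ?thesis
        using pide_perturb[OF Ss Qs \<Theta> dQ, of t \<kappa>] unfolding P_def by (simp add: pdQ)
    qed
    have "u 1 0 \<le> P (1, 0)"
    proof (rule comparison_subsolution[OF \<rho> \<Theta> u(1,2) Ps \<eta>])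
      fix t :: real assume t: "t \<in> {0..1}"
      show "(\<forall>\<kappa>. u t \<kappa> \<le> P (t, \<kappa>)) \<or> (0 < t \<and> (\<forall>\<kappa>. \<eta> \<le> pide \<Theta> P (t, \<kappa>)))"
      proof (cases "t < h + \<epsilon>\<^sup>2")
        case True
        have "0 \<le> (e + \<eta>) * t" using e \<eta> t by simp
        then have "u t \<kappa> \<le> P (t, \<kappa>)" for \<kappa>
          using start[of t \<kappa>] t True unfolding P c_def by simp
        then show ?thesis by blast
      next
        case False
        then have "0 < t" using h zero_le_power2[of \<epsilon>] by linarith
        moreover have "\<eta> \<le> pide \<Theta> P (t, \<kappa>)" for \<kappa>
          unfolding pP using pW[of "t - \<epsilon>\<^sup>2" \<kappa>] False t by simp
        ultimately show ?thesis by blast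
      qed
    qed simp
    also have "P (1, 0) = W (1 - \<epsilon>\<^sup>2, 0) + (e + \<eta>) + c" by (simp add: P)
    finally show ?thesis using finish unfolding c_def by (simp add: algebra_simps)
  qed
  then have "u 1 0 \<le> uh \<phi> h 1 0 + ?C * (3 * sqrt h + 7 * \<epsilon>) + e"
    by (rule field_le_epsilon)
  then show ?thesis by simp
qed

end

section \<open>The upper bound\<close>

lemma cont_bdd_on_bounded:
  assumes "cont_bdd_on {0..1} u"
  obtains B where "\<And>p. \<bar>time_ext u p\<bar> \<le> B"
proof -
  obtain B where "\<forall>x\<in>(\<lambda>(t, \<kappa>). u t \<kappa>) ` ({0..1} \<times> UNIV). norm x \<le> B"
    using assms unfolding cont_bdd_on_def bounded_iff by blast
  then have "\<bar>u t \<kappa>\<bar> \<le> B" if "t \<in> {0..1}" for t \<kappa> using that by force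
  then show thesis using clamp01(3) by (intro that[of B]) (simp add: time_ext_def)
qed

lemma associated_processD:
  fixes L :: "real \<Rightarrow> 'v \<Rightarrow> 'd::finite vec3"
  assumes "associated_process \<Theta> C0 H E L" "\<phi> \<in> Cb_Lip"
  shows "nonlinear_levy H E L" "viscosity_subsolution \<Theta> \<phi> (value_fun E L \<phi>)"
    "viscosity_supersolution \<Theta> \<phi> (value_fun E L \<phi>)" "cont_bdd_on {0..1} (value_fun E L \<phi>)"
    "parabolic_Hoelder (C0 \<phi>) (value_fun E L \<phi>)"
proof -
  show "nonlinear_levy H E L" using assms(1) by (simp add: associated_process_def)
  have "viscosity_solution \<Theta> \<phi> (value_fun E L \<phi>)"
    using assms unfolding associated_process_def by blast
  then show "viscosity_subsolution \<Theta> \<phi> (value_fun E L \<phi>)"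
    "viscosity_supersolution \<Theta> \<phi> (value_fun E L \<phi>)" "cont_bdd_on {0..1} (value_fun E L \<phi>)"
    by (simp_all add: viscosity_solution_def)
  have Ho: "\<forall>t\<in>{0..1}. \<forall>t'\<in>{0..1}. \<forall>x y z x' y' z'.
           \<bar>value_fun E L \<phi> t (x, y, z) - value_fun E L \<phi> t' (x', y', z')\<bar>
             \<le> C0 \<phi> * (sqrt \<bar>t - t'\<bar> + norm (x - x') + norm (y - y') + norm (z - z'))"
    using assms unfolding associated_process_def by blast
  show "parabolic_Hoelder (C0 \<phi>) (value_fun E L \<phi>)"
    unfolding parabolic_Hoelder_def
  proof (intro ballI allI)
    fix t t' :: real and \<kappa> \<kappa>' :: "'d vec3" assume t: "t \<in> {0..1}" "t' \<in> {0..1}"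
    obtain x y z x' y' z' where \<kappa>: "\<kappa> = (x, y, z)" "\<kappa>' = (x', y', z')" by (cases \<kappa>, cases \<kappa>')
    show "\<bar>value_fun E L \<phi> t \<kappa> - value_fun E L \<phi> t' \<kappa>'\<bar> \<le> C0 \<phi> * (sqrt \<bar>t - t'\<bar> + norm1 (\<kappa> - \<kappa>'))"
      using Ho[rule_format, OF t, of x y z x' y' z'] unfolding \<kappa> norm1_def by (simp add: add.assoc)
  qed
qed

lemma value_fun_0:
  assumes "sublinear_expectation H E" "nonlinear_levy H E L"
  shows "value_fun E L \<phi> 0 \<kappa> = \<phi> \<kappa>"
proof -
  have "L 0 \<omega> = 0" for \<omega> using assms(2) unfolding nonlinear_levy_def by blast
  then show ?thesis using sublinear_expectation.const[OF assms(1)] by (simp add: value_fun_def)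
qed

lemma parabolic_Hoelder_space:
  assumes "parabolic_Hoelder C u" "0 \<le> C"
  shows "\<bar>time_ext u (t, \<kappa>) - time_ext u (t, \<kappa>')\<bar> \<le> (2 * C) * norm (\<kappa> - \<kappa>')"
proof -
  have "\<bar>time_ext u (t, \<kappa>) - time_ext u (t, \<kappa>')\<bar> \<le> C * norm1 (\<kappa> - \<kappa>')"
    using parabolic_HoelderD[OF assms(1) clamp01(1,2) clamp01(1,2), of t \<kappa> t \<kappa>'] by (simp add: time_ext_def)
  also have "\<dots> \<le> C * (2 * norm (\<kappa> - \<kappa>'))" by (rule mult_left_mono[OF norm1_le assms(2)])
  finally show ?thesis by simp
qed

text \<open>Dynamic programming and Jensen's inequality bound \<open>v(s, \<kappa>) = E[W(t, \<kappa> + L s)]\<close> by \<open>W(t + s, \<kappa>)\<close>. As \<open>v\<close> is the value function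
  for the datum \<open>W(t, _)\<close>, it is a viscosity solution starting from \<open>W(t, _)\<close>, and
  \<open>smooth_majorant_supersolution\<close> applies. Strictness of \<open>t < 1 - \<epsilon>\<^sup>2\<close> leaves room for positive \<open>s\<close>.\<close>

lemma mollified_value_supersolution:
  fixes \<rho> :: "real \<times> 'd::finite vec3 \<Rightarrow> real"
  assumes \<rho>: "mollifier \<rho>" "0 < \<epsilon>" "\<epsilon> \<le> 1" and \<Theta>: "levy_bounded \<Theta> C"
    and E: "sublinear_expectation H E" and L: "associated_process \<Theta> C0 H E L"
    and \<phi>: "\<phi> \<in> Cb_Lip" and C0: "0 \<le> C0 \<phi>" and t: "0 \<le> t" "t < 1 - \<epsilon>\<^sup>2"
  shows "0 \<le> pide \<Theta> (conv (time_ext (value_fun E L \<phi>)) (scaled_kernel \<rho> \<epsilon>)) (t, \<kappa>)"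
proof -
  interpret sublinear_expectation H E by (rule E)
  let ?u = "value_fun E L \<phi>" and ?k = "scaled_kernel \<rho> \<epsilon>"
  let ?V = "time_ext ?u"
  note u = associated_processD[OF L \<phi>]
  note Vm = time_ext_measurable[OF u(4)]
  obtain B where B: "\<And>p. \<bar>?V p\<bar> \<le> B" using cont_bdd_on_bounded[OF u(4)] by blast
  note VL = parabolic_Hoelder_space[OF u(5) C0]
  define W where "W = conv ?V ?k"
  have W: "strip_smooth n W" for n
    unfolding W_def by (rule strip_smooth_conv[OF Vm B kernel_scaled[OF \<rho>]])
  define f where "f \<kappa> = W (t, \<kappa>)" for \<kappa>
  have f: "f \<in> Cb_Lip"
    unfolding f_def W_def by (rule mollified_slice_Cb_Lip[OF \<rho> Vm B VL])
  note v = associated_processD[OF L f]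
  have rL: "random_vector H (L s)" if "0 \<le> s" "s \<le> 1" for s
    using v(1) that unfolding nonlinear_levy_def by simp
  have "0 \<le> pide \<Theta> W (t, \<kappa>)"
  proof (rule smooth_majorant_supersolution[OF \<rho>(1) \<Theta> v(3,4) W])
    show "W (t, \<kappa>') \<le> value_fun E L f 0 \<kappa>'" for \<kappa>'
      by (simp add: value_fun_0[OF E v(1)] f_def)
    show "0 < 1 - \<epsilon>\<^sup>2 - t" using t by simp
    fix s assume s: "0 \<le> s" "s \<le> 1 - \<epsilon>\<^sup>2 - t"
    have s1: "s \<le> 1" using s t zero_le_power2[of \<epsilon>] by linarith
    show "value_fun E L f s \<kappa> \<le> W (t + s, \<kappa>)"
      unfolding value_fun_def[of E L f] f_def W_def
    proof (rule conv_Jensen[OF \<rho> rL[OF s(1) s1] Vm B _ VL finitely_patched_Hoelder[OF u(5) C0]])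
      show "0 \<le> 2 * C0 \<phi>" using C0 by simp
      fix q assume q: "?k q \<noteq> 0"
      note sq = scaled_kernel_support[OF \<rho>(1,2) q]
      have r: "0 \<le> t - fst q" "t - fst q + s \<le> 1" using s t sq by auto
      have "?V ((t + s, \<kappa>) - q) = ?u (t - fst q + s) (\<kappa> - snd q)"
        using r s by (cases q) (simp add: time_ext_def clamp01_id algebra_simps)
      also have "\<dots> = E (\<lambda>\<omega>. ?u (t - fst q) (\<kappa> - snd q + L s \<omega>))"
        by (rule value_fun_dynamic_programming[OF E u(1) \<phi> r(1) s(1) r(2)])
      also have "\<dots> = E (\<lambda>\<omega>. ?V ((t, \<kappa> + L s \<omega>) - q))"
        using r s by (cases q) (simp add: time_ext_def clamp01_id algebra_simps)
      finally show "E (\<lambda>\<omega>. ?V ((t, \<kappa> + L s \<omega>) - q)) \<le> ?V ((t + s, \<kappa>) - q)" by simp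
    qed
  qed
  then show ?thesis unfolding W_def .
qed

context iid_scheme
begin

text \<open>By \<open>super\<close> and consistency, the mollified function \<open>W\<close> fails to be a supersolution of the scheme by at most \<open>e\<close> per
  unit of time; as one step is monotone, the error is at most \<open>b + e\<close> along a grid of width \<open>h\<close> that ends at
  \<open>t\<^sub>1 < 1 - \<epsilon>\<^sup>2\<close> and starts in \<open>[0, h)\<close>, where \<open>b\<close> bounds the initial error.\<close>

lemma upper_bound:
  fixes \<rho> :: "real \<times> 'd vec3 \<Rightarrow> real"
  assumes \<rho>: "mollifier \<rho>" and \<epsilon>: "0 < \<epsilon>" "\<epsilon> < 4/5" and h: "0 < h" "h < 1" and \<phi>: "\<phi> \<in> Cb_Lip"
    and u: "cont_bdd_on {0..1} u" "parabolic_Hoelder (C0_const E \<alpha> X Y Z \<phi>) u" and u0: "\<And>\<kappa>. u 0 \<kappa> = \<phi> \<kappa>"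
    and super: "\<And>t \<kappa>. 0 \<le> t \<Longrightarrow> t < 1 - \<epsilon>\<^sup>2 \<Longrightarrow> 0 \<le> pide \<Theta> (conv (time_ext u) (scaled_kernel \<rho> \<epsilon>)) (t, \<kappa>)"
    and e: "0 \<le> e"
    and consistent: "\<And>t \<kappa>. h \<le> t \<Longrightarrow> t \<le> 1 \<Longrightarrow>
      pide_op \<Theta> (mollify \<rho> \<epsilon> u) t (fst \<kappa>) (fst (snd \<kappa>)) (snd (snd \<kappa>)) - e
      \<le> (mollify \<rho> \<epsilon> u t \<kappa> - step E (incr h) (mollify \<rho> \<epsilon> u (t - h)) \<kappa>) / h"
  shows "uh \<phi> h 1 0 - u 1 0 \<le> C0_const E \<alpha> X Y Z \<phi> * (2 * sqrt h + 15/2 * \<epsilon>) + e"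
proof -
  let ?C = "C0_const E \<alpha> X Y Z \<phi>" and ?k = "scaled_kernel \<rho> \<epsilon>" and ?V = "time_ext u"
  let ?T = "step E (incr h)"
  have C0: "0 \<le> ?C" by (rule C0_const_ge(3)[OF \<phi>])
  have \<epsilon>1: "\<epsilon> \<le> 1" and h1: "h \<le> 1" using \<epsilon> h by auto
  note \<rho>\<epsilon> = \<rho> \<epsilon>(1) \<epsilon>1 and h' = h(1) h1
  note Vm = time_ext_measurable[OF u(1)]
  obtain B where B: "\<And>p. \<bar>?V p\<bar> \<le> B" using cont_bdd_on_bounded[OF u(1)] by blast
  define W where "W = conv ?V ?k"
  have W: "strip_smooth n W" for n
    unfolding W_def by (rule strip_smooth_conv[OF Vm B kernel_scaled[OF \<rho>\<epsilon>]])
  have mW: "mollify \<rho> \<epsilon> u t \<kappa> = W (t, \<kappa>)" if "0 \<le> t" for t \<kappa>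
    unfolding W_def by (rule mollify_eq_conv[OF \<rho>\<epsilon> Vm B that])
  have slice: "(\<lambda>\<kappa>. W (t, \<kappa>)) \<in> Cb_Lip" for t
    unfolding W_def by (rule mollified_slice_Cb_Lip[OF \<rho>\<epsilon> Vm B parabolic_Hoelder_space[OF u(2) C0]])
  have stepW: "?T (\<lambda>\<kappa>. W (t - h, \<kappa>)) \<kappa> \<le> W (t, \<kappa>) + h * e" if t: "h \<le> t" "t < 1 - \<epsilon>\<^sup>2" for t \<kappa>
  proof -
    obtain x y z where \<kappa>: "\<kappa> = (x, y, z)" by (cases \<kappa>)
    have t1: "t \<le> 1" using t zero_le_power2[of \<epsilon>] by linarith
    have m: "mollify \<rho> \<epsilon> u (t - h) = (\<lambda>\<kappa>. W (t - h, \<kappa>))" using mW[of "t - h"] t by auto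
    have "pide_op \<Theta> (mollify \<rho> \<epsilon> u) t x y z = pide \<Theta> W (t, x, y, z)"
      using t t1 h by (intro pide_op_cong[OF W] mW) auto
    moreover have "0 \<le> pide \<Theta> W (t, x, y, z)" unfolding W_def using super[of t] t h by simp
    ultimately have "- e \<le> (W (t, \<kappa>) - ?T (\<lambda>\<kappa>. W (t - h, \<kappa>)) \<kappa>) / h"
      using consistent[OF t(1) t1, of \<kappa>] mW[of t \<kappa>] t h unfolding m \<kappa> by simp
    then show ?thesis using h by (simp add: pos_le_divide_eq algebra_simps)
  qed
  \<comment> \<open>Any factor above 1 in place of 5/4 keeps the final time strictly below \<open>1 - \<epsilon>\<^sup>2\<close>; this one leaves a total of at
    most \<open>8 \<epsilon>\<close>.\<close>
  define a where "a = (5/4 * \<epsilon>)\<^sup>2"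
  define t\<^sub>1 where "t\<^sub>1 = 1 - a"
  have sa: "sqrt a = 5/4 * \<epsilon>" using \<epsilon> by (simp add: a_def)
  have a: "\<epsilon>\<^sup>2 < a" "a < 1"
  proof -
    show "\<epsilon>\<^sup>2 < a" unfolding a_def using \<epsilon> by (intro power_strict_mono) auto
    have "a < 1\<^sup>2" unfolding a_def using \<epsilon> by (intro power_strict_mono) auto
    then show "a < 1" by simp
  qed
  have t\<^sub>1: "0 < t\<^sub>1" "t\<^sub>1 \<le> 1" "t\<^sub>1 < 1 - \<epsilon>\<^sup>2" using a order_trans[OF zero_le_power2 less_imp_le[OF a(1)]] by (auto simp: t\<^sub>1_def)
  define m where "m = nat \<lfloor>t\<^sub>1 / h\<rfloor>"
  have m: "real m \<le> t\<^sub>1 / h" "t\<^sub>1 / h < real m + 1" using t\<^sub>1 h by (simp_all add: m_def)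
  have mh: "real m * h \<le> t\<^sub>1" "t\<^sub>1 < real m * h + h" using m h by (simp_all add: field_simps)
  define t\<^sub>0 where "t\<^sub>0 = t\<^sub>1 - real m * h"
  have t\<^sub>0: "0 \<le> t\<^sub>0" "t\<^sub>0 < h" using mh by (auto simp: t\<^sub>0_def)
  define b where "b = ?C * (sqrt h + 3 * \<epsilon>)"
  have base: "\<bar>W (t\<^sub>0, \<kappa>) - \<phi> \<kappa>\<bar> \<le> b" for \<kappa>
  proof -
    have "\<bar>W (t\<^sub>0, \<kappa>) - \<phi> \<kappa>\<bar> \<le> ?C * (sqrt (h + \<epsilon>\<^sup>2) + 2 * \<epsilon>)"
      unfolding W_def
    proof (rule mollified_close[OF \<rho>\<epsilon> Vm B C0])
      fix s \<kappa>' assume s: "0 \<le> s" "s \<le> 1" "s \<le> max 0 (t\<^sub>0 + \<epsilon>\<^sup>2)"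
      have "\<bar>u s \<kappa>' - u 0 \<kappa>\<bar> \<le> ?C * (sqrt \<bar>s - 0\<bar> + norm1 (\<kappa>' - \<kappa>))"
        by (rule parabolic_HoelderD[OF u(2)]) (use s in auto)
      also have "\<dots> \<le> ?C * (sqrt (h + \<epsilon>\<^sup>2) + norm1 (\<kappa>' - \<kappa>))"
        using s t\<^sub>0 C0 zero_le_power2[of \<epsilon>] h by (intro mult_left_mono add_right_mono real_sqrt_le_mono) (auto simp: max_def split: if_splits)
      finally show "\<bar>u s \<kappa>' - \<phi> \<kappa>\<bar> \<le> ?C * (sqrt (h + \<epsilon>\<^sup>2) + norm1 (\<kappa>' - \<kappa>))" by (simp add: u0)
    qed
    also have "\<dots> \<le> b"
      unfolding b_def using C0 sqrt_add_le_add_sqrt[of h "\<epsilon>\<^sup>2"] h \<epsilon> by (intro mult_left_mono) auto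
    finally show ?thesis .
  qed
  have iter: "(?T ^^ j) \<phi> \<kappa> \<le> W (t\<^sub>0 + real j * h, \<kappa>) + (b + real j * h * e)" if "j \<le> m" for j \<kappa>
    using that
  proof (induction j arbitrary: \<kappa>)
    case 0
    then show ?case using base[of \<kappa>] by (simp add: abs_le_iff)
  next
    case (Suc j \<kappa>)
    let ?t = "t\<^sub>0 + real (Suc j) * h"
    have "real (Suc j) * h \<le> real m * h" using Suc.prems h by (intro mult_right_mono) auto
    then have t: "?t < 1 - \<epsilon>\<^sup>2" using t\<^sub>1 by (simp add: t\<^sub>0_def)
    have ht: "h \<le> ?t" using t\<^sub>0 h by (simp add: algebra_simps)
    have th: "?t - h = t\<^sub>0 + real j * h" by (simp add: algebra_simps)
    have "(?T ^^ Suc j) \<phi> \<kappa> = ?T ((?T ^^ j) \<phi>) \<kappa>" by simp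
    also have "\<dots> \<le> ?T (\<lambda>\<kappa>. W (?t - h, \<kappa>)) \<kappa> + (b + real j * h * e)"
      by (rule step_diff_le[OF rv_incr[OF h'] step_pow_Cb_Lip[OF rv_incr[OF h'] \<phi>] slice])
        (use Suc in \<open>simp only: th Suc_leD\<close>)
    also have "\<dots> \<le> W (?t, \<kappa>) + h * e + (b + real j * h * e)" using stepW[OF ht t] by simp
    finally show ?case by (simp add: algebra_simps)
  qed
  have "(?T ^^ m) \<phi> 0 \<le> W (t\<^sub>1, 0) + (b + real m * h * e)"
    using iter[OF order_refl, of 0] by (simp add: t\<^sub>0_def)
  also have "real m * h * e \<le> 1 * e" using mh t\<^sub>1 e by (intro mult_right_mono) auto
  finally have 1: "uh \<phi> h t\<^sub>1 0 \<le> W (t\<^sub>1, 0) + b + e" by (simp add: uh_def m_def)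
  have 2: "\<bar>uh \<phi> h 1 0 - uh \<phi> h t\<^sub>1 0\<bar> \<le> ?C * (5/4 * \<epsilon> + sqrt h)"
  proof -
    have "\<bar>uh \<phi> h 1 0 - uh \<phi> h t\<^sub>1 0\<bar> \<le> ?C * (sqrt (1 - t\<^sub>1 + h) + norm1 (0 - 0 :: 'd vec3))"
      by (rule uh_regularity(1)[OF \<phi> h' less_imp_le[OF t\<^sub>1(1)] t\<^sub>1(2) order_refl])
    also have "\<dots> \<le> ?C * (5/4 * \<epsilon> + sqrt h)"
      using C0 sqrt_add_le_add_sqrt[of a h] order_trans[OF zero_le_power2 less_imp_le[OF a(1)]] h
      by (intro mult_left_mono) (auto simp: t\<^sub>1_def sa norm1_def)
    finally show ?thesis .
  qed
  have 3: "\<bar>W (t\<^sub>1, 0) - u 1 0\<bar> \<le> ?C * (5/4 * \<epsilon> + 2 * \<epsilon>)"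
    unfolding W_def
  proof (rule mollified_close[OF \<rho>\<epsilon> Vm B C0])
    fix s and \<kappa>' :: "'d vec3" assume s: "0 \<le> s" "s \<le> 1" "min 1 t\<^sub>1 \<le> s"
    have "\<bar>u s \<kappa>' - u 1 0\<bar> \<le> ?C * (sqrt \<bar>s - 1\<bar> + norm1 (\<kappa>' - 0))"
      by (rule parabolic_HoelderD[OF u(2)]) (use s in auto)
    also have "\<dots> \<le> ?C * (5/4 * \<epsilon> + norm1 (\<kappa>' - 0))"
      unfolding sa[symmetric] using s C0 t\<^sub>1 by (intro mult_left_mono add_right_mono real_sqrt_le_mono) (auto simp: t\<^sub>1_def)
    finally show "\<bar>u s \<kappa>' - u 1 0\<bar> \<le> ?C * (5/4 * \<epsilon> + norm1 (\<kappa>' - 0))" .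
  qed
  have "uh \<phi> h 1 0 - u 1 0 \<le> ?C * (5/4 * \<epsilon> + sqrt h) + ?C * (5/4 * \<epsilon> + 2 * \<epsilon>) + b + e"
    using 1 2 3 by linarith
  also have "\<dots> = ?C * (2 * sqrt h + 15/2 * \<epsilon>) + e" unfolding b_def by (simp add: algebra_simps)
  finally show ?thesis .
qed

end

section \<open>The error bound\<close>

text \<open>The maximum runs over a finite nonempty set, since basis lists of bounded length are finite in number.\<close>

lemma K_rho_nonneg: "0 \<le> K_rho (\<rho> :: real \<times> 'd::finite vec3 \<Rightarrow> real)"
proof -
  let ?f = "\<lambda>i bs. LINT \<tau>:{-1..0}|lborel. (LINT e:ball 0 1|lborel.
        \<bar>iter_deriv (replicate i (1, 0) @ map (Pair 0) bs) \<rho> (\<tau>, e)\<bar>)"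
  let ?S = "{?f i bs |i j bs. i + j \<le> 3 \<and> bs \<in> (basis_lists j :: 'd vec3 list set)}"
  have "finite (basis_lists j :: 'd vec3 list set)" for j
    unfolding basis_lists_def by (rule finite_lists_length_eq) simp
  then have "finite ((\<lambda>(i, bs). ?f i bs) ` ({..3} \<times> (\<Union>j\<le>3. basis_lists j)))" by blast
  moreover have "?S \<subseteq> (\<lambda>(i, bs). ?f i bs) ` ({..3} \<times> (\<Union>j\<le>3. basis_lists j))"
  proof
    fix x assume "x \<in> ?S"
    then obtain i j bs where "x = ?f i bs" "i + j \<le> 3" "bs \<in> (basis_lists j :: 'd vec3 list set)" by blast
    then show "x \<in> (\<lambda>(i, bs). ?f i bs) ` ({..3} \<times> (\<Union>j\<le>3. basis_lists j))"
      by (intro image_eqI[of _ _ "(i, bs)"]) auto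
  qed
  ultimately have fin: "finite ?S" by (rule finite_subset[rotated])
  have "?f 0 [] \<in> ?S"
    by (intro CollectI exI[of _ 0] exI[of _ "[]"]) (simp add: basis_lists_def)
  then have "?f 0 [] \<le> Max ?S" by (rule Max_ge[OF fin])
  moreover have "0 \<le> ?f 0 []"
    unfolding set_lebesgue_integral_def
    by (intro Bochner_Integration.integral_nonneg scaleR_nonneg_nonneg) auto
  ultimately show ?thesis unfolding K_rho_def by linarith
qed

lemma sup_norm_nonneg:
  assumes "\<phi> \<in> Cb_Lip"
  shows "0 \<le> sup_norm \<phi>"
proof -
  obtain B where "\<And>x. \<bar>\<phi> x\<bar> \<le> B" using Cb_LipE[OF assms] by metis
  then have "bdd_above (range (\<lambda>x. \<bar>\<phi> x\<bar>))" by (intro bdd_aboveI2[of _ _ B]) auto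
  then have "\<bar>\<phi> 0\<bar> \<le> sup_norm \<phi>" unfolding sup_norm_def by (intro cSUP_upper) auto
  then show ?thesis by linarith
qed

lemma mollify_Cb_Lip:
  fixes \<rho> :: "real \<times> 'd::finite vec3 \<Rightarrow> real"
  assumes "mollifier \<rho>" "0 < \<epsilon>" "\<epsilon> \<le> 1"
    and "time_ext v \<in> borel_measurable borel" "\<And>p. \<bar>time_ext v p\<bar> \<le> B"
    and "\<And>t \<kappa> \<kappa>'. \<bar>time_ext v (t, \<kappa>) - time_ext v (t, \<kappa>')\<bar> \<le> L * norm (\<kappa> - \<kappa>')" and "0 \<le> t"
  shows "mollify \<rho> \<epsilon> v t \<in> Cb_Lip"
  unfolding ext[of "mollify \<rho> \<epsilon> v t", OF mollify_eq_conv[OF assms(1-5,7)]]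
  by (rule mollified_slice_Cb_Lip[OF assms(1-6)])

lemma (in iid_scheme) scheme_law:
  fixes X' Y' Z' :: "'w \<Rightarrow> real^'d"
  assumes law: "eq_dist E (\<lambda>\<omega>. (X' \<omega>, Y' \<omega>, Z' \<omega>)) E (\<lambda>\<omega>. (X 1 \<omega>, Y 1 \<omega>, Z 1 \<omega>))"
    and h: "0 < h" "h \<le> 1" and f: "f \<in> Cb_Lip"
  shows "step E (\<lambda>\<omega>. scale \<alpha> h (X' \<omega>, Y' \<omega>, Z' \<omega>)) f = step E (incr h) f"
proof
  fix \<kappa>
  have "(\<lambda>x. f (\<kappa> + scale \<alpha> h x)) \<in> Cb_Lip"
    using \<alpha> by (intro Cb_Lip_compose[OF Cb_Lip_translate[OF f] norm_scale_diff_le[OF h]]) simp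
  with law have "E (\<lambda>\<omega>. f (\<kappa> + scale \<alpha> h (X' \<omega>, Y' \<omega>, Z' \<omega>))) = E (\<lambda>\<omega>. f (\<kappa> + scale \<alpha> h (X 1 \<omega>, Y 1 \<omega>, Z 1 \<omega>)))"
    unfolding eq_dist_def by (rule bspec)
  then show "step E (\<lambda>\<omega>. scale \<alpha> h (X' \<omega>, Y' \<omega>, Z' \<omega>)) f \<kappa> = step E (incr h) f \<kappa>"
    by (simp add: step_def incr_def)
qed

lemma (in iid_scheme) u_scheme_eq_uh:
  fixes X' Y' Z' :: "'w \<Rightarrow> real^'d"
  assumes law: "eq_dist E (\<lambda>\<omega>. (X' \<omega>, Y' \<omega>, Z' \<omega>)) E (\<lambda>\<omega>. (X 1 \<omega>, Y 1 \<omega>, Z 1 \<omega>))"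
    and h: "0 < h" "h \<le> 1" and \<phi>: "\<phi> \<in> Cb_Lip"
  shows "u_scheme E \<alpha> X' Y' Z' \<phi> h = uh \<phi> h"
proof (intro ext)
  fix t \<kappa>
  have "(step E (\<lambda>\<omega>. scale \<alpha> h (X' \<omega>, Y' \<omega>, Z' \<omega>)) ^^ k) \<phi> = (step E (incr h) ^^ k) \<phi>" for k
  proof (induction k)
    case (Suc k)
    then show ?case using scheme_law[OF law h step_pow_Cb_Lip[OF rv_incr[OF h] \<phi>]] by simp
  qed simp
  then show "u_scheme E \<alpha> X' Y' Z' \<phi> h t \<kappa> = uh \<phi> h t \<kappa>"
    unfolding u_scheme_eq_step_pow[OF h(1)] uh_def by simp
qed

lemma (in iid_scheme) scheme_S_eq:
  fixes X' Y' Z' :: "'w \<Rightarrow> real^'d"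
  assumes law: "eq_dist E (\<lambda>\<omega>. (X' \<omega>, Y' \<omega>, Z' \<omega>)) E (\<lambda>\<omega>. (X 1 \<omega>, Y 1 \<omega>, Z 1 \<omega>))"
    and h: "0 < h" "h \<le> 1" and f: "f \<in> Cb_Lip"
  shows "scheme_S E \<alpha> X' Y' Z' h x y z p f = (p - step E (incr h) f (x, y, z)) / h"
  unfolding scheme_law[OF law h f, symmetric] by (simp add: scheme_S_def step_def scale_def)

lemma (in iid_scheme) normalized_sum_eq_uh:
  assumes n: "1 \<le> n" and \<phi>: "\<phi> \<in> Cb_Lip"
  shows "E (\<lambda>\<omega>. \<phi> (partial_sum X n \<omega> /\<^sub>R sqrt (real n), partial_sum Y n \<omega> /\<^sub>R real n,
                       partial_sum Z n \<omega> /\<^sub>R (real n powr (1/\<alpha>)))) = uh \<phi> (1 / real n) 1 0"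
proof -
  have h: "0 < 1 / real n" "1 / real n \<le> 1" using n by simp_all
  have "sqrt (1 / real n) = inverse (sqrt (real n))" "1 / real n = inverse (real n)"
    "(1 / real n) powr (1/\<alpha>) = inverse (real n powr (1/\<alpha>))"
    using n by (simp_all add: real_sqrt_divide powr_divide inverse_eq_divide)
  moreover have "uh \<phi> (1 / real n) 1 = (step E (incr (1 / real n)) ^^ n) \<phi>"
    unfolding uh_def by simp
  ultimately show ?thesis
    using E_sum_eq_step_pow[OF h \<phi>, of 0 n] by simp
qed

theorem theorem2p10:
  fixes \<alpha> lo hi :: real
    and K :: "(real^'d) measure set"
    and \<Theta> :: "((real^'d) measure \<times> (real^'d) \<times> (real^'d^'d)) set"
    and H :: "('w \<Rightarrow> real) set" and E :: "('w \<Rightarrow> real) \<Rightarrow> real"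
    and X Y Z :: "nat \<Rightarrow> 'w \<Rightarrow> real^'d"
    and X' Y' Z' :: "'w \<Rightarrow> real^'d"
    and H' :: "('v \<Rightarrow> real) set" and E' :: "('v \<Rightarrow> real) \<Rightarrow> real"
    and \<xi> \<eta> \<zeta> :: "real \<Rightarrow> 'v \<Rightarrow> real^'d"
    and \<rho> :: "real \<times> 'd vec3 \<Rightarrow> real"
    and E\<^sub>1 E\<^sub>2 :: "real \<Rightarrow> real \<Rightarrow> real \<Rightarrow> real \<Rightarrow> real \<Rightarrow> real"
    and \<phi> :: "'d vec3 \<Rightarrow> real"
    and C\<^sub>0 :: "('d vec3 \<Rightarrow> real) \<Rightarrow> real"
    and n :: nat
  assumes "C\<^sub>0 = C0_const E \<alpha> X Y Z"
    and "1 < \<alpha>" "\<alpha> < 2" "0 < lo" "lo < hi"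
    and "uncertainty_set \<alpha> lo hi K \<Theta>"
    and "sublinear_expectation H E"
    and "iid_seq H E (\<lambda>i \<omega>. (X i \<omega>, Y i \<omega>, Z i \<omega>))"
    and "XY_moment_conditions H E X Y"
    and "Z_moment_conditions H E \<alpha> Z"
    and "consistency_condition H E \<alpha> \<Theta> (X 1) (Y 1) (Z 1)"
    and "sublinear_expectation H' E'"
    and "associated_process \<Theta> C\<^sub>0 H' E' (\<lambda>t \<omega>. (\<xi> t \<omega>, \<eta> t \<omega>, \<zeta> t \<omega>))"
    and "random_vector H (\<lambda>\<omega>. (X' \<omega>, Y' \<omega>, Z' \<omega>))"
    and "eq_dist E (\<lambda>\<omega>. (X' \<omega>, Y' \<omega>, Z' \<omega>)) E (\<lambda>\<omega>. (X 1 \<omega>, Y 1 \<omega>, Z 1 \<omega>))"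
    and "mollifier \<rho>"
    and "nonneg5 E\<^sub>1" "nonneg5 E\<^sub>2"
    and "\<phi> \<in> Cb_Lip"
    and "upper_consistent E \<alpha> X' Y' Z' \<Theta>
           (\<lambda>\<epsilon> h. mollify \<rho> \<epsilon> (u_scheme E \<alpha> X' Y' Z' \<phi> h))
           (\<lambda>\<epsilon> h. E\<^sub>1 \<epsilon> h (sup_norm \<phi>) (C\<^sub>0 \<phi>) (K_rho \<rho>))"
    and "lower_consistent E \<alpha> X' Y' Z' \<Theta>
           (\<lambda>\<epsilon> h. mollify \<rho> \<epsilon> (value_fun E' (\<lambda>t \<omega>. (\<xi> t \<omega>, \<eta> t \<omega>, \<zeta> t \<omega>)) \<phi>))
           (\<lambda>\<epsilon> h. E\<^sub>2 \<epsilon> h (sup_norm \<phi>) (C\<^sub>0 \<phi>) (K_rho \<rho>))"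
    and "1 \<le> n"
  shows "- 4 * C\<^sub>0 \<phi> * real n powr (- 1/2)
           - (INF \<epsilon>\<in>{0<..}. 8 * C\<^sub>0 \<phi> * \<epsilon> + E\<^sub>1 \<epsilon> (1 / real n) (sup_norm \<phi>) (C\<^sub>0 \<phi>) (K_rho \<rho>))
         \<le> E (\<lambda>\<omega>. \<phi> (partial_sum X n \<omega> /\<^sub>R sqrt (real n), partial_sum Y n \<omega> /\<^sub>R real n,
                       partial_sum Z n \<omega> /\<^sub>R (real n powr (1/\<alpha>))))
           - E' (\<lambda>\<omega>. \<phi> (\<xi> 1 \<omega>, \<eta> 1 \<omega>, \<zeta> 1 \<omega>))
       \<and> E (\<lambda>\<omega>. \<phi> (partial_sum X n \<omega> /\<^sub>R sqrt (real n), partial_sum Y n \<omega> /\<^sub>R real n,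
                       partial_sum Z n \<omega> /\<^sub>R (real n powr (1/\<alpha>))))
           - E' (\<lambda>\<omega>. \<phi> (\<xi> 1 \<omega>, \<eta> 1 \<omega>, \<zeta> 1 \<omega>))
         \<le> 2 * C\<^sub>0 \<phi> * real n powr (- 1/2)
           + (INF \<epsilon>\<in>{0<..}. 8 * C\<^sub>0 \<phi> * \<epsilon> + E\<^sub>2 \<epsilon> (1 / real n) (sup_norm \<phi>) (C\<^sub>0 \<phi>) (K_rho \<rho>))"
proof -
  note C\<^sub>0 = assms(1) and \<rho> = assms(16) and \<phi> = assms(19) and law = assms(15)
  interpret iid_scheme H E \<alpha> X Y Z
    using assms(2,3,7-10) by (intro iid_scheme.intro iid_scheme_axioms.intro)
  define L where "L t \<omega> = (\<xi> t \<omega>, \<eta> t \<omega>, \<zeta> t \<omega>)" for t \<omega>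
  have proc: "associated_process \<Theta> C\<^sub>0 H' E' L" using assms(13) by (simp add: L_def[abs_def])
  define u where "u = value_fun E' L \<phi>"
  note u = associated_processD[OF proc \<phi>, folded u_def]
  have u0: "u 0 \<kappa> = \<phi> \<kappa>" for \<kappa> unfolding u_def by (rule value_fun_0[OF assms(12) u(1)])
  obtain C where \<Theta>: "levy_bounded \<Theta> C" using uncertainty_set_levy_bounded[OF assms(6)] by blast
  let ?C = "C\<^sub>0 \<phi>"
  have C: "0 \<le> ?C" unfolding C\<^sub>0 by (rule C0_const_ge(3)[OF \<phi>])
  define h where "h = 1 / real n"
  have h: "0 < h" "h \<le> 1" using assms(22) by (simp_all add: h_def)
  have nh: "real n powr (- 1/2) = sqrt h"
    using assms(22) by (simp add: h_def powr_minus powr_half_sqrt real_sqrt_divide inverse_eq_divide)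
  define a where "a = uh \<phi> h 1 0"
  have aE: "E (\<lambda>\<omega>. \<phi> (partial_sum X n \<omega> /\<^sub>R sqrt (real n), partial_sum Y n \<omega> /\<^sub>R real n,
                       partial_sum Z n \<omega> /\<^sub>R (real n powr (1/\<alpha>)))) = a"
    unfolding a_def h_def by (rule normalized_sum_eq_uh[OF assms(22) \<phi>])
  define b where "b = u 1 0"
  have bE: "E' (\<lambda>\<omega>. \<phi> (\<xi> 1 \<omega>, \<eta> 1 \<omega>, \<zeta> 1 \<omega>)) = b"
    by (simp add: b_def u_def value_fun_def L_def)
  \<comment> \<open>Settles the cases of large \<open>\<epsilon>\<close> and of \<open>n = 1\<close>, which \<open>lower_bound\<close> and \<open>upper_bound\<close> leave out.\<close>
  have crude: "\<bar>a - b\<bar> \<le> 2 * ?C"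
  proof -
    have "\<bar>a - \<phi> 0\<bar> \<le> ?C"
      using uh_regularity(2)[OF \<phi> h, of 0 1 0 0] unfolding a_def C\<^sub>0 by (simp add: norm1_def)
    moreover have "\<bar>b - \<phi> 0\<bar> \<le> ?C"
      using parabolic_HoelderD[OF u(5), of 1 0 0 0] unfolding b_def by (simp add: u0 norm1_def)
    ultimately show ?thesis by linarith
  qed
  define e\<^sub>1 where "e\<^sub>1 \<epsilon> = E\<^sub>1 \<epsilon> h (sup_norm \<phi>) ?C (K_rho \<rho>)" for \<epsilon>
  define e\<^sub>2 where "e\<^sub>2 \<epsilon> = E\<^sub>2 \<epsilon> h (sup_norm \<phi>) ?C (K_rho \<rho>)" for \<epsilon>
  have e: "0 \<le> e\<^sub>1 \<epsilon>" "0 \<le> e\<^sub>2 \<epsilon>" if "0 < \<epsilon>" for \<epsilon>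
    using assms(17,18) that h C sup_norm_nonneg[OF \<phi>] K_rho_nonneg[of \<rho>]
    unfolding nonneg5_def e\<^sub>1_def e\<^sub>2_def by simp_all
  have lower: "- 4 * ?C * sqrt h - (a - b) \<le> 8 * ?C * \<epsilon> + e\<^sub>1 \<epsilon>" if \<epsilon>: "0 < \<epsilon>" for \<epsilon>
  proof (cases "\<epsilon> < 1 \<and> h < 1")
    case True
    then have \<epsilon>1: "\<epsilon> < 1" "\<epsilon> \<le> 1" and h1: "h < 1" by auto
    note V = time_ext_uh[OF \<phi> h]
    obtain B where B: "\<And>p. \<bar>time_ext (uh \<phi> h) p\<bar> \<le> B" using V(2) by blast
    have sch: "u_scheme E \<alpha> X' Y' Z' \<phi> h = uh \<phi> h" by (rule u_scheme_eq_uh[OF law h \<phi>])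
    have "b - a \<le> C0_const E \<alpha> X Y Z \<phi> * (3 * sqrt h + 7 * \<epsilon>) + e\<^sub>1 \<epsilon>"
      unfolding a_def b_def
    proof (rule lower_bound[OF \<rho> \<epsilon> \<epsilon>1(1) h(1) h1 \<phi> \<Theta> u(2,4) u(5)[unfolded C\<^sub>0] u0 e(1)[OF \<epsilon>]])
      fix t :: real and \<kappa> :: "'d vec3" assume t: "h \<le> t" "t \<le> 1"
      obtain x y z where \<kappa>: "\<kappa> = (x, y, z)" by (cases \<kappa>)
      have slice: "mollify \<rho> \<epsilon> (uh \<phi> h) (t - h) \<in> Cb_Lip"
        using t by (intro mollify_Cb_Lip[OF \<rho> \<epsilon> \<epsilon>1(2) V(1) B V(3)]) simp
      have "scheme_S E \<alpha> X' Y' Z' h x y z (mollify \<rho> \<epsilon> (uh \<phi> h) t (x, y, z)) (mollify \<rho> \<epsilon> (uh \<phi> h) (t - h))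
          \<le> pide_op \<Theta> (mollify \<rho> \<epsilon> (uh \<phi> h)) t x y z + e\<^sub>1 \<epsilon>"
        using assms(20)[unfolded upper_consistent_def, rule_format, of \<epsilon> h t x y z] \<epsilon> \<epsilon>1 h h1 t
        unfolding sch e\<^sub>1_def by simp
      then show "(mollify \<rho> \<epsilon> (uh \<phi> h) t \<kappa> - step E (incr h) (mollify \<rho> \<epsilon> (uh \<phi> h) (t - h)) \<kappa>) / h
         \<le> pide_op \<Theta> (mollify \<rho> \<epsilon> (uh \<phi> h)) t (fst \<kappa>) (fst (snd \<kappa>)) (snd (snd \<kappa>)) + e\<^sub>1 \<epsilon>"
        unfolding scheme_S_eq[OF law h slice] \<kappa> by simp
    qed
    also have "C0_const E \<alpha> X Y Z \<phi> * (3 * sqrt h + 7 * \<epsilon>) \<le> ?C * (4 * sqrt h + 8 * \<epsilon>)"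
      unfolding C\<^sub>0[symmetric] using C h \<epsilon> by (intro mult_left_mono) auto
    finally show ?thesis by (simp add: algebra_simps)
  next
    case False
    then have "1 \<le> \<epsilon> \<or> h = 1" using h by auto
    then have "2 * ?C \<le> 4 * ?C * sqrt h + 8 * ?C * \<epsilon>"
    proof
      assume "1 \<le> \<epsilon>"
      then have "?C * 1 \<le> ?C * \<epsilon>" using C by (rule mult_left_mono)
      moreover have "0 \<le> ?C * sqrt h" using C h by simp
      ultimately show ?thesis using C by linarith
    next
      assume "h = 1"
      moreover have "0 \<le> ?C * \<epsilon>" using C \<epsilon> by simp
      ultimately show ?thesis using C by simp
    qed
    then show ?thesis using crude e(1)[OF \<epsilon>] by linarith
  qed
  have upper: "(a - b) - 2 * ?C * sqrt h \<le> 8 * ?C * \<epsilon> + e\<^sub>2 \<epsilon>" if \<epsilon>: "0 < \<epsilon>" for \<epsilon>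
  proof (cases "\<epsilon> < 4/5 \<and> h < 1")
    case True
    then have \<epsilon>1: "\<epsilon> < 4/5" "\<epsilon> \<le> 1" "\<epsilon> < 1" and h1: "h < 1" by auto
    obtain B where B: "\<And>p. \<bar>time_ext u p\<bar> \<le> B" using cont_bdd_on_bounded[OF u(4)] by blast
    have "a - b \<le> C0_const E \<alpha> X Y Z \<phi> * (2 * sqrt h + 15/2 * \<epsilon>) + e\<^sub>2 \<epsilon>"
      unfolding a_def b_def
    proof (rule upper_bound[OF \<rho> \<epsilon> \<epsilon>1(1) h(1) h1 \<phi> u(4) u(5)[unfolded C\<^sub>0] u0 _ e(2)[OF \<epsilon>]])
      show "0 \<le> pide \<Theta> (conv (time_ext u) (scaled_kernel \<rho> \<epsilon>)) (t, \<kappa>)" if "0 \<le> t" "t < 1 - \<epsilon>\<^sup>2" for t \<kappa>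
        unfolding u_def by (rule mollified_value_supersolution[OF \<rho> \<epsilon> \<epsilon>1(2) \<Theta> assms(12) proc \<phi> C that])
      fix t :: real and \<kappa> :: "'d vec3" assume t: "h \<le> t" "t \<le> 1"
      obtain x y z where \<kappa>: "\<kappa> = (x, y, z)" by (cases \<kappa>)
      have slice: "mollify \<rho> \<epsilon> u (t - h) \<in> Cb_Lip"
        using t by (intro mollify_Cb_Lip[OF \<rho> \<epsilon> \<epsilon>1(2) time_ext_measurable[OF u(4)] B parabolic_Hoelder_space[OF u(5) C]]) simp
      have "scheme_S E \<alpha> X' Y' Z' h x y z (mollify \<rho> \<epsilon> u t (x, y, z)) (mollify \<rho> \<epsilon> u (t - h))
          \<ge> pide_op \<Theta> (mollify \<rho> \<epsilon> u) t x y z - e\<^sub>2 \<epsilon>"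
        using assms(21)[unfolded lower_consistent_def, folded L_def, folded u_def, rule_format, of \<epsilon> h t x y z] \<epsilon> \<epsilon>1 h h1 t
        unfolding e\<^sub>2_def by simp
      then show "pide_op \<Theta> (mollify \<rho> \<epsilon> u) t (fst \<kappa>) (fst (snd \<kappa>)) (snd (snd \<kappa>)) - e\<^sub>2 \<epsilon>
         \<le> (mollify \<rho> \<epsilon> u t \<kappa> - step E (incr h) (mollify \<rho> \<epsilon> u (t - h)) \<kappa>) / h"
        unfolding scheme_S_eq[OF law h slice] \<kappa> by simp
    qed
    also have "C0_const E \<alpha> X Y Z \<phi> * (2 * sqrt h + 15/2 * \<epsilon>) \<le> ?C * (2 * sqrt h + 8 * \<epsilon>)"
      unfolding C\<^sub>0[symmetric] using C \<epsilon> by (intro mult_left_mono) auto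
    finally show ?thesis by (simp add: algebra_simps)
  next
    case False
    then have "4/5 \<le> \<epsilon> \<or> h = 1" using h by auto
    then have "2 * ?C \<le> 2 * ?C * sqrt h + 8 * ?C * \<epsilon>"
    proof
      assume "4/5 \<le> \<epsilon>"
      then have "?C * (4/5) \<le> ?C * \<epsilon>" using C by (rule mult_left_mono)
      moreover have "0 \<le> ?C * sqrt h" using C h by simp
      ultimately show ?thesis using C by linarith
    next
      assume "h = 1"
      moreover have "0 \<le> ?C * \<epsilon>" using C \<epsilon> by simp
      ultimately show ?thesis by (simp add: mult.commute)
    qed
    then show ?thesis using crude e(2)[OF \<epsilon>] by linarith
  qed
  have "- 4 * ?C * sqrt h - (a - b) \<le> (INF \<epsilon>\<in>{0<..}. 8 * ?C * \<epsilon> + e\<^sub>1 \<epsilon>)"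
    by (rule cINF_greatest[OF _ lower]) auto
  moreover have "(a - b) - 2 * ?C * sqrt h \<le> (INF \<epsilon>\<in>{0<..}. 8 * ?C * \<epsilon> + e\<^sub>2 \<epsilon>)"
    by (rule cINF_greatest[OF _ upper]) auto
  ultimately show ?thesis
    unfolding aE bE nh e\<^sub>1_def e\<^sub>2_def h_def[symmetric] by linarith
qed

end
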